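(* Let $X=(X^{(1)},\ldots,X^{(d)})$, where $X^{(1)},\dots,X^{(d)}$ are independent compensated compound Poisson processes with positive jumps, $X^{(i)}(t)=\sum_{k=1}^{N^{(i)}(t)}W^{(i)}(k)-\lambda_i t\,\mathbb E W^{(i)}(1)$, such that $x\mapsto\mathbb P(X^{(i)}(1)>x)$ is regularly varying at infinity with index $-\beta_i<-1$ for each $i$. Let $\bar X_n(t)=X(nt)/n$, $t\in[0,1]$. Let $A\subseteq\mathbb D^d$ be a Borel measurable set such that the minimization problem $$\min\Big\{\mathcal I(l_1,\dots,l_d): (l_1,\dots,l_d)\in\mathbb Z_+^d,\ \textstyle\prod_{i=1}^d\mathbb D_{l_i}\cap A\neq\emptyset\Big\}$$ has a unique minimizer $(l_1^*,\dots,l_d^* )$, such that $A$ is bounded away from $\mathbb D_{<(l_1^*,\dots,l_d^* )}$, and such that $C_{l_1^*}\times\cdots\times C_{l_d^*}(A^\circ)>0$. Fix $w\in(0,1)$. Set $A_n=\{\bar X_n\in A\}$ and, for $\gamma\in(0,\infty)^d$, $B_n^\gamma=\{\bar X_n\in B^\gamma\}$. Then there exists $\gamma\in(0,\infty)^d$ such that the estimator $$Z_n=\frac{\mathbf 1_{A_n}}{w+\frac{1-w}{\mathbb P(B_n^\gamma)}\mathbf 1_{B_n^\gamma}},$$ sampled under $\mathbb Q_{\gamma,w}(\cdot)=w\,\mathbb P(\cdot)+(1-w)\,\mathbb P(\cdot\mid B_n^\gamma)$, is strongly efficient for estimating $\mathbb P(A_n)$, i.e. $\mathbb E^{\mathbb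 Q_{\gamma,w}}[Z_n^2]=\mathcal O(\mathbb P(A_n)^2)$ as $n\to\infty$.
   Context: $\mathbb D$ is the space of real-valued càdlàg functions on $[0,1]$ with the Skorokhod $J_1$ metric $d(x,y)=\inf_{\lambda}\|\lambda-\mathrm{id}\|_\infty\vee\|x\circ\lambda-y\|_\infty$ (infimum over increasing continuous bijections $\lambda$ of $[0,1]$); $\mathbb D^d$ carries the maximum metric of the coordinates. $A$ is bounded away from $S$ if $\inf_{x\in A,y\in S}d(x,y)>0$ (with $\inf\emptyset=\infty$). $A^\circ$ is the interior of $A$. $\mathbb Z_+=\{0,1,2,\dots\}$. The $N^{(i)}$ are independent Poisson processes with rates $\lambda_i>0$; for each $i$ the $W^{(i)}(k)$, $k\ge1$, are i.i.d. positive, and all these families are independent. $\mathbb D_l$: the set of non-decreasing step functions in $\mathbb D$ vanishing at time $0$ with exactly $l$ jumps; $\mathbb D_{<l}=\bigcup_{j\le l-1}\mathbb D_j$ (so $\mathbb D_{<0}=\emptyset$). $\mathcal I(l_1,\dots,l_d)=\sum_{i=1}^d(\beta_i-1)l_i$. $$I_{<(l_1^*,\dots,l_d^* )}=\{l\in\mathbb Z_+^d\setminus\{l^*\}:\mathcal I(l)\le\mathcal I(l^* )\},\qquad \mathbb D_{<(l_1^*,\dots,l_d^* )}=\bigcup_{l\in I_{<(l_1^*,\dots,l_d^* )}}\prod_{i=1}^d\mathbb D_{l_i}.$$ Let $\mathbb C_{(l_1,\dots,l_d)}=\bigcup_{i=1}^d\mathbb D^{i-1}\times\mathbb D_{<l_i}\times\mathbb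 D^{d-i}$ and write $l\prec m$ iff $\mathbb C_l\subsetneq\mathbb C_m$. Let $$J_{(l_1^*,\dots,l_d^* )}=\{l\in\mathbb Z_+^d\setminus I_{<(l_1^*,\dots,l_d^* )}: m\prec l\Rightarrow m\in I_{<(l_1^*,\dots,l_d^* )}\},$$ which is a finite set. For $\gamma\in(0,\infty)^d$, $B^\gamma=\bigcup_{l\in J_{(l_1^*,\dots,l_d^* )}}B^{\gamma;l}$, where $$B^{\gamma;l}=\{\xi\in\mathbb D^d:\#\{t:\xi^{(i)}(t)-\xi^{(i)}(t^-)>\gamma_i\}\ge l_i\ \ \forall i\in\{1,\dots,d\}\}.$$ Measure $C_{l_i}$ (for coordinate $i$): with $\nu_{\beta_i}(x,\infty)=x^{-\beta_i}$, let $\nu_{\beta_i}^{l}$ be the restriction of the $l$-fold product measure of $\nu_{\beta_i}$ to $\{x\in\mathbb R_+^l:x_1\ge\cdots\ge x_l\}$; then for $l\ge1$, $C_l(\cdot)=\mathbb E\big[\nu_{\beta_i}^l\{y\in(0,\infty)^l:\sum_{j=1}^l y_j\mathbf 1_{[U_j,1]}\in\cdot\}\big]$ with $U_j$ i.i.d. uniform on $[0,1]$; $C_0$ is the Dirac measure at the zero function. $C_{l_1^*}\times\cdots\times C_{l_d^*}$ is the product measure. *)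

theory Defs
  imports "HOL-Probability.Probability"
begin

section \<open>The Skorokhod space on the unit interval\<close>

text \<open>Only the values on the unit interval matter; left limits at 0 and right limits at 1 are
  not required.\<close>

definition cadlag :: "(real \<Rightarrow> real) \<Rightarrow> bool" where
  "cadlag x \<longleftrightarrow>
     (\<forall>t\<in>{0..<1}. (x \<longlongrightarrow> x t) (at_right t)) \<and>
     (\<forall>t\<in>{0<..1}. \<exists>l. (x \<longlongrightarrow> l) (at_left t))"

lemma cadlag_cong:
  assumes "\<And>t. t \<in> {0..1} \<Longrightarrow> x t = y t" and "cadlag x"
  shows "cadlag y"
  unfolding cadlag_def
proof (intro conjI ballI)
  fix t :: real assume t: "t \<in> {0..<1}"
  have "eventually (\<lambda>s. x s = y s) (at_right t)"
    using t assms(1) by (intro eventually_at_rightI[of t 1]) auto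
  moreover have "(x \<longlongrightarrow> y t) (at_right t)"
    using assms t by (auto simp: cadlag_def)
  ultimately show "(y \<longlongrightarrow> y t) (at_right t)"
    using tendsto_cong by blast
next
  fix t :: real assume t: "t \<in> {0<..1}"
  have "eventually (\<lambda>s. x s = y s) (at_left t)"
    using t assms(1) by (intro eventually_at_leftI[of 0 t]) auto
  moreover obtain l where "(x \<longlongrightarrow> l) (at_left t)"
    using assms(2) t unfolding cadlag_def by blast
  ultimately show "\<exists>l. (y \<longlongrightarrow> l) (at_left t)"
    using tendsto_cong by blast
qed

lemma cadlag_const: "cadlag (\<lambda>_. c)"
  by (auto simp: cadlag_def)

text \<open>Elements are made unique representatives by fixing their value off the unit interval to
  \<^term>\<open>undefined\<close>.\<close>

typedef skorokhod = "{x. cadlag x \<and> x \<in> extensional {0..1}}"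
  morphisms eval_path Abs_path
proof -
  have "cadlag (restrict (\<lambda>_. 0) {0..1})"
    by (rule cadlag_cong[OF _ cadlag_const[of 0]]) auto
  thus ?thesis by auto
qed

text \<open>The element of the Skorokhod space given by a function that is cadlag on the unit interval.\<close>

definition mk_path :: "(real \<Rightarrow> real) \<Rightarrow> skorokhod" where
  "mk_path f = Abs_path (restrict f {0..1})"

lemma eval_mk_path:
  assumes "cadlag f" "t \<in> {0..1}"
  shows "eval_path (mk_path f) t = f t"
proof -
  have "cadlag (restrict f {0..1})"
    by (rule cadlag_cong[OF _ assms(1)]) auto
  thus ?thesis using assms(2) by (simp add: mk_path_def Abs_path_inverse)
qed

lemma cadlag_eval_path: "cadlag (eval_path x)"
  using eval_path[of x] by simp

lemma path_eqI:
  assumes "\<And>t. t \<in> {0..1} \<Longrightarrow> eval_path x t = eval_path y t"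
  shows "x = y"
  using assms eval_path[of x] eval_path[of y]
  by (metis (mono_tags, lifting) extensionalityI eval_path_inject mem_Collect_eq)

lemma cadlag_bounded:
  assumes "cadlag x"
  obtains K where "\<And>t. t \<in> {0..1} \<Longrightarrow> \<bar>x t\<bar> \<le> K"
proof -
  have loc: "\<exists>e>0. \<exists>K. \<forall>s\<in>{0..1}. \<bar>s - t\<bar> < e \<longrightarrow> \<bar>x s\<bar> \<le> K" if t: "t \<in> {0..1}" for t
  proof -
    have r: "\<exists>e>0. \<exists>K. \<forall>s\<in>{0..1}. t < s \<and> s < t + e \<longrightarrow> \<bar>x s\<bar> \<le> K"
    proof (cases "t < 1")
      case True
      then have "(x \<longlongrightarrow> x t) (at_right t)" using assms t by (auto simp: cadlag_def)
      then have "eventually (\<lambda>s. dist (x s) (x t) < 1) (at_right t)"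
        by (rule tendstoD) simp
      then obtain b where b: "b > t" "\<And>s. t < s \<Longrightarrow> s < b \<Longrightarrow> dist (x s) (x t) < 1"
        by (auto simp: eventually_at_right_field)
      show ?thesis
      proof (rule exI[of _ "b - t"], intro conjI exI[of _ "\<bar>x t\<bar> + 1"] ballI impI)
        show "0 < b - t" using b by simp
        fix s assume "t < s \<and> s < t + (b - t)"
        then have "dist (x s) (x t) < 1" using b by auto
        then show "\<bar>x s\<bar> \<le> \<bar>x t\<bar> + 1" by (auto simp: dist_real_def)
      qed
    next
      case False
      then show ?thesis by (intro exI[of _ 1]) auto
    qed
    have l: "\<exists>e>0. \<exists>K. \<forall>s\<in>{0..1}. s < t \<and> t - e < s \<longrightarrow> \<bar>x s\<bar> \<le> K"
    proof (cases "0 < t")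
      case True
      then obtain c where "(x \<longlongrightarrow> c) (at_left t)" using assms t unfolding cadlag_def by force
      then have "eventually (\<lambda>s. dist (x s) c < 1) (at_left t)"
        by (rule tendstoD) simp
      then obtain b where b: "b < t" "\<And>s. b < s \<Longrightarrow> s < t \<Longrightarrow> dist (x s) c < 1"
        by (auto simp: eventually_at_left_field)
      show ?thesis
      proof (rule exI[of _ "t - b"], intro conjI exI[of _ "\<bar>c\<bar> + 1"] ballI impI)
        show "0 < t - b" using b by simp
        fix s assume "s < t \<and> t - (t - b) < s"
        then have "dist (x s) c < 1" using b by auto
        then show "\<bar>x s\<bar> \<le> \<bar>c\<bar> + 1" by (auto simp: dist_real_def)
      qed
    next
      case False
      then show ?thesis using t by (intro exI[of _ 1]) auto
    qed
    from r obtain e1 K1 where 1: "e1 > 0" "\<And>s. s\<in>{0..1} \<Longrightarrow> t < s \<Longrightarrow> s < t + e1 \<Longrightarrow> \<bar>x s\<bar> \<le> K1"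
      by blast
    from l obtain e2 K2 where 2: "e2 > 0" "\<And>s. s\<in>{0..1} \<Longrightarrow> s < t \<Longrightarrow> t - e2 < s \<Longrightarrow> \<bar>x s\<bar> \<le> K2"
      by blast
    show ?thesis
    proof (rule exI[of _ "min e1 e2"], intro conjI exI[of _ "max (max K1 K2) \<bar>x t\<bar>"] ballI impI)
      show "0 < min e1 e2" using 1 2 by simp
      fix s :: real assume s: "s \<in> {0..1}" "\<bar>s - t\<bar> < min e1 e2"
      consider "s = t" | "s < t" | "t < s" by linarith
      then show "\<bar>x s\<bar> \<le> max (max K1 K2) \<bar>x t\<bar>"
      proof cases
        case 2 then show ?thesis using \<open>\<And>s. s\<in>{0..1} \<Longrightarrow> s < t \<Longrightarrow> t - e2 < s \<Longrightarrow> \<bar>x s\<bar> \<le> K2\<close>[of s] s by auto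
      next
        case 3 then show ?thesis using 1(2)[of s] s by auto
      qed auto
    qed
  qed
  have "\<exists>e. \<forall>t\<in>{0..1}. e t > 0 \<and> (\<exists>K. \<forall>s\<in>{0..1}. \<bar>s - t\<bar> < e t \<longrightarrow> \<bar>x s\<bar> \<le> K)"
    by (rule bchoice) (use loc in blast)
  then obtain e where e: "\<And>t. t\<in>{0..1} \<Longrightarrow> e t > 0"
    and "\<forall>t\<in>{0..1}. \<exists>K. \<forall>s\<in>{0..1}. \<bar>s - t\<bar> < e t \<longrightarrow> \<bar>x s\<bar> \<le> K" by blast
  then obtain K where K: "\<And>t s. t\<in>{0..1} \<Longrightarrow> s\<in>{0..1} \<Longrightarrow> \<bar>s - t\<bar> < e t \<Longrightarrow> \<bar>x s\<bar> \<le> K t"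
    by (metis (no_types, lifting) bchoice)
  obtain C where C: "C \<subseteq> {0..1}" "finite C" "{0..1} \<subseteq> (\<Union>t\<in>C. ball t (e t))"
    by (rule compactE_image[of "{0..1::real}" "{0..1}" "\<lambda>t. ball t (e t)"])
       (use e in auto)
  show thesis
  proof
    fix s :: real assume s: "s \<in> {0..1}"
    then obtain t where t: "t \<in> C" "s \<in> ball t (e t)" using C by blast
    then have "\<bar>x s\<bar> \<le> K t" using K[of t s] s C by (auto simp: dist_real_def abs_minus_commute)
    also have "\<dots> \<le> Max (K ` C)" using t C by auto
    finally show "\<bar>x s\<bar> \<le> Max (K ` C)" .
  qed
qed

text \<open>The increasing continuous bijections of the unit interval; their values elsewhere are
  irrelevant.\<close>

definition time_changes :: "(real \<Rightarrow> real) set" where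
  "time_changes = {\<kappa>. strict_mono_on {0..1} \<kappa> \<and> continuous_on {0..1} \<kappa> \<and> bij_betw \<kappa> {0..1} {0..1}}"

definition sup_dist :: "(real \<Rightarrow> real) \<Rightarrow> (real \<Rightarrow> real) \<Rightarrow> real" where
  "sup_dist f g = (SUP t\<in>{0..1}. \<bar>f t - g t\<bar>)"

definition J1_dist :: "(real \<Rightarrow> real) \<Rightarrow> (real \<Rightarrow> real) \<Rightarrow> real" where
  "J1_dist x y = (INF \<kappa>\<in>time_changes. max (sup_dist \<kappa> id) (sup_dist (x \<circ> \<kappa>) y))"

lemma sup_dist_le:
  assumes "\<And>t. t \<in> {0..1} \<Longrightarrow> \<bar>f t - g t\<bar> \<le> c"
  shows "sup_dist f g \<le> c"
  unfolding sup_dist_def by (rule cSUP_least) (use assms in auto)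

definition bdd_fun :: "(real \<Rightarrow> real) \<Rightarrow> bool" where
  "bdd_fun f \<longleftrightarrow> (\<exists>K. \<forall>t\<in>{0..1}. \<bar>f t\<bar> \<le> K)"

lemma le_sup_dist:
  assumes "bdd_fun f" "bdd_fun g" "t \<in> {0..1}"
  shows "\<bar>f t - g t\<bar> \<le> sup_dist f g"
proof -
  obtain K L where "\<And>t. t\<in>{0..1} \<Longrightarrow> \<bar>f t\<bar> \<le> K" "\<And>t. t\<in>{0..1} \<Longrightarrow> \<bar>g t\<bar> \<le> L"
    using assms(1,2) unfolding bdd_fun_def by blast
  then have "\<And>t. t\<in>{0..1} \<Longrightarrow> \<bar>f t - g t\<bar> \<le> K + L" by (smt (verit))
  then have "bdd_above ((\<lambda>t. \<bar>f t - g t\<bar>) ` {0..1})" by (intro bdd_aboveI[of _ "K + L"]) auto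
  then show ?thesis unfolding sup_dist_def using assms(3) by (rule cSUP_upper2) auto
qed

lemma sup_dist_nonneg: "bdd_fun f \<Longrightarrow> bdd_fun g \<Longrightarrow> 0 \<le> sup_dist f g"
  using le_sup_dist[of f g 0] by force

lemma time_changeD:
  assumes "\<kappa> \<in> time_changes"
  shows "\<And>t. t \<in> {0..1} \<Longrightarrow> \<kappa> t \<in> {0..1}" "bdd_fun \<kappa>" "\<kappa> 1 = 1" "inj_on \<kappa> {0..1}"
    "\<And>s t. s \<in> {0..1} \<Longrightarrow> t \<in> {0..1} \<Longrightarrow> s < t \<Longrightarrow> \<kappa> s < \<kappa> t"
proof -
  have b: "bij_betw \<kappa> {0..1} {0..1}" and m: "strict_mono_on {0..1} \<kappa>"
    using assms by (auto simp: time_changes_def)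
  show *: "\<kappa> t \<in> {0..1}" if "t \<in> {0..1}" for t
    using b that bij_betwE by blast
  have "\<forall>t\<in>{0..1}. \<bar>\<kappa> t\<bar> \<le> 1"
  proof
    fix t :: real assume "t \<in> {0..1}"
    from *[OF this] show "\<bar>\<kappa> t\<bar> \<le> 1" by simp
  qed
  then show "bdd_fun \<kappa>" unfolding bdd_fun_def by blast
  show "inj_on \<kappa> {0..1}" using b by (rule bij_betw_imp_inj_on)
  show l: "\<kappa> s < \<kappa> t" if "s \<in> {0..1}" "t \<in> {0..1}" "s < t" for s t
    using m that by (auto simp: strict_mono_on_def)
  have "1 \<in> \<kappa> ` {0..1}" using b by (simp add: bij_betw_def)
  then obtain s where s: "s \<in> {0..1}" "\<kappa> s = 1" by auto
  show "\<kappa> 1 = 1"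
  proof (cases "s = 1")
    case False
    then have "\<kappa> s < \<kappa> 1" using s by (intro l) auto
    then show ?thesis using s *[of 1] by auto
  qed (use s in simp)
qed

lemma id_time_change: "id \<in> time_changes"
  by (auto simp: time_changes_def strict_mono_on_def)

lemma bdd_fun_id: "bdd_fun id"
  unfolding bdd_fun_def by (rule exI[of _ 1]) simp

lemma comp_time_change:
  assumes "\<kappa> \<in> time_changes" "\<mu> \<in> time_changes"
  shows "\<kappa> \<circ> \<mu> \<in> time_changes"
proof -
  have "continuous_on {0..1} (\<kappa> \<circ> \<mu>)"
    using assms unfolding time_changes_def bij_betw_def
    by (intro continuous_on_compose) simp_all
  moreover have "bij_betw (\<kappa> \<circ> \<mu>) {0..1} {0..1}"
    using assms by (auto simp: time_changes_def intro: bij_betw_trans)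
  moreover have "strict_mono_on {0..1} (\<kappa> \<circ> \<mu>)"
    using time_changeD[OF assms(1)] time_changeD[OF assms(2)] by (simp add: strict_mono_on_def)
  ultimately show ?thesis by (simp add: time_changes_def)
qed

lemma inv_time_change:
  assumes "\<kappa> \<in> time_changes"
  shows "\<exists>\<mu>\<in>time_changes. \<forall>t\<in>{0..1}. \<kappa> (\<mu> t) = t"
proof -
  let ?\<mu> = "inv_into {0..1} \<kappa>"
  have b: "bij_betw \<kappa> {0..1} {0..1}" and c: "continuous_on {0..1} \<kappa>"
    using assms by (auto simp: time_changes_def)
  have 1: "\<kappa> (?\<mu> t) = t" if "t \<in> {0..1}" for t
    using b that by (simp add: bij_betw_inv_into_right)
  have 2: "?\<mu> (\<kappa> t) = t" if "t \<in> {0..1}" for t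
    using b that by (simp add: bij_betw_inv_into_left)
  have b': "bij_betw ?\<mu> {0..1} {0..1}" by (rule bij_betw_inv_into[OF b])
  have "continuous_on (\<kappa> ` {0..1}) ?\<mu>"
    by (rule continuous_on_inv[OF c]) (use 2 in auto)
  then have "continuous_on {0..1} ?\<mu>" using b by (simp add: bij_betw_def)
  moreover have "strict_mono_on {0..1} ?\<mu>"
  proof (rule strict_mono_onI)
    fix s t :: real assume st: "s \<in> {0..1}" "t \<in> {0..1}" "s < t"
    then have m: "?\<mu> s \<in> {0..1}" "?\<mu> t \<in> {0..1}" using b' bij_betwE by blast+
    show "?\<mu> s < ?\<mu> t"
    proof (rule ccontr)
      assume "\<not> ?thesis"
      then have "?\<mu> t \<le> ?\<mu> s" by simp
      then have "\<kappa> (?\<mu> t) \<le> \<kappa> (?\<mu> s)"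
        using time_changeD(5)[OF assms m(2,1)] by (cases "?\<mu> t = ?\<mu> s") auto
      then show False using 1 st by auto
    qed
  qed
  ultimately have "?\<mu> \<in> time_changes" using b' by (simp add: time_changes_def)
  then show ?thesis using 1 by blast
qed

lemma bdd_fun_comp:
  assumes "bdd_fun x" "\<kappa> \<in> time_changes" shows "bdd_fun (x \<circ> \<kappa>)"
  using assms time_changeD(1)[OF assms(2)] unfolding bdd_fun_def comp_def by blast

lemma bdd_below_J1:
  assumes "bdd_fun x" "bdd_fun y"
  shows "bdd_below ((\<lambda>\<kappa>. max (sup_dist \<kappa> id) (sup_dist (x \<circ> \<kappa>) y)) ` time_changes)"
  by (rule bdd_belowI[of _ 0])
     (auto simp: le_max_iff_disj intro!: sup_dist_nonneg time_changeD(2) bdd_fun_id)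

lemma J1_dist_lessE:
  assumes "bdd_fun x" "bdd_fun y" "J1_dist x y < e"
  obtains \<kappa> where "\<kappa> \<in> time_changes" "sup_dist \<kappa> id < e" "sup_dist (x \<circ> \<kappa>) y < e"
  using assms(3) id_time_change unfolding J1_dist_def
  by (subst (asm) cINF_less_iff[OF _ bdd_below_J1[OF assms(1,2)]]) auto

lemma J1_dist_le:
  assumes "bdd_fun x" "bdd_fun y" "\<kappa> \<in> time_changes"
    "\<And>t. t \<in> {0..1} \<Longrightarrow> \<bar>\<kappa> t - t\<bar> \<le> e" "\<And>t. t \<in> {0..1} \<Longrightarrow> \<bar>x (\<kappa> t) - y t\<bar> \<le> e"
  shows "J1_dist x y \<le> e"
  unfolding J1_dist_def
  by (rule cINF_lower2[OF bdd_below_J1[OF assms(1,2)] assms(3)])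
     (use assms(4,5) in \<open>auto intro!: sup_dist_le\<close>)

lemma J1_dist_nonneg: "bdd_fun x \<Longrightarrow> bdd_fun y \<Longrightarrow> 0 \<le> J1_dist x y"
  unfolding J1_dist_def using id_time_change
  by (intro cINF_greatest)
     (auto simp: le_max_iff_disj intro!: sup_dist_nonneg time_changeD(2) bdd_fun_id)

lemma J1_dist_commute_le:
  assumes "bdd_fun x" "bdd_fun y"
  shows "J1_dist y x \<le> J1_dist x y"
proof (rule field_le_epsilon)
  fix e :: real assume "e > 0"
  obtain \<kappa> where l: "\<kappa> \<in> time_changes" "sup_dist \<kappa> id < J1_dist x y + e"
    "sup_dist (x \<circ> \<kappa>) y < J1_dist x y + e"
    by (rule J1_dist_lessE[OF assms, of "J1_dist x y + e"]) (use \<open>e > 0\<close> in auto)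
  obtain \<mu> where m: "\<mu> \<in> time_changes" and m2: "\<forall>t\<in>{0..1}. \<kappa> (\<mu> t) = t"
    using inv_time_change[OF l(1)] by blast
  show "J1_dist y x \<le> J1_dist x y + e"
  proof (rule J1_dist_le[OF assms(2,1) m])
    fix t :: real assume t: "t \<in> {0..1}"
    have mt: "\<mu> t \<in> {0..1}" using time_changeD(1)[OF m t] .
    show "\<bar>\<mu> t - t\<bar> \<le> J1_dist x y + e"
      using le_sup_dist[OF time_changeD(2)[OF l(1)] bdd_fun_id mt] l(2) bspec[OF m2 t] by auto
    show "\<bar>y (\<mu> t) - x t\<bar> \<le> J1_dist x y + e"
      using le_sup_dist[OF bdd_fun_comp[OF assms(1) l(1)] assms(2) mt] l(3) bspec[OF m2 t] by auto
  qed
qed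

lemma J1_dist_triangle:
  assumes "bdd_fun x" "bdd_fun y" "bdd_fun z"
  shows "J1_dist x z \<le> J1_dist x y + J1_dist y z"
proof (rule field_le_epsilon)
  fix e :: real assume "e > 0"
  obtain \<kappa> where l: "\<kappa> \<in> time_changes" "sup_dist \<kappa> id < J1_dist x y + e/2"
    "sup_dist (x \<circ> \<kappa>) y < J1_dist x y + e/2"
    by (rule J1_dist_lessE[OF assms(1,2), of "J1_dist x y + e/2"]) (use \<open>e > 0\<close> in auto)
  obtain \<mu> where m: "\<mu> \<in> time_changes" "sup_dist \<mu> id < J1_dist y z + e/2"
    "sup_dist (y \<circ> \<mu>) z < J1_dist y z + e/2"
    by (rule J1_dist_lessE[OF assms(2,3), of "J1_dist y z + e/2"]) (use \<open>e > 0\<close> in auto)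
  show "J1_dist x z \<le> J1_dist x y + J1_dist y z + e"
  proof (rule J1_dist_le[OF assms(1,3) comp_time_change[OF l(1) m(1)]])
    fix t :: real assume t: "t \<in> {0..1}"
    have mt: "\<mu> t \<in> {0..1}" using time_changeD(1)[OF m(1) t] .
    show "\<bar>(\<kappa> \<circ> \<mu>) t - t\<bar> \<le> J1_dist x y + J1_dist y z + e"
      using le_sup_dist[OF time_changeD(2)[OF l(1)] bdd_fun_id mt] l(2)
        le_sup_dist[OF time_changeD(2)[OF m(1)] bdd_fun_id t] m(2) unfolding comp_def id_def by linarith
    show "\<bar>x ((\<kappa> \<circ> \<mu>) t) - z t\<bar> \<le> J1_dist x y + J1_dist y z + e"
      using le_sup_dist[OF bdd_fun_comp[OF assms(1) l(1)] assms(2) mt] l(3)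
        le_sup_dist[OF bdd_fun_comp[OF assms(2) m(1)] assms(3) t] m(3) unfolding comp_def id_def by linarith
  qed
qed

lemma J1_dist_zero_imp_eq:
  assumes x: "cadlag x" "bdd_fun x" and y: "cadlag y" "bdd_fun y"
    and 0: "J1_dist x y = 0" and t: "t \<in> {0..1}"
  shows "x t = y t"
proof (cases "t < 1")
  case False
  then have [simp]: "t = 1" using t by simp
  have "\<bar>x t - y t\<bar> \<le> e" if e: "e > 0" for e
  proof -
    obtain \<kappa> where l: "\<kappa> \<in> time_changes" "sup_dist (x \<circ> \<kappa>) y < e"
      by (rule J1_dist_lessE[OF x(2) y(2), of e]) (use 0 e in auto)
    show ?thesis
      using le_sup_dist[OF bdd_fun_comp[OF x(2) l(1)] y(2) t] l(2) time_changeD(3)[OF l(1)] by auto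
  qed
  then show ?thesis using field_le_epsilon[of "\<bar>x t - y t\<bar>" 0] by auto
next
  case True
  have "\<bar>x t - y t\<bar> \<le> 3 * e" if e: "e > 0" for e
  proof -
    have "(x \<longlongrightarrow> x t) (at_right t)" "(y \<longlongrightarrow> y t) (at_right t)"
      using x(1) y(1) t True by (auto simp: cadlag_def)
    then have "eventually (\<lambda>s. dist (x s) (x t) < e) (at_right t)"
      "eventually (\<lambda>s. dist (y s) (y t) < e) (at_right t)"
      using e by (auto intro: tendstoD)
    then obtain b c where b: "b > t" "\<And>s. t < s \<Longrightarrow> s < b \<Longrightarrow> dist (x s) (x t) < e"
      and c: "c > t" "\<And>s. t < s \<Longrightarrow> s < c \<Longrightarrow> dist (y s) (y t) < e"
      by (auto simp: eventually_at_right_field)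
    define d where "d = min (min b c) 1 - t"
    have d: "d > 0" using b c True by (simp add: d_def)
    define s where "s = t + d / 2"
    have s: "s \<in> {0..1}" "t < s" "s < b" "s < c"
      using d t b c True unfolding s_def d_def by (auto simp: field_simps min_def split: if_splits)
    obtain \<kappa> where l: "\<kappa> \<in> time_changes" "sup_dist \<kappa> id < min (d/2) e"
      "sup_dist (x \<circ> \<kappa>) y < min (d/2) e"
      by (rule J1_dist_lessE[OF x(2) y(2), of "min (d/2) e"]) (use 0 e d in auto)
    have "\<bar>\<kappa> s - s\<bar> < d / 2"
      using le_sup_dist[OF time_changeD(2)[OF l(1)] bdd_fun_id s(1)] l(2) by auto
    then have ls: "t < \<kappa> s" "\<kappa> s < b" unfolding s_def d_def by (auto simp: field_simps abs_less_iff min_def split: if_splits)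
    have "\<bar>x (\<kappa> s) - y s\<bar> < e"
      using le_sup_dist[OF bdd_fun_comp[OF x(2) l(1)] y(2) s(1)] l(3) by auto
    moreover have "\<bar>x (\<kappa> s) - x t\<bar> < e" using b(2)[OF ls] by (simp add: dist_real_def)
    moreover have "\<bar>y s - y t\<bar> < e" using c(2) s by (simp add: dist_real_def)
    ultimately show ?thesis by linarith
  qed
  then have "\<bar>x t - y t\<bar> \<le> e" if "e > 0" for e
    using that by (metis divide_pos_pos nonzero_mult_div_cancel_left times_divide_eq_right zero_less_numeral zero_neq_numeral)
  then show ?thesis using field_le_epsilon[of "\<bar>x t - y t\<bar>" 0] by auto
qed

lemma bdd_fun_eval_path: "bdd_fun (eval_path x)"
  using cadlag_bounded[OF cadlag_eval_path[of x]] by (metis bdd_fun_def)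

instantiation skorokhod :: metric_space
begin

definition dist_skorokhod :: "skorokhod \<Rightarrow> skorokhod \<Rightarrow> real" where
  "dist_skorokhod x y = J1_dist (eval_path x) (eval_path y)"

definition uniformity_skorokhod :: "(skorokhod \<times> skorokhod) filter" where
  "uniformity_skorokhod = (INF e\<in>{0<..}. principal {(x, y). dist x y < e})"

definition open_skorokhod :: "skorokhod set \<Rightarrow> bool" where
  "open_skorokhod U \<longleftrightarrow> (\<forall>x\<in>U. eventually (\<lambda>(x', y). x' = x \<longrightarrow> y \<in> U) uniformity)"

instance
proof
  fix x y z :: skorokhod
  show "dist x y = 0 \<longleftrightarrow> x = y"
  proof
    assume "dist x y = 0"
    then have 0: "J1_dist (eval_path x) (eval_path y) = 0" by (simp add: dist_skorokhod_def)
    show "x = y"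
      by (rule path_eqI, rule J1_dist_zero_imp_eq[OF cadlag_eval_path bdd_fun_eval_path
            cadlag_eval_path bdd_fun_eval_path 0])
  next
    assume "x = y"
    then have "dist x y \<le> 0"
      unfolding dist_skorokhod_def
      by (intro J1_dist_le[OF _ _ id_time_change] bdd_fun_eval_path) auto
    then show "dist x y = 0"
      using J1_dist_nonneg[of "eval_path x" "eval_path y"]
      by (simp add: dist_skorokhod_def bdd_fun_eval_path)
  qed
  have "dist x y \<le> dist x z + J1_dist (eval_path z) (eval_path y)"
    unfolding dist_skorokhod_def by (intro J1_dist_triangle bdd_fun_eval_path)
  also have "J1_dist (eval_path z) (eval_path y) \<le> dist y z"
    unfolding dist_skorokhod_def by (intro J1_dist_commute_le bdd_fun_eval_path)
  finally show "dist x y \<le> dist x z + dist y z" by simp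
qed (simp_all add: uniformity_skorokhod_def open_skorokhod_def)

end

text \<open>The topology (hence interior and Borel sets) of the space of d-dimensional paths is the product
  topology of the function type; \<open>open_max_dist\<close> below states that it is induced by the
  maximum metric.\<close>

definition max_dist :: "('d::finite \<Rightarrow> 'a::metric_space) \<Rightarrow> ('d \<Rightarrow> 'a) \<Rightarrow> real" where
  "max_dist x y = Max (range (\<lambda>i. dist (x i) (y i)))"

lemma max_dist_less_iff: "max_dist x y < e \<longleftrightarrow> (\<forall>i. dist (x i) (y i) < e)"
  unfolding max_dist_def by (subst Max_less_iff) auto

lemma open_max_dist:
  fixes U :: "('d::finite \<Rightarrow> 'a::metric_space) set"
  shows "open U \<longleftrightarrow> (\<forall>x\<in>U. \<exists>e>0. \<forall>y. max_dist x y < e \<longrightarrow> y \<in> U)"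
proof
  assume U: "open U"
  show "\<forall>x\<in>U. \<exists>e>0. \<forall>y. max_dist x y < e \<longrightarrow> y \<in> U"
  proof
    fix x assume x: "x \<in> U"
    have "openin (product_topology (\<lambda>i. euclidean) UNIV) U"
      using U by (simp add: open_fun_def)
    from product_topology_open_contains_basis[OF this x]
    obtain X where X: "x \<in> Pi\<^sub>E UNIV X" "\<And>i. open (X i)" "Pi\<^sub>E UNIV X \<subseteq> U" by auto
    have "\<exists>e>0. ball (x i) e \<subseteq> X i" for i
      using X(1,2) by (auto simp: open_contains_ball)
    then obtain e where e: "\<And>i. e i > 0" "\<And>i. ball (x i) (e i) \<subseteq> X i" by metis
    have "0 < Min (range e)" using e by simp
    moreover have "y \<in> U" if y: "max_dist x y < Min (range e)" for y
    proof -
      have "y i \<in> X i" for i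
      proof -
        have "dist (x i) (y i) < Min (range e)" using y by (simp add: max_dist_less_iff)
        also have "\<dots> \<le> e i" by simp
        finally show ?thesis using e(2)[of i] by auto
      qed
      then show ?thesis using X(3) by auto
    qed
    ultimately show "\<exists>e>0. \<forall>y. max_dist x y < e \<longrightarrow> y \<in> U" by blast
  qed
next
  assume *: "\<forall>x\<in>U. \<exists>e>0. \<forall>y. max_dist x y < e \<longrightarrow> y \<in> U"
  show "open U"
  proof (subst open_subopen, intro ballI)
    fix x assume "x \<in> U"
    then obtain e where e: "e > 0" "\<And>y. max_dist x y < e \<Longrightarrow> y \<in> U" using * by blast
    have "open (Pi\<^sub>E UNIV (\<lambda>i. ball (x i) e))" by (intro open_PiE) auto
    moreover have "x \<in> Pi\<^sub>E UNIV (\<lambda>i. ball (x i) e)" using e by auto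
    moreover have "Pi\<^sub>E UNIV (\<lambda>i. ball (x i) e) \<subseteq> U"
      using e by (auto simp: max_dist_less_iff PiE_iff)
    ultimately show "\<exists>T. open T \<and> x \<in> T \<and> T \<subseteq> U" by blast
  qed
qed

text \<open>In \<^typ>\<open>ereal\<close> the infimum of the empty set is infinite.\<close>

definition bounded_away :: "('d::finite \<Rightarrow> skorokhod) set \<Rightarrow> ('d \<Rightarrow> skorokhod) set \<Rightarrow> bool" where
  "bounded_away A S \<longleftrightarrow> 0 < (INF x\<in>A. INF y\<in>S. ereal (max_dist x y))"


section \<open>Step functions and jumps\<close>

definition jump :: "skorokhod \<Rightarrow> real \<Rightarrow> real" where
  "jump x t = eval_path x t - Lim (at_left t) (eval_path x)"

definition jump_times :: "skorokhod \<Rightarrow> real set" where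
  "jump_times x = {t\<in>{0<..1}. jump x t \<noteq> 0}"

text \<open>Since paths are right-continuous, a step function is constant on the half-open intervals
  between successive points of some finite partition.\<close>

definition is_step :: "skorokhod \<Rightarrow> bool" where
  "is_step x \<longleftrightarrow> (\<exists>T. finite T \<and>
     (\<forall>s t. 0 \<le> s \<and> s \<le> t \<and> t \<le> 1 \<and> {s<..t} \<inter> T = {} \<longrightarrow> eval_path x s = eval_path x t))"

definition D_eq :: "nat \<Rightarrow> skorokhod set" where
  "D_eq l = {x. is_step x \<and> mono_on {0..1} (eval_path x) \<and> eval_path x 0 = 0 \<and>
                finite (jump_times x) \<and> card (jump_times x) = l}"

definition D_lt :: "nat \<Rightarrow> skorokhod set" where
  "D_lt l = (\<Union>j\<in>{..<l}. D_eq j)"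

definition D_prod :: "('d \<Rightarrow> nat) \<Rightarrow> ('d \<Rightarrow> skorokhod) set" where
  "D_prod l = (\<Pi> i\<in>UNIV. D_eq (l i))"

definition cost :: "('d::finite \<Rightarrow> real) \<Rightarrow> ('d \<Rightarrow> nat) \<Rightarrow> real" where
  "cost \<beta> l = (\<Sum>i\<in>UNIV. (\<beta> i - 1) * real (l i))"

definition I_lt :: "('d::finite \<Rightarrow> real) \<Rightarrow> ('d \<Rightarrow> nat) \<Rightarrow> ('d \<Rightarrow> nat) set" where
  "I_lt \<beta> l' = {l. l \<noteq> l' \<and> cost \<beta> l \<le> cost \<beta> l'}"

definition D_lt_prod :: "('d::finite \<Rightarrow> real) \<Rightarrow> ('d \<Rightarrow> nat) \<Rightarrow> ('d \<Rightarrow> skorokhod) set" where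
  "D_lt_prod \<beta> l' = (\<Union>l\<in>I_lt \<beta> l'. D_prod l)"

definition C_set :: "('d \<Rightarrow> nat) \<Rightarrow> ('d \<Rightarrow> skorokhod) set" where
  "C_set l = (\<Union>i. {\<xi>. \<xi> i \<in> D_lt (l i)})"

definition prec :: "('d \<Rightarrow> nat) \<Rightarrow> ('d \<Rightarrow> nat) \<Rightarrow> bool" where
  "prec l m \<longleftrightarrow> C_set l \<subset> C_set m"

definition J_set :: "('d::finite \<Rightarrow> real) \<Rightarrow> ('d \<Rightarrow> nat) \<Rightarrow> ('d \<Rightarrow> nat) set" where
  "J_set \<beta> l' = {l. l \<notin> I_lt \<beta> l' \<and> (\<forall>m. prec m l \<longrightarrow> m \<in> I_lt \<beta> l')}"

text \<open>A cadlag path has only finitely many jumps above any positive level, so for positive \<gamma>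
  the cardinality is that of a finite set.\<close>

definition B_lev :: "('d \<Rightarrow> real) \<Rightarrow> ('d \<Rightarrow> nat) \<Rightarrow> ('d \<Rightarrow> skorokhod) set" where
  "B_lev \<gamma> l = {\<xi>. \<forall>i. l i \<le> card {t\<in>{0<..1}. \<gamma> i < jump (\<xi> i) t}}"

definition B_set :: "('d::finite \<Rightarrow> real) \<Rightarrow> ('d \<Rightarrow> nat) \<Rightarrow> ('d \<Rightarrow> real) \<Rightarrow> ('d \<Rightarrow> skorokhod) set" where
  "B_set \<beta> l' \<gamma> = (\<Union>l\<in>J_set \<beta> l'. B_lev \<gamma> l)"


section \<open>The limit measures\<close>

definition nu :: "real \<Rightarrow> real measure" where
  "nu \<beta> = density lborel (\<lambda>x. ennreal (\<beta> * x powr (- \<beta> - 1)) * indicator {0<..} x)"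

lemma nu_tail:
  assumes "\<beta> > 0" "x > 0"
  shows "emeasure (nu \<beta>) {x<..} = ennreal (x powr - \<beta>)"
proof -
  have lim: "((\<lambda>y. - (y powr - \<beta>)) \<longlongrightarrow> 0) at_top"
    using assms by (intro tendsto_minus_cancel_left[THEN iffD1, of _ 0, simplified] tendsto_neg_powr filterlim_ident) auto
  have "emeasure (nu \<beta>) {x<..} = emeasure (nu \<beta>) {x..}"
  proof -
    have "AE y in lborel. y \<noteq> x" by (rule AE_lborel_singleton)
    then show ?thesis unfolding nu_def
      by (subst (1 2) emeasure_density) (auto intro!: nn_integral_cong_AE simp: indicator_def)
  qed
  also have "\<dots> = (\<integral>\<^sup>+y. ennreal (\<beta> * y powr (- \<beta> - 1)) * indicator {x..} y \<partial>lborel)"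
    unfolding nu_def using assms
    by (subst emeasure_density) (auto intro!: nn_integral_cong simp: indicator_def)
  also have "\<dots> = ennreal (0 - (- (x powr - \<beta>)))"
  proof (rule nn_integral_FTC_atLeast)
    fix y assume "x \<le> y"
    then have "y > 0" using assms by simp
    then show "DERIV (\<lambda>y. - (y powr - \<beta>)) y :> \<beta> * y powr (- \<beta> - 1)"
      by (auto intro!: derivative_eq_intros simp: powr_diff)
    show "0 \<le> \<beta> * y powr (- \<beta> - 1)" using assms by simp
  qed (use lim in auto)
  finally show ?thesis by simp
qed

text \<open>The jump sizes \<open>y\<^sub>1, \<dots>, y\<^sub>l\<close> are indexed by \<open>{..<l}\<close>.\<close>

definition nu_pow :: "real \<Rightarrow> nat \<Rightarrow> (nat \<Rightarrow> real) measure" where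
  "nu_pow \<beta> l =
     (let P = (\<Pi>\<^sub>M j\<in>{..<l}. nu \<beta>)
      in density P (indicator {y\<in>space P. \<forall>i j. i \<le> j \<and> j < l \<longrightarrow> y j \<le> y i}))"

definition step_path :: "nat \<Rightarrow> (nat \<Rightarrow> real) \<Rightarrow> (nat \<Rightarrow> real) \<Rightarrow> skorokhod" where
  "step_path l u y = mk_path (\<lambda>t. \<Sum>j<l. y j * indicator {u j..1} t)"

lemma cadlag_step_path: "cadlag (\<lambda>t. \<Sum>j<l. y j * indicator {u j..1} t)"
  unfolding cadlag_def
proof (intro conjI ballI)
  fix t :: real assume t: "t \<in> {0..<1}"
  have "((\<lambda>s. indicator {u j..1} s :: real) \<longlongrightarrow> indicator {u j..1} t) (at_right t)" for j
  proof (rule tendsto_eventually)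
    show "eventually (\<lambda>s. indicator {u j..1} s = (indicator {u j..1} t :: real)) (at_right t)"
      using t by (intro eventually_at_rightI[of t "if u j \<le> t then 1 else u j"])
                 (auto simp: indicator_def split: if_splits)
  qed
  then show "((\<lambda>t. \<Sum>j<l. y j * indicator {u j..1} t) \<longlongrightarrow> (\<Sum>j<l. y j * indicator {u j..1} t)) (at_right t)"
    by (intro tendsto_intros)
next
  fix t :: real assume t: "t \<in> {0<..1}"
  have "((\<lambda>s. indicator {u j..1} s :: real) \<longlongrightarrow> (if u j < t then 1 else 0)) (at_left t)" for j
  proof (rule tendsto_eventually)
    show "eventually (\<lambda>s. indicator {u j..1} s = (if u j < t then 1 else 0 :: real)) (at_left t)"
      using t by (intro eventually_at_leftI[of "if u j < t then u j else 0" t])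
                 (auto simp: indicator_def split: if_splits)
  qed
  then have "((\<lambda>t. \<Sum>j<l. y j * indicator {u j..1} t) \<longlongrightarrow>
      (\<Sum>j<l. y j * (if u j < t then 1 else 0))) (at_left t)"
    by (intro tendsto_intros)
  then show "\<exists>c. ((\<lambda>t. \<Sum>j<l. y j * indicator {u j..1} t) \<longlongrightarrow> c) (at_left t)" by blast
qed

text \<open>The expectation over the independent uniform jump times \<open>U\<^sub>1, \<dots>, U\<^sub>l\<close> is taken on the
  product space on which they are the coordinates.\<close>

definition C_meas :: "real \<Rightarrow> nat \<Rightarrow> skorokhod measure" where
  "C_meas \<beta> l =
     (if l = 0 then return borel (mk_path (\<lambda>_. 0))
      else measure_of UNIV (sets borel)
        (\<lambda>S. \<integral>\<^sup>+u. emeasure (nu_pow \<beta> l)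
                 {y\<in>space (nu_pow \<beta> l). (\<forall>j<l. 0 < y j) \<and> step_path l u y \<in> S}
             \<partial>(\<Pi>\<^sub>M j\<in>{..<l}. uniform_measure lborel {0..1})))"


section \<open>Compensated compound Poisson processes\<close>

text \<open>Path regularity is required surely, so that the scaled process has all its paths in the
  Skorokhod space. The truncated subtraction of naturals is exact, as paths are non-decreasing.\<close>

definition poisson_process :: "'w measure \<Rightarrow> real \<Rightarrow> (real \<Rightarrow> 'w \<Rightarrow> nat) \<Rightarrow> bool" where
  "poisson_process M lam N \<longleftrightarrow>
     (\<forall>t\<ge>0. N t \<in> measurable M (count_space UNIV)) \<and>
     (\<forall>\<omega>\<in>space M. N 0 \<omega> = 0 \<and> mono_on {0..} (\<lambda>t. N t \<omega>) \<and>
        (\<forall>t\<ge>0. ((\<lambda>s. N s \<omega>) \<longlongrightarrow> N t \<omega>) (at_right t))) \<and>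
     (\<forall>(k::nat) t. 0 \<le> t 0 \<and> (\<forall>j<k. t j \<le> t (Suc j)) \<longrightarrow>
        prob_space.indep_vars M (\<lambda>_. count_space UNIV)
          (\<lambda>j \<omega>. N (t (Suc j)) \<omega> - N (t j) \<omega>) {..<k}) \<and>
     (\<forall>s t. 0 \<le> s \<and> s < t \<longrightarrow>
        distr M (count_space UNIV) (\<lambda>\<omega>. N t \<omega> - N s \<omega>) = measure_pmf (poisson_pmf (lam * (t - s))))"

definition positive_iid :: "'w measure \<Rightarrow> (nat \<Rightarrow> 'w \<Rightarrow> real) \<Rightarrow> bool" where
  "positive_iid M W \<longleftrightarrow>
     prob_space.indep_vars M (\<lambda>_. borel) W {1..} \<and>
     (\<forall>k\<ge>1. distr M borel (W k) = distr M borel (W 1)) \<and>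
     (\<forall>k\<ge>1. AE \<omega> in M. 0 < W k \<omega>)"

definition gen_sigma :: "'w measure \<Rightarrow> 't set \<Rightarrow> ('t \<Rightarrow> 'w \<Rightarrow> 'b) \<Rightarrow> 'b measure \<Rightarrow> 'w set set" where
  "gen_sigma M T Y E = sigma_sets (space M) (\<Union>t\<in>T. {Y t -` S \<inter> space M |S. S \<in> sets E})"

text \<open>Mutual independence of all the \<open>N i\<close> and all the sequences \<open>W i\<close>, through the
  \<sigma>-algebras that they generate.\<close>

definition indep_families ::
  "'w measure \<Rightarrow> ('d \<Rightarrow> real \<Rightarrow> 'w \<Rightarrow> nat) \<Rightarrow> ('d \<Rightarrow> nat \<Rightarrow> 'w \<Rightarrow> real) \<Rightarrow> bool" where
  "indep_families M N W \<longleftrightarrow>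
     prob_space.indep_sets M
       (case_sum (\<lambda>i. gen_sigma M {0..} (N i) (count_space UNIV)) (\<lambda>i. gen_sigma M {1..} (W i) borel))
       UNIV"

definition compensated_cp ::
  "'w measure \<Rightarrow> real \<Rightarrow> (real \<Rightarrow> 'w \<Rightarrow> nat) \<Rightarrow> (nat \<Rightarrow> 'w \<Rightarrow> real) \<Rightarrow> real \<Rightarrow> 'w \<Rightarrow> real" where
  "compensated_cp M lam N W t \<omega> = (\<Sum>k=1..N t \<omega>. W k \<omega>) - lam * t * (\<integral>\<omega>'. W 1 \<omega>' \<partial>M)"

definition scaled_path :: "('d \<Rightarrow> real \<Rightarrow> 'w \<Rightarrow> real) \<Rightarrow> nat \<Rightarrow> 'w \<Rightarrow> 'd \<Rightarrow> skorokhod" where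
  "scaled_path X n \<omega> = (\<lambda>i. mk_path (\<lambda>t. X i (real n * t) \<omega> / real n))"

lemma cadlag_scaled_path:
  assumes N: "poisson_process M lam N" and \<omega>: "\<omega> \<in> space M" and n: "n > 0"
  shows "cadlag (\<lambda>t. compensated_cp M lam N W (real n * t) \<omega> / real n)"
proof -
  have mono: "mono_on {0..} (\<lambda>t. N t \<omega>)"
    and rc: "\<And>t. t \<ge> 0 \<Longrightarrow> ((\<lambda>s. N s \<omega>) \<longlongrightarrow> N t \<omega>) (at_right t)"
    using N \<omega> by (auto simp: poisson_process_def)
  define S where "S m = (\<Sum>k=1..m. W k \<omega>)" for m
  have right: "((\<lambda>s. S (N (real n * s) \<omega>)) \<longlongrightarrow> S (N (real n * t) \<omega>)) (at_right t)" if t: "t \<ge> 0" for t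
  proof -
    have "eventually (\<lambda>s. N s \<omega> = N (real n * t) \<omega>) (at_right (real n * t))"
      using rc[of "real n * t"] t by (simp add: tendsto_discrete)
    then obtain b where b: "b > real n * t" "\<And>s. real n * t < s \<Longrightarrow> s < b \<Longrightarrow> N s \<omega> = N (real n * t) \<omega>"
      by (auto simp: eventually_at_right_field)
    have "eventually (\<lambda>s. N (real n * s) \<omega> = N (real n * t) \<omega>) (at_right t)"
      using b n by (intro eventually_at_rightI[of t "b / real n"]) (auto simp: field_simps)
    then show ?thesis by (intro tendsto_eventually) (auto elim: eventually_mono)
  qed
  have left: "\<exists>c. ((\<lambda>s. S (N (real n * s) \<omega>)) \<longlongrightarrow> c) (at_left t)" if t: "t > 0" for t
  proof -
    let ?R = "(\<lambda>s. N (real n * s) \<omega>) ` {0..<t}"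
    have fin: "finite ?R"
      by (rule finite_subset[of _ "{..N (real n * t) \<omega>}"])
         (use mono t in \<open>auto intro!: mono_onD[OF mono] mult_left_mono\<close>)
    have "Max ?R \<in> ?R" using t fin by (intro Max_in) auto
    then obtain s0 where s0: "s0 \<in> {0..<t}" "Max ?R = N (real n * s0) \<omega>" by auto
    have "N (real n * s) \<omega> = N (real n * s0) \<omega>" if s: "s0 < s" "s < t" for s
    proof (rule antisym)
      have "s \<in> {0..<t}" using s s0 by auto
      then show "N (real n * s) \<omega> \<le> N (real n * s0) \<omega>"
        unfolding s0(2)[symmetric] using fin by (intro Max_ge) auto
      show "N (real n * s0) \<omega> \<le> N (real n * s) \<omega>"
        using s s0 by (intro mono_onD[OF mono]) (auto intro!: mult_left_mono)
    qed
    then have "eventually (\<lambda>s. N (real n * s) \<omega> = N (real n * s0) \<omega>) (at_left t)"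
      using s0 by (intro eventually_at_leftI[of s0 t]) auto
    then have "((\<lambda>s. S (N (real n * s) \<omega>)) \<longlongrightarrow> S (N (real n * s0) \<omega>)) (at_left t)"
      by (intro tendsto_eventually) (auto elim: eventually_mono)
    then show ?thesis by blast
  qed
  show ?thesis
    unfolding cadlag_def compensated_cp_def S_def[symmetric]
  proof (intro conjI ballI)
    fix t :: real assume "t \<in> {0..<1}"
    then show "((\<lambda>t. (S (N (real n * t) \<omega>) - lam * (real n * t) * (\<integral>\<omega>'. W 1 \<omega>' \<partial>M)) / real n) \<longlongrightarrow>
      (S (N (real n * t) \<omega>) - lam * (real n * t) * (\<integral>\<omega>'. W 1 \<omega>' \<partial>M)) / real n) (at_right t)"
      using n by (intro tendsto_intros right) auto
  next
    fix t :: real assume "t \<in> {0<..1}"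
    then obtain c where "((\<lambda>s. S (N (real n * s) \<omega>)) \<longlongrightarrow> c) (at_left t)" using left by auto
    then have "((\<lambda>t. (S (N (real n * t) \<omega>) - lam * (real n * t) * (\<integral>\<omega>'. W 1 \<omega>' \<partial>M)) / real n) \<longlongrightarrow>
      (c - lam * (real n * t) * (\<integral>\<omega>'. W 1 \<omega>' \<partial>M)) / real n) (at_left t)"
      using n by (intro tendsto_intros) auto
    then show "\<exists>l. ((\<lambda>t. (S (N (real n * t) \<omega>) - lam * (real n * t) * (\<integral>\<omega>'. W 1 \<omega>' \<partial>M)) / real n) \<longlongrightarrow> l) (at_left t)"
      by blast
  qed
qed

definition regularly_varying :: "(real \<Rightarrow> real) \<Rightarrow> real \<Rightarrow> bool" where
  "regularly_varying f \<rho> \<longleftrightarrow>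
     f \<in> borel_measurable borel \<and> (\<forall>\<^sub>F x in at_top. 0 < f x) \<and>
     (\<forall>a>0. ((\<lambda>x. f (a * x) / f x) \<longlongrightarrow> a powr \<rho>) at_top)"


section \<open>The importance sampling estimator\<close>

text \<open>\<^term>\<open>uniform_measure M B\<close> is the conditional measure given \<open>B\<close>.\<close>

definition mixture :: "real \<Rightarrow> 'w measure \<Rightarrow> 'w set \<Rightarrow> 'w measure" where
  "mixture w M B = measure_of (space M) (sets M)
     (\<lambda>E. ennreal w * emeasure M E + ennreal (1 - w) * emeasure (uniform_measure M B) E)"

lemma sets_mixture [simp, measurable_cong]: "sets (mixture w M B) = sets M"
  and space_mixture [simp]: "space (mixture w M B) = space M"
  by (simp_all add: mixture_def)

lemma emeasure_mixture:
  assumes "E \<in> sets M"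
  shows "emeasure (mixture w M B) E =
    ennreal w * emeasure M E + ennreal (1 - w) * emeasure (uniform_measure M B) E"
proof (rule emeasure_measure_of[OF mixture_def])
  show "countably_additive (sets (mixture w M B))
     (\<lambda>E. ennreal w * emeasure M E + ennreal (1 - w) * emeasure (uniform_measure M B) E)"
  proof (rule countably_additiveI)
    fix F :: "nat \<Rightarrow> _" assume F: "range F \<subseteq> sets (mixture w M B)" "disjoint_family F"
    have 1: "(\<Sum>i. emeasure M (F i)) = emeasure M (\<Union>i. F i)"
      using F by (intro suminf_emeasure) auto
    have 2: "(\<Sum>i. emeasure (uniform_measure M B) (F i)) = emeasure (uniform_measure M B) (\<Union>i. F i)"
      using F by (intro suminf_emeasure) auto
    show "(\<Sum>i. ennreal w * emeasure M (F i) + ennreal (1 - w) * emeasure (uniform_measure M B) (F i)) =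
      ennreal w * emeasure M (\<Union>i. F i) + ennreal (1 - w) * emeasure (uniform_measure M B) (\<Union>i. F i)"
      by (subst suminf_add[symmetric]) (auto simp: ennreal_suminf_cmult 1 2)
  qed
qed (use assms sets.space_closed in \<open>auto simp: positive_def\<close>)

definition estimator :: "real \<Rightarrow> 'w measure \<Rightarrow> 'w set \<Rightarrow> 'w set \<Rightarrow> 'w \<Rightarrow> real" where
  "estimator w M A B \<omega> = indicator A \<omega> / (w + (1 - w) / measure M B * indicator B \<omega>)"

text \<open>The estimator takes values in the interval from 0 to \<open>1 / w\<close>, so its second moment is a
  finite Bochner integral.\<close>

definition strongly_efficient ::
  "(nat \<Rightarrow> 'w measure) \<Rightarrow> (nat \<Rightarrow> 'w \<Rightarrow> real) \<Rightarrow> (nat \<Rightarrow> real) \<Rightarrow> bool" where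
  "strongly_efficient Q Z p \<longleftrightarrow> (\<lambda>n. \<integral>\<omega>. (Z n \<omega>)\<^sup>2 \<partial>Q n) \<in> O(\<lambda>n. (p n)\<^sup>2)"

end

theory Submission
  imports Defs "HOL-Real_Asymp.Real_Asymp"
begin

text \<open>The second moment of the estimator is at most
  \<open>P(A\<^sub>n - B\<^sub>n) / w + P(A\<^sub>n) P(B\<^sub>n) / (1 - w)\<close>, so it suffices that
  \<open>P(A\<^sub>n - B\<^sub>n) = O(P(A\<^sub>n)\<^sup>2)\<close> and \<open>P(B\<^sub>n) = O(P(A\<^sub>n))\<close>. Let
  \<open>r\<^sub>n\<close> be the product over \<open>i\<close> of \<open>(n P(W\<^sup>i > n))\<close> to the power \<open>l\<^sup>*\<^sub>i\<close>; up to factors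
  \<open>n\<^sup>\<epsilon>\<close> it is \<open>n\<close> to the power \<open>- \<I>(l\<^sup>*)\<close>.

  Lower bound: the interior of \<open>A\<close> has positive limit measure and hence contains a step path with distinct
  jump times in the open unit interval and positive jump sizes. The scaled process stays near such
  a path with probability at least a multiple of \<open>r\<^sub>n\<close>, so \<open>P(A\<^sub>n) \<ge> c r\<^sub>n\<close>.

  Upper bound for \<open>B\<^sub>n\<close>: every level vector in \<open>J\<close> is \<open>l\<^sup>*\<close> or costs strictly more than
  \<open>l\<^sup>*\<close>, and finitely many of them suffice to cover \<open>B\<^sup>\<gamma>\<close>; hence \<open>P(B\<^sub>n) = O(r\<^sub>n)\<close>.

  Off \<open>B\<^sub>n\<close> the vector of numbers of jumps above \<open>\<gamma>\<close> lies in \<open>I\<^sub><\<close>, so keeping only those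
  jumps gives an element of the set from which \<open>A\<close> is bounded away. On
  \<open>A\<^sub>n - B\<^sub>n\<close> the compensated sum of the jumps below \<open>\<gamma> n\<close> must therefore deviate by a
  multiple of \<open>n\<close>, which for small \<open>\<gamma>\<close> has probability \<open>O(n\<^sup>-\<^sup>p)\<close> with \<open>p\<close> as large as
  desired.\<close>

section \<open>Jumps of step paths\<close>

text \<open>The hypothesis concerns the tail of the process at time one, while all estimates need
  the tail of a single jump; regular variation has to be carried back from a compound Poisson sum to
  its summand.

  Rates are controlled only up to factors n^\<epsilon>, so \<open>P(A - B) = O(P(A)^2)\<close> is
  not reached by matching exponents: \<open>p\<close> is taken above twice a crude exponent of the
  lower bound for \<open>P(A)\<close>. This is affordable because truncation at
  \<open>\<gamma> n\<close> admits a Chernoff parameter of order log n / n, and small \<gamma> lets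
  its constant, hence the power of n gained, be large. The bound on \<open>P(B)\<close> holds for
  every positive \<gamma>, so \<gamma> is dictated by \<open>A - B\<close> alone.

  Independence is available between the \<sigma>-algebras of the arrivals and of the jump sizes.
  Events to be multiplied are therefore written as an arrival event intersected with a jump-size
  event that involves a deterministic number of jumps; the random count enters only through a
  regularity event.\<close>

lemma mk_path_cong: "(\<And>t. t \<in> {0..1} \<Longrightarrow> f t = g t) \<Longrightarrow> mk_path f = mk_path g"
  by (simp add: mk_path_def cong: restrict_cong)

lemma dist_mk_path_le:
  assumes "cadlag f" "cadlag g" "\<kappa> \<in> time_changes"
    "\<And>t. t \<in> {0..1} \<Longrightarrow> \<bar>\<kappa> t - t\<bar> \<le> e" "\<And>t. t \<in> {0..1} \<Longrightarrow> \<bar>f (\<kappa> t) - g t\<bar> \<le> e"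
  shows "dist (mk_path f) (mk_path g) \<le> e"
  unfolding dist_skorokhod_def
  by (rule J1_dist_le[OF bdd_fun_eval_path bdd_fun_eval_path assms(3)])
     (use assms time_changeD(1)[OF assms(3)] in \<open>simp_all add: eval_mk_path del: atLeastAtMost_iff\<close>)

lemma dist_mk_path_le_sup:
  assumes "cadlag f" "cadlag g" "\<And>t. t \<in> {0..1} \<Longrightarrow> \<bar>f t - g t\<bar> \<le> e" "0 \<le> e"
  shows "dist (mk_path f) (mk_path g) \<le> e"
  by (rule dist_mk_path_le[OF assms(1,2) id_time_change]) (use assms in auto)

text \<open>Common form of the step paths and of the scaled process: finitely many jumps
  \<open>y k\<close> at times \<open>u k\<close> plus a drift of slope \<open>c\<close>. The
  arbitrary index set lets jumps be dropped, truncated or moved without renumbering.\<close>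

definition jump_fun :: "'k set \<Rightarrow> ('k \<Rightarrow> real) \<Rightarrow> ('k \<Rightarrow> real) \<Rightarrow> real \<Rightarrow> real \<Rightarrow> real" where
  "jump_fun K u y c t = (\<Sum>k\<in>K. y k * of_bool (u k \<le> t)) + c * t"

lemma jump_fun_right: "(jump_fun K u y c \<longlongrightarrow> jump_fun K u y c t) (at_right t)"
proof -
  have "((\<lambda>s. of_bool (u k \<le> s) :: real) \<longlongrightarrow> of_bool (u k \<le> t)) (at_right t)" for k
  proof (rule tendsto_eventually)
    show "eventually (\<lambda>s. of_bool (u k \<le> s) = (of_bool (u k \<le> t) :: real)) (at_right t)"
      by (intro eventually_at_rightI[of t "if u k \<le> t then t + 1 else u k"]) (auto split: if_splits)
  qed
  then show ?thesis unfolding jump_fun_def by (intro tendsto_intros)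
qed

lemma jump_fun_left:
  "(jump_fun K u y c \<longlongrightarrow> (\<Sum>k\<in>K. y k * of_bool (u k < t)) + c * t) (at_left t)"
proof -
  have "((\<lambda>s. of_bool (u k \<le> s) :: real) \<longlongrightarrow> of_bool (u k < t)) (at_left t)" for k
  proof (rule tendsto_eventually)
    show "eventually (\<lambda>s. of_bool (u k \<le> s) = (of_bool (u k < t) :: real)) (at_left t)"
      by (intro eventually_at_leftI[of "if u k < t then u k else t - 1" t]) (auto split: if_splits)
  qed
  then show ?thesis unfolding jump_fun_def by (intro tendsto_intros)
qed

lemma cadlag_jump_fun: "cadlag (jump_fun K u y c)"
  unfolding cadlag_def using jump_fun_right jump_fun_left by blast

lemma jump_mk_path:
  assumes "cadlag f" "t \<in> {0<..1}" "(f \<longlongrightarrow> L) (at_left t)"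
  shows "jump (mk_path f) t = f t - L"
proof -
  have "eventually (\<lambda>s. eval_path (mk_path f) s = f s) (at_left t)"
    using assms by (intro eventually_at_leftI[of 0 t]) (auto intro!: eval_mk_path)
  then have "(eval_path (mk_path f) \<longlongrightarrow> L) (at_left t)"
    using assms(3) tendsto_cong by blast
  then have "Lim (at_left t) (eval_path (mk_path f)) = L"
    by (intro tendsto_Lim) auto
  then show ?thesis using assms by (simp add: jump_def eval_mk_path)
qed

lemma jump_jump_fun:
  assumes "t \<in> {0<..1}"
  shows "jump (mk_path (jump_fun K u y c)) t = (\<Sum>k\<in>K. y k * of_bool (u k = t))"
proof -
  have "jump (mk_path (jump_fun K u y c)) t =
      (\<Sum>k\<in>K. y k * of_bool (u k \<le> t)) - (\<Sum>k\<in>K. y k * of_bool (u k < t))"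
    using jump_mk_path[OF cadlag_jump_fun assms jump_fun_left] by (simp add: jump_fun_def)
  also have "\<dots> = (\<Sum>k\<in>K. y k * of_bool (u k = t))"
    unfolding sum_subtractf[symmetric] by (intro sum.cong) auto
  finally show ?thesis .
qed

lemma jump_jump_fun_at:
  assumes "finite K" "inj_on u K" "k \<in> K" "u k \<in> {0<..1}"
  shows "jump (mk_path (jump_fun K u y c)) (u k) = y k"
proof -
  have "(\<Sum>j\<in>K. y j * of_bool (u j = u k)) = (\<Sum>j\<in>K. if j = k then y j else 0)"
    using assms by (intro sum.cong) (auto dest: inj_onD)
  then show ?thesis using assms by (simp add: jump_jump_fun)
qed

lemma jump_jump_fun_notin:
  assumes "t \<in> {0<..1}" "t \<notin> u ` K"
  shows "jump (mk_path (jump_fun K u y c)) t = 0"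
  using assms by (auto simp: jump_jump_fun intro!: sum.neutral)

lemma card_jumps_jump_fun:
  assumes "finite K" "inj_on u K" "u ` K \<subseteq> {0<..1}" "0 \<le> g"
  shows "card {t\<in>{0<..1}. g < jump (mk_path (jump_fun K u y c)) t} = card {k\<in>K. g < y k}"
proof -
  have "{t\<in>{0<..1}. g < jump (mk_path (jump_fun K u y c)) t} = u ` {k\<in>K. g < y k}" (is "?L = ?R")
  proof
    show "?L \<subseteq> ?R"
    proof
      fix t assume t: "t \<in> ?L"
      then have "t \<in> u ` K" using jump_jump_fun_notin[of t u K y c] assms(4) by force
      then obtain k where "k \<in> K" "t = u k" by auto
      then show "t \<in> ?R" using t jump_jump_fun_at[OF assms(1,2), of k y c] by auto
    qed
    show "?R \<subseteq> ?L" using jump_jump_fun_at[OF assms(1,2)] assms(3) by auto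
  qed
  moreover have "inj_on u {k\<in>K. g < y k}" using assms(2) by (rule inj_on_subset) auto
  ultimately show ?thesis by (simp add: card_image)
qed

lemma jump_fun_D_eq:
  assumes "finite K" "inj_on u K" "u ` K \<subseteq> {0<..1}" "\<And>k. k \<in> K \<Longrightarrow> 0 < y k"
  shows "mk_path (jump_fun K u y 0) \<in> D_eq (card K)"
proof -
  let ?x = "mk_path (jump_fun K u y 0)"
  have ev: "eval_path ?x t = jump_fun K u y 0 t" if "t \<in> {0..1}" for t
    using that by (simp add: eval_mk_path cadlag_jump_fun del: atLeastAtMost_iff)
  have jt: "jump_times ?x = u ` K"
  proof
    show "jump_times ?x \<subseteq> u ` K"
      unfolding jump_times_def using jump_jump_fun_notin[of _ u K y 0] by blast
    show "u ` K \<subseteq> jump_times ?x"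
    proof
      fix t assume "t \<in> u ` K"
      then obtain k where k: "k \<in> K" "t = u k" by auto
      then have "u k \<in> {0<..1}" using assms(3) by auto
      from jump_jump_fun_at[OF assms(1,2) k(1) this, of y 0] assms(4)[OF k(1)] this
      show "t \<in> jump_times ?x" using k(2) unfolding jump_times_def by simp
    qed
  qed
  have step: "is_step ?x"
    unfolding is_step_def
  proof (intro exI[of _ "u ` K"] conjI allI impI)
    fix s t :: real assume st: "0 \<le> s \<and> s \<le> t \<and> t \<le> 1 \<and> {s<..t} \<inter> u ` K = {}"
    have eq: "u k \<le> s \<longleftrightarrow> u k \<le> t" if "k \<in> K" for k
    proof -
      have "u k \<notin> {s<..t}" using st that by blast
      then show ?thesis using st by auto
    qed
    have "jump_fun K u y 0 s = jump_fun K u y 0 t"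
      unfolding jump_fun_def using eq by (auto intro!: sum.cong)
    then show "eval_path ?x s = eval_path ?x t" using st ev by auto
  qed (use assms in auto)
  have mono: "mono_on {0..1} (eval_path ?x)"
  proof (rule mono_onI)
    fix s t :: real assume st: "s \<in> {0..1}" "t \<in> {0..1}" "s \<le> t"
    have "jump_fun K u y 0 s \<le> jump_fun K u y 0 t"
      unfolding jump_fun_def using st assms(4)
      by (auto intro!: sum_mono mult_left_mono simp: less_imp_le)
    then show "eval_path ?x s \<le> eval_path ?x t" using ev st by simp
  qed
  have "eval_path ?x 0 = (\<Sum>k\<in>K. y k * of_bool (u k \<le> 0))" by (simp add: ev jump_fun_def)
  also have "\<dots> = 0" using assms(3) by (intro sum.neutral) force
  finally show ?thesis
    using step mono jt assms(1) by (simp add: D_eq_def card_image[OF assms(2)])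
qed

lemma D_eq_unique: "x \<in> D_eq j \<Longrightarrow> x \<in> D_eq l \<Longrightarrow> j = l"
  by (simp add: D_eq_def)

text \<open>Supplies paths with a prescribed number of jumps in each coordinate, the test points by
  which index vectors are recovered from the sets \<open>C_set\<close>.\<close>

lemma D_eq_nonempty: "\<exists>x. x \<in> D_eq j"
proof -
  have "inj_on (\<lambda>k. 1 / (real k + 1)) {..<j}" by (auto simp: inj_on_def field_simps)
  then have "mk_path (jump_fun {..<j} (\<lambda>k. 1 / (real k + 1)) (\<lambda>_. 1) 0) \<in> D_eq (card {..<j})"
    by (intro jump_fun_D_eq) (auto simp: field_simps)
  then show ?thesis by auto
qed

text \<open>Tent functions of height \<open>h v - v\<close> around the points \<open>v\<close> have total slope less than one
  if the displacements are small, so adding them to the identity keeps it increasing.\<close>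

lemma time_change_through_points:
  assumes V: "finite V" "V \<subseteq> {0<..(1::real)}"
  shows "\<exists>e>0. \<forall>h. (1 \<in> V \<longrightarrow> h 1 = 1) \<and> (\<Sum>v\<in>V. \<bar>h v - v\<bar>) < e \<longrightarrow>
    (\<exists>\<kappa>\<in>time_changes. (\<forall>v\<in>V. \<kappa> v = h v) \<and> (\<forall>t. \<bar>\<kappa> t - t\<bar> \<le> (\<Sum>v\<in>V. \<bar>h v - v\<bar>)))"
proof -
  \<comment> \<open>The minimum of \<open>F\<close> becomes the half-width of the tents: at most any
    \<open>v\<close>, any \<open>1 - v\<close> for \<open>v\<close> other than 1, and any distance
    between two points. Each tent then vanishes at 0, at the other points of \<open>V\<close> and,
    unless centred there, at 1. The inserted 1 keeps \<open>F\<close> nonempty.\<close>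
  define F where "F = insert 1 (V \<union> (\<lambda>v. 1 - v) ` (V - {1}) \<union> (\<lambda>(v, w). \<bar>v - w\<bar>) ` (V \<times> V - Id))"
  have F: "finite F" "\<And>x. x \<in> F \<Longrightarrow> 0 < x" using V by (force simp: F_def)+
  define e where "e = Min F"
  have e: "0 < e" "\<And>x. x \<in> F \<Longrightarrow> e \<le> x"
    using F by (auto simp: e_def F_def)
  have e1: "e \<le> v" if "v \<in> V" for v using that e(2) by (simp add: F_def)
  have e2: "e \<le> 1 - v" if "v \<in> V" "v \<noteq> 1" for v using that e(2) by (simp add: F_def)
  have e3: "e \<le> \<bar>v - w\<bar>" if "v \<in> V" "w \<in> V" "v \<noteq> w" for v w
    using that by (intro e(2)) (force simp: F_def)
  show ?thesis
  proof (intro exI[of _ e] conjI allI impI e(1))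
    fix h assume h: "(1 \<in> V \<longrightarrow> h 1 = 1) \<and> (\<Sum>v\<in>V. \<bar>h v - v\<bar>) < e"
    define D where "D = (\<Sum>v\<in>V. \<bar>h v - v\<bar>)"
    have D: "D < e" "0 \<le> D" using h by (auto simp: D_def sum_nonneg)
    define tent where "tent v t = max 0 (1 - \<bar>t - v\<bar> / e)" for v t :: real
    define \<kappa> where "\<kappa> t = t + (\<Sum>v\<in>V. (h v - v) * tent v t)" for t
    have lip: "\<bar>tent v s - tent v t\<bar> \<le> \<bar>s - t\<bar> / e" for v s t
    proof -
      have "\<bar>tent v s - tent v t\<bar> \<le> \<bar>\<bar>t - v\<bar> / e - \<bar>s - v\<bar> / e\<bar>" unfolding tent_def by linarith
      also have "\<dots> = \<bar>\<bar>t - v\<bar> - \<bar>s - v\<bar>\<bar> / e" using e(1) by (simp add: diff_divide_distrib[symmetric])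
      also have "\<dots> \<le> \<bar>s - t\<bar> / e" using e(1) by (intro divide_right_mono) auto
      finally show ?thesis .
    qed
    have less: "\<kappa> s < \<kappa> t" if st: "s < t" for s t
    proof -
      have "\<bar>(\<Sum>v\<in>V. (h v - v) * (tent v s - tent v t))\<bar> \<le> (\<Sum>v\<in>V. \<bar>h v - v\<bar> * ((t - s) / e))"
        using lip[of _ s t] st
        by (intro order.trans[OF sum_abs] sum_mono) (auto simp: abs_mult simp del: times_divide_eq_right intro!: mult_left_mono)
      also have "\<dots> = D / e * (t - s)" by (simp add: D_def sum_distrib_right sum_divide_distrib)
      also have "\<dots> < 1 * (t - s)" using D e(1) st by (intro mult_strict_right_mono) auto
      finally have "\<bar>(\<Sum>v\<in>V. (h v - v) * tent v s) - (\<Sum>v\<in>V. (h v - v) * tent v t)\<bar> < t - s"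
        by (simp add: sum_subtractf[symmetric] algebra_simps)
      then show ?thesis unfolding \<kappa>_def by linarith
    qed
    have tent0: "tent v t = 0" if "e \<le> \<bar>t - v\<bar>" for v t using that e(1) by (simp add: tent_def field_simps)
    have tent1: "0 \<le> tent v t" "tent v t \<le> 1" for v t using e(1) by (auto simp: tent_def)
    have at: "\<kappa> v = h v" if v: "v \<in> V" for v
    proof -
      have "(\<Sum>w\<in>V. (h w - w) * tent w v) = (\<Sum>w\<in>V. if w = v then h w - w else 0)"
        using v e3 e(1) by (intro sum.cong) (auto intro!: tent0 simp: tent_def)
      then show ?thesis using v V by (simp add: \<kappa>_def)
    qed
    have k0: "\<kappa> 0 = 0"
    proof -
      have "(h v - v) * tent v 0 = 0" if "v \<in> V" for v
        using that e1[of v] by (auto intro!: tent0)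
      then show ?thesis unfolding \<kappa>_def by (simp add: sum.neutral)
    qed
    have k1: "\<kappa> 1 = 1"
    proof -
      \<comment> \<open>A tent centred at 1 has coefficient \<open>h 1 - 1 = 0\<close>; the others
        do not reach 1.\<close>
      have "(h v - v) * tent v 1 = 0" if "v \<in> V" for v
        using that h e2[of v] by (cases "v = 1") (auto intro!: tent0)
      then show ?thesis unfolding \<kappa>_def by (simp add: sum.neutral)
    qed
    have cont: "continuous_on {0..1} \<kappa>"
      unfolding \<kappa>_def tent_def using e(1) by (intro continuous_intros) auto
    have "\<kappa> ` {0..1} = {0..1}"
    proof
      have "\<kappa> s \<le> \<kappa> t" if "s \<le> t" for s t using less[of s t] that by (cases "s = t") auto
      from this[of 0] this[of _ 1] show "\<kappa> ` {0..1} \<subseteq> {0..1}" using k0 k1 by auto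
      show "{0..1} \<subseteq> \<kappa> ` {0..1}"
      proof
        fix z :: real assume "z \<in> {0..1}"
        then show "z \<in> \<kappa> ` {0..1}" using IVT'[of \<kappa> 0 z 1] k0 k1 cont by force
      qed
    qed
    moreover have "inj_on \<kappa> {0..1}" 
    proof (rule inj_onI)
      fix s t assume "\<kappa> s = \<kappa> t"
      then show "s = t" using less[of s t] less[of t s] by (cases s t rule: linorder_cases) auto
    qed
    ultimately have "\<kappa> \<in> time_changes"
      using cont less by (auto simp: time_changes_def bij_betw_def strict_mono_on_def)
    moreover have "\<bar>\<kappa> t - t\<bar> \<le> (\<Sum>v\<in>V. \<bar>h v - v\<bar>)" for t
    proof -
      have "\<bar>\<kappa> t - t\<bar> \<le> (\<Sum>v\<in>V. \<bar>(h v - v) * tent v t\<bar>)" unfolding \<kappa>_def by simp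
      also have "\<dots> \<le> (\<Sum>v\<in>V. \<bar>h v - v\<bar> * 1)"
        using tent1 by (intro sum_mono) (simp add: abs_mult mult_left_le)
      finally show ?thesis by simp
    qed
    ultimately show "\<exists>\<kappa>\<in>time_changes. (\<forall>v\<in>V. \<kappa> v = h v) \<and> (\<forall>t. \<bar>\<kappa> t - t\<bar> \<le> (\<Sum>v\<in>V. \<bar>h v - v\<bar>))"
      using at by blast
  qed
qed

lemma time_change_le_iff:
  assumes "\<kappa> \<in> time_changes" "s \<in> {0..1}" "t \<in> {0..1}"
  shows "\<kappa> s \<le> \<kappa> t \<longleftrightarrow> s \<le> t"
  using time_changeD(5)[OF assms] time_changeD(5)[OF assms(1,3,2)]
  by (cases s t rule: linorder_cases) auto

text \<open>For large \<open>m\<close> a time change carries every jump time to its rounded value,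
  so the jumps cancel exactly and only the drift leaves an error, at most |c| times the
  displacement. Rounding up fixes 1 and moves a jump to the right end of its grid cell, just as
  sampling the process on the grid does.\<close>

lemma jump_fun_rounded_tendsto:
  fixes u y :: "'k \<Rightarrow> real"
  assumes "finite K" "u ` K \<subseteq> {0<..1}"
  shows "(\<lambda>m. mk_path (jump_fun K (\<lambda>k. of_int \<lceil>real (Suc m) * u k\<rceil> / real (Suc m)) y c))
    \<longlonglongrightarrow> mk_path (jump_fun K u y c)"
proof -
  define V where "V = u ` K"
  have V: "finite V" "V \<subseteq> {0<..1}" using assms by (auto simp: V_def)
  obtain e where e: "e > 0" and *: "\<And>h. (1 \<in> V \<longrightarrow> h 1 = 1) \<Longrightarrow> (\<Sum>v\<in>V. \<bar>h v - v\<bar>) < e \<Longrightarrow>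
    \<exists>\<kappa>\<in>time_changes. (\<forall>v\<in>V. \<kappa> v = h v) \<and> (\<forall>t. \<bar>\<kappa> t - t\<bar> \<le> (\<Sum>v\<in>V. \<bar>h v - v\<bar>))"
    using time_change_through_points[OF V] by blast
  define r :: "nat \<Rightarrow> real \<Rightarrow> real" where "r m v = of_int \<lceil>real (Suc m) * v\<rceil> / real (Suc m)" for m v
  have r: "\<bar>r m v - v\<bar> \<le> 1 / real (Suc m)" for m v
  proof -
    have "\<bar>real_of_int \<lceil>real (Suc m) * v\<rceil> - real (Suc m) * v\<bar> \<le> 1"
      using ceiling_correct[of "real (Suc m) * v"] by linarith
    then have "\<bar>real_of_int \<lceil>real (Suc m) * v\<rceil> - real (Suc m) * v\<bar> / real (Suc m) \<le> 1 / real (Suc m)"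
      by (intro divide_right_mono) auto
    moreover have "r m v - v = (real_of_int \<lceil>real (Suc m) * v\<rceil> - real (Suc m) * v) / real (Suc m)"
      unfolding r_def by (simp add: field_simps)
    ultimately show ?thesis by (simp only: abs_divide abs_of_nat)
  qed
  have S: "(\<Sum>v\<in>V. \<bar>r m v - v\<bar>) \<le> real (card V) / real (Suc m)" for m
    using sum_mono[of V "\<lambda>v. \<bar>r m v - v\<bar>" "\<lambda>_. 1 / real (Suc m)"] r by (simp add: algebra_simps)
  have lim: "(\<lambda>m. real (card V) / real (Suc m)) \<longlonglongrightarrow> 0"
    by (rule LIMSEQ_Suc[OF lim_const_over_n])
  have le: "\<forall>\<^sub>F m in sequentially. dist (mk_path (jump_fun K (\<lambda>k. r m (u k)) y c)) (mk_path (jump_fun K u y c))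
      \<le> (1 + \<bar>c\<bar>) * (real (card V) / real (Suc m))"
    using order_tendstoD(2)[OF lim e]
  proof eventually_elim
    fix m assume "real (card V) / real (Suc m) < e"
    then have "(\<Sum>v\<in>V. \<bar>r m v - v\<bar>) < e" using S[of m] by simp
    moreover have "r m 1 = 1" by (simp add: r_def)
    ultimately obtain \<kappa> where k: "\<kappa> \<in> time_changes" "\<And>v. v \<in> V \<Longrightarrow> \<kappa> v = r m v"
      "\<And>t. \<bar>\<kappa> t - t\<bar> \<le> (\<Sum>v\<in>V. \<bar>r m v - v\<bar>)" using *[of "r m"] by blast
    have k3: "\<bar>\<kappa> t - t\<bar> \<le> real (card V) / real (Suc m)" for t using k(3)[of t] S[of m] by simp
    show "dist (mk_path (jump_fun K (\<lambda>k. r m (u k)) y c)) (mk_path (jump_fun K u y c))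
        \<le> (1 + \<bar>c\<bar>) * (real (card V) / real (Suc m))"
    proof (rule dist_mk_path_le[OF cadlag_jump_fun cadlag_jump_fun k(1)])
      fix t :: real assume t: "t \<in> {0..1}"
      have ex: "(1 + \<bar>c\<bar>) * (real (card V) / real (Suc m)) =
          real (card V) / real (Suc m) + \<bar>c\<bar> * (real (card V) / real (Suc m))"
        by (simp only: distrib_right mult_1)
      have nn: "0 \<le> \<bar>c\<bar> * (real (card V) / real (Suc m))" "0 \<le> real (card V) / real (Suc m)" by simp_all
      show "\<bar>\<kappa> t - t\<bar> \<le> (1 + \<bar>c\<bar>) * (real (card V) / real (Suc m))"
        unfolding ex using k3[of t] nn by linarith
      have "r m (u k) \<le> \<kappa> t \<longleftrightarrow> u k \<le> t" if "k \<in> K" for k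
      proof -
        have "u k \<in> V" using that by (simp add: V_def)
        moreover from this have "u k \<in> {0..1}" using V by auto
        ultimately show ?thesis using time_change_le_iff[OF k(1) _ t, of "u k"] k(2)[of "u k"] by simp
      qed
      then have "jump_fun K (\<lambda>k. r m (u k)) y c (\<kappa> t) - jump_fun K u y c t = c * (\<kappa> t - t)"
        unfolding jump_fun_def by (simp add: algebra_simps cong: sum.cong)
      also have "\<bar>\<dots>\<bar> \<le> \<bar>c\<bar> * (real (card V) / real (Suc m))"
        unfolding abs_mult using k3 by (intro mult_left_mono) auto
      finally show "\<bar>jump_fun K (\<lambda>k. r m (u k)) y c (\<kappa> t) - jump_fun K u y c t\<bar>
          \<le> (1 + \<bar>c\<bar>) * (real (card V) / real (Suc m))"
        unfolding ex using nn by linarith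
    qed
  qed
  have "(\<lambda>m. (1 + \<bar>c\<bar>) * (real (card V) / real (Suc m))) \<longlonglongrightarrow> (1 + \<bar>c\<bar>) * 0"
    by (intro tendsto_intros lim)
  then have "(\<lambda>m. dist (mk_path (jump_fun K (\<lambda>k. r m (u k)) y c)) (mk_path (jump_fun K u y c))) \<longlonglongrightarrow> 0"
    by (intro tendsto_sandwich[OF _ le tendsto_const]) auto
  then show ?thesis unfolding r_def using tendsto_dist_iff by blast
qed

lemma step_path_eq_jump_fun: "step_path l u y = mk_path (jump_fun {..<l} u y 0)"
  unfolding step_path_def by (rule mk_path_cong) (auto simp: jump_fun_def indicator_def intro!: sum.cong)

text \<open>A time change taking each \<open>u j\<close> to \<open>u' j\<close> aligns the jumps, so
  that only the size errors and the uniform remainder are left. Distinctness of the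
  \<open>u j\<close> makes this assignment a function on the set of jump times.\<close>

lemma step_path_nbhd:
  assumes u: "inj_on u {..<l}" "u ` {..<l} \<subseteq> {0<..<1}" and d: "0 < d"
  shows "\<exists>e>0. \<forall>g u' y'. cadlag g \<longrightarrow> (\<forall>j<l. \<bar>u' j - u j\<bar> \<le> e \<and> \<bar>y' j - y j\<bar> \<le> e) \<longrightarrow>
    (\<forall>t\<in>{0..1}. \<bar>g t - (\<Sum>j<l. y' j * of_bool (u' j \<le> t))\<bar> \<le> e) \<longrightarrow>
    dist (mk_path g) (step_path l u y) < d"
proof -
  define V where "V = u ` {..<l}"
  have V: "finite V" "V \<subseteq> {0<..1}" "1 \<notin> V" using u by (auto simp: V_def)
  obtain e0 where e0: "e0 > 0" and *: "\<And>h. (1 \<in> V \<longrightarrow> h 1 = 1) \<Longrightarrow> (\<Sum>v\<in>V. \<bar>h v - v\<bar>) < e0 \<Longrightarrow>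
    \<exists>\<kappa>\<in>time_changes. (\<forall>v\<in>V. \<kappa> v = h v) \<and> (\<forall>t. \<bar>\<kappa> t - t\<bar> \<le> (\<Sum>v\<in>V. \<bar>h v - v\<bar>))"
    using time_change_through_points[OF V(1,2)] by blast
  \<comment> \<open>\<open>real l * e\<close> bounds the total displacement and also the total size
    error, a further \<open>e\<close> is the remainder of \<open>g\<close>, and the last
    \<open>e\<close> makes the inequalities strict.\<close>
  define e where "e = min e0 d / (real l + 2)"
  have "0 < e" "(real l + 2) * e = min e0 d" using e0 d by (auto simp: e_def)
  then have e: "0 < e" "real l * e < e0" "real l * e + e < d" by (auto simp: algebra_simps)
  show ?thesis
  proof (intro exI[of _ e] conjI allI impI e(1))
    fix g u' y'
    assume g: "cadlag g" and uy: "\<forall>j<l. \<bar>u' j - u j\<bar> \<le> e \<and> \<bar>y' j - y j\<bar> \<le> e"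
      and r: "\<forall>t\<in>{0..1}. \<bar>g t - (\<Sum>j<l. y' j * of_bool (u' j \<le> t))\<bar> \<le> e"
    define h where "h v = u' (the_inv_into {..<l} u v)" for v
    have h: "h (u j) = u' j" if "j < l" for j
      using u(1) that by (simp add: h_def the_inv_into_f_f)
    have "(\<Sum>v\<in>V. \<bar>h v - v\<bar>) = (\<Sum>j<l. \<bar>u' j - u j\<bar>)"
      unfolding V_def using u(1) h by (subst sum.reindex) auto
    also have "\<dots> \<le> real l * e" using sum_mono[of "{..<l}" "\<lambda>j. \<bar>u' j - u j\<bar>" "\<lambda>_. e"] uy by simp
    finally have S: "(\<Sum>v\<in>V. \<bar>h v - v\<bar>) \<le> real l * e" .
    have "(\<Sum>v\<in>V. \<bar>h v - v\<bar>) < e0" using S e by simp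
    with *[of h] V(3) obtain \<kappa> where k: "\<kappa> \<in> time_changes" "\<And>v. v \<in> V \<Longrightarrow> \<kappa> v = h v"
      "\<And>t. \<bar>\<kappa> t - t\<bar> \<le> (\<Sum>v\<in>V. \<bar>h v - v\<bar>)" by blast
    have k3: "\<bar>\<kappa> t - t\<bar> \<le> real l * e" for t using k(3)[of t] S by linarith
    have "dist (mk_path g) (step_path l u y) \<le> real l * e + e"
      unfolding step_path_eq_jump_fun
    proof (rule dist_mk_path_le[OF g cadlag_jump_fun k(1)])
      fix t :: real assume t: "t \<in> {0..1}"
      show "\<bar>\<kappa> t - t\<bar> \<le> real l * e + e" using k3[of t] e(1) by simp
      have le: "u' j \<le> \<kappa> t \<longleftrightarrow> u j \<le> t" if "j < l" for j
      proof -
        have "u j \<in> V" using that by (simp add: V_def)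
        moreover from this have "u j \<in> {0..1}" using V by auto
        ultimately show ?thesis using time_change_le_iff[OF k(1) _ t, of "u j"] k(2)[of "u j"] h that by simp
      qed
      have kt: "\<kappa> t \<in> {0..1}" by (rule time_changeD(1)[OF k(1) t])
      have "\<bar>(\<Sum>j<l. y' j * of_bool (u' j \<le> \<kappa> t)) - jump_fun {..<l} u y 0 t\<bar> =
          \<bar>\<Sum>j<l. (y' j - y j) * of_bool (u j \<le> t)\<bar>"
        unfolding jump_fun_def using le
        by (simp add: sum_subtractf[symmetric] left_diff_distrib del: sum_mult_of_bool_eq sum_of_bool_mult_eq)
      also have "\<dots> \<le> (\<Sum>j<l. e)"
        using uy e(1) by (intro order.trans[OF sum_abs] sum_mono) auto
      finally have "\<bar>(\<Sum>j<l. y' j * of_bool (u' j \<le> \<kappa> t)) - jump_fun {..<l} u y 0 t\<bar> \<le> real l * e" by simp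
      then show "\<bar>g (\<kappa> t) - jump_fun {..<l} u y 0 t\<bar> \<le> real l * e + e"
        using bspec[OF r kt] by linarith
    qed
    then show "dist (mk_path g) (step_path l u y) < d" using e by simp
  qed
qed

section \<open>Paths with few large jumps\<close>

lemma finite_positive_lower_bound:
  assumes "finite F" "\<And>x. x \<in> F \<Longrightarrow> 0 < (f x :: real)"
  shows "\<exists>e>0. \<forall>x\<in>F. e \<le> f x"
  using assms by (intro exI[of _ "Min (insert 1 (f ` F))"]) auto

lemma jump_left_limit:
  assumes "s \<in> {0<..1}"
  obtains L where "(eval_path x \<longlongrightarrow> L) (at_left s)" "jump x s = eval_path x s - L"
proof -
  obtain L where L: "(eval_path x \<longlongrightarrow> L) (at_left s)"
    using cadlag_eval_path[of x] assms unfolding cadlag_def by blast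
  then have "Lim (at_left s) (eval_path x) = L" by (intro tendsto_Lim) auto
  then show thesis using L that by (simp add: jump_def)
qed

lemma jump_le_of_near_const:
  assumes s: "s \<in> {0<..1}" "a < s" "s < b" and near: "\<And>t. a < t \<Longrightarrow> t < b \<Longrightarrow> t \<in> {0..1} \<Longrightarrow> \<bar>eval_path x t - c\<bar> \<le> e"
  shows "jump x s \<le> 2 * e"
proof -
  obtain L where L: "(eval_path x \<longlongrightarrow> L) (at_left s)" "jump x s = eval_path x s - L"
    using jump_left_limit[OF s(1)] .
  have "eventually (\<lambda>t. c - e \<le> eval_path x t) (at_left s)"
  proof (rule eventually_at_leftI[of "max 0 a"])
    fix t assume "t \<in> {max 0 a<..<s}"
    then have "\<bar>eval_path x t - c\<bar> \<le> e" using s by (intro near) auto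
    then show "c - e \<le> eval_path x t" by linarith
  qed (use s in auto)
  then have "c - e \<le> L" using tendsto_lowerbound[OF L(1)] by simp
  moreover have "\<bar>eval_path x s - c\<bar> \<le> e" using s by (intro near) auto
  ultimately show ?thesis using L(2) by linarith
qed

text \<open>Compactness: around every \<open>t\<close> there is a neighbourhood on each side of
  which the path stays within \<open>g / 2\<close> of a constant, so a jump above \<open>g\<close>
  can occur there only at \<open>t\<close> itself. The centres of a finite subcover contain all big
  jumps.\<close>

lemma finite_big_jumps:
  assumes g: "0 < g"
  shows "finite {t\<in>{0<..1}. g < jump x t}"
proof -
  let ?f = "eval_path x"
  have "\<exists>e>0. \<forall>s\<in>{0<..1}. s \<noteq> t \<and> \<bar>s - t\<bar> < e \<longrightarrow> jump x s \<le> g" if t: "t \<in> {0..1}" for t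
  proof -
    have "\<exists>b>t. \<forall>s. t < s \<and> s < b \<and> s \<in> {0..1} \<longrightarrow> \<bar>?f s - ?f t\<bar> \<le> g / 2"
    proof (cases "t < 1")
      case True
      then have "(?f \<longlongrightarrow> ?f t) (at_right t)" using cadlag_eval_path[of x] t by (auto simp: cadlag_def)
      then have "eventually (\<lambda>s. dist (?f s) (?f t) < g / 2) (at_right t)" by (rule tendstoD) (use g in simp)
      then show ?thesis by (force simp: eventually_at_right_field dist_real_def)
    qed (auto intro!: exI[of _ "t + 1"])
    then obtain b where b: "b > t" "\<And>s. t < s \<Longrightarrow> s < b \<Longrightarrow> s \<in> {0..1} \<Longrightarrow> \<bar>?f s - ?f t\<bar> \<le> g / 2" by blast
    have "\<exists>a<t. \<exists>c. \<forall>s. a < s \<and> s < t \<and> s \<in> {0..1} \<longrightarrow> \<bar>?f s - c\<bar> \<le> g / 2"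
    proof (cases "0 < t")
      case True
      then obtain c where "(?f \<longlongrightarrow> c) (at_left t)" using cadlag_eval_path[of x] t unfolding cadlag_def by force
      then have "eventually (\<lambda>s. dist (?f s) c < g / 2) (at_left t)" by (rule tendstoD) (use g in simp)
      then obtain a where "a < t" "\<And>s. a < s \<Longrightarrow> s < t \<Longrightarrow> dist (?f s) c < g / 2"
        by (auto simp: eventually_at_left_field)
      then show ?thesis by (intro exI[of _ a] conjI exI[of _ c]) (force simp: dist_real_def)+
    qed (auto intro!: exI[of _ "t - 1"])
    then obtain a c where a: "a < t" "\<And>s. a < s \<Longrightarrow> s < t \<Longrightarrow> s \<in> {0..1} \<Longrightarrow> \<bar>?f s - c\<bar> \<le> g / 2" by blast
    show ?thesis
    proof (intro exI[of _ "min (b - t) (t - a)"] conjI ballI impI)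
      fix s assume s: "s \<in> {0<..1}" "s \<noteq> t \<and> \<bar>s - t\<bar> < min (b - t) (t - a)"
      show "jump x s \<le> g"
      proof (cases "t < s")
        case True
        then show ?thesis using jump_le_of_near_const[OF s(1), of t b x "?f t" "g / 2"] b(2) s(2) by auto
      next
        case False
        then show ?thesis using jump_le_of_near_const[OF s(1), of a t x c "g / 2"] a(2) s(2) by auto
      qed
    qed (use a b in auto)
  qed
  then obtain e where e: "\<And>t. t \<in> {0..1} \<Longrightarrow> e t > 0"
    "\<And>t s. t \<in> {0..1} \<Longrightarrow> s \<in> {0<..1} \<Longrightarrow> s \<noteq> t \<Longrightarrow> \<bar>s - t\<bar> < e t \<Longrightarrow> jump x s \<le> g" by metis
  obtain C where C: "C \<subseteq> {0..1}" "finite C" "{0..1} \<subseteq> (\<Union>t\<in>C. ball t (e t))"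
    by (rule compactE_image[of "{0..1::real}" "{0..1}" "\<lambda>t. ball t (e t)"]) (use e(1) in auto)
  have "{t\<in>{0<..1}. g < jump x t} \<subseteq> C"
  proof
    fix s assume s: "s \<in> {t\<in>{0<..1}. g < jump x t}"
    then have "s \<in> {0..1}" by auto
    then obtain t where t: "t \<in> C" "s \<in> ball t (e t)" using C(3) by blast
    show "s \<in> C"
    proof (rule ccontr)
      assume "s \<notin> C"
      then have "jump x s \<le> g" using t C(1) s
        by (intro e(2)[of t s]) (auto simp: dist_real_def abs_minus_commute)
      then show False using s by simp
    qed
  qed
  then show ?thesis using C(2) finite_subset by blast
qed

text \<open>A time change that nearly realizes the distance carries a jump of \<open>x\<close> at
  \<open>t\<close> to one of \<open>y\<close> at \<open>\<kappa> t\<close>. The value and the left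
  limit move by at most \<open>e\<close> each, so a slack of \<open>2 * e\<close> suffices; fixing a
  finite set \<open>F\<close> of \<open>l\<close> jumps makes one slack serve all of them.\<close>

lemma many_jumps_nbhd:
  assumes g: "0 < g" and l: "l \<le> card {t\<in>{0<..1}. g < jump x t}"
  shows "\<exists>e>0. \<forall>y. dist y x < e \<longrightarrow> l \<le> card {t\<in>{0<..1}. g < jump y t}"
proof -
  obtain F where F: "F \<subseteq> {t\<in>{0<..1}. g < jump x t}" "card F = l" "finite F"
    using obtain_subset_with_card_n[OF l] by blast
  have "\<exists>e>0. \<forall>t\<in>F. e \<le> (jump x t - g) / 3"
    using F by (intro finite_positive_lower_bound) auto
  then obtain e where e: "0 < e" "\<And>t. t \<in> F \<Longrightarrow> g + 2 * e < jump x t" by fastforce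
  show ?thesis
  proof (intro exI[of _ e] conjI allI impI e(1))
    fix y assume "dist y x < e"
    then have "J1_dist (eval_path y) (eval_path x) < e" by (simp add: dist_skorokhod_def)
    then obtain \<kappa> where k: "\<kappa> \<in> time_changes" "sup_dist (eval_path y \<circ> \<kappa>) (eval_path x) < e"
      using J1_dist_lessE[OF bdd_fun_eval_path bdd_fun_eval_path] by metis
    have near: "\<bar>eval_path y (\<kappa> s) - eval_path x s\<bar> < e" if "s \<in> {0..1}" for s
      using le_sup_dist[OF bdd_fun_comp[OF bdd_fun_eval_path[of y] k(1)] bdd_fun_eval_path[of x] that] k(2)
      by simp
    have big: "\<kappa> t \<in> {t\<in>{0<..1}. g < jump y t}" if t: "t \<in> F" for t
    proof -
      have t1: "t \<in> {0<..1}" "t \<in> {0..1}" using t F(1) by auto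
      have kt: "\<kappa> t \<in> {0<..1}"
        using time_changeD(1)[OF k(1), of 0] time_changeD(1)[OF k(1) t1(2)]
          time_changeD(5)[OF k(1), of 0 t] t1 by auto
      obtain L where L: "(eval_path x \<longlongrightarrow> L) (at_left t)" "jump x t = eval_path x t - L"
        using jump_left_limit[OF t1(1)] .
      obtain L' where L': "(eval_path y \<longlongrightarrow> L') (at_left (\<kappa> t))" "jump y (\<kappa> t) = eval_path y (\<kappa> t) - L'"
        using jump_left_limit[OF kt] .
      have ev: "eventually (\<lambda>s. s \<in> {0..1} \<and> s < t) (at_left t)"
        using t1 by (intro eventually_at_leftI[of 0 t]) auto
      have "continuous_on {0..t} \<kappa>"
        using k(1) t1 by (auto simp: time_changes_def intro: continuous_on_subset)
      then have "(\<kappa> \<longlongrightarrow> \<kappa> t) (at t within {0..t})" using t1 by (simp add: continuous_on_def)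
      then have "(\<kappa> \<longlongrightarrow> \<kappa> t) (at_left t)" using t1 by (simp add: at_within_Icc_at_left)
      moreover have "eventually (\<lambda>s. \<kappa> s \<in> {..<\<kappa> t} \<and> \<kappa> s \<noteq> \<kappa> t) (at_left t)"
        using ev by eventually_elim (use time_changeD(5)[OF k(1) _ t1(2)] in force)
      \<comment> \<open>Since \<open>\<kappa>\<close> increases strictly to
        \<open>\<kappa> t\<close>, the left limit of \<open>y\<close> there is also the left limit
        of the composed path at \<open>t\<close>.\<close>
      ultimately have "filterlim \<kappa> (at_left (\<kappa> t)) (at_left t)" by (simp add: filterlim_at)
      from filterlim_compose[OF L'(1) this]
      have "((\<lambda>s. eval_path y (\<kappa> s) - eval_path x s) \<longlongrightarrow> L' - L) (at_left t)"
        using L(1) by (intro tendsto_diff)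
      moreover have "eventually (\<lambda>s. eval_path y (\<kappa> s) - eval_path x s \<le> e) (at_left t)"
        using ev by eventually_elim (use near in force)
      ultimately have "L' - L \<le> e" using tendsto_upperbound by fastforce
      then show ?thesis using near[OF t1(2)] e(2)[OF t] L(2) L'(2) kt by auto
    qed
    have "inj_on \<kappa> F" using time_changeD(4)[OF k(1)] by (rule inj_on_subset) (use F in auto)
    then have "l = card (\<kappa> ` F)" using F by (simp add: card_image)
    also have "\<dots> \<le> card {t\<in>{0<..1}. g < jump y t}"
      using big by (intro card_mono finite_big_jumps[OF g]) auto
    finally show "l \<le> card {t\<in>{0<..1}. g < jump y t}" .
  qed
qed

text \<open>Openness is stable under arbitrary unions, so \<open>B_set\<close> becomes Borel for the
  whole family \<open>J_set\<close> at once.\<close>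

lemma open_B_lev:
  fixes \<gamma> :: "'d::finite \<Rightarrow> real"
  assumes "\<And>i. 0 < \<gamma> i"
  shows "open (B_lev \<gamma> l)"
proof -
  define S where "S i = {x. l i \<le> card {t\<in>{0<..1}. \<gamma> i < jump x t}}" for i
  have "B_lev \<gamma> l = (\<Inter>i. (\<lambda>\<xi>. \<xi> i) -` S i)"
    by (auto simp: B_lev_def S_def)
  moreover have "open (S i)" for i
    unfolding open_dist S_def using many_jumps_nbhd[OF assms] by blast
  ultimately show ?thesis
    by (auto intro!: open_INT open_vimage continuous_on_product_coordinates simp del: vimage_Collect_eq)
qed

text \<open>A vector of paths with exactly \<open>l j\<close> jumps in each coordinate
  \<open>j\<close> lies outside \<open>C_set l\<close>, but belongs to \<open>C_set m\<close> as
  soon as some \<open>m i\<close> exceeds \<open>l i\<close>.\<close>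

lemma C_set_subset_imp_le:
  assumes "C_set m \<subseteq> C_set l"
  shows "m \<le> l"
proof (rule le_funI, rule ccontr)
  fix i assume i: "\<not> m i \<le> l i"
  have "\<forall>j. \<exists>x. x \<in> D_eq (l j)" using D_eq_nonempty by blast
  then obtain \<xi> where \<xi>: "\<And>j. \<xi> j \<in> D_eq (l j)" by metis
  then have "\<xi> \<in> C_set m" using i by (auto simp: C_set_def D_lt_def intro!: exI[of _ i] bexI[of _ "l i"])
  then obtain j where "\<xi> j \<in> D_lt (l j)" using assms by (auto simp: C_set_def)
  then obtain k where "k < l j" "\<xi> j \<in> D_eq k" by (auto simp: D_lt_def)
  then show False using D_eq_unique[OF \<xi>[of j]] by auto
qed

lemma prec_imp_less: "prec m l \<Longrightarrow> m \<le> l \<and> m \<noteq> l"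
  using C_set_subset_imp_le by (auto simp: prec_def)

definition jump_counts :: "('d \<Rightarrow> real) \<Rightarrow> ('d \<Rightarrow> skorokhod) \<Rightarrow> 'd \<Rightarrow> nat" where
  "jump_counts \<gamma> \<xi> i = card {t\<in>{0<..1}. \<gamma> i < jump (\<xi> i) t}"

text \<open>Otherwise consider the vectors outside \<open>I_lt\<close> that lie below the jump
  counts and take one of least total. Whatever precedes it has a smaller total and so lies in
  \<open>I_lt\<close>; hence it belongs to \<open>J_set\<close> and witnesses membership in
  \<open>B_set\<close>.\<close>

lemma jump_counts_I_lt:
  fixes l' :: "'d::finite \<Rightarrow> nat"
  assumes "\<xi> \<notin> B_set \<beta> l' \<gamma>"
  shows "jump_counts \<gamma> \<xi> \<in> I_lt \<beta> l'"
proof (rule ccontr)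
  assume not: "jump_counts \<gamma> \<xi> \<notin> I_lt \<beta> l'"
  define l where "l = arg_min (\<lambda>l. \<Sum>i\<in>UNIV. l i) (\<lambda>l. l \<notin> I_lt \<beta> l' \<and> l \<le> jump_counts \<gamma> \<xi>)"
  have l: "l \<notin> I_lt \<beta> l'" "l \<le> jump_counts \<gamma> \<xi>"
    and min: "\<And>m. m \<notin> I_lt \<beta> l' \<Longrightarrow> m \<le> jump_counts \<gamma> \<xi> \<Longrightarrow> (\<Sum>i\<in>UNIV. l i) \<le> (\<Sum>i\<in>UNIV. m i)"
    using arg_min_nat_lemma[of "\<lambda>l. l \<notin> I_lt \<beta> l' \<and> l \<le> jump_counts \<gamma> \<xi>" "jump_counts \<gamma> \<xi>"
        "\<lambda>l. \<Sum>i\<in>UNIV. l i"] not by (auto simp: l_def)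
  have "m \<in> I_lt \<beta> l'" if "prec m l" for m
  proof (rule ccontr)
    assume m: "m \<notin> I_lt \<beta> l'"
    have ml: "m \<le> l" "m \<noteq> l" using prec_imp_less[OF that] by auto
    then obtain i where "m i < l i" by (metis ext le_funD order_le_less)
    then have "(\<Sum>i\<in>UNIV. m i) < (\<Sum>i\<in>UNIV. l i)"
      using ml(1) by (intro sum_strict_mono_ex1) (auto simp: le_fun_def)
    then show False using min[OF m] ml l(2) by fastforce
  qed
  then have "l \<in> J_set \<beta> l'" using l(1) by (simp add: J_set_def)
  moreover have "\<xi> \<in> B_lev \<gamma> l" using l(2) by (auto simp: B_lev_def jump_counts_def le_fun_def)
  ultimately show False using assms by (auto simp: B_set_def)
qed

text \<open>Capping all entries at \<open>m\<close> keeps a vector outside \<open>I_lt\<close>,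
  because a single entry equal to \<open>m\<close> already costs more than \<open>l'\<close>. Asking
  for fewer jumps only enlarges \<open>B_lev\<close>, so the finite box of capped vectors covers. A
  vector outside \<open>I_lt\<close> is \<open>l'\<close> or strictly dearer, the dichotomy on which
  the rate bounds rest.\<close>

lemma B_set_cover:
  fixes \<beta> :: "'d::finite \<Rightarrow> real"
  assumes "\<And>i. 1 < \<beta> i"
  obtains L where "finite L" "\<And>l. l \<in> L \<Longrightarrow> l = l' \<or> cost \<beta> l' < cost \<beta> l"
    "\<And>\<gamma>. B_set \<beta> l' \<gamma> \<subseteq> (\<Union>l\<in>L. B_lev \<gamma> l)"
proof -
  have "\<exists>m. \<forall>i. cost \<beta> l' < (\<beta> i - 1) * real m"
  proof -
    have "\<exists>m::nat. cost \<beta> l' < (\<beta> i - 1) * real m" for i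
      using reals_Archimedean3[of "\<beta> i - 1"] assms by (simp add: mult.commute)
    then obtain f where f: "\<And>i. cost \<beta> l' < (\<beta> i - 1) * real (f i)" by metis
    have "cost \<beta> l' < (\<beta> i - 1) * real (Max (range f))" for i
      using assms[of i] by (intro order.strict_trans2[OF f[of i]] mult_left_mono) auto
    then show ?thesis by blast
  qed
  then obtain m where m: "\<And>i. cost \<beta> l' < (\<beta> i - 1) * real m" by blast
  define L where "L = {l. l \<notin> I_lt \<beta> l' \<and> (\<forall>i. l i \<le> m)}"
  show thesis
  proof
    have "L \<subseteq> PiE UNIV (\<lambda>_. {..m})" by (auto simp: L_def)
    then show "finite L" by (rule finite_subset) (auto intro!: finite_PiE)
    show "l = l' \<or> cost \<beta> l' < cost \<beta> l" if "l \<in> L" for l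
      using that by (auto simp: L_def I_lt_def)
    fix \<gamma>
    show "B_set \<beta> l' \<gamma> \<subseteq> (\<Union>l\<in>L. B_lev \<gamma> l)"
    proof
      fix \<xi> assume "\<xi> \<in> B_set \<beta> l' \<gamma>"
      then obtain l where l: "l \<notin> I_lt \<beta> l'" "\<xi> \<in> B_lev \<gamma> l" by (auto simp: B_set_def J_set_def)
      define k where "k i = min (l i) m" for i
      have "k \<notin> I_lt \<beta> l'"
      proof (cases "\<forall>i. l i \<le> m")
        case True
        then have "k = l" by (auto simp: k_def min_def)
        then show ?thesis using l by simp
      next
        case False
        then obtain i where "\<not> l i \<le> m" by blast
        then have i: "k i = m" by (simp add: k_def)
        have "(\<beta> i - 1) * real (k i) \<le> cost \<beta> k"
          unfolding cost_def using assms
          by (intro member_le_sum[of i UNIV "\<lambda>i. (\<beta> i - 1) * real (k i)"]) (auto simp: less_imp_le)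
        then show ?thesis using m[of i] i by (simp add: I_lt_def)
      qed
      then have "k \<in> L" by (simp add: L_def k_def)
      moreover have "\<xi> \<in> B_lev \<gamma> k" using l(2) by (auto simp: B_lev_def k_def min_le_iff_disj)
      ultimately show "\<xi> \<in> (\<Union>l\<in>L. B_lev \<gamma> l)" by blast
    qed
  qed
qed

section \<open>The limit measures\<close>

text \<open>The general position on which the limit measure lives. Jump times in the open interval
  leave room for displacement on both sides.\<close>

definition generic_steps :: "nat \<Rightarrow> skorokhod set" where
  "generic_steps l = {step_path l u y |u y. inj_on u {..<l} \<and> u ` {..<l} \<subseteq> {0<..<1} \<and> (\<forall>j<l. 0 < y j)}"

text \<open>Fubini in coordinate \<open>j\<close>: with the other coordinates fixed, the diagonal is
  a single point, which has measure zero.\<close>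

lemma AE_PiM_coordinates_neq:
  fixes \<mu> :: "real measure"
  assumes "prob_space \<mu>" and sets: "sets \<mu> = sets borel" and null: "\<And>x. emeasure \<mu> {x} = 0"
    and "finite I" "i \<in> I" "j \<in> I" "i \<noteq> j"
  shows "AE u in (\<Pi>\<^sub>M j\<in>I. \<mu>). u i \<noteq> u j"
proof -
  interpret prob_space \<mu> by fact
  interpret product_sigma_finite "\<lambda>_. \<mu>" by unfold_locales
  have [measurable_cong]: "sets \<mu> = sets borel" by fact
  let ?J = "I - {j}"
  have I: "insert j ?J = I" using assms by auto
  have meas: "{u \<in> space (\<Pi>\<^sub>M j\<in>I. \<mu>). u i = u j} \<in> sets (\<Pi>\<^sub>M j\<in>I. \<mu>)"
    using assms by measurable
  let ?f = "indicator {u \<in> space (\<Pi>\<^sub>M j\<in>I. \<mu>). u i = u j} :: _ \<Rightarrow> ennreal"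
  have "emeasure (\<Pi>\<^sub>M j\<in>I. \<mu>) {u \<in> space (\<Pi>\<^sub>M j\<in>I. \<mu>). u i = u j} = (\<integral>\<^sup>+u. ?f u \<partial>(\<Pi>\<^sub>M j\<in>insert j ?J. \<mu>))"
    unfolding I using meas by simp
  also have "\<dots> = (\<integral>\<^sup>+x. (\<integral>\<^sup>+y. ?f (x(j := y)) \<partial>\<mu>) \<partial>(\<Pi>\<^sub>M j\<in>?J. \<mu>))"
    using assms meas
    by (intro product_nn_integral_insert) (simp_all only: I finite_Diff borel_measurable_indicator, auto)
  also have "\<dots> = (\<integral>\<^sup>+x. 0 \<partial>(\<Pi>\<^sub>M j\<in>?J. \<mu>))"
  proof (intro nn_integral_cong)
    fix x
    have "(\<integral>\<^sup>+y. ?f (x(j := y)) \<partial>\<mu>) \<le> (\<integral>\<^sup>+y. indicator {x i} y \<partial>\<mu>)"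
      using assms(7) by (intro nn_integral_mono) (auto simp: indicator_def)
    also have "\<dots> = 0" using null by (simp add: sets)
    finally show "(\<integral>\<^sup>+y. ?f (x(j := y)) \<partial>\<mu>) = 0" by simp
  qed
  finally have "emeasure (\<Pi>\<^sub>M j\<in>I. \<mu>) {u \<in> space (\<Pi>\<^sub>M j\<in>I. \<mu>). u i = u j} = 0" by simp
  then show ?thesis using meas by (auto simp: AE_iff_null null_sets_def)
qed

text \<open>\<open>extend_measure\<close> takes the prescribed values if some measure does, and
  otherwise is the zero measure; the upper bound holds in both cases. This bounds boxes in a product
  whose factors have not been shown to be \<sigma>-finite.\<close>

lemma emeasure_extend_measure_cases:
  assumes "i \<in> I" "G ` I \<subseteq> Pow \<Omega>"
  shows "emeasure (extend_measure \<Omega> I G \<mu>) (G i) \<le> \<mu> i"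
proof (cases "(\<exists>\<mu>'. (\<forall>i\<in>I. \<mu>' (G i) = \<mu> i) \<and> measure_space \<Omega> (sigma_sets \<Omega> (G ` I)) \<mu>') \<and> \<not> (\<forall>i\<in>I. \<mu> i = 0)")
  case True
  then obtain \<mu>' where m: "\<forall>i\<in>I. \<mu>' (G i) = \<mu> i" "measure_space \<Omega> (sigma_sets \<Omega> (G ` I)) \<mu>'" by blast
  have sets: "sets (extend_measure \<Omega> I G \<mu>) = sigma_sets \<Omega> (G ` I)"
    using assms(2) by (rule sets_extend_measure)
  have "emeasure (extend_measure \<Omega> I G \<mu>) (G i) = \<mu> i"
    using m assms by (intro emeasure_extend_measure[OF refl, of I \<mu>' G \<mu>]) (auto simp: measure_space_def sets)
  then show ?thesis by simp
next
  case False
  then show ?thesis unfolding extend_measure_def by (auto simp: emeasure_sigma)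
qed

text \<open>Independent uniform times are almost surely interior and distinct, so almost every inner
  measure is that of the empty set. Passing to the closure makes the exceptional set open and hence
  usable as the side of a measurable box.\<close>

lemma C_meas_null: "emeasure (C_meas \<beta> l) (- closure (generic_steps l)) = 0"
proof (cases "l = 0")
  case True
  have "step_path 0 undefined undefined \<in> generic_steps 0"
    unfolding generic_steps_def by fastforce
  then have "mk_path (\<lambda>_. 0) \<in> closure (generic_steps 0)"
    using closure_subset by (fastforce simp: step_path_def)
  then show ?thesis using True by (simp add: C_meas_def)
next
  case False
  let ?\<mu> = "uniform_measure lborel {0..1::real}"
  let ?S = "- closure (generic_steps l)"
  have ps: "prob_space ?\<mu>" by (rule prob_space_uniform_measure) auto
  have null: "emeasure ?\<mu> {x} = 0" for x
  proof -
    have "emeasure lborel ({0..1} \<inter> {x}) \<le> emeasure lborel {x}" by (rule emeasure_mono) auto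
    then show ?thesis by simp
  qed
  have 1: "AE u in (\<Pi>\<^sub>M j\<in>{..<l}. ?\<mu>). u j \<in> {0<..<1}" if "j < l" for j
  proof (rule AE_PiM_component[where P="\<lambda>x. x \<in> {0<..<1}"])
    have "AE x in lborel. x \<noteq> 0" "AE x in lborel. x \<noteq> (1::real)" by (rule AE_lborel_singleton)+
    then have "AE x in lborel. x \<in> {0..1} \<longrightarrow> x \<in> {0<..<1::real}" by eventually_elim auto
    then show "AE x in ?\<mu>. x \<in> {0<..<1}" by (intro AE_uniform_measureI) auto
  qed (use that ps in auto)
  have 2: "AE u in (\<Pi>\<^sub>M j\<in>{..<l}. ?\<mu>). i \<noteq> j \<longrightarrow> u i \<noteq> u j" if "i < l" "j < l" for i j
    using AE_PiM_coordinates_neq[OF ps _ null, of "{..<l}" i j] that by (cases "i = j") auto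
  have "AE u in (\<Pi>\<^sub>M j\<in>{..<l}. ?\<mu>). (\<forall>j\<in>{..<l}. u j \<in> {0<..<1}) \<and> (\<forall>i\<in>{..<l}. \<forall>j\<in>{..<l}. i \<noteq> j \<longrightarrow> u i \<noteq> u j)"
    using 1 2 by (auto simp: AE_finite_all)
  then have "AE u in (\<Pi>\<^sub>M j\<in>{..<l}. ?\<mu>). emeasure (nu_pow \<beta> l)
      {y\<in>space (nu_pow \<beta> l). (\<forall>j<l. 0 < y j) \<and> step_path l u y \<in> ?S} = 0"
  proof eventually_elim
    case (elim u)
    have "step_path l u y \<in> closure (generic_steps l)" if "\<forall>j<l. 0 < y j" for y
      using that elim closure_subset[of "generic_steps l"]
      unfolding generic_steps_def inj_on_def by blast
    then have "{y\<in>space (nu_pow \<beta> l). (\<forall>j<l. 0 < y j) \<and> step_path l u y \<in> ?S} = {}" by auto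
    then show ?case by (simp only: emeasure_empty)
  qed
  then have "(\<integral>\<^sup>+u. emeasure (nu_pow \<beta> l)
      {y\<in>space (nu_pow \<beta> l). (\<forall>j<l. 0 < y j) \<and> step_path l u y \<in> ?S} \<partial>(\<Pi>\<^sub>M j\<in>{..<l}. ?\<mu>)) = 
      (\<integral>\<^sup>+u. 0 \<partial>(\<Pi>\<^sub>M j\<in>{..<l}. ?\<mu>))"
    by (rule nn_integral_cong_AE)
  \<comment> \<open>\<open>measure_of\<close> returns the displayed integral or 0, and both vanish;
    countable additivity of the integral need not be established.\<close>
  then show ?thesis using False
    by (simp add: C_meas_def emeasure_measure_of_conv)
qed

lemma sets_C_meas [simp]: "sets (C_meas \<beta> l) = sets borel" and space_C_meas [simp]: "space (C_meas \<beta> l) = UNIV"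
  using sets.sigma_sets_eq[of "borel :: skorokhod measure"] by (auto simp: C_meas_def)

text \<open>If \<open>U\<close> missed the product of the closures, finitely many boxes with one
  null side would cover it. A point of \<open>U\<close> in that product is then moved to genuine
  generic steps inside a ball contained in \<open>U\<close>.\<close>

lemma generic_point_in_open:
  fixes U :: "('d::finite \<Rightarrow> skorokhod) set"
  assumes pos: "0 < emeasure (\<Pi>\<^sub>M i\<in>UNIV. C_meas (\<beta> i) (l i)) U" and U: "open U"
  obtains u y where "\<And>i. inj_on (u i) {..<l i}" "\<And>i. u i ` {..<l i} \<subseteq> {0<..<1}"
    "\<And>i j. j < l i \<Longrightarrow> 0 < y i j" "(\<lambda>i. step_path (l i) (u i) (y i)) \<in> U"
proof -
  let ?P = "\<Pi>\<^sub>M i\<in>UNIV. C_meas (\<beta> i) (l i)"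
  have "\<exists>\<xi>\<in>U. \<forall>i. \<xi> i \<in> closure (generic_steps (l i))"
  proof (rule ccontr)
    assume not: "\<not> ?thesis"
    define S where "S i = - closure (generic_steps (l i))" for i
    define E where "E i j = (if j = i then S i else UNIV)" for i j
    have sub: "U \<subseteq> (\<Union>i. Pi\<^sub>E UNIV (E i))"
    proof
      fix \<xi> assume "\<xi> \<in> U"
      then obtain i where "\<xi> i \<in> S i" using not by (auto simp: S_def)
      then have "\<xi> \<in> Pi\<^sub>E UNIV (E i)" by (auto simp: E_def)
      then show "\<xi> \<in> (\<Union>i. Pi\<^sub>E UNIV (E i))" by blast
    qed
    have E: "E i j \<in> sets (C_meas (\<beta> j) (l j))" for i j by (simp add: E_def S_def)
    have sets: "Pi\<^sub>E UNIV (E i) \<in> sets ?P" for i using E by (intro sets_PiM_I_finite) auto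
    have null: "emeasure ?P (Pi\<^sub>E UNIV (E i)) = 0" for i
    proof -
      let ?M = "\<lambda>i. C_meas (\<beta> i) (l i)"
      let ?I = "{(J, X). (J \<noteq> {} \<or> (UNIV :: 'd set) = {}) \<and> finite J \<and> J \<subseteq> UNIV \<and> X \<in> (\<Pi> j\<in>J. sets (?M j))}"
      let ?G = "\<lambda>(J, X). prod_emb UNIV ?M J (\<Pi>\<^sub>E j\<in>J. X j)"
      let ?m = "\<lambda>(J, X). \<Prod>j\<in>J \<union> {i \<in> UNIV. emeasure (?M i) (space (?M i)) \<noteq> 1}.
          if j \<in> J then emeasure (?M j) (X j) else emeasure (?M j) (space (?M j))"
      have "emeasure ?P (?G (UNIV, E i)) \<le> ?m (UNIV, E i)"
        unfolding PiM_def
      proof (rule emeasure_extend_measure_cases)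
        show "(UNIV, E i) \<in> ?I" using E by auto
        show "?G ` ?I \<subseteq> Pow (\<Pi>\<^sub>E i\<in>UNIV. space (?M i))" by auto
      qed
      moreover have "?G (UNIV, E i) = Pi\<^sub>E UNIV (E i)"
        by (simp add: prod_emb_def restrict_def)
      \<comment> \<open>The null side makes the product 0 even when other sides have infinite
        mass.\<close>
      moreover have "?m (UNIV, E i) = 0"
        by (auto intro!: prod_zero bexI[of _ i] simp: E_def S_def C_meas_null)
      ultimately show ?thesis by (simp only: le_zero_eq)
    qed
    have "emeasure ?P U \<le> emeasure ?P (\<Union>i. Pi\<^sub>E UNIV (E i))"
      using sub sets by (intro emeasure_mono) auto
    also have "\<dots> \<le> (\<Sum>i\<in>UNIV. emeasure ?P (Pi\<^sub>E UNIV (E i)))"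
      using sets by (intro emeasure_subadditive_finite) auto
    finally show False using pos null by simp
  qed
  then obtain \<xi> where \<xi>: "\<xi> \<in> U" "\<And>i. \<xi> i \<in> closure (generic_steps (l i))" by blast
  obtain e where e: "e > 0" "\<And>\<eta>. max_dist \<xi> \<eta> < e \<Longrightarrow> \<eta> \<in> U"
    using U \<xi>(1) unfolding open_max_dist by blast
  have "\<exists>\<eta>\<in>generic_steps (l i). dist (\<xi> i) \<eta> < e" for i
    using \<xi>(2)[of i] e(1) by (auto simp: closure_approachable dist_commute)
  then have "\<exists>u y. inj_on u {..<l i} \<and> u ` {..<l i} \<subseteq> {0<..<1} \<and> (\<forall>j<l i. 0 < y j) \<and>
      dist (\<xi> i) (step_path (l i) u y) < e" for i
    unfolding generic_steps_def by blast
  then obtain u y where uy: "\<And>i. inj_on (u i) {..<l i} \<and> u i ` {..<l i} \<subseteq> {0<..<1} \<and> (\<forall>j<l i. 0 < y i j) \<and>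
      dist (\<xi> i) (step_path (l i) (u i) (y i)) < e" by metis
  then have "(\<lambda>i. step_path (l i) (u i) (y i)) \<in> U" by (intro e(2)) (simp add: max_dist_less_iff)
  then show thesis using uy that by blast
qed

section \<open>Measurability of the scaled path\<close>

text \<open>\<open>T k\<close> is the first time at which \<open>f\<close> reaches \<open>k\<close>.
  Right-continuity turns the infimum into a minimum, which gives the equivalence, and
  \<open>f 0 = 0\<close> makes the arrival times positive.\<close>

lemma counting_times:
  fixes f :: "real \<Rightarrow> nat"
  assumes mono: "mono_on {0..} f" and rc: "\<And>t. 0 \<le> t \<Longrightarrow> (f \<longlongrightarrow> f t) (at_right t)"
    and f0: "f 0 = 0" and b: "0 \<le> b"
  obtains T where "\<And>k. k \<in> {1..f b} \<Longrightarrow> T k \<in> {0<..b}"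
    "\<And>k t. k \<in> {1..f b} \<Longrightarrow> t \<in> {0..b} \<Longrightarrow> k \<le> f t \<longleftrightarrow> T k \<le> t"
proof -
  define S where "S k = {t\<in>{0..b}. k \<le> f t}" for k
  define T where "T k = Inf (S k)" for k
  have S: "b \<in> S k" if "k \<in> {1..f b}" for k using that b by (simp add: S_def)
  have bdd: "bdd_below (S k)" for k by (rule bdd_belowI[of _ 0]) (simp add: S_def)
  have T0: "0 \<le> T k" "T k \<le> b" if "k \<in> {1..f b}" for k
  proof -
    show "0 \<le> T k" unfolding T_def using S[OF that] by (intro cInf_greatest) (auto simp: S_def)
    show "T k \<le> b" unfolding T_def using S[OF that] bdd by (rule cInf_lower)
  qed
  have fT: "k \<le> f (T k)" if k: "k \<in> {1..f b}" for k
  proof -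
    have "eventually (\<lambda>s. f s = f (T k)) (at_right (T k))"
      using rc[OF T0(1)[OF k]] by (simp add: tendsto_discrete)
    then obtain c where c: "c > T k" "\<And>s. T k < s \<Longrightarrow> s < c \<Longrightarrow> f s = f (T k)"
      by (auto simp: eventually_at_right_field)
    obtain s where s: "s \<in> S k" "s < c"
      using cInf_lessD[of "S k" c] S[OF k] c(1) unfolding T_def by auto
    have "T k \<le> s" unfolding T_def using s(1) bdd by (rule cInf_lower)
    then show ?thesis using c(2)[of s] s by (cases "s = T k") (auto simp: S_def)
  qed
  have iff: "k \<le> f t \<longleftrightarrow> T k \<le> t" if k: "k \<in> {1..f b}" and t: "t \<in> {0..b}" for k t
  proof
    assume "k \<le> f t"
    then show "T k \<le> t" unfolding T_def using t bdd by (intro cInf_lower) (auto simp: S_def)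
  next
    assume "T k \<le> t"
    then have "f (T k) \<le> f t" using T0(1)[OF k] by (intro mono_onD[OF mono]) auto
    then show "k \<le> f t" using fT[OF k] by simp
  qed
  have pos: "T k \<noteq> 0" if "k \<in> {1..f b}" for k
  proof
    assume "T k = 0"
    then show False using fT[OF that] f0 that by simp
  qed
  show thesis
  proof (rule that[of T])
    show "T k \<in> {0<..b}" if "k \<in> {1..f b}" for k
      using T0[OF that] pos[OF that] by (simp add: less_le)
  qed (rule iff)
qed

text \<open>If two indices shared an arrival time, the grid cell containing it would see an
  increment of at least 2.\<close>

lemma counting_times_inj:
  fixes f :: "real \<Rightarrow> nat"
  assumes T: "\<And>k. k \<in> {1..f b} \<Longrightarrow> T k \<in> {0<..b}"
    "\<And>k t. k \<in> {1..f b} \<Longrightarrow> t \<in> {0..b} \<Longrightarrow> k \<le> f t \<longleftrightarrow> T k \<le> t"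
    and b: "0 < b" and m: "0 < m" and inc: "\<And>j. j < m \<Longrightarrow> f (b * real (Suc j) / real m) - f (b * real j / real m) \<le> 1"
  shows "inj_on T {1..f b}"
proof (rule linorder_inj_onI)
  fix k k' assume k: "k < k'" "k \<in> {1..f b}" "k' \<in> {1..f b}"
  show "T k \<noteq> T k'"
  proof
    assume eq: "T k = T k'"
    define z where "z = real m * T k / b"
    have z: "0 < z" "z \<le> real m" using T(1)[OF k(2)] b m by (auto simp: z_def field_simps)
    \<comment> \<open>The cell is open on the left and closed on the right, so an arrival exactly at
      a grid point belongs to the cell ending there.\<close>
    define j where "j = nat (\<lceil>z\<rceil> - 1)"
    have cz: "0 < \<lceil>z\<rceil>" "\<lceil>z\<rceil> \<le> int m" using z by (auto simp: ceiling_le_iff)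
    have j: "j < m" "real j < z" "z \<le> real (Suc j)"
    proof -
      have "int j = \<lceil>z\<rceil> - 1" using cz by (simp add: j_def)
      then show "j < m" using cz by linarith
      show "real j < z" "z \<le> real (Suc j)" using \<open>int j = \<lceil>z\<rceil> - 1\<close> ceiling_correct[of z] by linarith+
    qed
    have j1: "b * real j / real m < T k" "T k \<le> b * real (Suc j) / real m"
      using j(2,3) b m unfolding z_def by (auto simp: field_simps)
    have "b * real j \<le> b * real m" "b * real (Suc j) \<le> b * real m"
      using b j(1) by (auto intro!: mult_left_mono)
    then have in1: "b * real j / real m \<in> {0..b}" "b * real (Suc j) / real m \<in> {0..b}"
      using b m by (auto simp: divide_le_eq)
    have "\<not> k \<le> f (b * real j / real m)" using T(2)[OF k(2) in1(1)] j1 by simp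
    moreover have "k' \<le> f (b * real (Suc j) / real m)" using T(2)[OF k(3) in1(2)] j1 eq by simp
    ultimately show False using inc[OF j(1)] k(1) by linarith
  qed
qed (rule linear)

text \<open>For fixed jump times the uniform distance of two paths is at most the sum of the
  differences of their sizes. Continuity in the product topology then yields Borel measurability of
  a path-valued map from that of real coordinates.\<close>

lemma continuous_jump_fun_sizes:
  fixes g :: "'k \<Rightarrow> 'a"
  assumes "finite K"
  shows "continuous_on UNIV (\<lambda>D :: 'a \<Rightarrow> real. mk_path (jump_fun K u (\<lambda>k. D (g k)) c))"
  unfolding continuous_on_def
proof
  fix D0 :: "'a \<Rightarrow> real"
  have coord: "((\<lambda>D. D (g k)) \<longlongrightarrow> D0 (g k)) (at D0)" for k
    using continuous_on_product_coordinates[of "g k"] unfolding continuous_on_def by auto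
  have "((\<lambda>D. \<Sum>k\<in>K. \<bar>D (g k) - D0 (g k)\<bar>) \<longlongrightarrow> (\<Sum>k\<in>K. \<bar>D0 (g k) - D0 (g k)\<bar>)) (at D0)"
    by (intro tendsto_intros coord)
  then have lim: "((\<lambda>D. \<Sum>k\<in>K. \<bar>D (g k) - D0 (g k)\<bar>) \<longlongrightarrow> 0) (at D0)" by simp
  have le: "dist (mk_path (jump_fun K u (\<lambda>k. D (g k)) c)) (mk_path (jump_fun K u (\<lambda>k. D0 (g k)) c))
      \<le> (\<Sum>k\<in>K. \<bar>D (g k) - D0 (g k)\<bar>)" for D
  proof (rule dist_mk_path_le_sup[OF cadlag_jump_fun cadlag_jump_fun])
    fix t :: real
    have "\<bar>jump_fun K u (\<lambda>k. D (g k)) c t - jump_fun K u (\<lambda>k. D0 (g k)) c t\<bar> =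
        \<bar>\<Sum>k\<in>K. (D (g k) - D0 (g k)) * of_bool (u k \<le> t)\<bar>"
      unfolding jump_fun_def
      by (simp add: sum_subtractf[symmetric] left_diff_distrib del: sum_mult_of_bool_eq sum_of_bool_mult_eq)
    also have "\<dots> \<le> (\<Sum>k\<in>K. \<bar>D (g k) - D0 (g k)\<bar>)"
      by (intro order.trans[OF sum_abs] sum_mono) auto
    finally show "\<bar>jump_fun K u (\<lambda>k. D (g k)) c t - jump_fun K u (\<lambda>k. D0 (g k)) c t\<bar>
        \<le> (\<Sum>k\<in>K. \<bar>D (g k) - D0 (g k)\<bar>)" .
  qed (auto intro: sum_nonneg)
  have "((\<lambda>D. dist (mk_path (jump_fun K u (\<lambda>k. D (g k)) c)) (mk_path (jump_fun K u (\<lambda>k. D0 (g k)) c))) \<longlongrightarrow> 0) (at D0)"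
    by (rule tendsto_sandwich[OF _ _ tendsto_const lim]) (use le in auto)
  then show "((\<lambda>D. mk_path (jump_fun K u (\<lambda>k. D (g k)) c)) \<longlongrightarrow> mk_path (jump_fun K u (\<lambda>k. D0 (g k)) c))
      (at D0 within UNIV)"
    using tendsto_dist_iff by blast
qed

lemma poisson_path:
  assumes "poisson_process M lam N" "\<omega> \<in> space M"
  shows "mono_on {0..} (\<lambda>t. N t \<omega>)" "\<And>t. 0 \<le> t \<Longrightarrow> ((\<lambda>s. N s \<omega>) \<longlongrightarrow> N t \<omega>) (at_right t)" "N 0 \<omega> = 0"
proof -
  have "\<forall>\<omega>\<in>space M. N 0 \<omega> = 0 \<and> mono_on {0..} (\<lambda>t. N t \<omega>) \<and>
      (\<forall>t\<ge>0. ((\<lambda>s. N s \<omega>) \<longlongrightarrow> N t \<omega>) (at_right t))"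
    using assms(1) unfolding poisson_process_def by (elim conjE)
  from bspec[OF this assms(2)]
  have *: "N 0 \<omega> = 0" "mono_on {0..} (\<lambda>t. N t \<omega>)"
      "\<forall>t\<ge>0. ((\<lambda>s. N s \<omega>) \<longlongrightarrow> N t \<omega>) (at_right t)" by (blast elim: conjE)+
  show "mono_on {0..} (\<lambda>t. N t \<omega>)" by (rule *(2))
  show "N 0 \<omega> = 0" by (rule *(1))
  show "((\<lambda>s. N s \<omega>) \<longlongrightarrow> N t \<omega>) (at_right t)" if "0 \<le> t" for t
    using *(3) that by (elim allE[of _ t]) (erule mp)
qed

lemma poisson_times:
  assumes "poisson_process M lam N" "\<omega> \<in> space M" "0 \<le> b"
  obtains T where "\<And>k. k \<in> {1..N b \<omega>} \<Longrightarrow> T k \<in> {0<..b}"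
    "\<And>k t. k \<in> {1..N b \<omega>} \<Longrightarrow> t \<in> {0..b} \<Longrightarrow> k \<le> N t \<omega> \<longleftrightarrow> T k \<le> t"
proof -
  obtain T where T: "\<And>k. k \<in> {1..N b \<omega>} \<Longrightarrow> T k \<in> {0<..b}"
    "\<And>k t. k \<in> {1..N b \<omega>} \<Longrightarrow> t \<in> {0..b} \<Longrightarrow> k \<le> N t \<omega> \<longleftrightarrow> T k \<le> t"
    using counting_times[OF poisson_path(1)[OF assms(1,2)] poisson_path(2)[OF assms(1,2)]
      poisson_path(3)[OF assms(1,2)] assms(3)] by blast
  then show thesis by (rule that)
qed

lemma sum_upto_count_eq:
  assumes N: "poisson_process M lam N" "\<omega> \<in> space M" and t: "t \<in> {0..b}"
    and T: "\<And>k t. k \<in> {1..N b \<omega>} \<Longrightarrow> t \<in> {0..b} \<Longrightarrow> k \<le> N t \<omega> \<longleftrightarrow> T k \<le> t"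
  shows "(\<Sum>k=1..N t \<omega>. w k) = (\<Sum>k=1..N b \<omega>. (w k :: real) * of_bool (T k \<le> t))"
proof -
  have le: "N t \<omega> \<le> N b \<omega>" using mono_onD[OF poisson_path(1)[OF N], of t b] t by auto
  have "(\<Sum>k=1..N b \<omega>. w k * of_bool (T k \<le> t)) = (\<Sum>k\<in>{1..N b \<omega>} \<inter> {k. T k \<le> t}. w k)"
    by simp
  also have "{1..N b \<omega>} \<inter> {k. T k \<le> t} = {1..N t \<omega>}"
  proof -
    have "T k \<le> t \<longleftrightarrow> k \<le> N t \<omega>" if "k \<in> {1..N b \<omega>}" for k using T[OF that t] by simp
    then show ?thesis using le by force
  qed
  finally show ?thesis by simp
qed

lemma compensated_cp_eq_jump_fun:
  assumes N: "poisson_process M lam N" "\<omega> \<in> space M" and n: "0 < n" and t: "t \<in> {0..1}"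
    and T: "\<And>k t. k \<in> {1..N (real n) \<omega>} \<Longrightarrow> t \<in> {0..real n} \<Longrightarrow> k \<le> N t \<omega> \<longleftrightarrow> T k \<le> t"
  shows "compensated_cp M lam N W (real n * t) \<omega> / real n =
    jump_fun {1..N (real n) \<omega>} (\<lambda>k. T k / real n) (\<lambda>k. W k \<omega> / real n) (- lam * (\<integral>\<omega>'. W 1 \<omega>' \<partial>M)) t"
proof -
  have nt: "real n * t \<in> {0..real n}" using t n by (auto intro: mult_left_le)
  have "(\<Sum>k=1..N (real n * t) \<omega>. W k \<omega>) = (\<Sum>k=1..N (real n) \<omega>. W k \<omega> * of_bool (T k \<le> real n * t))"
    by (rule sum_upto_count_eq[OF N nt T])
  also have "\<dots> / real n = (\<Sum>k=1..N (real n) \<omega>. W k \<omega> / real n * of_bool (T k / real n \<le> t))"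
    unfolding sum_divide_distrib using n by (intro sum.cong) (auto simp: field_simps)
  finally show ?thesis using n unfolding compensated_cp_def jump_fun_def
    by (simp add: diff_divide_distrib del: sum_mult_of_bool_eq)
qed

lemma tendsto_finite_funI:
  fixes f :: "'b \<Rightarrow> 'd::finite \<Rightarrow> 'a::metric_space"
  assumes "\<And>i. ((\<lambda>m. f m i) \<longlongrightarrow> l i) F"
  shows "(f \<longlongrightarrow> l) F"
proof (rule topological_tendstoI)
  fix U assume "open U" "l \<in> U"
  then obtain e where e: "e > 0" "\<And>y. max_dist l y < e \<Longrightarrow> y \<in> U" unfolding open_max_dist by blast
  have "\<forall>\<^sub>F m in F. \<forall>i. dist (f m i) (l i) < e"
    using tendstoD[OF assms e(1)] by (rule eventually_all_finite)
  then show "\<forall>\<^sub>F m in F. f m \<in> U"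
    by eventually_elim (auto intro!: e(2) simp: max_dist_less_iff dist_commute)
qed

text \<open>The scaled path is a pointwise limit of paths jumping only at grid points, each a
  continuous function of measurable increments. All coordinates are treated together, so the Borel
  sets of the full path space are reached directly and not through a product
  \<sigma>-algebra.\<close>

lemma scaled_path_measurable:
  fixes X :: "'d::finite \<Rightarrow> real \<Rightarrow> 'w \<Rightarrow> real"
  assumes N: "\<And>i. poisson_process M (lam i) (N i)"
    and W: "\<And>i k. 1 \<le> k \<Longrightarrow> W i k \<in> borel_measurable M"
    and X: "\<And>i. X i = compensated_cp M (lam i) (N i) (W i)" and n: "0 < n"
  shows "scaled_path X n \<in> measurable M borel"
proof -
  define c where "c i = - lam i * (\<integral>\<omega>'. W i 1 \<omega>' \<partial>M)" for i
  define S where "S i t \<omega> = (\<Sum>k=1..N i t \<omega>. W i k \<omega>) / real n" for i t \<omega>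
  \<comment> \<open>Increment of the scaled sums over the cell from \<open>j - 1\<close> to
    \<open>j\<close>; the drift is kept apart, as it is exact in the approximating path. Pairs
    \<open>(i, j)\<close> gather the increments of all coordinates in one real-valued
    function.\<close>
  define D where "D m \<omega> = (\<lambda>(i, j). S i (real n * real j / real (Suc m)) \<omega> - S i (real n * real (j - 1) / real (Suc m)) \<omega>)"
    for m \<omega>
  define Y where "Y m \<omega> = (\<lambda>i. mk_path (jump_fun {1..Suc m} (\<lambda>j. real j / real (Suc m)) (\<lambda>j. D m \<omega> (i, j)) (c i)))"
    for m \<omega>
  have Sm: "S i t \<in> borel_measurable M" if "0 \<le> t" for i t
  proof -
    have [measurable]: "N i t \<in> measurable M (count_space UNIV)"
      using N[of i] that by (auto simp: poisson_process_def)
    have [measurable]: "(\<lambda>\<omega>. (\<Sum>k=1..m. W i k \<omega>)) \<in> borel_measurable M" for m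
      using W by (intro borel_measurable_sum) auto
    show ?thesis unfolding S_def by measurable
  qed
  have Ym: "Y m \<in> measurable M borel" for m
  proof -
    have "D m \<in> measurable M borel"
    proof (rule measurable_coordinatewise_then_product)
      fix p :: "'d \<times> nat"
      obtain i j where [simp]: "p = (i, j)" by (cases p)
      show "(\<lambda>\<omega>. D m \<omega> p) \<in> borel_measurable M"
        unfolding D_def by (simp, intro borel_measurable_diff Sm) auto
    qed
    moreover have "(\<lambda>d i. mk_path (jump_fun {1..Suc m} (\<lambda>j. real j / real (Suc m)) (\<lambda>j. d (i, j)) (c i)))
        \<in> borel_measurable (borel :: ('d \<times> nat \<Rightarrow> real) measure)"
      by (intro borel_measurable_continuous_onI continuous_on_coordinatewise_then_product continuous_jump_fun_sizes) auto
    ultimately show ?thesis unfolding Y_def by (rule measurable_compose)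
  qed
  have lim: "(\<lambda>m. Y m \<omega>) \<longlonglongrightarrow> scaled_path X n \<omega>" if \<omega>: "\<omega> \<in> space M" for \<omega>
  proof (rule tendsto_finite_funI)
    show "(\<lambda>m. Y m \<omega> i) \<longlonglongrightarrow> scaled_path X n \<omega> i" for i
  proof -
    obtain T where T: "\<And>k. k \<in> {1..N i (real n) \<omega>} \<Longrightarrow> T k \<in> {0<..real n}"
      "\<And>k t. k \<in> {1..N i (real n) \<omega>} \<Longrightarrow> t \<in> {0..real n} \<Longrightarrow> k \<le> N i t \<omega> \<longleftrightarrow> T k \<le> t"
      using poisson_times[OF N[of i] \<omega> of_nat_0_le_iff[of n]] by blast
    let ?K = "{1..N i (real n) \<omega>}" and ?u = "\<lambda>k. T k / real n" and ?w = "\<lambda>k. W i k \<omega> / real n"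
    have lim: "(\<lambda>m. mk_path (jump_fun ?K (\<lambda>k. of_int \<lceil>real (Suc m) * ?u k\<rceil> / real (Suc m)) ?w (c i)))
        \<longlonglongrightarrow> mk_path (jump_fun ?K ?u ?w (c i))"
      using T(1) n by (intro jump_fun_rounded_tendsto) (auto simp: field_simps)
    have 1: "scaled_path X n \<omega> i = mk_path (jump_fun ?K ?u ?w (c i))"
      unfolding scaled_path_def X c_def
      by (intro mk_path_cong compensated_cp_eq_jump_fun[OF N \<omega> n _ T(2)]) auto
    \<comment> \<open>Crediting the increment of a cell to its right end amounts to rounding every
      arrival time up to the grid.\<close>
    have 2: "Y m \<omega> i = mk_path (jump_fun ?K (\<lambda>k. of_int \<lceil>real (Suc m) * ?u k\<rceil> / real (Suc m)) ?w (c i))" for m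
      unfolding Y_def
    proof (rule mk_path_cong)
      fix t :: real assume t: "t \<in> {0..1}"
      define q where "q = real (Suc m)"
      have q: "0 < q" by (simp add: q_def)
      \<comment> \<open>Index of the last grid point not exceeding \<open>t\<close>; the increments
        up to it telescope to the value of the sum there.\<close>
      define p where "p = nat \<lfloor>q * t\<rfloor>"
      have qt: "0 \<le> q * t" "q * t \<le> q" using q t by auto
      have p: "real p \<le> q * t" "q * t < real p + 1" "p \<le> Suc m"
      proof -
        show "real p \<le> q * t" "q * t < real p + 1" using qt by (auto simp: p_def of_nat_nat)
        from this(1) qt(2) have "real p \<le> real (Suc m)" unfolding q_def by (rule order.trans)
        then show "p \<le> Suc m" by linarith
      qed
      have p_iff: "of_int z \<le> q * t \<longleftrightarrow> real_of_int z \<le> real p" for z :: int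
      proof -
        have "of_int z \<le> q * t \<longleftrightarrow> z \<le> \<lfloor>q * t\<rfloor>" by (simp add: le_floor_iff)
        also have "\<dots> \<longleftrightarrow> z \<le> int p" using qt by (simp add: p_def)
        finally show ?thesis by linarith
      qed
      have "(\<Sum>j\<in>{1..Suc m}. D m \<omega> (i, j) * of_bool (real j / real (Suc m) \<le> t)) =
          (\<Sum>j\<in>{1..Suc m} \<inter> {j. real j / q \<le> t}. D m \<omega> (i, j))"
        unfolding q_def by (rule sum_mult_of_bool_eq) (rule finite_atLeastAtMost)
      also have "{1..Suc m} \<inter> {j. real j / q \<le> t} = {Suc 0..p}"
      proof -
        have *: "real j / q \<le> t \<longleftrightarrow> j \<le> p" for j
        proof -
          have "real j / q \<le> t \<longleftrightarrow> of_int (int j) \<le> q * t" using q by (simp add: field_simps)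
          also have "\<dots> \<longleftrightarrow> real j \<le> real p" unfolding p_iff by simp
          finally show ?thesis by simp
        qed
        show ?thesis unfolding * using p(3) by (intro set_eqI) (simp only: Int_iff mem_Collect_eq atLeastAtMost_iff, linarith)
      qed
      also have "(\<Sum>j\<in>{Suc 0..p}. D m \<omega> (i, j)) = S i (real n * real p / q) \<omega> - S i (real n * real 0 / q) \<omega>"
        unfolding D_def q_def prod.case
        by (rule sum_telescope''[of 0 p "\<lambda>j. S i (real n * real j / real (Suc m)) \<omega>"]) simp
      also have "\<dots> = S i (real n * real p / q) \<omega>"
        using poisson_path(3)[OF N \<omega>] by (simp add: S_def)
      also have "\<dots> = (\<Sum>k\<in>?K. W i k \<omega> * of_bool (T k \<le> real n * real p / q)) / real n"
      proof -
        have "real p \<le> q" using p(1) qt(2) by linarith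
        then have "real n * real p \<le> real n * q" by (rule mult_left_mono) simp
        then have mem: "real n * real p / q \<in> {0..real n}"
          using q by (auto simp: pos_divide_le_eq)
        show ?thesis unfolding S_def
          by (rule arg_cong[of _ _ "\<lambda>x. x / real n"], rule sum_upto_count_eq[OF N \<omega> mem]) (rule T(2))
      qed
      also have "\<dots> = (\<Sum>k\<in>?K. ?w k * of_bool (of_int \<lceil>q * ?u k\<rceil> / q \<le> t))"
        unfolding sum_divide_distrib
      proof (intro sum.cong refl)
        fix k
        have "of_int \<lceil>q * ?u k\<rceil> / q \<le> t \<longleftrightarrow> of_int \<lceil>q * ?u k\<rceil> \<le> q * t"
          unfolding pos_divide_le_eq[OF q] mult.commute[of t q] by (rule refl)
        also have "\<dots> \<longleftrightarrow> \<lceil>q * ?u k\<rceil> \<le> int p" unfolding p_iff by linarith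
        also have "\<dots> \<longleftrightarrow> T k \<le> real n * real p / q"
          using q n by (simp add: ceiling_le_iff pos_le_divide_eq pos_divide_le_eq mult_ac)
        finally show "W i k \<omega> * of_bool (T k \<le> real n * real p / q) / real n =
            ?w k * of_bool (of_int \<lceil>q * ?u k\<rceil> / q \<le> t)" by simp
      qed
      finally show "jump_fun {1..Suc m} (\<lambda>j. real j / real (Suc m)) (\<lambda>j. D m \<omega> (i, j)) (c i) t =
          jump_fun ?K (\<lambda>k. of_int \<lceil>real (Suc m) * ?u k\<rceil> / real (Suc m)) ?w (c i) t"
        unfolding jump_fun_def q_def by (simp only:)
    qed
    show ?thesis unfolding 1 2 by (rule lim)
  qed
  qed
  show ?thesis by (rule borel_measurable_LIMSEQ_metric[OF Ym lim])
qed

section \<open>Simplicity of the arrival times\<close>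

lemma poisson_increment_ge_2:
  assumes "prob_space M" "poisson_process M lam N" "0 < lam" "0 \<le> s" "s < t"
  shows "measure M {\<omega>\<in>space M. 2 \<le> N t \<omega> - N s \<omega>} \<le> (lam * (t - s))\<^sup>2"
proof -
  interpret prob_space M by fact
  let ?r = "lam * (t - s)"
  have r: "0 < ?r" using assms by simp
  have [measurable]: "N t \<in> measurable M (count_space UNIV)" "N s \<in> measurable M (count_space UNIV)"
    using assms by (auto simp: poisson_process_def)
  have "measure M {\<omega>\<in>space M. 2 \<le> N t \<omega> - N s \<omega>} = measure (distr M (count_space UNIV) (\<lambda>\<omega>. N t \<omega> - N s \<omega>)) {2..}"
    by (subst measure_distr) (auto intro!: arg_cong[of _ _ "measure M"])
  also have "\<dots> = measure_pmf.prob (poisson_pmf ?r) {2..}"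
    using assms by (auto simp: poisson_process_def)
  also have "{2..} = UNIV - {0, 1 :: nat}" by auto
  also have "measure_pmf.prob (poisson_pmf ?r) (UNIV - {0, 1}) = 1 - (pmf (poisson_pmf ?r) 0 + pmf (poisson_pmf ?r) 1)"
    by (subst measure_pmf.finite_measure_Diff) (auto simp: measure_measure_pmf_finite)
  also have "\<dots> = 1 - (1 + ?r) * exp (- ?r)" using r by (simp add: algebra_simps)
  also have "\<dots> \<le> 1 - (1 + ?r) * (1 + - ?r)"
    using r by (intro diff_left_mono mult_left_mono exp_ge_add_one_self) auto
  also have "\<dots> = ?r\<^sup>2" by (simp add: power2_eq_square algebra_simps)
  finally show ?thesis .
qed

text \<open>A union bound over \<open>m\<close> cells of length \<open>b / m\<close> costs a
  constant over \<open>m\<close>, so the event that every grid has a cell with two arrivals is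
  null.\<close>

lemma AE_no_double_jumps:
  assumes "prob_space M" "poisson_process M lam N" "0 < lam" "0 < b"
  shows "AE \<omega> in M. \<exists>m>0. \<forall>j<m. N (b * real (Suc j) / real m) \<omega> - N (b * real j / real m) \<omega> \<le> 1"
proof -
  interpret prob_space M by fact
  have N: "N t \<in> measurable M (count_space UNIV)" if "0 \<le> t" for t
    using assms that by (auto simp: poisson_process_def)
  have [measurable]: "N (b * real j / real m) \<in> measurable M (count_space UNIV)" for j m :: nat
    using assms(4) by (intro N) auto
  define F where "F m j = {\<omega>\<in>space M. 2 \<le> N (b * real (Suc j) / real m) \<omega> - N (b * real j / real m) \<omega>}" for m j
  define E where "E m = (\<Union>j<m. F m j)" for m
  have F: "F m j \<in> events" for m j unfolding F_def by measurable
  then have E: "E m \<in> events" for m unfolding E_def by auto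
  have le: "prob (E m) \<le> (lam * b)\<^sup>2 / real m" if m: "0 < m" for m
  proof -
    have "prob (E m) \<le> (\<Sum>j<m. prob (F m j))"
      unfolding E_def using F by (intro finite_measure_subadditive_finite) auto
    also have "\<dots> \<le> (\<Sum>j<m. (lam * (b / real m))\<^sup>2)"
    proof (intro sum_mono)
      fix j
      have "prob (F m j) \<le> (lam * (b * real (Suc j) / real m - b * real j / real m))\<^sup>2"
        unfolding F_def using m assms(4)
        by (intro poisson_increment_ge_2[OF assms(1-3)]) (auto simp: field_simps)
      also have "b * real (Suc j) / real m - b * real j / real m = b / real m"
        by (simp add: diff_divide_distrib[symmetric] algebra_simps)
      finally show "prob (F m j) \<le> (lam * (b / real m))\<^sup>2" .
    qed
    also have "\<dots> = (lam * b)\<^sup>2 / real m" using m by (simp add: power2_eq_square field_simps)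
    finally show ?thesis .
  qed
  have Emeas: "(\<Inter>m\<in>{0<..}. E m) \<in> events" using E by (intro sets.countable_INT) auto
  have "prob (\<Inter>m\<in>{0<..}. E m) \<le> 0"
  proof (rule LIMSEQ_le_const)
    have "(\<lambda>m. (lam * b)\<^sup>2 / real m) \<longlonglongrightarrow> 0" by (rule lim_const_over_n)
    then show "(\<lambda>m. (lam * b)\<^sup>2 / real m) \<longlonglongrightarrow> 0" .
    show "\<exists>k. \<forall>m\<ge>k. prob (\<Inter>m\<in>{0<..}. E m) \<le> (lam * b)\<^sup>2 / real m"
    proof (intro exI[of _ 1] allI impI)
      fix m :: nat assume "1 \<le> m"
      then have "prob (\<Inter>m\<in>{0<..}. E m) \<le> prob (E m)"
        using E by (intro finite_measure_mono) auto
      then show "prob (\<Inter>m\<in>{0<..}. E m) \<le> (lam * b)\<^sup>2 / real m" using le[of m] \<open>1 \<le> m\<close> by simp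
    qed
  qed
  then have "prob (\<Inter>m\<in>{0<..}. E m) = 0" by (simp add: measure_le_0_iff)
  then have "(\<Inter>m\<in>{0<..}. E m) \<in> null_sets M"
    using Emeas by (auto simp: null_sets_def emeasure_eq_measure)
  then have "AE \<omega> in M. \<omega> \<notin> (\<Inter>m\<in>{0<..}. E m)" by (rule AE_not_in)
  then show ?thesis using AE_space
  proof eventually_elim
    case (elim \<omega>)
    then obtain m where m: "0 < m" "\<And>j. j < m \<Longrightarrow> \<omega> \<notin> F m j" by (auto simp: E_def)
    have "N (b * real (Suc j) / real m) \<omega> - N (b * real j / real m) \<omega> \<le> 1" if "j < m" for j
    proof -
      have "\<not> 2 \<le> N (b * real (Suc j) / real m) \<omega> - N (b * real j / real m) \<omega>"
        using m(2)[OF that] elim(2) unfolding F_def by blast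
      then show ?thesis by linarith
    qed
    then show ?case using m(1) by blast
  qed
qed

section \<open>Tails of a compound Poisson process\<close>

lemma power_two_between:
  assumes "1 \<le> (r :: real)"
  obtains j :: nat where "2 ^ j \<le> r" "r < 2 * 2 ^ j"
proof -
  define k where "k = nat \<lfloor>log 2 r\<rfloor>"
  have "\<lfloor>log 2 r\<rfloor> = int k" using assms by (simp add: k_def)
  then have "2 powr real k \<le> r \<and> r < 2 powr (real k + 1)"
    using assms floor_log_eq_powr_iff[of r 2 "int k"] by auto
  then have "2 ^ k \<le> r" "r < 2 * 2 ^ k" by (auto simp: powr_realpow powr_add)
  then show thesis by (rule that)
qed

text \<open>Potter-type bound from the scale factor 2 alone: the ratio under doubling is eventually
  below \<open>2 powr - p\<close>, iteration gives the bound on dyadic multiples of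
  \<open>x0\<close>, and monotonicity fills the gaps.\<close>

lemma doubling_upper:
  fixes g :: "real \<Rightarrow> real"
  assumes anti: "\<And>x y. x \<le> y \<Longrightarrow> g y \<le> g x" and nonneg: "\<And>x. 0 \<le> g x"
    and pos: "eventually (\<lambda>x. 0 < g x) at_top"
    and lim: "((\<lambda>x. g (2 * x) / g x) \<longlongrightarrow> 2 powr - \<beta>) at_top" and p: "0 \<le> p" "p < \<beta>"
  obtains C where "0 < C" "eventually (\<lambda>x. g x \<le> C * x powr - p) at_top"
proof -
  have "eventually (\<lambda>x. g (2 * x) / g x < 2 powr - p) at_top"
    by (rule order_tendstoD(2)[OF lim]) (use p in simp)
  then have "eventually (\<lambda>x. g (2 * x) \<le> 2 powr - p * g x \<and> 1 \<le> x) at_top"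
    using pos eventually_ge_at_top[of "1::real"] by eventually_elim (auto simp: field_simps)
  then obtain x0 where x0: "\<And>x. x0 \<le> x \<Longrightarrow> g (2 * x) \<le> 2 powr - p * g x \<and> 1 \<le> x"
    by (auto simp: eventually_at_top_linorder)
  have x01: "1 \<le> x0" using x0 by blast
  have pow: "g (2 ^ j * x0) \<le> (2 ^ j) powr - p * g x0" for j
  proof (induction j)
    case (Suc j)
    have "g (2 ^ Suc j * x0) = g (2 * (2 ^ j * x0))" by (simp add: mult_ac)
    also have "\<dots> \<le> 2 powr - p * g (2 ^ j * x0)" using x0[of "2 ^ j * x0"] x01 by simp
    also have "\<dots> \<le> 2 powr - p * ((2 ^ j) powr - p * g x0)" using Suc by (intro mult_left_mono) auto
    also have "\<dots> = (2 ^ Suc j) powr - p * g x0" by (simp add: powr_mult)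
    finally show ?case .
  qed simp
  \<comment> \<open>The power comes from \<open>2 ^ j > x / (2 * x0)\<close>; adding 1 to
    \<open>g x0\<close> makes the constant positive without knowing that \<open>g x0\<close>
    is.\<close>
  define C where "C = (1 / (2 * x0)) powr - p * (g x0 + 1)"
  show thesis
  proof
    show "0 < C" using x01 nonneg[of x0] by (auto simp: C_def intro!: mult_pos_pos)
    show "eventually (\<lambda>x. g x \<le> C * x powr - p) at_top"
      using eventually_ge_at_top[of x0]
    proof eventually_elim
      fix x assume x: "x0 \<le> x"
      obtain j :: nat where j: "2 ^ j \<le> x / x0" "x / x0 < 2 * 2 ^ j"
        using power_two_between[of "x / x0"] x x01 by auto
      have "g x \<le> g (2 ^ j * x0)" using j(1) x01 by (intro anti) (simp add: field_simps)
      also have "\<dots> \<le> (2 ^ j) powr - p * g x0" by (rule pow)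
      also have "\<dots> \<le> (x / (2 * x0)) powr - p * (g x0 + 1)"
        using j(2) x x01 p nonneg[of x0]
        by (intro mult_mono powr_mono2') (auto simp: field_simps)
      also have "(x / (2 * x0)) powr - p = (1 / (2 * x0)) powr - p * x powr - p"
        using x x01 by (subst powr_mult[symmetric]) auto
      finally show "g x \<le> C * x powr - p" by (simp add: C_def mult_ac)
    qed
  qed
qed

text \<open>The same iteration from below: \<open>x\<close> is compared with the next dyadic
  multiple above it, whence \<open>2 / x0\<close> in the constant.\<close>

lemma doubling_lower:
  fixes g :: "real \<Rightarrow> real"
  assumes anti: "\<And>x y. x \<le> y \<Longrightarrow> g y \<le> g x"
    and pos: "eventually (\<lambda>x. 0 < g x) at_top"
    and lim: "((\<lambda>x. g (2 * x) / g x) \<longlongrightarrow> 2 powr - \<beta>) at_top" and p: "0 \<le> p" "\<beta> < p"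
  obtains c where "0 < c" "eventually (\<lambda>x. c * x powr - p \<le> g x) at_top"
proof -
  have "eventually (\<lambda>x. 2 powr - p < g (2 * x) / g x) at_top"
    by (rule order_tendstoD(1)[OF lim]) (use p in simp)
  then have "eventually (\<lambda>x. 2 powr - p * g x \<le> g (2 * x) \<and> 1 \<le> x \<and> 0 < g x) at_top"
    using pos eventually_ge_at_top[of "1::real"] by eventually_elim (auto simp: field_simps)
  then obtain x0 where x0: "\<And>x. x0 \<le> x \<Longrightarrow> 2 powr - p * g x \<le> g (2 * x) \<and> 1 \<le> x \<and> 0 < g x"
    by (auto simp: eventually_at_top_linorder)
  have x01: "1 \<le> x0" "0 < g x0" using x0 by blast+
  have pow: "(2 ^ j) powr - p * g x0 \<le> g (2 ^ j * x0)" for j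
  proof (induction j)
    case (Suc j)
    have "(2 ^ Suc j) powr - p * g x0 = 2 powr - p * ((2 ^ j) powr - p * g x0)" by (simp add: powr_mult)
    also have "\<dots> \<le> 2 powr - p * g (2 ^ j * x0)" using Suc by (intro mult_left_mono) auto
    also have "\<dots> \<le> g (2 * (2 ^ j * x0))" using x0[of "2 ^ j * x0"] x01 by simp
    also have "\<dots> = g (2 ^ Suc j * x0)" by (simp add: mult_ac)
    finally show ?case .
  qed simp
  define c where "c = (2 / x0) powr - p * g x0"
  show thesis
  proof
    show "0 < c" using x01 by (auto simp: c_def intro!: mult_pos_pos)
    show "eventually (\<lambda>x. c * x powr - p \<le> g x) at_top"
      using eventually_ge_at_top[of x0]
    proof eventually_elim
      fix x assume x: "x0 \<le> x"
      obtain j :: nat where j: "2 ^ j \<le> x / x0" "x / x0 < 2 * 2 ^ j"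
        using power_two_between[of "x / x0"] x x01 by auto
      have "c * x powr - p = (2 * x / x0) powr - p * g x0"
        using x x01 powr_mult[of "2 / x0" x "- p"] by (simp add: c_def mult_ac)
      also have "\<dots> \<le> (2 ^ Suc j) powr - p * g x0"
        using j(1) x x01 p by (intro mult_right_mono powr_mono2') auto
      also have "\<dots> \<le> g (2 ^ Suc j * x0)" by (rule pow)
      also have "\<dots> \<le> g x" using j(2) x01 by (intro anti) (simp add: field_simps)
      finally show "c * x powr - p \<le> g x" .
    qed
  qed
qed

lemma exp_chord:
  fixes a y x :: real
  assumes "0 < y" "0 \<le> x" "x \<le> y"
  shows "exp (a * x) \<le> 1 + x / y * (exp (a * y) - 1)"
proof -
  have "exp ((1 - x / y) *\<^sub>R 0 + (x / y) *\<^sub>R (a * y)) \<le> (1 - x / y) * exp 0 + x / y * exp (a * y)"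
    using assms by (intro convex_onD[OF exp_convex]) auto
  then show ?thesis using assms by (simp add: algebra_simps)
qed

section \<open>One compound Poisson coordinate: mixtures over the count and tails of the sum\<close>

locale compound_poisson = prob_space M for M :: "'w measure" +
  fixes lam :: real and N :: "real \<Rightarrow> 'w \<Rightarrow> nat" and W :: "nat \<Rightarrow> 'w \<Rightarrow> real"
  assumes lam: "0 < lam" and N: "poisson_process M lam N" and W: "positive_iid M W"
    and indep: "\<And>E F. E \<in> gen_sigma M {0..} N (count_space UNIV) \<Longrightarrow> F \<in> gen_sigma M {1..} W borel \<Longrightarrow>
      prob (E \<inter> F) = prob E * prob F"
begin

text \<open>Indexing from 0 makes the first \<open>m\<close> jumps those over \<open>{..<m}\<close>;
  jump \<open>k\<close> arrives at the arrival time with index \<open>Suc k\<close>.\<close>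

definition V :: "nat \<Rightarrow> 'w \<Rightarrow> real" where "V k = W (Suc k)"

text \<open>The generated \<sigma>-algebra in the guise of a measure, so that membership of an event
  becomes a measurability statement.\<close>

definition N_alg :: "'w measure" where
  "N_alg = sigma (space M) (\<Union>t\<in>{0..}. {N t -` S \<inter> space M |S. S \<in> sets (count_space UNIV)})"

definition V_alg :: "'w measure" where
  "V_alg = sigma (space M) (\<Union>k\<in>{1..}. {W k -` S \<inter> space M |S. S \<in> sets borel})"

definition tail :: "real \<Rightarrow> real" where "tail x = prob {\<omega>\<in>space M. x < V 0 \<omega>}"

definition mu :: real where "mu = expectation (V 0)"

lemma space_algs [simp]: "space N_alg = space M" "space V_alg = space M"
  by (auto simp: N_alg_def V_alg_def intro!: space_measure_of)

lemma sets_algs: "sets N_alg = gen_sigma M {0..} N (count_space UNIV)" "sets V_alg = gen_sigma M {1..} W borel"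
  unfolding N_alg_def V_alg_def gen_sigma_def by (auto intro!: sets_measure_of)

lemma indep_algs: "E \<in> sets N_alg \<Longrightarrow> F \<in> sets V_alg \<Longrightarrow> prob (E \<inter> F) = prob E * prob F"
  using indep by (simp add: sets_algs)

lemma N_measurable_alg: "0 \<le> t \<Longrightarrow> N t \<in> measurable N_alg (count_space UNIV)"
proof (rule measurableI)
  fix S :: "nat set" assume t: "0 \<le> t"
  then have "N t -` S \<inter> space M \<in> (\<Union>t\<in>{0..}. {N t -` S \<inter> space M |S. S \<in> sets (count_space UNIV)})"
    by (intro UN_I[of t]) auto
  then show "N t -` S \<inter> space N_alg \<in> sets N_alg"
    unfolding space_algs unfolding N_alg_def by (intro in_measure_of) auto
qed simp

lemma V_measurable_alg [measurable]: "V k \<in> borel_measurable V_alg"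
proof (rule measurableI)
  fix S :: "real set" assume "S \<in> sets borel"
  then have "W (Suc k) -` S \<inter> space M \<in> (\<Union>k\<in>{1..}. {W k -` S \<inter> space M |S. S \<in> sets borel})"
    by (intro UN_I[of "Suc k"]) auto
  then show "V k -` S \<inter> space V_alg \<in> sets V_alg"
    unfolding V_def space_algs unfolding V_alg_def by (intro in_measure_of) auto
qed simp

lemma N_measurable: "0 \<le> t \<Longrightarrow> N t \<in> measurable M (count_space UNIV)"
  using N by (auto simp: poisson_process_def)

lemma W_measurable: "1 \<le> k \<Longrightarrow> W k \<in> borel_measurable M"
  using W by (auto simp: positive_iid_def indep_vars_def)

lemma V_measurable [measurable]: "V k \<in> borel_measurable M"
  unfolding V_def by (rule W_measurable) simp

lemma sets_V_alg_subset: "sets V_alg \<subseteq> events"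
  unfolding sets_algs gen_sigma_def
  by (rule sets.sigma_sets_subset) (use measurable_sets[OF W_measurable] in blast)

lemma sets_N_alg_subset: "sets N_alg \<subseteq> events"
  unfolding sets_algs gen_sigma_def
  by (rule sets.sigma_sets_subset) (use measurable_sets[OF N_measurable] in blast)

lemma V_indep: "indep_vars (\<lambda>_. borel) V UNIV"
  unfolding indep_vars_def2
proof
  have Wi: "indep_sets (\<lambda>i. {W i -` A \<inter> space M |A. A \<in> sets borel}) {1..}"
    using W unfolding positive_iid_def indep_vars_def2 by (elim conjE)
  show "indep_sets (\<lambda>i. {V i -` A \<inter> space M |A. A \<in> sets borel}) UNIV"
  proof (rule indep_setsI)
    show "{V i -` A \<inter> space M |A. A \<in> sets borel} \<subseteq> events" for i
      using measurable_sets[OF V_measurable] by blast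
    fix A J assume J: "J \<noteq> {}" "J \<subseteq> (UNIV :: nat set)" "finite J"
      and A: "\<forall>j\<in>J. A j \<in> {V j -` A \<inter> space M |A. A \<in> sets borel}"
    have "prob (\<Inter>j\<in>Suc ` J. A (j - 1)) = (\<Prod>j\<in>Suc ` J. prob (A (j - 1)))"
      using J A by (intro indep_setsD[OF Wi]) (auto simp: V_def)
    then show "prob (\<Inter>j\<in>J. A j) = (\<Prod>j\<in>J. prob (A j))"
      by (simp add: prod.reindex)
  qed
qed simp

lemma V_distr: "distr M borel (V k) = distr M borel (V 0)"
  using W unfolding positive_iid_def V_def by (metis One_nat_def le_add1 plus_1_eq_Suc)

lemma V_pos: "AE \<omega> in M. \<forall>k. 0 < V k \<omega>"
  unfolding AE_all_countable V_def using W by (auto simp: positive_iid_def)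

lemma prob_V: "S \<in> sets borel \<Longrightarrow> prob {\<omega>\<in>space M. V k \<omega> \<in> S} = prob {\<omega>\<in>space M. V 0 \<omega> \<in> S}"
  using V_distr[of k] measure_distr[OF V_measurable, of S k] measure_distr[OF V_measurable, of S 0]
  by (simp add: vimage_def Int_def conj_commute)

lemma prob_V_gt: "prob {\<omega>\<in>space M. x < V k \<omega>} = tail x"
  using prob_V[of "{x<..}" k] by (simp add: tail_def)

lemma prob_V_all:
  assumes "finite J" "\<And>k. k \<in> J \<Longrightarrow> S k \<in> sets borel"
  shows "prob {\<omega>\<in>space M. \<forall>k\<in>J. V k \<omega> \<in> S k} = (\<Prod>k\<in>J. prob {\<omega>\<in>space M. V 0 \<omega> \<in> S k})"
proof (cases "J = {}")
  case False
  have "prob (\<Inter>k\<in>J. V k -` S k \<inter> space M) = (\<Prod>k\<in>J. prob (V k -` S k \<inter> space M))"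
    using assms False by (intro indep_varsD[OF V_indep]) auto
  also have "(\<Inter>k\<in>J. V k -` S k \<inter> space M) = {\<omega>\<in>space M. \<forall>k\<in>J. V k \<omega> \<in> S k}"
    using False by auto
  also have "(\<Prod>k\<in>J. prob (V k -` S k \<inter> space M)) = (\<Prod>k\<in>J. prob {\<omega>\<in>space M. V 0 \<omega> \<in> S k})"
  proof (intro prod.cong refl)
    fix k assume "k \<in> J"
    then have S: "S k \<in> sets borel" by (rule assms(2))
    have eq: "V k -` S k \<inter> space M = {\<omega>\<in>space M. V k \<omega> \<in> S k}" by auto
    show "prob (V k -` S k \<inter> space M) = prob {\<omega>\<in>space M. V 0 \<omega> \<in> S k}"
      unfolding eq by (rule prob_V[OF S])
  qed
  finally show ?thesis .
qed (simp add: prob_space)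

lemma expectation_V:
  assumes [measurable]: "f \<in> borel_measurable borel"
  shows "expectation (\<lambda>\<omega>. f (V k \<omega>) :: real) = expectation (\<lambda>\<omega>. f (V 0 \<omega>))"
  using integral_distr[of "V k" M borel f] integral_distr[of "V 0" M borel f] V_distr[of k] by simp

lemma integrable_exp_bounded:
  assumes [measurable]: "f \<in> borel_measurable borel" and "\<And>x. f x \<le> c"
  shows "integrable M (\<lambda>\<omega>. exp (f (V k \<omega>) :: real))"
  by (rule integrable_const_bound[where B="exp c"]) (use assms(2) in auto)

text \<open>Sign and scale are left inside \<open>f\<close>, so both one-sided deviations are
  covered; the upper bound on \<open>f\<close> makes its exponential integrable.\<close>

lemma chernoff:
  assumes [measurable]: "f \<in> borel_measurable borel" and c: "\<And>x. f x \<le> c"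
  shows "prob {\<omega>\<in>space M. a \<le> (\<Sum>k<m. f (V k \<omega>))} \<le> exp (- a) * (expectation (\<lambda>\<omega>. exp (f (V 0 \<omega>)))) ^ m"
proof -
  let ?Z = "\<lambda>\<omega>. \<Prod>k\<in>{..<m}. exp (f (V k \<omega>))"
  have ind: "indep_vars (\<lambda>_. borel) (\<lambda>k \<omega>. exp (f (V k \<omega>))) {..<m}"
    by (rule indep_vars_compose2[OF indep_vars_subset[OF V_indep]]) auto
  have int: "integrable M ?Z"
    by (intro indep_vars_integrable ind integrable_exp_bounded[OF assms]) auto
  have "expectation ?Z = (\<Prod>k\<in>{..<m}. expectation (\<lambda>\<omega>. exp (f (V k \<omega>))))"
    by (intro indep_vars_lebesgue_integral ind integrable_exp_bounded[OF assms]) auto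
  also have "\<dots> = (\<Prod>k\<in>{..<m}. expectation (\<lambda>\<omega>. exp (f (V 0 \<omega>))))"
    by (intro prod.cong refl expectation_V) auto
  finally have E: "expectation ?Z = (expectation (\<lambda>\<omega>. exp (f (V 0 \<omega>)))) ^ m" by simp
  have "prob {\<omega>\<in>space M. ?Z \<omega> \<ge> exp a} \<le> expectation ?Z / exp a"
    by (rule integral_Markov_inequality_measure[OF int, of "{}"]) (auto intro!: prod_nonneg)
  also have "{\<omega>\<in>space M. ?Z \<omega> \<ge> exp a} = {\<omega>\<in>space M. a \<le> (\<Sum>k<m. f (V k \<omega>))}"
    by (simp add: exp_sum[symmetric])
  finally show ?thesis by (simp add: E exp_minus field_simps)
qed

lemma prob_N:
  assumes "0 < t"
  shows "prob {\<omega>\<in>space M. N t \<omega> = m} = (lam * t) ^ m / fact m * exp (- (lam * t))"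
proof -
  have [measurable]: "N t \<in> measurable M (count_space UNIV)" "N 0 \<in> measurable M (count_space UNIV)"
    using assms by (auto intro: N_measurable)
  have d: "distr M (count_space UNIV) (\<lambda>\<omega>. N t \<omega> - N 0 \<omega>) = measure_pmf (poisson_pmf (lam * (t - 0)))"
    using N assms unfolding poisson_process_def by (metis order_refl)
  have "prob {\<omega>\<in>space M. N t \<omega> = m} = measure (distr M (count_space UNIV) (\<lambda>\<omega>. N t \<omega> - N 0 \<omega>)) {m}"
    using poisson_path(3)[OF N] by (subst measure_distr) (auto intro!: arg_cong[of _ _ prob])
  also have "\<dots> = pmf (poisson_pmf (lam * t)) m" unfolding d by (simp add: pmf.rep_eq)
  finally show ?thesis using lam assms by simp
qed

text \<open>Splitting by the value of \<open>N t\<close> gives products, because \<open>N t\<close>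
  is measurable for \<open>N_alg\<close> while every \<open>F m\<close> lies in
  \<open>V_alg\<close>.\<close>

lemma poisson_mixture_sums:
  assumes t: "0 < t" and F: "\<And>m. F m \<in> sets V_alg"
  shows "(\<lambda>m. (lam * t) ^ m / fact m * exp (- (lam * t)) * prob (F m)) sums prob {\<omega>\<in>space M. \<omega> \<in> F (N t \<omega>)}"
proof -
  define A where "A m = {\<omega>\<in>space M. N t \<omega> = m} \<inter> F m" for m
  have E: "{\<omega>\<in>space M. N t \<omega> = m} \<in> sets N_alg" for m
    using measurable_sets[OF N_measurable_alg, of t "{m}"] t by (simp add: vimage_def Int_def conj_commute)
  have A: "A m \<in> events" for m
    unfolding A_def using E F sets_V_alg_subset sets_N_alg_subset by blast
  have "(\<lambda>m. prob (A m)) sums prob (\<Union>m. A m)"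
    using A by (intro finite_measure_UNION) (auto simp: disjoint_family_on_def A_def)
  also have "(\<Union>m. A m) = {\<omega>\<in>space M. \<omega> \<in> F (N t \<omega>)}" by (auto simp: A_def)
  finally show ?thesis
    unfolding A_def by (simp only: indep_algs[OF E F] prob_N[OF t])
qed

lemma exp_weights_sums: "(\<lambda>m. (lam * t) ^ m / fact m * exp (- (lam * t)) * (c * z ^ m)) sums (c * exp (lam * t * (z - 1)))"
proof -
  have "(\<lambda>m. c * exp (- (lam * t)) * ((lam * t * z) ^ m /\<^sub>R fact m)) sums (c * exp (- (lam * t)) * exp (lam * t * z))"
    by (intro sums_mult exp_converges)
  also have "(\<lambda>m. c * exp (- (lam * t)) * ((lam * t * z) ^ m /\<^sub>R fact m)) =
      (\<lambda>m. (lam * t) ^ m / fact m * exp (- (lam * t)) * (c * z ^ m))"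
    by (simp add: fun_eq_iff power_mult_distrib divide_inverse mult_ac)
  finally show ?thesis by (simp add: algebra_simps exp_add[symmetric])
qed

text \<open>Geometric bounds on the conditional probabilities sum up to the Poisson generating
  function. This is why the estimates for a fixed number of jumps are brought to the form
  \<open>c * z ^ m\<close>.\<close>

lemma poisson_mixture_le:
  assumes "0 < t" "\<And>m. F m \<in> sets V_alg" "\<And>m. prob (F m) \<le> c * z ^ m"
  shows "prob {\<omega>\<in>space M. \<omega> \<in> F (N t \<omega>)} \<le> c * exp (lam * t * (z - 1))"
  using assms lam
  by (intro sums_le[OF _ poisson_mixture_sums[OF assms(1,2)] exp_weights_sums] mult_left_mono) auto

lemma poisson_mixture_eq:
  assumes "0 < t" "\<And>m. F m \<in> sets V_alg" "\<And>m. prob (F m) = c * z ^ m"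
  shows "prob {\<omega>\<in>space M. \<omega> \<in> F (N t \<omega>)} = c * exp (lam * t * (z - 1))"
proof (rule sums_unique2)
  show "(\<lambda>m. (lam * t) ^ m / fact m * exp (- (lam * t)) * (c * z ^ m)) sums prob {\<omega>\<in>space M. \<omega> \<in> F (N t \<omega>)}"
    using poisson_mixture_sums[OF assms(1,2)] unfolding assms(3) .
qed (rule exp_weights_sums)

lemma tail_antimono: "x \<le> y \<Longrightarrow> tail y \<le> tail x"
  unfolding tail_def by (intro finite_measure_mono) auto

lemma tail_nonneg: "0 \<le> tail x" and tail_le_1: "tail x \<le> 1"
  by (simp_all add: tail_def)

definition S :: "'w \<Rightarrow> real" where "S \<omega> = (\<Sum>k<N 1 \<omega>. V k \<omega>)"

text \<open>Values above \<open>y\<close> become 0 and not \<open>y\<close>, so truncation removes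
  the large jumps altogether. Nonpositive values are cut as well, which makes the bounds hold
  everywhere and not just almost surely.\<close>

definition trunc :: "real \<Rightarrow> real \<Rightarrow> real" where "trunc y x = (if 0 < x \<and> x \<le> y then x else 0)"

lemma trunc_measurable [measurable]: "trunc y \<in> borel_measurable borel"
  unfolding trunc_def by measurable

lemma trunc_nonneg: "0 \<le> trunc y x" and trunc_le: "0 \<le> y \<Longrightarrow> trunc y x \<le> y"
  by (auto simp: trunc_def)

text \<open>Thinning: given \<open>m\<close> jumps none exceeds \<open>x\<close> with probability
  \<open>(1 - tail x) ^ m\<close>, and the generating function turns this into an
  exponential.\<close>

lemma prob_exists_gt: "prob {\<omega>\<in>space M. \<exists>k<N 1 \<omega>. x < V k \<omega>} = 1 - exp (- (lam * tail x))"
proof -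
  define F where "F m = {\<omega>\<in>space M. \<forall>k\<in>{..<m}. V k \<omega> \<in> {..x}}" for m
  have F: "F m \<in> sets V_alg" for m
  proof -
    have "{\<omega>\<in>space V_alg. \<forall>k\<in>{..<m}. V k \<omega> \<in> {..x}} \<in> sets V_alg" by measurable
    then show ?thesis by (simp add: F_def)
  qed
  have "prob {\<omega>\<in>space M. V 0 \<omega> \<in> {..x}} = 1 - tail x"
    unfolding tail_def by (subst prob_compl[symmetric]) (auto intro!: arg_cong[of _ _ prob])
  then have "prob (F m) = 1 * (1 - tail x) ^ m" for m
    unfolding F_def by (subst prob_V_all) auto
  from poisson_mixture_eq[OF zero_less_one F this]
  have eq: "prob {\<omega>\<in>space M. \<omega> \<in> F (N 1 \<omega>)} = exp (- (lam * tail x))" by simp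
  have [measurable]: "N 1 \<in> measurable M (count_space UNIV)" by (rule N_measurable) simp
  have m: "{\<omega>\<in>space M. \<omega> \<in> F (N 1 \<omega>)} \<in> events"
  proof -
    have "{\<omega>\<in>space M. \<forall>k<N 1 \<omega>. V k \<omega> \<le> x} \<in> events" by measurable
    also have "{\<omega>\<in>space M. \<forall>k<N 1 \<omega>. V k \<omega> \<le> x} = {\<omega>\<in>space M. \<omega> \<in> F (N 1 \<omega>)}" by (auto simp: F_def)
    finally show ?thesis .
  qed
  have "{\<omega>\<in>space M. \<exists>k<N 1 \<omega>. x < V k \<omega>} = space M - {\<omega>\<in>space M. \<omega> \<in> F (N 1 \<omega>)}"
    unfolding F_def by (intro set_eqI iffI) (force, force)
  then show ?thesis using prob_compl[OF m] eq by simp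
qed

lemma S_measurable [measurable]: "S \<in> borel_measurable M"
proof -
  have [measurable]: "N 1 \<in> measurable M (count_space UNIV)" by (rule N_measurable) simp
  have [measurable]: "(\<lambda>\<omega>. \<Sum>k<m. V k \<omega>) \<in> borel_measurable M" for m by measurable
  show ?thesis unfolding S_def by measurable
qed

text \<open>As all jumps are almost surely positive, one jump above \<open>x\<close> already lifts
  the sum above \<open>x\<close>.\<close>

lemma tail_lower: "1 - exp (- (lam * tail x)) \<le> prob {\<omega>\<in>space M. x < S \<omega>}"
  unfolding prob_exists_gt[symmetric]
proof (rule finite_measure_mono_AE)
  show "AE \<omega> in M. \<omega> \<in> {\<omega>\<in>space M. \<exists>k<N 1 \<omega>. x < V k \<omega>} \<longrightarrow> \<omega> \<in> {\<omega>\<in>space M. x < S \<omega>}"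
    using V_pos
  proof eventually_elim
    case (elim \<omega>)
    have "V k \<omega> \<le> S \<omega>" if "k < N 1 \<omega>" for k
      unfolding S_def using that elim by (intro member_le_sum) (auto simp: less_imp_le)
    then show ?case by fastforce
  qed
qed simp

text \<open>A union bound over pairs. Their number is bounded generously by \<open>4 ^ m\<close> to
  stay geometric, and \<open>4 - 1\<close> is the 3 in the exponent.\<close>

lemma prob_two_gt: "prob {\<omega>\<in>space M. \<exists>i<N 1 \<omega>. \<exists>j<i. x < V i \<omega> \<and> x < V j \<omega>} \<le> (tail x)\<^sup>2 * exp (3 * lam)"
proof -
  define F where "F m = {\<omega>\<in>space M. \<exists>i<m. \<exists>j<i. x < V i \<omega> \<and> x < V j \<omega>}" for m :: nat
  define P where "P m = {(i, j). i < m \<and> j < (i :: nat)}" for m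
  define E where "E p = {\<omega>\<in>space M. \<forall>k\<in>{fst p, snd p}. V k \<omega> \<in> {x<..}}" for p
  have fin: "finite (P m)" for m unfolding P_def by (rule finite_subset[of _ "{..<m} \<times> {..<m}"]) auto
  have Fm: "F m = (\<Union>p\<in>P m. E p)" for m by (auto simp: F_def P_def E_def) blast
  have E: "E p \<in> sets V_alg" for p
  proof -
    have "{\<omega>\<in>space V_alg. \<forall>k\<in>{fst p, snd p}. V k \<omega> \<in> {x<..}} \<in> sets V_alg" by measurable
    then show ?thesis by (simp add: E_def)
  qed
  have F: "F m \<in> sets V_alg" for m unfolding Fm using fin E by auto
  have "prob (F m) \<le> (tail x)\<^sup>2 * 4 ^ m" for m
  proof -
    have Ep: "prob (E p) = (tail x)\<^sup>2" if "p \<in> P m" for p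
    proof -
      have "fst p \<noteq> snd p" using that by (auto simp: P_def)
      then show ?thesis unfolding E_def
        by (subst prob_V_all) (auto simp: tail_def power2_eq_square)
    qed
    have "prob (F m) \<le> (\<Sum>p\<in>P m. prob (E p))"
      unfolding Fm using fin E sets_V_alg_subset by (intro finite_measure_subadditive_finite) auto
    also have "\<dots> = real (card (P m)) * (tail x)\<^sup>2" using Ep by simp
    also have "\<dots> \<le> 4 ^ m * (tail x)\<^sup>2"
    proof (intro mult_right_mono)
      have "card (P m) \<le> card ({..<m} \<times> {..<m})" by (intro card_mono) (auto simp: P_def)
      also have "\<dots> = m * m" by simp
      also have "\<dots> \<le> 2 ^ m * 2 ^ m" by (intro mult_mono) (auto intro: less_imp_le)
      also have "\<dots> = 4 ^ m" by (simp add: power_mult_distrib[symmetric])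
      finally have "real (card (P m)) \<le> real (4 ^ m)" by (rule of_nat_mono)
      then show "real (card (P m)) \<le> 4 ^ m" by simp
    qed simp
    finally show ?thesis by (simp add: mult.commute)
  qed
  from poisson_mixture_le[OF zero_less_one F this] show ?thesis by (simp add: F_def mult.commute)
qed

text \<open>The parameter \<open>ln (1 + y) / y\<close> makes the chord of the exponential over
  \<open>[0, y]\<close> equal to \<open>1 + x\<close>. The exponential moment of a truncated jump is
  thus at most \<open>1 + mu\<close> whatever \<open>y\<close> is, and the decay is polynomial with
  exponent \<open>a / y\<close>.\<close>

lemma prob_trunc_sum_ge:
  assumes int: "integrable M (V 0)" and y: "0 < y" and a: "0 \<le> a"
  shows "prob {\<omega>\<in>space M. a \<le> (\<Sum>k<N 1 \<omega>. trunc y (V k \<omega>))} \<le> (1 + y) powr (- (a / y)) * exp (lam * mu)"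
proof -
  define \<theta> where "\<theta> = ln (1 + y) / y"
  have th: "0 < \<theta>" "\<theta> * y = ln (1 + y)" using y by (auto simp: \<theta>_def)
  define F where "F m = {\<omega>\<in>space M. \<theta> * a \<le> (\<Sum>k<m. \<theta> * trunc y (V k \<omega>))}" for m
  have F: "F m \<in> sets V_alg" for m
  proof -
    have "{\<omega>\<in>space V_alg. \<theta> * a \<le> (\<Sum>k<m. \<theta> * trunc y (V k \<omega>))} \<in> sets V_alg" by measurable
    then show ?thesis by (simp add: F_def)
  qed
  have bd: "\<theta> * trunc y x \<le> \<theta> * y" for x using th y by (intro mult_left_mono trunc_le) auto
  have E: "expectation (\<lambda>\<omega>. exp (\<theta> * trunc y (V 0 \<omega>))) \<le> 1 + mu"
  proof -
    have "expectation (\<lambda>\<omega>. exp (\<theta> * trunc y (V 0 \<omega>))) \<le> expectation (\<lambda>\<omega>. 1 + V 0 \<omega>)"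
    proof (rule integral_mono_AE)
      show "integrable M (\<lambda>\<omega>. exp (\<theta> * trunc y (V 0 \<omega>)))"
        by (rule integrable_exp_bounded[OF _ bd]) measurable
      show "AE \<omega> in M. exp (\<theta> * trunc y (V 0 \<omega>)) \<le> 1 + V 0 \<omega>"
        using V_pos
      proof eventually_elim
        case (elim \<omega>)
        show ?case
        proof (cases "V 0 \<omega> \<le> y")
          case True
          then have "exp (\<theta> * V 0 \<omega>) \<le> 1 + V 0 \<omega> / y * (exp (\<theta> * y) - 1)"
            using elim y by (intro exp_chord) (auto simp: less_imp_le)
          also have "\<dots> = 1 + V 0 \<omega>" using y by (simp add: th)
          finally show ?thesis using True elim by (simp add: trunc_def)
        qed (use elim in \<open>auto simp: trunc_def less_imp_le\<close>)
      qed
    qed (use int in auto)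
    also have "\<dots> = 1 + mu" using int by (simp add: mu_def prob_space)
    finally show ?thesis .
  qed
  have "prob (F m) \<le> exp (- (\<theta> * a)) * (1 + mu) ^ m" for m
  proof -
    have "prob (F m) \<le> exp (- (\<theta> * a)) * expectation (\<lambda>\<omega>. exp (\<theta> * trunc y (V 0 \<omega>))) ^ m"
      unfolding F_def by (rule chernoff[OF _ bd]) measurable
    also have "\<dots> \<le> exp (- (\<theta> * a)) * (1 + mu) ^ m"
      using E by (intro mult_left_mono power_mono) auto
    finally show ?thesis .
  qed
  from poisson_mixture_le[OF zero_less_one F this]
  have "prob {\<omega>\<in>space M. \<omega> \<in> F (N 1 \<omega>)} \<le> exp (- (\<theta> * a)) * exp (lam * mu)" by simp
  also have "{\<omega>\<in>space M. \<omega> \<in> F (N 1 \<omega>)} = {\<omega>\<in>space M. a \<le> (\<Sum>k<N 1 \<omega>. trunc y (V k \<omega>))}"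
    using th by (auto simp: F_def sum_distrib_left[symmetric])
  also have "exp (- (\<theta> * a)) = (1 + y) powr (- (a / y))"
    using y by (simp add: powr_def \<theta>_def mult_ac)
  finally show ?thesis .
qed

text \<open>If no summand exceeds \<open>(1 - e) * x\<close> and at most one exceeds \<open>x / K\<close>, then the summands
  that are at most \<open>x / K\<close> contribute more than \<open>e * x\<close>.\<close>

lemma tail_upper:
  assumes int: "integrable M (V 0)" and x: "0 < x" and K: "1 \<le> K" and e: "0 < e" "e < 1"
  shows "prob {\<omega>\<in>space M. x < S \<omega>} \<le> lam * tail ((1 - e) * x) + (tail (x / K))\<^sup>2 * exp (3 * lam) +
    (1 + x / K) powr (- (e * K)) * exp (lam * mu)"
proof -
  have [measurable]: "N 1 \<in> measurable M (count_space UNIV)" by (rule N_measurable) simp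
  have [measurable]: "(\<lambda>\<omega>. \<Sum>k<m. trunc (x / K) (V k \<omega>)) \<in> borel_measurable M" for m by measurable
  let ?A = "{\<omega>\<in>space M. \<exists>k<N 1 \<omega>. (1 - e) * x < V k \<omega>}"
  let ?B = "{\<omega>\<in>space M. \<exists>i<N 1 \<omega>. \<exists>j<i. x / K < V i \<omega> \<and> x / K < V j \<omega>}"
  let ?C = "{\<omega>\<in>space M. e * x \<le> (\<Sum>k<N 1 \<omega>. trunc (x / K) (V k \<omega>))}"
  have meas: "?A \<in> events" "?B \<in> events" "?C \<in> events" by measurable
  have "prob {\<omega>\<in>space M. x < S \<omega>} \<le> prob (?A \<union> ?B \<union> ?C)"
  proof (rule finite_measure_mono_AE)
    show "AE \<omega> in M. \<omega> \<in> {\<omega>\<in>space M. x < S \<omega>} \<longrightarrow> \<omega> \<in> ?A \<union> ?B \<union> ?C"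
      using V_pos
    proof eventually_elim
      case (elim \<omega>)
      show ?case
      proof (intro impI, rule ccontr)
        assume S: "\<omega> \<in> {\<omega>\<in>space M. x < S \<omega>}" and not: "\<omega> \<notin> ?A \<union> ?B \<union> ?C"
        let ?K = "{..<N 1 \<omega>}"
        have a: "V k \<omega> \<le> (1 - e) * x" if "k < N 1 \<omega>" for k
        proof (rule leI, rule notI)
          assume "(1 - e) * x < V k \<omega>"
          then show False using that S not by blast
        qed
        have b: "\<not> (x / K < V i \<omega> \<and> x / K < V j \<omega>)" if "i < N 1 \<omega>" "j < i" for i j using that S not by blast
        have c: "(\<Sum>k\<in>?K. trunc (x / K) (V k \<omega>)) < e * x"
        proof (rule ccontr)
          assume "\<not> ?thesis"
          then show False using S not by simp
        qed
        have tr: "trunc (x / K) (V k \<omega>) = V k \<omega>" if "V k \<omega> \<le> x / K" for k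
          using that elim by (simp add: trunc_def)
        have "S \<omega> \<le> (1 - e) * x + (\<Sum>k\<in>?K. trunc (x / K) (V k \<omega>))"
        proof (cases "\<exists>k\<in>?K. x / K < V k \<omega>")
          case True
          then obtain i where i: "i \<in> ?K" "x / K < V i \<omega>" by blast
          have "V k \<omega> \<le> x / K" if "k \<in> ?K - {i}" for k
            using b[of i k] b[of k i] i that by (cases k i rule: linorder_cases) auto
          then have "(\<Sum>k\<in>?K - {i}. V k \<omega>) = (\<Sum>k\<in>?K - {i}. trunc (x / K) (V k \<omega>))"
            using tr by (intro sum.cong) auto
          also have "\<dots> \<le> (\<Sum>k\<in>?K. trunc (x / K) (V k \<omega>))"
            by (intro sum_mono2) (auto simp: trunc_nonneg)
          finally show ?thesis using a[of i] i unfolding S_def by (subst sum.remove[of _ i]) auto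
        next
          case False
          then have "S \<omega> = (\<Sum>k\<in>?K. trunc (x / K) (V k \<omega>))"
            unfolding S_def using tr by (intro sum.cong) (auto simp: not_less)
          then show ?thesis using e x by simp
        qed
        also have "\<dots> < (1 - e) * x + e * x" using c by simp
        also have "\<dots> = x" by (simp add: algebra_simps)
        finally show False using S by simp
      qed
    qed
  qed (use meas in auto)
  also have "\<dots> \<le> prob ?A + prob ?B + prob ?C"
    using meas by (intro order.trans[OF measure_Un_le] add_mono measure_Un_le order_refl) auto
  also have "\<dots> \<le> lam * tail ((1 - e) * x) + (tail (x / K))\<^sup>2 * exp (3 * lam) +
      (1 + x / K) powr (- (e * K)) * exp (lam * mu)"
  proof (intro add_mono prob_two_gt)
    show "prob ?A \<le> lam * tail ((1 - e) * x)"
      unfolding prob_exists_gt using exp_ge_add_one_self[of "- (lam * tail ((1 - e) * x))"] by simp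
    \<comment> \<open>Truncating at \<open>x / K\<close> and asking for \<open>e * x\<close> gives
      the exponent \<open>e * K\<close>, which can be made as large as desired.\<close>
    have "prob ?C \<le> (1 + x / K) powr (- (e * x / (x / K))) * exp (lam * mu)"
      using x K e by (intro prob_trunc_sum_ge int) auto
    also have "e * x / (x / K) = e * K" using x K by simp
    finally show "prob ?C \<le> (1 + x / K) powr (- (e * K)) * exp (lam * mu)" .
  qed
  finally show ?thesis .
qed

lemma sum_W_eq_V: "(\<Sum>k=1..m. f (W k \<omega>)) = (\<Sum>k<m. f (V k \<omega>))"
  by (simp add: V_def sum.atLeast1_atMost_eq)

lemma expectation_W: "(\<integral>\<omega>. W 1 \<omega> \<partial>M) = mu"
  by (simp add: mu_def V_def)

lemma mu_nonneg: "0 \<le> mu"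
  unfolding mu_def using V_pos by (intro integral_nonneg_AE) (auto elim!: eventually_mono intro: less_imp_le)

end

lemma le_suminf_ennreal: "(f :: nat \<Rightarrow> ennreal) j \<le> (\<Sum>j. f j)"
  using sum_le_suminf[of f "{j}"] by simp

lemma one_minus_exp_lower: "0 \<le> z \<Longrightarrow> z / (1 + z) \<le> 1 - exp (- z :: real)"
  using exp_ge_add_one_self[of z] by (simp add: exp_minus field_simps)

lemma powr_near_1:
  assumes "l < (1 :: real)"
  obtains e where "0 < e" "e < 1" "l < (1 - e) powr p"
proof -
  have "((\<lambda>e. (1 - e) powr p) \<longlongrightarrow> (1 - 0) powr p) (at_right 0)"
    by (intro tendsto_intros) auto
  then have "eventually (\<lambda>e. l < (1 - e) powr p) (at_right 0)"
    using assms by (auto dest: order_tendstoD(1))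
  moreover have "eventually (\<lambda>e. e \<in> {0<..<1::real}) (at_right 0)"
    by (intro eventually_at_rightI[of 0 1]) auto
  ultimately have "eventually (\<lambda>e. l < (1 - e) powr p \<and> e \<in> {0<..<1}) (at_right 0)"
    by (rule eventually_conj)
  then show thesis using that eventually_happens[of _ "at_right (0::real)"] by auto
qed

section \<open>Transfer of regular variation from the process to its jumps\<close>

locale heavy_tailed = compound_poisson +
  fixes \<beta> :: real
  assumes beta: "1 < \<beta>"
    and rv: "regularly_varying (\<lambda>x. measure M {\<omega>\<in>space M. compensated_cp M lam N W 1 \<omega> > x}) (- \<beta>)"
begin

definition G :: "real \<Rightarrow> real" where "G x = prob {\<omega>\<in>space M. compensated_cp M lam N W 1 \<omega> > x}"

lemma prob_S_gt: "prob {\<omega>\<in>space M. x < S \<omega>} = G (x - lam * mu)"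
  unfolding G_def compensated_cp_def expectation_W S_def sum_W_eq_V[of "\<lambda>x. x"]
  by (intro arg_cong[of _ _ prob]) auto

lemma G_antimono: "x \<le> y \<Longrightarrow> G y \<le> G x"
proof -
  assume "x \<le> y"
  have "G t = prob {\<omega>\<in>space M. t + lam * mu < S \<omega>}" for t using prob_S_gt[of "t + lam * mu"] by simp
  then show ?thesis using \<open>x \<le> y\<close> by (auto intro!: finite_measure_mono)
qed

lemma G_nonneg: "0 \<le> G x"
  by (simp add: G_def)

lemma G_pos: "eventually (\<lambda>x. 0 < G x) at_top"
  using rv by (simp add: regularly_varying_def G_def)

lemma G_lim: "0 < a \<Longrightarrow> ((\<lambda>x. G (a * x) / G x) \<longlongrightarrow> a powr - \<beta>) at_top"
  using rv by (simp add: regularly_varying_def G_def)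

text \<open>Combines \<open>1 - exp (- z) \<ge> z / (1 + z)\<close> with the bound by a single big
  jump. The factor \<open>1 + lam * tail x\<close> tends to 1, so this is already sharp to first
  order.\<close>

lemma tail_le_shift: "lam * tail x \<le> (1 + lam * tail x) * G (x - lam * mu)"
proof -
  have z: "0 \<le> lam * tail x" using lam tail_nonneg by simp
  have "lam * tail x / (1 + lam * tail x) \<le> G (x - lam * mu)"
    using one_minus_exp_lower[OF z] tail_lower[of x] unfolding prob_S_gt by linarith
  then show ?thesis using z by (simp add: pos_divide_le_eq mult.commute)
qed

lemma tail_le_G: "2 * (lam * mu) \<le> x \<Longrightarrow> 0 \<le> x \<Longrightarrow> tail x \<le> (1 + lam) / lam * G (x / 2)"
proof -
  assume x: "2 * (lam * mu) \<le> x" "0 \<le> x"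
  have "lam * tail x \<le> (1 + lam * tail x) * G (x - lam * mu)" by (rule tail_le_shift)
  also have "\<dots> \<le> (1 + lam) * G (x / 2)"
    using x lam tail_le_1[of x] by (intro mult_mono G_antimono) (auto simp: G_nonneg)
  finally show ?thesis using lam by (simp add: field_simps)
qed

text \<open>Obtained from the crude comparison \<open>tail_le_G\<close> and not from regular
  variation of \<open>tail\<close>: the latter is derived by means of the integrability that this
  bound provides.\<close>

lemma tail_poly_upper:
  assumes p: "0 \<le> p" "p < \<beta>"
  obtains C where "0 < C" "eventually (\<lambda>x. tail x \<le> C * x powr - p) at_top"
proof -
  obtain C where C: "0 < C" "eventually (\<lambda>x. G x \<le> C * x powr - p) at_top"
    using doubling_upper[OF G_antimono G_nonneg G_pos G_lim[of 2] p] by auto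
  have "eventually (\<lambda>x. G (1 / 2 * x) \<le> C * (1 / 2 * x) powr - p) at_top"
    by (rule eventually_compose_filterlim[OF C(2)]) real_asymp
  then have "eventually (\<lambda>x. tail x \<le> ((1 + lam) / lam * C * (1 / 2) powr - p) * x powr - p) at_top"
    using eventually_ge_at_top[of "max 0 (2 * (lam * mu))"]
  proof eventually_elim
    case (elim x)
    have "tail x \<le> (1 + lam) / lam * G (x / 2)" using elim by (intro tail_le_G) auto
    also have "\<dots> \<le> (1 + lam) / lam * (C * (1 / 2 * x) powr - p)"
      using elim lam by (intro mult_left_mono) auto
    also have "(1 / 2 * x) powr - p = (1 / 2) powr - p * x powr - p" using elim by (intro powr_mult)
    finally show ?case by (simp only: mult_ac)
  qed
  moreover have "0 < (1 + lam) / lam * C * (1 / 2) powr - p" using C lam by simp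
  ultimately show thesis using that by blast
qed

text \<open>Summation over dyadic shells; the polynomial tail bound makes the terms
  geometric.\<close>

lemma moment:
  assumes p: "0 \<le> p" "p < \<beta>"
  shows "integrable M (\<lambda>\<omega>. (1 + V 0 \<omega>) powr p)"
proof -
  \<comment> \<open>Strictly between \<open>p\<close> and \<open>\<beta>\<close>, so that
    \<open>2 powr (p - q)\<close> is a convergent geometric ratio.\<close>
  define q where "q = (p + \<beta>) / 2"
  have q: "0 \<le> q" "p < q" "q < \<beta>" using p by (auto simp: q_def)
  obtain C where C: "0 < C" "eventually (\<lambda>x. tail x \<le> C * x powr - q) at_top"
    using tail_poly_upper[OF q(1,3)] .
  \<comment> \<open>Contribution of the shell with \<open>V 0\<close> between \<open>2 ^ j\<close>
    and \<open>2 ^ (j + 1)\<close>, on which \<open>1 + V 0\<close> is at most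
    \<open>2 ^ (j + 2)\<close>.\<close>
  define a where "a j = 2 powr (real (j + 2) * p) * tail (2 ^ j)" for j :: nat
  have a0: "0 \<le> a j" for j by (simp add: a_def tail_nonneg)
  have "summable a"
  proof (rule summable_comparison_test_ev)
    have "filterlim (\<lambda>j::nat. (2::real) ^ j) at_top sequentially" by real_asymp
    from eventually_compose_filterlim[OF C(2) this]
    show "eventually (\<lambda>j. norm (a j) \<le> 4 powr p * C * (2 powr (p - q)) ^ j) sequentially"
    proof eventually_elim
      case (elim j)
      have "a j \<le> 2 powr (real (j + 2) * p) * (C * (2 ^ j) powr - q)"
        unfolding a_def using elim by (intro mult_left_mono) auto
      also have "\<dots> = 4 powr p * C * (2 powr (p - q)) ^ j"
      proof -
        have "(4::real) powr p = 2 powr (2 * p)" using powr_powr[of 2 2 p] by simp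
        then show ?thesis
          by (simp add: powr_realpow[symmetric] powr_powr powr_add[symmetric] algebra_simps)
      qed
      finally show ?case using a0 by simp
    qed
    have "2 powr (p - q) < (1 :: real)" using q powr_less_mono[of "p - q" 0 2] by simp
    then show "summable (\<lambda>j. 4 powr p * C * (2 powr (p - q)) ^ j)"
      by (intro summable_mult summable_geometric) auto
  qed
  then have fin: "(\<Sum>j. ennreal (a j)) \<noteq> top" using a0 by (intro ennreal_suminf_neq_top)
  have "(\<integral>\<^sup>+\<omega>. ennreal (norm ((1 + V 0 \<omega>) powr p)) \<partial>M) \<le>
      (\<integral>\<^sup>+\<omega>. ennreal (2 powr p) + (\<Sum>j. ennreal (2 powr (real (j + 2) * p)) * indicator {\<omega>\<in>space M. 2 ^ j < V 0 \<omega>} \<omega>) \<partial>M)"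
  proof (rule nn_integral_mono_AE)
    show "AE \<omega> in M. ennreal (norm ((1 + V 0 \<omega>) powr p)) \<le>
        ennreal (2 powr p) + (\<Sum>j. ennreal (2 powr (real (j + 2) * p)) * indicator {\<omega>\<in>space M. 2 ^ j < V 0 \<omega>} \<omega>)"
      using V_pos AE_space
    proof eventually_elim
      case (elim \<omega>)
      let ?s = "\<lambda>j. ennreal (2 powr (real (j + 2) * p)) * indicator {\<omega>\<in>space M. 2 ^ j < V 0 \<omega>} \<omega>"
      show ?case
      proof (cases "V 0 \<omega> \<le> 1")
        case True
        have "0 < V 0 \<omega>" using elim(1) by blast
        then have "(1 + V 0 \<omega>) powr p \<le> 2 powr p" using True p by (intro powr_mono2) auto
        then have "ennreal (norm ((1 + V 0 \<omega>) powr p)) \<le> ennreal (2 powr p)"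
          by (intro ennreal_leI) simp
        then show ?thesis by (rule order.trans) simp
      next
        case False
        define j where "j = nat (\<lceil>log 2 (V 0 \<omega>)\<rceil> - 1)"
        have c: "0 < \<lceil>log 2 (V 0 \<omega>)\<rceil>" using False by simp
        then have j: "real j < log 2 (V 0 \<omega>)" "log 2 (V 0 \<omega>) \<le> real j + 1"
          unfolding j_def by linarith+
        have v: "2 ^ j < V 0 \<omega>" "V 0 \<omega> \<le> 2 * 2 ^ j"
          using j False by (auto simp: less_log_iff log_le_iff powr_realpow powr_add)
        have "1 \<le> (2 :: real) ^ j" by simp
        moreover have "2 ^ (j + 2) = 4 * (2 :: real) ^ j" by (simp add: power_add)
        ultimately have "1 + V 0 \<omega> \<le> 2 ^ (j + 2)" using v by linarith
        then have "(1 + V 0 \<omega>) powr p \<le> (2 ^ (j + 2)) powr p"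
          using p False by (intro powr_mono2) auto
        also have "\<dots> = 2 powr (real (j + 2) * p)" unfolding powr_powr[symmetric] by (subst powr_realpow) auto
        finally have "ennreal (norm ((1 + V 0 \<omega>) powr p)) \<le> ?s j" using v elim by (simp add: ennreal_leI)
        also have "\<dots> \<le> (\<Sum>j. ?s j)" by (rule le_suminf_ennreal[of ?s])
        finally show ?thesis by (rule order.trans) simp
      qed
    qed
  qed
  also have "\<dots> = ennreal (2 powr p) + (\<Sum>j. ennreal (a j))"
  proof -
    have "(\<integral>\<^sup>+\<omega>. ennreal (2 powr (real (j + 2) * p)) * indicator {\<omega>\<in>space M. 2 ^ j < V 0 \<omega>} \<omega> \<partial>M) = ennreal (a j)" for j :: nat
      by (subst nn_integral_cmult_indicator)
         (auto simp: a_def tail_def emeasure_eq_measure ennreal_mult)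
    then show ?thesis
      by (subst nn_integral_add) (auto simp: nn_integral_suminf emeasure_space_1)
  qed
  also have "\<dots> < top" using fin by (simp add: less_top)
  finally show ?thesis by (intro integrableI_bounded) auto
qed

lemma integrable_V: "integrable M (V 0)"
proof (rule Bochner_Integration.integrable_bound[OF moment[of 1]])
  show "AE \<omega> in M. norm (V 0 \<omega>) \<le> norm ((1 + V 0 \<omega>) powr 1)"
    using V_pos by eventually_elim (auto simp: less_imp_le add_nonneg_pos)
qed (use beta in auto)

lemma tail_tendsto_0: "(tail \<longlongrightarrow> 0) at_top"
proof -
  obtain C where C: "0 < C" "eventually (\<lambda>x. tail x \<le> C * x powr - 1) at_top"
    using tail_poly_upper[of 1] beta by auto
  show ?thesis
  proof (rule tendsto_sandwich[OF _ C(2) tendsto_const])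
    show "((\<lambda>x. C * x powr - 1) \<longlongrightarrow> 0) at_top" by real_asymp
  qed (simp add: tail_nonneg)
qed

text \<open>A fixed shift is eventually swallowed by a factor \<open>1 - e\<close> of the argument,
  whose effect tends to 1 as \<open>e\<close> does to 0.\<close>

lemma G_shift: "((\<lambda>x. G (x - c) / G x) \<longlongrightarrow> 1) at_top" if c: "0 \<le> c"
proof (rule order_tendstoI)
  fix u :: real assume u: "u < 1"
  show "eventually (\<lambda>x. u < G (x - c) / G x) at_top"
    using G_pos
  proof eventually_elim
    case (elim x)
    have "G x \<le> G (x - c)" using c by (intro G_antimono) simp
    then have "1 \<le> G (x - c) / G x" using elim by simp
    then show ?case using u by simp
  qed
next
  fix u :: real assume u: "1 < u"
  then have "1 / u < 1" by simp
  then obtain e where e: "0 < e" "e < 1" "1 / u < (1 - e) powr \<beta>"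
    using powr_near_1 by blast
  then have "(1 - e) powr - \<beta> < u" using u by (simp add: powr_minus field_simps)
  with e have "eventually (\<lambda>x. G ((1 - e) * x) / G x < u) at_top"
    by (intro order_tendstoD(2)[OF G_lim]) auto
  moreover have "eventually (\<lambda>x. (1 - e) * x \<le> x - c) at_top" using e(1) by real_asymp
  ultimately show "eventually (\<lambda>x. G (x - c) / G x < u) at_top" using G_pos
  proof eventually_elim
    case (elim x)
    have "G (x - c) / G x \<le> G ((1 - e) * x) / G x"
      using elim by (intro divide_right_mono G_antimono) auto
    then show ?case using elim by simp
  qed
qed

text \<open>A large sum is due to a single large jump. The upper bound is
  \<open>tail_le_shift\<close> with \<open>G_shift\<close>. For the lower bound
  \<open>tail_upper\<close> is applied at \<open>x / (1 - e)\<close>: its main term is then exactly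
  \<open>lam * tail x\<close>, and the two remaining terms are negligible against
  \<open>G x\<close>.\<close>

lemma tail_equiv: "((\<lambda>x. lam * tail x / G x) \<longlongrightarrow> 1) at_top"
proof (rule order_tendstoI)
  fix u :: real assume u: "1 < u"
  have "((\<lambda>x. (1 + lam * tail x) * (G (x - lam * mu) / G x)) \<longlongrightarrow> (1 + lam * 0) * 1) at_top"
    using lam mu_nonneg by (intro tendsto_intros tail_tendsto_0 G_shift) auto
  then have "eventually (\<lambda>x. (1 + lam * tail x) * (G (x - lam * mu) / G x) < u) at_top"
    using u by (auto dest: order_tendstoD(2))
  then show "eventually (\<lambda>x. lam * tail x / G x < u) at_top"
    using G_pos
  proof eventually_elim
    case (elim x)
    then show ?case using divide_right_mono[OF tail_le_shift[of x], of "G x"] by simp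
  qed
next
  fix l :: real assume "l < 1"
  then obtain e where e: "0 < e" "e < 1" "l < (1 - e) powr \<beta>" using powr_near_1 by blast
  \<comment> \<open>Makes the exponent \<open>e * K\<close> of the truncated sum at least
    \<open>\<beta> + 1\<close>, beyond the decay \<open>\<beta> + 1 / 2\<close> allowed to
    \<open>G\<close>.\<close>
  define K where "K = max 1 ((\<beta> + 1) / e)"
  have K: "1 \<le> K" "\<beta> + 1 \<le> e * K" using e by (auto simp: K_def field_simps max_def)
  define a where "a = 1 / (1 - e)"
  \<comment> \<open>\<open>b * x\<close> is the level \<open>a * x / K\<close> halved, since
    \<open>tail_le_G\<close> evaluates \<open>G\<close> at half the argument.\<close>
  define b where "b = a / (2 * K)"
  have ab: "0 < a" "0 < b" "1 \<le> a" using e K by (auto simp: a_def b_def)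
  obtain c where c: "0 < c" "eventually (\<lambda>x. c * x powr - (\<beta> + 1 / 2) \<le> G x) at_top"
    using doubling_lower[OF G_antimono G_pos G_lim[of 2], of "\<beta> + 1 / 2"] beta by auto
  define K1 where "K1 = (1 + lam) / lam"
  \<comment> \<open>Lower bound for \<open>lam * tail x / G x\<close>. The square of the two-jump
    term leaves a spare factor \<open>G (b * x)\<close> that tends to 0, so \<open>f\<close> tends
    to \<open>(1 - e) powr \<beta>\<close>, which exceeds \<open>l\<close>.\<close>
  define f where "f x = G (a * x) / G x - (K1\<^sup>2 * exp (3 * lam) * (G (b * x) * (G (b * x) / G x)) +
      exp (lam * mu) * (2 * b) powr - (\<beta> + 1) / c * x powr - (1 / 2))" for x
  have Gb: "((\<lambda>x. G (b * x)) \<longlongrightarrow> 0) at_top"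
  proof -
    obtain C where C: "0 < C" "eventually (\<lambda>x. G x \<le> C * x powr - 1) at_top"
      using doubling_upper[OF G_antimono G_nonneg G_pos G_lim[of 2], of 1] beta by auto
    have "(G \<longlongrightarrow> 0) at_top"
    proof (rule tendsto_sandwich[OF _ C(2) tendsto_const])
      show "((\<lambda>x. C * x powr - 1) \<longlongrightarrow> 0) at_top" by real_asymp
    qed (simp add: G_nonneg)
    moreover have "filterlim (\<lambda>x. b * x) at_top at_top" using ab by real_asymp
    ultimately show ?thesis by (rule filterlim_compose)
  qed
  have xh: "((\<lambda>x. x powr - (1 / 2)) \<longlongrightarrow> (0 :: real)) at_top" by real_asymp
  have "(f \<longlongrightarrow> a powr - \<beta> - (K1\<^sup>2 * exp (3 * lam) * (0 * b powr - \<beta>) +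
      exp (lam * mu) * (2 * b) powr - (\<beta> + 1) / c * 0)) at_top"
    unfolding f_def using ab by (intro tendsto_intros G_lim Gb xh) auto
  moreover have "a powr - \<beta> = (1 - e) powr \<beta>"
    using e by (simp add: a_def powr_minus powr_divide)
  ultimately have "eventually (\<lambda>x. l < f x) at_top"
    using e(3) by (auto dest: order_tendstoD(1))
  moreover have "eventually (\<lambda>x. 2 * (lam * mu) \<le> a * x / K) at_top"
    using eventually_ge_at_top[of "2 * (lam * mu) * K / a"]
    by eventually_elim (use ab K in \<open>simp add: field_simps\<close>)
  ultimately show "eventually (\<lambda>x. l < lam * tail x / G x) at_top"
    using c(2) G_pos eventually_gt_at_top[of 0]
  proof eventually_elim
    case (elim x)
    have ax: "0 < a * x" "(1 - e) * (a * x) = x" using ab elim e by (auto simp: a_def)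
    have "G (a * x) \<le> G (a * x - lam * mu)" using lam mu_nonneg by (intro G_antimono) simp
    also have "\<dots> \<le> lam * tail x + (tail (a * x / K))\<^sup>2 * exp (3 * lam) +
        (1 + a * x / K) powr (- (e * K)) * exp (lam * mu)"
      using tail_upper[OF integrable_V ax(1) K(1) e(1,2)] unfolding ax(2) prob_S_gt .
    also have "\<dots> \<le> lam * tail x + (K1 * G (b * x))\<^sup>2 * exp (3 * lam) +
        (2 * b) powr - (\<beta> + 1) * x powr - (\<beta> + 1) * exp (lam * mu)"
    proof (intro add_mono mult_right_mono power_mono order_refl)
      have "tail (a * x / K) \<le> K1 * G (a * x / K / 2)"
        unfolding K1_def using elim ax K by (intro tail_le_G) auto
      then show "tail (a * x / K) \<le> K1 * G (b * x)" by (simp add: b_def mult_ac)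
      have axK: "0 < a * x / K" using ax K by simp
      have "(1 + a * x / K) powr (- (e * K)) \<le> (1 + a * x / K) powr (- (\<beta> + 1))"
        using K axK by (intro powr_mono) auto
      also have "\<dots> \<le> (a * x / K) powr (- (\<beta> + 1))"
        using axK beta by (intro powr_mono2') auto
      also have "(a * x / K) powr (- (\<beta> + 1)) = (2 * b * x) powr (- (\<beta> + 1))" using K by (simp add: b_def)
      also have "(2 * b * x) powr (- (\<beta> + 1)) = (2 * b) powr - (\<beta> + 1) * x powr - (\<beta> + 1)"
        using ab elim by (intro powr_mult)
      finally show "(1 + a * x / K) powr (- (e * K)) \<le> (2 * b) powr - (\<beta> + 1) * x powr - (\<beta> + 1)" .
    qed (auto simp: tail_nonneg)
    finally have "G (a * x) / G x \<le> (lam * tail x + (K1 * G (b * x))\<^sup>2 * exp (3 * lam) +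
        (2 * b) powr - (\<beta> + 1) * x powr - (\<beta> + 1) * exp (lam * mu)) / G x"
      using elim by (intro divide_right_mono) auto
    also have "\<dots> = lam * tail x / G x + K1\<^sup>2 * exp (3 * lam) * (G (b * x) * (G (b * x) / G x)) +
        exp (lam * mu) * (2 * b) powr - (\<beta> + 1) * (x powr - (\<beta> + 1) / G x)"
      by (simp add: add_divide_distrib power2_eq_square mult_ac)
    also have "\<dots> \<le> lam * tail x / G x + K1\<^sup>2 * exp (3 * lam) * (G (b * x) * (G (b * x) / G x)) +
        exp (lam * mu) * (2 * b) powr - (\<beta> + 1) * (x powr - (1 / 2) / c)"
    proof (intro add_left_mono mult_left_mono)
      have "x powr - (\<beta> + 1) * c = x powr - (1 / 2) * (c * x powr - (\<beta> + 1 / 2))"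
      proof -
        have "x powr - (\<beta> + 1) = x powr - (1 / 2) * x powr - (\<beta> + 1 / 2)"
          unfolding powr_add[symmetric] by (rule arg_cong[where f="\<lambda>z. x powr z"]) simp
        then show ?thesis by (simp only: mult_ac)
      qed
      also have "\<dots> \<le> x powr - (1 / 2) * G x" using elim by (intro mult_left_mono) auto
      finally show "x powr - (\<beta> + 1) / G x \<le> x powr - (1 / 2) / c"
        using elim c(1) by (simp add: field_simps)
    qed auto
    finally show ?case using elim(1) unfolding f_def by simp
  qed
qed

lemma tail_pos: "eventually (\<lambda>x. 0 < tail x) at_top"
proof -
  have "eventually (\<lambda>x. 1 / 2 < lam * tail x / G x) at_top"
    by (rule order_tendstoD(1)[OF tail_equiv]) simp
  then show ?thesis
  proof eventually_elim
    case (elim x)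
    show ?case
    proof (rule ccontr)
      assume "\<not> 0 < tail x"
      then have "tail x = 0" using tail_nonneg[of x] by simp
      then show False using elim by simp
    qed
  qed
qed

lemma tail_lim:
  assumes a: "0 < a"
  shows "((\<lambda>x. tail (a * x) / tail x) \<longlongrightarrow> a powr - \<beta>) at_top"
proof -
  have ax: "filterlim (\<lambda>x. a * x) at_top at_top" using a by real_asymp
  have "((\<lambda>x. (lam * tail (a * x) / G (a * x)) * (G (a * x) / G x) / (lam * tail x / G x)) \<longlongrightarrow>
      1 * a powr - \<beta> / 1) at_top"
    by (intro tendsto_intros tail_equiv G_lim a filterlim_compose[OF tail_equiv ax]) auto
  moreover have "eventually (\<lambda>x. (lam * tail (a * x) / G (a * x)) * (G (a * x) / G x) / (lam * tail x / G x) =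
      tail (a * x) / tail x) at_top"
    using G_pos eventually_compose_filterlim[OF G_pos ax] by eventually_elim (use lam in simp)
  ultimately show ?thesis by (simp add: tendsto_cong)
qed

lemma tail_poly_lower:
  assumes "\<beta> < p"
  obtains c where "0 < c" "eventually (\<lambda>x. c * x powr - p \<le> tail x) at_top"
  using doubling_lower[OF tail_antimono tail_pos tail_lim[of 2] _ assms] assms beta by auto

end

section \<open>Deviation bounds\<close>

lemma abs_exp_minus_one_le:
  fixes s x :: real
  assumes s: "s = 1 \<or> s = -1" and x: "0 \<le> x"
  shows "\<bar>exp (s * x) - 1\<bar> \<le> x * exp x"
proof -
  have 1: "1 - exp (- x) \<le> x" using exp_ge_add_one_self[of "- x"] by simp
  have "(1 - exp (- x)) * exp x \<le> x * exp x" using 1 by (intro mult_right_mono) auto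
  then have 2: "exp x - 1 \<le> x * exp x" by (simp add: algebra_simps exp_minus_inverse)
  have 3: "x * 1 \<le> x * exp x" using x by (intro mult_left_mono) auto
  show ?thesis using s 1 2 3 x by auto
qed

lemma le_abs_iff_signs: "(a :: real) \<le> \<bar>x\<bar> \<longleftrightarrow> a \<le> 1 * x \<or> a \<le> (-1) * x"
  by auto

context heavy_tailed
begin

text \<open>Dominated convergence for a derivative at 0. The truncation keeps
  \<open>exp (\<theta> n * v)\<close> below a constant times \<open>(1 + v) powr (r * g)\<close>, so
  a moment of order \<open>1 + r * g\<close> dominates; this is where a large \<open>r\<close>
  forces a small truncation level \<open>g\<close>.\<close>

lemma exp_moment_tendsto:
  assumes r: "0 < r" and g: "0 < g" "1 + r * g < \<beta>" and s: "s = 1 \<or> s = -1"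
  shows "(\<lambda>n. expectation (\<lambda>\<omega>. (exp (s * (r * ln (real n) / real n) * trunc (g * real n) (V 0 \<omega>)) - 1) / (r * ln (real n) / real n)))
    \<longlonglongrightarrow> s * mu"
proof -
  define \<theta> where "\<theta> n = r * ln (real n) / real n" for n
  define f where "f n \<omega> = (exp (s * \<theta> n * trunc (g * real n) (V 0 \<omega>)) - 1) / \<theta> n" for n \<omega>
  have th0: "\<theta> \<longlonglongrightarrow> 0" unfolding \<theta>_def using r by real_asymp
  have thpos: "0 < \<theta> n" if "2 \<le> n" for n using that r by (simp add: \<theta>_def)
  have th_at: "filterlim \<theta> (at 0) sequentially"
    unfolding filterlim_at
  proof (intro conjI th0)
    show "eventually (\<lambda>n. \<theta> n \<in> UNIV \<and> \<theta> n \<noteq> 0) sequentially"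
      using eventually_ge_at_top[of 2] by eventually_elim (use thpos in force)
  qed
  \<comment> \<open>For \<open>n\<close> at most 1 the parameter is 0 and division by zero makes the
    quotient vanish, so the domination holds for every \<open>n\<close>.\<close>
  have th_small: "\<theta> n = 0" if "\<not> 2 \<le> n" for n
  proof -
    have "n = 0 \<or> n = 1" using that by linarith
    then show ?thesis by (auto simp: \<theta>_def)
  qed
  have "(\<lambda>n. expectation (f n)) \<longlonglongrightarrow> expectation (\<lambda>\<omega>. s * V 0 \<omega>)"
  proof (rule integral_dominated_convergence[where w="\<lambda>\<omega>. exp r * (1 + V 0 \<omega>) powr (1 + r * g)"])
    show "integrable M (\<lambda>\<omega>. exp r * (1 + V 0 \<omega>) powr (1 + r * g))"
      using r g by (intro integrable_mult_right moment) auto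
    show "AE \<omega> in M. (\<lambda>n. f n \<omega>) \<longlonglongrightarrow> s * V 0 \<omega>"
      using V_pos
    proof eventually_elim
      case (elim \<omega>)
      let ?v = "V 0 \<omega>"
      have v: "0 < ?v" using elim by blast
      have "((\<lambda>x. exp (s * x * ?v)) has_field_derivative (s * ?v)) (at 0)"
        by (auto intro!: derivative_eq_intros)
      then have "((\<lambda>x. (exp (s * x * ?v) - 1) / x) \<longlongrightarrow> s * ?v) (at 0)"
        by (simp add: has_field_derivative_iff)
      from filterlim_compose[OF this th_at]
      have lim: "(\<lambda>n. (exp (s * \<theta> n * ?v) - 1) / \<theta> n) \<longlonglongrightarrow> s * ?v" .
      have "filterlim (\<lambda>n. g * real n) at_top sequentially" using g(1) by real_asymp
      then have "eventually (\<lambda>n. ?v \<le> g * real n) sequentially" by (simp add: filterlim_at_top)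
      then have "eventually (\<lambda>n. (exp (s * \<theta> n * ?v) - 1) / \<theta> n = f n \<omega>) sequentially"
        by eventually_elim (use v in \<open>simp add: f_def trunc_def\<close>)
      then show ?case using lim by (rule Lim_transform_eventually[rotated])
    qed
    show "AE \<omega> in M. norm (f n \<omega>) \<le> exp r * (1 + V 0 \<omega>) powr (1 + r * g)" for n
      using V_pos
    proof eventually_elim
      case (elim \<omega>)
      define v where "v = V 0 \<omega>"
      have v: "0 < v" using elim by (simp add: v_def)
      show ?case
      proof (cases "2 \<le> n \<and> v \<le> g * real n")
        case False
        then have "f n \<omega> = 0" using th_small v by (auto simp: f_def trunc_def v_def)
        then show ?thesis by simp
      next
        case True
        then have n: "0 < real n" and th: "0 < \<theta> n" using thpos by auto
        \<comment> \<open>Writing \<open>ln n\<close> as \<open>ln (n / v) + ln v\<close> leaves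
          \<open>x * ln (1 / x)\<close> at \<open>x = v / n\<close>, which is bounded, and
          \<open>ln v\<close> with a factor at most \<open>g\<close>.\<close>
        have ln_le: "v / real n * ln (real n / v) \<le> 1"
        proof -
          have "ln (real n / v) \<le> real n / v - 1" using n v by (intro ln_le_minus_one) simp
          then have "v / real n * ln (real n / v) \<le> v / real n * (real n / v)"
            using n v by (intro mult_left_mono) auto
          then show ?thesis using n v by simp
        qed
        have "ln (real n) = ln (real n / v) + ln v" using n v by (simp add: ln_div)
        then have "\<theta> n * v = r * (v / real n * ln (real n / v) + v / real n * ln v)"
          by (simp add: \<theta>_def algebra_simps add_divide_distrib)
        also have "\<dots> \<le> r * (1 + g * ln (1 + v))"
        proof (intro mult_left_mono add_mono ln_le)
          have "v / real n * ln v \<le> v / real n * ln (1 + v)" using n v by (intro mult_left_mono) auto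
          also have "\<dots> \<le> g * ln (1 + v)" using True n v by (intro mult_right_mono) (auto simp: field_simps)
          finally show "v / real n * ln v \<le> g * ln (1 + v)" .
        qed (use r in auto)
        finally have "exp (\<theta> n * v) \<le> exp (r * (1 + g * ln (1 + v)))" by simp
        also have "\<dots> = exp r * (1 + v) powr (r * g)"
          using v by (simp add: powr_def algebra_simps exp_add)
        finally have e: "exp (\<theta> n * v) \<le> exp r * (1 + v) powr (r * g)" .
        have "norm (f n \<omega>) = \<bar>exp (s * (\<theta> n * v)) - 1\<bar> / \<theta> n"
          using True v th by (simp add: f_def trunc_def v_def mult_ac)
        also have "\<dots> \<le> (\<theta> n * v * exp (\<theta> n * v)) / \<theta> n"
          using th v by (intro divide_right_mono abs_exp_minus_one_le s) auto
        also have "\<dots> = v * exp (\<theta> n * v)" using th by simp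
        also have "\<dots> \<le> (1 + v) * (exp r * (1 + v) powr (r * g))" using v e by (intro mult_mono) auto
        also have "\<dots> = exp r * (1 + v) powr (1 + r * g)" using v by (simp add: powr_add)
        finally show ?thesis by (simp add: v_def)
      qed
    qed
  qed (unfold f_def, measurable)
  then show ?thesis by (simp add: f_def[abs_def] \<theta>_def mu_def)
qed

text \<open>Chernoff with parameter \<open>r * ln n / n\<close>. The error of the exponential mean,
  accumulated over at most \<open>C * n\<close> summands, uses half of \<open>d\<close>; the other
  half gives the power \<open>r * d / 2\<close>, uniformly in \<open>m\<close>.\<close>

lemma trunc_sum_deviation:
  assumes r: "0 < r" and g: "0 < g" "1 + r * g < \<beta>" and s: "s = 1 \<or> s = -1" and d: "0 < d" and C: "0 < C"
  shows "eventually (\<lambda>n. \<forall>m. real m \<le> C * real n \<longrightarrow>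
    prob {\<omega>\<in>space M. d * real n \<le> s * ((\<Sum>k<m. trunc (g * real n) (V k \<omega>)) - real m * mu)} \<le> real n powr - (r * d / 2)) sequentially"
proof -
  define \<theta> where "\<theta> n = r * ln (real n) / real n" for n
  define h where "h n = expectation (\<lambda>\<omega>. (exp (s * \<theta> n * trunc (g * real n) (V 0 \<omega>)) - 1) / \<theta> n)" for n
  have "h \<longlonglongrightarrow> s * mu" unfolding h_def \<theta>_def by (rule exp_moment_tendsto[OF r g s])
  then have "eventually (\<lambda>n. dist (h n) (s * mu) < d / (2 * C)) sequentially"
    using d C by (intro tendstoD) auto
  then show ?thesis using eventually_ge_at_top[of 2]
  proof eventually_elim
    case (elim n)
    then have n: "0 < real n" and th: "0 < \<theta> n" using r by (auto simp: \<theta>_def)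
    define f where "f x = s * \<theta> n * trunc (g * real n) x" for x
    have bd: "f x \<le> \<theta> n * (g * real n)" for x
    proof -
      have t: "0 \<le> trunc (g * real n) x" "trunc (g * real n) x \<le> g * real n"
        using g n by (auto intro: trunc_nonneg trunc_le)
      have "\<theta> n * trunc (g * real n) x \<le> \<theta> n * (g * real n)" "0 \<le> \<theta> n * trunc (g * real n) x"
        using t th by (auto intro!: mult_left_mono)
      then show ?thesis using s by (auto simp: f_def)
    qed
    have [measurable]: "f \<in> borel_measurable borel" unfolding f_def by measurable
    have int: "integrable M (\<lambda>\<omega>. exp (f (V 0 \<omega>)))" by (rule integrable_exp_bounded[OF _ bd]) measurable
    have E: "expectation (\<lambda>\<omega>. exp (f (V 0 \<omega>))) \<le> exp (\<theta> n * h n)"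
    proof -
      have "h n = (expectation (\<lambda>\<omega>. exp (f (V 0 \<omega>))) - 1) / \<theta> n"
        unfolding h_def f_def[symmetric] using int by (simp add: prob_space)
      then have "expectation (\<lambda>\<omega>. exp (f (V 0 \<omega>))) = 1 + \<theta> n * h n" using th by simp
      then show ?thesis using exp_ge_add_one_self[of "\<theta> n * h n"] by simp
    qed
    show ?case
    proof (intro allI impI)
      fix m assume m: "real m \<le> C * real n"
      have "{\<omega>\<in>space M. d * real n \<le> s * ((\<Sum>k<m. trunc (g * real n) (V k \<omega>)) - real m * mu)} =
          {\<omega>\<in>space M. \<theta> n * (d * real n + s * real m * mu) \<le> (\<Sum>k<m. f (V k \<omega>))}"
      proof -
        have "d * real n \<le> s * (x - real m * mu) \<longleftrightarrow> \<theta> n * (d * real n + s * real m * mu) \<le> s * \<theta> n * x" for x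
        proof -
          have "d * real n \<le> s * (x - real m * mu) \<longleftrightarrow> d * real n + s * real m * mu \<le> s * x" by (simp add: algebra_simps)
          also have "\<dots> \<longleftrightarrow> \<theta> n * (d * real n + s * real m * mu) \<le> \<theta> n * (s * x)"
            using th by (simp only: mult_le_cancel_left_pos)
          finally show ?thesis by (simp only: mult_ac)
        qed
        then show ?thesis unfolding f_def sum_distrib_left[symmetric] by simp
      qed
      also have "prob \<dots> \<le> exp (- (\<theta> n * (d * real n + s * real m * mu))) * expectation (\<lambda>\<omega>. exp (f (V 0 \<omega>))) ^ m"
        by (rule chernoff[OF _ bd]) measurable
      also have "\<dots> \<le> exp (- (\<theta> n * (d * real n + s * real m * mu))) * exp (\<theta> n * h n) ^ m"
        using E by (intro mult_left_mono power_mono) auto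
      also have "\<dots> = exp (\<theta> n * (real m * (h n - s * mu) - d * real n))"
        by (simp add: exp_of_nat_mult[symmetric] exp_add[symmetric] algebra_simps)
      also have "\<dots> \<le> exp (\<theta> n * (- (d / 2) * real n))"
      proof -
        have "real m * (h n - s * mu) \<le> real m * \<bar>h n - s * mu\<bar>" by (intro mult_left_mono) auto
        also have "\<dots> \<le> (C * real n) * (d / (2 * C))"
          using m elim by (intro mult_mono) (auto simp: dist_real_def)
        also have "\<dots> = d / 2 * real n" using C by simp
        finally have "real m * (h n - s * mu) - d * real n \<le> - (d / 2) * real n" by (simp add: algebra_simps)
        then show ?thesis
          unfolding exp_le_cancel_iff by (rule mult_left_mono) (use th in simp)
      qed
      also have "\<dots> = real n powr - (r * d / 2)" using n by (simp add: \<theta>_def powr_def)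
      finally show "prob {\<omega>\<in>space M. d * real n \<le> s * ((\<Sum>k<m. trunc (g * real n) (V k \<omega>)) - real m * mu)}
          \<le> real n powr - (r * d / 2)" .
    qed
  qed
qed

text \<open>A union bound over both signs and the linearly many \<open>m\<close> costs one power of
  \<open>n\<close>, which a larger \<open>r\<close> pays for.\<close>

lemma max_trunc_sum_deviation:
  assumes d: "0 < d" and C: "0 < C" and p: "0 < p"
  obtains g0 where "0 < g0" "\<And>g. 0 < g \<Longrightarrow> g \<le> g0 \<Longrightarrow> \<exists>K>0. eventually (\<lambda>n.
    prob {\<omega>\<in>space M. \<exists>m. real m \<le> C * real n \<and> d * real n \<le> \<bar>(\<Sum>k<m. trunc (g * real n) (V k \<omega>)) - real m * mu\<bar>}
      \<le> K * real n powr - p) sequentially"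
proof -
  \<comment> \<open>Chosen so that \<open>r * d / 2 = p + 1\<close>; the level \<open>g0\<close>
    then makes \<open>r * g0\<close> half of \<open>\<beta> - 1\<close>, keeping the moment order
    below \<open>\<beta>\<close>.\<close>
  define r where "r = 2 * (p + 1) / d"
  have r: "0 < r" "r * d / 2 = p + 1" using d p by (auto simp: r_def)
  define g0 where "g0 = (\<beta> - 1) / (2 * r)"
  have g0: "0 < g0" "1 + r * g0 < \<beta>" using beta r by (auto simp: g0_def field_simps)
  show thesis
  proof
    show "0 < g0" by fact
    fix g assume g: "0 < g" "g \<le> g0"
    then have "r * g \<le> r * g0" using r by (intro mult_left_mono) auto
    then have g': "1 + r * g < \<beta>" using g0 by linarith
    define E where "E s n m = {\<omega>\<in>space M. d * real n \<le> s * ((\<Sum>k<m. trunc (g * real n) (V k \<omega>)) - real m * mu)}" for s n m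
    have E[measurable]: "E s n m \<in> events" for s n m unfolding E_def by measurable
    have ev: "eventually (\<lambda>n. \<forall>m. real m \<le> C * real n \<longrightarrow> prob (E s n m) \<le> real n powr - (p + 1)) sequentially"
      if "s = 1 \<or> s = -1" for s
      using trunc_sum_deviation[OF r(1) g(1) g' that d C] unfolding E_def r(2) .
    show "\<exists>K>0. eventually (\<lambda>n.
        prob {\<omega>\<in>space M. \<exists>m. real m \<le> C * real n \<and> d * real n \<le> \<bar>(\<Sum>k<m. trunc (g * real n) (V k \<omega>)) - real m * mu\<bar>}
        \<le> K * real n powr - p) sequentially"
    proof (intro exI[of _ "2 * (C + 1)"] conjI)
      show "eventually (\<lambda>n.
        prob {\<omega>\<in>space M. \<exists>m. real m \<le> C * real n \<and> d * real n \<le> \<bar>(\<Sum>k<m. trunc (g * real n) (V k \<omega>)) - real m * mu\<bar>}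
        \<le> 2 * (C + 1) * real n powr - p) sequentially"
        using ev[OF disjI1[OF refl]] ev[OF disjI2[OF refl]] eventually_ge_at_top[of 1] 
      proof eventually_elim
        case (elim n)
        define I where "I = {m. real m \<le> C * real n}"
        have Isub: "I \<subseteq> {..nat \<lfloor>C * real n\<rfloor>}" by (auto simp: I_def le_nat_floor)
        then have fin: "finite I" by (rule finite_subset) simp
        have "card I \<le> nat \<lfloor>C * real n\<rfloor> + 1" using card_mono[OF _ Isub] by simp
        then have "real (card I) \<le> real (nat \<lfloor>C * real n\<rfloor> + 1)" by (rule of_nat_mono)
        also have "\<dots> \<le> C * real n + 1" using C by (simp add: of_nat_floor)
        also have "\<dots> \<le> (C + 1) * real n" using elim by (simp add: algebra_simps)
        finally have cI: "real (card I) \<le> (C + 1) * real n" .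
        have "{\<omega>\<in>space M. \<exists>m. real m \<le> C * real n \<and> d * real n \<le> \<bar>(\<Sum>k<m. trunc (g * real n) (V k \<omega>)) - real m * mu\<bar>}
            = (\<Union>m\<in>I. E 1 n m \<union> E (-1) n m)"
          unfolding I_def E_def le_abs_iff_signs by blast
        also have "prob \<dots> \<le> (\<Sum>m\<in>I. prob (E 1 n m \<union> E (-1) n m))"
          using fin by (intro finite_measure_subadditive_finite) auto
        also have "\<dots> \<le> (\<Sum>m\<in>I. 2 * real n powr - (p + 1))"
        proof (intro sum_mono)
          fix m assume "m \<in> I"
          then have "prob (E 1 n m) \<le> real n powr - (p + 1)" "prob (E (-1) n m) \<le> real n powr - (p + 1)"
            using elim by (auto simp: I_def)
          moreover have "prob (E 1 n m \<union> E (-1) n m) \<le> prob (E 1 n m) + prob (E (-1) n m)"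
            by (rule measure_Un_le) auto
          ultimately show "prob (E 1 n m \<union> E (-1) n m) \<le> 2 * real n powr - (p + 1)" by linarith
        qed
        also have "\<dots> = real (card I) * (2 * real n powr - (p + 1))" by simp
        also have "\<dots> \<le> (C + 1) * real n * (2 * real n powr - (p + 1))" using cI by (intro mult_right_mono) auto
        also have "\<dots> = 2 * (C + 1) * (real n powr 1 * real n powr - (p + 1))" using elim by simp
        also have "real n powr 1 * real n powr - (p + 1) = real n powr - p" unfolding powr_add[symmetric] by simp
        finally show ?case .
      qed
    qed (use C in simp)
  qed
qed

end

section \<open>Deviations of the Poisson counts and numbers of large jumps\<close>

lemma exp_quadratic_bound:
  fixes s x :: real
  assumes s: "s = 1 \<or> s = -1" and x: "0 \<le> x" "x \<le> 1"
  shows "exp (s * x) - 1 - s * x \<le> x\<^sup>2"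
proof (cases "s = 1")
  case True
  then show ?thesis using exp_bound[of x] x by simp
next
  case False
  have "exp (- x) \<le> 1 / (1 + x)"
    using exp_ge_add_one_self[of x] x by (simp add: exp_minus field_simps)
  also have "\<dots> \<le> 1 - x + x\<^sup>2"
  proof -
    have "0 \<le> x * (x * x)" using x by simp
    then have "1 \<le> (1 - x + x\<^sup>2) * (1 + x)" by (simp add: algebra_simps power2_eq_square)
    then show ?thesis using x by (simp add: pos_divide_le_eq)
  qed
  finally show ?thesis using False s by simp
qed

context compound_poisson
begin

text \<open>The mixture bound is used with events \<open>F m\<close> that are everything or nothing:
  it then reduces to the exponential moment of the Poisson law.\<close>

lemma poisson_deviation:
  assumes s: "s = 1 \<or> s = -1" and t: "0 < t" and th: "0 \<le> \<theta>" "\<theta> \<le> 1"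
  shows "prob {\<omega>\<in>space M. a \<le> s * (real (N t \<omega>) - lam * t)} \<le> exp (lam * t * \<theta>\<^sup>2 - \<theta> * a)"
proof -
  define F where "F m = (if a \<le> s * (real m - lam * t) then space M else {})" for m
  define c where "c = exp (- (\<theta> * s * lam * t) - \<theta> * a)"
  have "F m \<in> sets V_alg" for m using sets.top[of V_alg] by (simp add: F_def)
  moreover have "prob (F m) \<le> c * exp (s * \<theta>) ^ m" for m
  proof (cases "a \<le> s * (real m - lam * t)")
    case True
    then have "\<theta> * a \<le> \<theta> * (s * (real m - lam * t))" using th by (intro mult_left_mono) auto
    then have "1 \<le> exp (- (\<theta> * s * lam * t) - \<theta> * a + real m * (s * \<theta>))" by (simp add: algebra_simps)
    then show ?thesis using True by (simp add: F_def c_def exp_add exp_of_nat_mult prob_space)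
  qed (simp add: F_def c_def)
  ultimately have "prob {\<omega>\<in>space M. \<omega> \<in> F (N t \<omega>)} \<le> c * exp (lam * t * (exp (s * \<theta>) - 1))"
    by (rule poisson_mixture_le[OF t])
  also have "{\<omega>\<in>space M. \<omega> \<in> F (N t \<omega>)} = {\<omega>\<in>space M. a \<le> s * (real (N t \<omega>) - lam * t)}"
    by (auto simp: F_def split: if_splits)
  also have "c * exp (lam * t * (exp (s * \<theta>) - 1)) = exp (lam * t * (exp (s * \<theta>) - 1 - s * \<theta>) - \<theta> * a)"
    by (simp add: c_def exp_add[symmetric] algebra_simps)
  also have "\<dots> \<le> exp (lam * t * \<theta>\<^sup>2 - \<theta> * a)"
    using exp_quadratic_bound[OF s th] lam t by (auto intro!: mult_left_mono)
  finally show ?thesis .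
qed

text \<open>Each integer time has an exponentially small exceptional probability, so a union bound
  over \<open>n + 1\<close> times still beats every power of \<open>n\<close>.\<close>

lemma max_poisson_deviation:
  assumes d: "0 < d"
  shows "eventually (\<lambda>n. prob {\<omega>\<in>space M. \<exists>j\<le>n. d * real n \<le> \<bar>real (N (real j) \<omega>) - lam * real j\<bar>}
    \<le> real n powr - p) sequentially"
proof -
  \<comment> \<open>The cap \<open>d / (2 * lam)\<close> keeps the quadratic term below half of the
    linear one; the cap 1 is the range of the quadratic bound.\<close>
  define \<theta> where "\<theta> = min 1 (d / (2 * lam))"
  have th: "0 < \<theta>" "\<theta> \<le> 1" "\<theta> \<le> d / (2 * lam)" using d lam by (auto simp: \<theta>_def)
  define c where "c = \<theta> * d / 2"
  have c: "0 < c" using th d by (simp add: c_def)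
  define E where "E s n j = {\<omega>\<in>space M. d * real n \<le> s * (real (N (real j) \<omega>) - lam * real j)}" for s n j
  have [measurable]: "N (real j) \<in> measurable M (count_space UNIV)" for j by (rule N_measurable) simp
  have E[measurable]: "E s n j \<in> events" for s n j unfolding E_def by measurable
  have PE: "prob (E s n j) \<le> exp (- c * real n)" if s: "s = 1 \<or> s = -1" and j: "j \<le> n" "1 \<le> n" for s n j
  proof (cases "j = 0")
    case True
    have "E s n j = {}" using True d j poisson_path(3)[OF N] by (auto simp: E_def mult_le_0_iff)
    then show ?thesis by simp
  next
    case False
    then have "prob (E s n j) \<le> exp (lam * real j * \<theta>\<^sup>2 - \<theta> * (d * real n))"
      unfolding E_def using th by (intro poisson_deviation s) auto
    also have "\<dots> \<le> exp (- c * real n)"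
    proof -
      have "lam * real j * \<theta>\<^sup>2 \<le> lam * real n * (\<theta> * (d / (2 * lam)))"
        unfolding power2_eq_square using j th lam by (intro mult_mono) auto
      also have "\<dots> = c * real n" using lam by (simp add: c_def)
      finally show ?thesis by (simp add: c_def algebra_simps)
    qed
    finally show ?thesis .
  qed
  have "eventually (\<lambda>n. (real n + 1) * (2 * exp (- c * real n)) \<le> real n powr - p) sequentially"
    using c by real_asymp
  then show ?thesis using eventually_ge_at_top[of 1]
  proof eventually_elim
    case (elim n)
    have "{\<omega>\<in>space M. \<exists>j\<le>n. d * real n \<le> \<bar>real (N (real j) \<omega>) - lam * real j\<bar>} = (\<Union>j\<in>{..n}. E 1 n j \<union> E (-1) n j)"
      unfolding E_def le_abs_iff_signs by blast
    also have "prob \<dots> \<le> (\<Sum>j\<in>{..n}. prob (E 1 n j \<union> E (-1) n j))"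
      by (intro finite_measure_subadditive_finite) auto
    also have "\<dots> \<le> (\<Sum>j\<in>{..n}. 2 * exp (- c * real n))"
    proof (intro sum_mono)
      fix j assume "j \<in> {..n}"
      then have "prob (E 1 n j) \<le> exp (- c * real n)" "prob (E (-1) n j) \<le> exp (- c * real n)"
        using elim PE[OF disjI1[OF refl], of j n] PE[OF disjI2[OF refl], of j n] by auto
      moreover have "prob (E 1 n j \<union> E (-1) n j) \<le> prob (E 1 n j) + prob (E (-1) n j)"
        by (rule measure_Un_le) auto
      ultimately show "prob (E 1 n j \<union> E (-1) n j) \<le> 2 * exp (- c * real n)" by linarith
    qed
    also have "\<dots> = (real n + 1) * (2 * exp (- c * real n))" by simp
    finally show ?case using elim by linarith
  qed
qed

text \<open>Union bound over the \<open>l\<close>-element index sets, whose number is at most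
  \<open>m ^ l\<close>.\<close>

lemma many_big_jumps_le:
  "prob {\<omega>\<in>space M. l \<le> card {k. k < m \<and> x < V k \<omega>}} \<le> (real m * tail x) ^ l"
proof -
  define P where "P = {J. J \<subseteq> {..<m} \<and> card J = l}"
  have fin: "finite P" unfolding P_def by (rule finite_subset[of _ "Pow {..<m}"]) auto
  define E where "E J = {\<omega>\<in>space M. \<forall>k\<in>J. V k \<omega> \<in> {x<..}}" for J
  have Em: "E J \<in> events" if "J \<in> P" for J
  proof -
    have [simp]: "finite J" using that by (auto simp: P_def intro: finite_subset)
    show ?thesis unfolding E_def by measurable
  qed
  have sub: "{\<omega>\<in>space M. l \<le> card {k. k < m \<and> x < V k \<omega>}} \<subseteq> (\<Union>J\<in>P. E J)"
  proof
    fix \<omega> assume w: "\<omega> \<in> {\<omega>\<in>space M. l \<le> card {k. k < m \<and> x < V k \<omega>}}"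
    then obtain J where "J \<subseteq> {k. k < m \<and> x < V k \<omega>}" "card J = l"
      using obtain_subset_with_card_n by blast
    then have "J \<in> P" "\<omega> \<in> E J" using w by (auto simp: P_def E_def)
    then show "\<omega> \<in> (\<Union>J\<in>P. E J)" by blast
  qed
  have "prob {\<omega>\<in>space M. l \<le> card {k. k < m \<and> x < V k \<omega>}} \<le> prob (\<Union>J\<in>P. E J)"
    using sub fin Em by (intro finite_measure_mono) auto
  also have "\<dots> \<le> (\<Sum>J\<in>P. prob (E J))"
    using fin Em by (intro finite_measure_subadditive_finite) auto
  also have "\<dots> = (\<Sum>J\<in>P. tail x ^ l)"
  proof (intro sum.cong refl)
    fix J assume "J \<in> P"
    then have "finite J" "card J = l" by (auto simp: P_def intro: finite_subset)
    then show "prob (E J) = tail x ^ l"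
      unfolding E_def by (subst prob_V_all) (auto simp: tail_def)
  qed
  also have "\<dots> = real (m choose l) * tail x ^ l"
    unfolding P_def by (simp add: n_subsets)
  also have "\<dots> \<le> real (m ^ l) * tail x ^ l"
  proof (intro mult_right_mono of_nat_mono)
    show "m choose l \<le> m ^ l"
      by (cases "l \<le> m") (simp_all add: binomial_le_pow binomial_eq_0)
  qed (simp add: tail_nonneg)
  finally show ?thesis by (simp add: power_mult_distrib)
qed

end

section \<open>Large jumps near prescribed positions\<close>

text \<open>Counts the indices available to one prescribed jump. The factor 2 absorbs the loss of 1
  once \<open>b\<close> is at least 1.\<close>

lemma card_nat_interval_ge:
  fixes a b :: real
  assumes a: "b \<le> a" and b: "0 \<le> b"
  shows "2 * b - 1 \<le> real (card {k. \<bar>real k - a\<bar> \<le> b})"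
proof -
  have fin: "finite {k. \<bar>real k - a\<bar> \<le> b}"
    by (rule finite_subset[of _ "{..nat \<lfloor>a + b\<rfloor>}"]) (auto simp: le_nat_floor)
  define c where "c = nat \<lceil>a - b\<rceil>"
  have c: "a - b \<le> real c" "real c < a - b + 1"
    using a by (auto simp: c_def) linarith+
  define m where "m = nat \<lfloor>2 * b\<rfloor>"
  have m: "real m \<le> 2 * b" "2 * b < real m + 1" using b by (auto simp: m_def)
  have "(\<lambda>k. c + k) ` {..<m} \<subseteq> {k. \<bar>real k - a\<bar> \<le> b}"
  proof
    fix k assume "k \<in> (\<lambda>k. c + k) ` {..<m}"
    then obtain i where i: "k = c + i" "i < m" by auto
    then have "real i + 1 \<le> real m" by linarith
    then show "k \<in> {k. \<bar>real k - a\<bar> \<le> b}" using i(1) c m by (auto simp: abs_le_iff)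
  qed
  then have "card ((\<lambda>k. c + k) ` {..<m}) \<le> card {k. \<bar>real k - a\<bar> \<le> b}" by (rule card_mono[OF fin])
  then have "m \<le> card {k. \<bar>real k - a\<bar> \<le> b}" by (simp add: card_image)
  then have "real m \<le> real (card {k. \<bar>real k - a\<bar> \<le> b})" by (rule of_nat_mono)
  then show ?thesis using m by linarith
qed

context compound_poisson
begin

text \<open>The predicates see only the restrictions to their index blocks, which turns independence
  of the jumps into a product formula for events about disjoint blocks.\<close>

lemma prob_V_indep_blocks:
  fixes B :: "nat set"
  assumes AB: "finite A" "finite B" "A \<inter> B = {}"
    and P: "{f \<in> space (\<Pi>\<^sub>M k\<in>A. borel). P f} \<in> sets (\<Pi>\<^sub>M k\<in>A. (borel :: real measure))"
    and Q: "{f \<in> space (\<Pi>\<^sub>M k\<in>B. borel). Q f} \<in> sets (\<Pi>\<^sub>M k\<in>B. (borel :: real measure))"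
  shows "prob {\<omega>\<in>space M. P (\<lambda>k\<in>A. V k \<omega>) \<and> Q (\<lambda>k\<in>B. V k \<omega>)} =
    prob {\<omega>\<in>space M. P (\<lambda>k\<in>A. V k \<omega>)} * prob {\<omega>\<in>space M. Q (\<lambda>k\<in>B. V k \<omega>)}"
proof -
  let ?P = "{f \<in> space (\<Pi>\<^sub>M k\<in>A. (borel :: real measure)). P f}"
  let ?Q = "{f \<in> space (\<Pi>\<^sub>M k\<in>B. (borel :: real measure)). Q f}"
  have "indep_var (\<Pi>\<^sub>M k\<in>A. borel) (\<lambda>\<omega>. \<lambda>k\<in>A. V k \<omega>) (\<Pi>\<^sub>M k\<in>B. borel) (\<lambda>\<omega>. \<lambda>k\<in>B. V k \<omega>)"
    using AB by (intro indep_var_restrict[OF V_indep]) auto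
  from indep_varD[OF this P Q]
  have "prob ((\<lambda>\<omega>. (\<lambda>k\<in>A. V k \<omega>, \<lambda>k\<in>B. V k \<omega>)) -` (?P \<times> ?Q) \<inter> space M) =
      prob ((\<lambda>\<omega>. \<lambda>k\<in>A. V k \<omega>) -` ?P \<inter> space M) * prob ((\<lambda>\<omega>. \<lambda>k\<in>B. V k \<omega>) -` ?Q \<inter> space M)" .
  moreover have "(\<lambda>\<omega>. (\<lambda>k\<in>A. V k \<omega>, \<lambda>k\<in>B. V k \<omega>)) -` (?P \<times> ?Q) \<inter> space M =
      {\<omega>\<in>space M. P (\<lambda>k\<in>A. V k \<omega>) \<and> Q (\<lambda>k\<in>B. V k \<omega>)}"
    by (auto simp: space_PiM)
  moreover have "(\<lambda>\<omega>. \<lambda>k\<in>A. V k \<omega>) -` ?P \<inter> space M = {\<omega>\<in>space M. P (\<lambda>k\<in>A. V k \<omega>)}"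
    by (auto simp: space_PiM)
  moreover have "(\<lambda>\<omega>. \<lambda>k\<in>B. V k \<omega>) -` ?Q \<inter> space M = {\<omega>\<in>space M. Q (\<lambda>k\<in>B. V k \<omega>)}"
    by (auto simp: space_PiM)
  ultimately show ?thesis by simp
qed

end

context heavy_tailed
begin

text \<open>The expected number of jumps above \<open>g * n\<close> among linearly many is of order
  \<open>n * tail (g * n)\<close> and tends to 0 as \<open>\<beta> > 1\<close>; the deviation event
  is negligible by the maximal bound.\<close>

lemma prob_small_regular_tendsto:
  assumes d: "0 < d" and C: "0 < C"
  obtains g0 where "0 < g0" "\<And>g. 0 < g \<Longrightarrow> g \<le> g0 \<Longrightarrow> eventually (\<lambda>n. 1 / 2 \<le>
    prob {\<omega>\<in>space M. \<forall>m. real m \<le> C * real n \<longrightarrow> 0 < V m \<omega> \<and> V m \<omega> \<le> g * real n \<and>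
      \<bar>(\<Sum>k<m. trunc (g * real n) (V k \<omega>)) - real m * mu\<bar> < d * real n}) sequentially"
proof -
  obtain g0 where g0: "0 < g0" and K: "\<And>g. 0 < g \<Longrightarrow> g \<le> g0 \<Longrightarrow> \<exists>K>0. eventually (\<lambda>n.
    prob {\<omega>\<in>space M. \<exists>m. real m \<le> C * real n \<and> d * real n \<le> \<bar>(\<Sum>k<m. trunc (g * real n) (V k \<omega>)) - real m * mu\<bar>}
      \<le> K * real n powr - 1) sequentially"
    using max_trunc_sum_deviation[OF d C zero_less_one] by blast
  show thesis
  proof (rule that[OF g0])
    fix g assume g: "0 < g" "g \<le> g0"
    obtain K where K0: "0 < K" and ev1: "eventually (\<lambda>n.
      prob {\<omega>\<in>space M. \<exists>m. real m \<le> C * real n \<and> d * real n \<le> \<bar>(\<Sum>k<m. trunc (g * real n) (V k \<omega>)) - real m * mu\<bar>}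
        \<le> K * real n powr - 1) sequentially" using K[OF g] by blast
    \<comment> \<open>Any exponent strictly between 1 and \<open>\<beta>\<close> serves: more than 1
      beats the linear number of jumps, less than \<open>\<beta>\<close> is available for the
      tail.\<close>
    define p where "p = (1 + \<beta>) / 2"
    have p: "1 < p" "p < \<beta>" using beta by (auto simp: p_def)
    obtain C' where C': "0 < C'" "eventually (\<lambda>x. tail x \<le> C' * x powr - p) at_top"
      using tail_poly_upper[of p] p by auto
    have "filterlim (\<lambda>n. g * real n) at_top sequentially" using g by real_asymp
    from eventually_compose_filterlim[OF C'(2) this]
    have ev2: "eventually (\<lambda>n. tail (g * real n) \<le> C' * (g * real n) powr - p) sequentially" .
    have "(\<lambda>n. (C * real n + 1) * (C' * (g * real n) powr - p) + K * real n powr - 1) \<longlonglongrightarrow> 0"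
    proof (rule tendsto_add_zero)
      show "(\<lambda>n. (C * real n + 1) * (C' * (g * real n) powr - p)) \<longlonglongrightarrow> 0"
        using C C'(1) g(1) p by real_asymp
      show "(\<lambda>n. K * real n powr - 1) \<longlonglongrightarrow> 0" by real_asymp
    qed
    then have ev3: "eventually (\<lambda>n. (C * real n + 1) * (C' * (g * real n) powr - p) + K * real n powr - 1 < 1 / 2) sequentially"
      by (rule order_tendstoD) simp
    show "eventually (\<lambda>n. 1 / 2 \<le>
      prob {\<omega>\<in>space M. \<forall>m. real m \<le> C * real n \<longrightarrow> 0 < V m \<omega> \<and> V m \<omega> \<le> g * real n \<and>
        \<bar>(\<Sum>k<m. trunc (g * real n) (V k \<omega>)) - real m * mu\<bar> < d * real n}) sequentially"
      using ev1 ev2 ev3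
    proof eventually_elim
      case (elim n)
      let ?R = "{\<omega>\<in>space M. \<forall>m. real m \<le> C * real n \<longrightarrow> 0 < V m \<omega> \<and> V m \<omega> \<le> g * real n \<and>
        \<bar>(\<Sum>k<m. trunc (g * real n) (V k \<omega>)) - real m * mu\<bar> < d * real n}"
      let ?B = "{\<omega>\<in>space M. \<exists>m. real m \<le> C * real n \<and> d * real n \<le> \<bar>(\<Sum>k<m. trunc (g * real n) (V k \<omega>)) - real m * mu\<bar>}"
      define I where "I = {m. real m \<le> C * real n}"
      have Isub: "I \<subseteq> {..nat \<lfloor>C * real n\<rfloor>}" by (auto simp: I_def le_nat_floor)
      then have fin: "finite I" by (rule finite_subset) simp
      have "card I \<le> nat \<lfloor>C * real n\<rfloor> + 1" using card_mono[OF _ Isub] by simp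
      then have "real (card I) \<le> real (nat \<lfloor>C * real n\<rfloor> + 1)" by (rule of_nat_mono)
      also have "\<dots> \<le> C * real n + 1" using C by (simp add: of_nat_floor)
      finally have cI: "real (card I) \<le> C * real n + 1" .
      let ?T = "\<Union>k\<in>I. {\<omega>\<in>space M. g * real n < V k \<omega>}"
      have R: "?R \<in> events" by measurable
      have B: "?B \<in> events" by measurable
      have T: "?T \<in> events" using fin by (intro sets.finite_UN) measurable
      have "prob (space M) \<le> prob (?R \<union> (?T \<union> ?B))"
      proof (rule finite_measure_mono_AE)
        show "AE \<omega> in M. \<omega> \<in> space M \<longrightarrow> \<omega> \<in> ?R \<union> (?T \<union> ?B)"
          using V_pos by eventually_elim (auto simp: I_def not_le not_less)
      qed (use R B T in auto)
      also have "\<dots> \<le> prob ?R + (prob ?T + prob ?B)"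
        using R B T by (intro order.trans[OF measure_Un_le] add_left_mono measure_Un_le) auto
      finally have 1: "1 \<le> prob ?R + (prob ?T + prob ?B)" by (simp add: prob_space)
      have "prob ?T \<le> (\<Sum>k\<in>I. prob {\<omega>\<in>space M. g * real n < V k \<omega>})"
        using fin by (intro finite_measure_subadditive_finite) auto
      also have "\<dots> = real (card I) * tail (g * real n)" by (simp add: prob_V_gt)
      also have "\<dots> \<le> (C * real n + 1) * (C' * (g * real n) powr - p)"
        using cI elim C by (intro mult_mono) (auto simp: tail_nonneg)
      finally show ?case using 1 elim by linarith
    qed
  qed
qed

text \<open>A difference of two tails; by regular variation it is of the order of
  \<open>tail n\<close>, and \<open>c\<close> is half of the limiting ratio.\<close>

lemma prob_V_interval_lower:
  assumes e: "0 < e" "e < y"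
  obtains c where "0 < c" "eventually (\<lambda>n. c * tail (real n) \<le> prob {\<omega>\<in>space M. \<bar>V 0 \<omega> - y * real n\<bar> \<le> e * real n}) sequentially"
proof -
  define c where "c = ((y - e) powr - \<beta> - (y + e) powr - \<beta>) / 2"
  have c: "0 < c"
    using e beta by (simp add: c_def powr_less_mono2_neg)
  have lim: "((\<lambda>x. tail ((y - e) * x) / tail x - tail ((y + e) * x) / tail x) \<longlongrightarrow> (y - e) powr - \<beta> - (y + e) powr - \<beta>) at_top"
    using e by (intro tendsto_intros tail_lim) auto
  have "c < (y - e) powr - \<beta> - (y + e) powr - \<beta>" using c by (simp add: c_def)
  from order_tendstoD(1)[OF lim this]
  have "eventually (\<lambda>x. c * tail x \<le> tail ((y - e) * x) - tail ((y + e) * x)) at_top"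
    using tail_pos
  proof eventually_elim
    case (elim x)
    then have "c < (tail ((y - e) * x) - tail ((y + e) * x)) / tail x" by (simp add: diff_divide_distrib)
    then show ?case using elim(2) by (simp add: pos_less_divide_eq)
  qed
  from eventually_compose_filterlim[OF this filterlim_real_sequentially]
  have "eventually (\<lambda>n. c * tail (real n) \<le> tail ((y - e) * real n) - tail ((y + e) * real n)) sequentially" .
  then have "eventually (\<lambda>n. c * tail (real n) \<le> prob {\<omega>\<in>space M. \<bar>V 0 \<omega> - y * real n\<bar> \<le> e * real n}) sequentially"
  proof eventually_elim
    case (elim n)
    let ?A = "{\<omega>\<in>space M. (y - e) * real n < V 0 \<omega>}" and ?B = "{\<omega>\<in>space M. (y + e) * real n < V 0 \<omega>}"
    have "(y - e) * real n \<le> (y + e) * real n" using e by (intro mult_right_mono) auto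
    then have "prob (?A - ?B) = prob ?A - prob ?B" by (intro finite_measure_Diff) auto
    moreover have "prob (?A - ?B) \<le> prob {\<omega>\<in>space M. \<bar>V 0 \<omega> - y * real n\<bar> \<le> e * real n}"
      by (intro finite_measure_mono) (auto simp: abs_le_iff algebra_simps)
    ultimately show ?case using elim by (simp add: tail_def)
  qed
  then show thesis using c that by blast
qed

text \<open>Disjointness of the events over all choices of indices of the big jumps makes their
  probabilities add up.\<close>

lemma big_jumps_lower:
  fixes u y :: "nat \<Rightarrow> real"
  assumes C: "0 < C" and e: "0 < e"
    and u: "\<And>j. j < l \<Longrightarrow> e \<le> lam * u j" "\<And>j. j < l \<Longrightarrow> lam * u j + e \<le> C"
    and sep: "\<And>i j. i < l \<Longrightarrow> j < l \<Longrightarrow> i \<noteq> j \<Longrightarrow> 2 * e < \<bar>lam * u i - lam * u j\<bar>"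
    and y: "\<And>j. j < l \<Longrightarrow> e < y j"
  obtains c \<Omega> where "0 < c" "\<And>n. \<Omega> n \<in> sets V_alg"
    "eventually (\<lambda>n. c * (real n * tail (real n)) ^ l \<le> prob (\<Omega> n)) sequentially"
    "\<And>n \<omega>. 0 < n \<Longrightarrow> \<omega> \<in> \<Omega> n \<Longrightarrow> \<exists>\<kappa>. inj_on \<kappa> {..<l} \<and>
      (\<forall>j<l. \<bar>real (\<kappa> j) - lam * u j * real n\<bar> \<le> e * real n \<and> \<bar>V (\<kappa> j) \<omega> - y j * real n\<bar> \<le> e * real n) \<and>
      (\<forall>m. real m \<le> C * real n \<longrightarrow> \<bar>(\<Sum>k\<in>{..<m} - \<kappa> ` {..<l}. V k \<omega>) - real m * mu\<bar> \<le> e * real n)"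
proof -
  obtain g0 where g0: "0 < g0" and reg: "\<And>g. 0 < g \<Longrightarrow> g \<le> g0 \<Longrightarrow> eventually (\<lambda>n. 1 / 2 \<le>
    prob {\<omega>\<in>space M. \<forall>m. real m \<le> C * real n \<longrightarrow> 0 < V m \<omega> \<and> V m \<omega> \<le> g * real n \<and>
      \<bar>(\<Sum>k<m. trunc (g * real n) (V k \<omega>)) - real m * mu\<bar> < e / 2 * real n}) sequentially"
    using prob_small_regular_tendsto[of "e / 2" C] e C by auto
  have "\<exists>b>0. \<forall>j\<in>{..<l}. b \<le> (y j - e) / 2" using y by (intro finite_positive_lower_bound) auto
  then obtain b where b: "0 < b" "\<And>j. j < l \<Longrightarrow> b < y j - e" using y by force
  \<comment> \<open>Three demands: below \<open>g0\<close> for regularity, at most \<open>b\<close>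
    so that a prescribed jump cannot pass for a small one, and \<open>l * g\<close> at most
    \<open>e / 2\<close> so that removing \<open>l\<close> small jumps shifts a partial sum by at
    most \<open>e / 2 * n\<close>.\<close>
  define g where "g = min (min g0 b) (e / (2 * (real l + 1)))"
  have g: "0 < g" "g \<le> g0" "g \<le> b" using g0 b e by (auto simp: g_def)
  have "g \<le> e / (2 * (real l + 1))" by (simp add: g_def)
  then have "real l * g + g \<le> e / 2" by (simp add: field_simps)
  then have gl: "real l * g \<le> e / 2" using g by linarith
  \<comment> \<open>Arrivals come at rate \<open>lam\<close>, so the jump near time
    \<open>u j * n\<close> should have an index near \<open>lam * u j * n\<close>.\<close>
  define Blk where "Blk n j = {k. \<bar>real k - lam * u j * real n\<bar> \<le> e * real n}" for n j
  define KK where "KK n = PiE {..<l} (Blk n)" for n :: nat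
  define I where "I n = {k. real k \<le> C * real n}" for n :: nat
  define JE where "JE n \<kappa> = {\<omega>\<in>space M. \<forall>j<l. \<bar>V (\<kappa> j) \<omega> - y j * real n\<bar> \<le> e * real n}" for n \<kappa>
  define T where "T \<kappa> m \<omega> = (\<Sum>k\<in>{..<m} - \<kappa> ` {..<l}. V k \<omega>)" for \<kappa> m \<omega>
  \<comment> \<open>Involves only indices outside the image of \<open>\<kappa>\<close>, hence is
    independent of \<open>JE\<close>. Its bound on all other jumps makes the choice of
    \<open>\<kappa>\<close> recoverable, which gives the disjointness.\<close>
  define FE where "FE n \<kappa> = {\<omega>\<in>space M. (\<forall>k\<in>I n - \<kappa> ` {..<l}. V k \<omega> \<le> g * real n) \<and>
      (\<forall>m\<in>I n. \<bar>T \<kappa> m \<omega> - real m * mu\<bar> \<le> e * real n)}" for n \<kappa>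
  define \<Omega> where "\<Omega> n = (\<Union>\<kappa>\<in>KK n. JE n \<kappa> \<inter> FE n \<kappa>)" for n
  have finI: "finite (I n)" for n
    by (rule finite_subset[of _ "{..nat \<lfloor>C * real n\<rfloor>}"]) (auto simp: I_def le_nat_floor)
  have BlkI: "Blk n j \<subseteq> I n" if "j < l" for n j
  proof
    fix k assume "k \<in> Blk n j"
    then have "real k \<le> (lam * u j + e) * real n" by (simp add: Blk_def abs_le_iff algebra_simps)
    also have "\<dots> \<le> C * real n" using u(2)[OF that] by (intro mult_right_mono) auto
    finally show "k \<in> I n" by (simp add: I_def)
  qed
  have finK: "finite (KK n)" for n
    unfolding KK_def by (intro finite_PiE) (auto intro: finite_subset[OF BlkI finI])
  have disj: "i = j" if "0 < n" "i < l" "j < l" "k \<in> Blk n i" "k \<in> Blk n j" for n i j k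
  proof (rule ccontr)
    assume "i \<noteq> j"
    have "\<bar>lam * u i * real n - lam * u j * real n\<bar> \<le> 2 * e * real n" using that(4,5) by (simp add: Blk_def)
    moreover have "lam * u i * real n - lam * u j * real n = (lam * u i - lam * u j) * real n" by (simp add: algebra_simps)
    ultimately have "\<bar>lam * u i - lam * u j\<bar> * real n \<le> 2 * e * real n" by (simp add: abs_mult)
    then show False using sep[OF that(2,3) \<open>i \<noteq> j\<close>] that(1) by simp
  qed
  have inj: "inj_on \<kappa> {..<l}" if "0 < n" "\<kappa> \<in> KK n" for n \<kappa>
  proof (rule inj_onI)
    fix i j assume ij: "i \<in> {..<l}" "j \<in> {..<l}" "\<kappa> i = \<kappa> j"
    have "\<kappa> i \<in> Blk n i" "\<kappa> j \<in> Blk n j" using that(2) ij(1,2) by (auto simp: KK_def PiE_iff)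
    then show "i = j" using disj[of n i j "\<kappa> i"] that(1) ij by simp
  qed
  have JV: "JE n \<kappa> \<in> sets V_alg" for n \<kappa>
  proof -
    have 1: "{\<omega>\<in>space V_alg. \<bar>V k \<omega> - c\<bar> \<le> d} \<in> sets V_alg" for k c d by measurable
    have "{\<omega>\<in>space V_alg. \<forall>j\<in>{..<l}. \<bar>V (\<kappa> j) \<omega> - y j * real n\<bar> \<le> e * real n} \<in> sets V_alg"
      by (intro sets.sets_Collect_finite_All 1) auto
    moreover have "{\<omega>\<in>space V_alg. \<forall>j\<in>{..<l}. \<bar>V (\<kappa> j) \<omega> - y j * real n\<bar> \<le> e * real n} = JE n \<kappa>"
      by (auto simp: JE_def)
    ultimately show ?thesis by simp
  qed
  have FV: "FE n \<kappa> \<in> sets V_alg" for n \<kappa>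
  proof -
    have 1: "{\<omega>\<in>space V_alg. V k \<omega> \<le> c} \<in> sets V_alg" for k c by measurable
    have 2: "{\<omega>\<in>space V_alg. \<bar>T \<kappa> m \<omega> - c\<bar> \<le> d} \<in> sets V_alg" for m c d
      unfolding T_def by measurable
    have "{\<omega>\<in>space V_alg. (\<forall>k\<in>I n - \<kappa> ` {..<l}. V k \<omega> \<le> g * real n) \<and>
      (\<forall>m\<in>I n. \<bar>T \<kappa> m \<omega> - real m * mu\<bar> \<le> e * real n)} \<in> sets V_alg"
      by (intro sets.sets_Collect_conj sets.sets_Collect_finite_All 1 2) (auto simp: finI)
    then show ?thesis by (simp only: FE_def space_algs)
  qed
  define q where "q n j = prob {\<omega>\<in>space M. \<bar>V 0 \<omega> - y j * real n\<bar> \<le> e * real n}" for n j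
  have "\<forall>j\<in>{..<l}. \<exists>c. 0 < c \<and> eventually (\<lambda>n. c * tail (real n) \<le> q n j) sequentially"
  proof
    fix j assume "j \<in> {..<l}"
    then have "e < y j" using y by simp
    then show "\<exists>c. 0 < c \<and> eventually (\<lambda>n. c * tail (real n) \<le> q n j) sequentially"
      unfolding q_def using prob_V_interval_lower[OF e] by blast
  qed
  from bchoice[OF this] obtain cj where
    "\<forall>j\<in>{..<l}. 0 < cj j \<and> eventually (\<lambda>n. cj j * tail (real n) \<le> q n j) sequentially" by (rule exE)
  then have cj: "\<And>j. j < l \<Longrightarrow> 0 < cj j"
    "\<And>j. j < l \<Longrightarrow> eventually (\<lambda>n. cj j * tail (real n) \<le> q n j) sequentially"
    by simp_all
  \<comment> \<open>The factor 1/2 bounds \<open>FE\<close>, the \<open>cj\<close> bound the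
    intervals of jump sizes, and \<open>e ^ l\<close> together with \<open>n ^ l\<close> counts the
    choices of \<open>\<kappa>\<close>.\<close>
  define c where "c = 1 / 2 * (\<Prod>j<l. cj j) * e ^ l"
  show thesis
  proof
    show "0 < c" unfolding c_def using cj(1) e by (intro mult_pos_pos prod_pos zero_less_power) auto
    show "\<Omega> n \<in> sets V_alg" for n
      unfolding \<Omega>_def using finK JV FV by (intro sets.finite_UN sets.Int) auto
    show "\<exists>\<kappa>. inj_on \<kappa> {..<l} \<and>
      (\<forall>j<l. \<bar>real (\<kappa> j) - lam * u j * real n\<bar> \<le> e * real n \<and> \<bar>V (\<kappa> j) \<omega> - y j * real n\<bar> \<le> e * real n) \<and>
      (\<forall>m. real m \<le> C * real n \<longrightarrow> \<bar>(\<Sum>k\<in>{..<m} - \<kappa> ` {..<l}. V k \<omega>) - real m * mu\<bar> \<le> e * real n)"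
      if n: "0 < n" and w: "\<omega> \<in> \<Omega> n" for n \<omega>
    proof -
      obtain \<kappa> where k: "\<kappa> \<in> KK n" "\<omega> \<in> JE n \<kappa>" "\<omega> \<in> FE n \<kappa>" using w by (auto simp: \<Omega>_def)
      have "\<kappa> j \<in> Blk n j" if "j < l" for j using k(1) that by (auto simp: KK_def PiE_iff)
      then show ?thesis using inj[OF n k(1)] k(2,3)
        unfolding T_def[symmetric] JE_def FE_def Blk_def I_def by (intro exI[of _ \<kappa>]) blast
    qed
    have "eventually (\<lambda>n. \<forall>j\<in>{..<l}. cj j * tail (real n) \<le> q n j) sequentially"
      using cj(2) by (intro eventually_ball_finite) auto
    moreover have "filterlim (\<lambda>n. e * real n) at_top sequentially" using e by real_asymp
    then have "eventually (\<lambda>n. 1 \<le> e * real n) sequentially" by (simp add: filterlim_at_top)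
    ultimately show "eventually (\<lambda>n. c * (real n * tail (real n)) ^ l \<le> prob (\<Omega> n)) sequentially"
      using reg[OF g(1,2)] eventually_gt_at_top[of 0]
    proof eventually_elim
      case (elim n)
      let ?R = "{\<omega>\<in>space M. \<forall>m. real m \<le> C * real n \<longrightarrow> 0 < V m \<omega> \<and> V m \<omega> \<le> g * real n \<and>
        \<bar>(\<Sum>k<m. trunc (g * real n) (V k \<omega>)) - real m * mu\<bar> < e / 2 * real n}"
      \<comment> \<open>The regular event, in which all jumps are small, implies \<open>FE\<close>
        for every \<open>\<kappa>\<close>; its probability therefore bounds all \<open>FE\<close> at
        once.\<close>
      have RF: "?R \<subseteq> FE n \<kappa>" for \<kappa>
      proof
        fix \<omega> assume w: "\<omega> \<in> ?R"
        then have v: "0 < V k \<omega>" "V k \<omega> \<le> g * real n" if "real k \<le> C * real n" for k using that by auto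
        have "\<bar>T \<kappa> m \<omega> - real m * mu\<bar> \<le> e * real n" if m: "real m \<le> C * real n" for m
        proof -
          have vm: "0 < V k \<omega>" "V k \<omega> \<le> g * real n" if "k < m" for k using v[of k] that m by auto
          have "(\<Sum>k<m. trunc (g * real n) (V k \<omega>)) = (\<Sum>k<m. V k \<omega>)"
            using vm by (intro sum.cong) (auto simp: trunc_def)
          then have a: "\<bar>(\<Sum>k<m. V k \<omega>) - real m * mu\<bar> \<le> e / 2 * real n" using w m by force
          let ?A = "{..<m} \<inter> \<kappa> ` {..<l}"
          have s: "(\<Sum>k<m. V k \<omega>) = T \<kappa> m \<omega> + (\<Sum>k\<in>?A. V k \<omega>)"
            unfolding T_def by (subst sum.union_disjoint[symmetric]) (auto intro!: sum.cong)
          have "0 \<le> (\<Sum>k\<in>?A. V k \<omega>)" using vm by (intro sum_nonneg) (auto simp: less_imp_le)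
          moreover have "(\<Sum>k\<in>?A. V k \<omega>) \<le> e / 2 * real n"
          proof -
            have "(\<Sum>k\<in>?A. V k \<omega>) \<le> real (card ?A) * (g * real n)"
              using vm by (intro sum_bounded_above) auto
            also have "\<dots> \<le> real l * (g * real n)"
            proof (intro mult_right_mono of_nat_mono)
              have "card ?A \<le> card (\<kappa> ` {..<l})" by (intro card_mono) auto
              also have "\<dots> \<le> l" using card_image_le[of "{..<l}" \<kappa>] by simp
              finally show "card ?A \<le> l" .
            qed (use g in simp)
            also have "\<dots> = (real l * g) * real n" by simp
            also have "\<dots> \<le> e / 2 * real n" using gl by (intro mult_right_mono) auto
            finally show ?thesis .
          qed
          ultimately show ?thesis using a s unfolding abs_le_iff by linarith
        qed
        then show "\<omega> \<in> FE n \<kappa>" using v w unfolding FE_def I_def by blast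
      qed
      have PF: "1 / 2 \<le> prob (FE n \<kappa>)" for \<kappa>
      proof -
        have "prob ?R \<le> prob (FE n \<kappa>)" using RF FV sets_V_alg_subset by (intro finite_measure_mono) auto
        then show ?thesis using elim by linarith
      qed
      have PJ: "(\<Prod>j<l. cj j) * tail (real n) ^ l \<le> prob (JE n \<kappa>)" if k: "\<kappa> \<in> KK n" for \<kappa>
      proof -
        have inj': "inj_on \<kappa> {..<l}" using inj elim k by simp
        define h where "h k = the_inv_into {..<l} \<kappa> k" for k
        have h: "h (\<kappa> j) = j" if "j < l" for j using inj' that by (simp add: h_def the_inv_into_f_f)
        have "JE n \<kappa> = {\<omega>\<in>space M. \<forall>k\<in>\<kappa> ` {..<l}. V k \<omega> \<in> {x. \<bar>x - y (h k) * real n\<bar> \<le> e * real n}}"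
          using h by (auto simp: JE_def)
        then have "prob (JE n \<kappa>) = (\<Prod>k\<in>\<kappa> ` {..<l}. prob {\<omega>\<in>space M. V 0 \<omega> \<in> {x. \<bar>x - y (h k) * real n\<bar> \<le> e * real n}})"
          by (simp only:, intro prob_V_all) auto
        also have "\<dots> = (\<Prod>j<l. q n j)"
          unfolding q_def using h by (subst prod.reindex[OF inj']) (auto intro!: prod.cong)
        also have "\<dots> \<ge> (\<Prod>j<l. cj j * tail (real n))"
          using elim cj(1) tail_nonneg by (intro prod_mono) (auto simp: less_imp_le)
        finally show ?thesis by (simp add: prod.distrib)
      qed
      have PJF: "prob (JE n \<kappa> \<inter> FE n \<kappa>) = prob (JE n \<kappa>) * prob (FE n \<kappa>)" if k: "\<kappa> \<in> KK n" for \<kappa>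
      proof -
        let ?A = "\<kappa> ` {..<l}" and ?B = "I n - \<kappa> ` {..<l}"
        let ?P = "\<lambda>f. \<forall>j<l. \<bar>f (\<kappa> j) - y j * real n\<bar> \<le> e * real n"
        let ?Q = "\<lambda>f. (\<forall>k\<in>?B. f k \<le> g * real n) \<and>
          (\<forall>m\<in>I n. \<bar>(\<Sum>k\<in>{..<m} - \<kappa> ` {..<l}. f k) - real m * mu\<bar> \<le> e * real n)"
        have sub: "{..<m} - \<kappa> ` {..<l} \<subseteq> ?B" if "m \<in> I n" for m
          using that by (auto simp: I_def intro: order.trans[rotated])
        have [simp]: "finite (I n)" by (rule finI)
        have ca: "(\<lambda>f. f (\<kappa> j)) \<in> borel_measurable (\<Pi>\<^sub>M k\<in>?A. (borel :: real measure))" if "j < l" for j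
          using that by (intro measurable_component_singleton) auto
        have cb: "(\<lambda>f. f k) \<in> borel_measurable (\<Pi>\<^sub>M k\<in>?B. (borel :: real measure))" if "k \<in> ?B" for k
          using that by (intro measurable_component_singleton) auto
        have cs: "(\<lambda>f. \<Sum>k\<in>{..<m} - \<kappa> ` {..<l}. f k) \<in> borel_measurable (\<Pi>\<^sub>M k\<in>?B. (borel :: real measure))"
          if "m \<in> I n" for m
          using sub[OF that] by (intro borel_measurable_sum cb) auto
        have mP: "{f \<in> space (\<Pi>\<^sub>M k\<in>?A. (borel :: real measure)). ?P f} \<in> sets (\<Pi>\<^sub>M k\<in>?A. borel)"
        proof (rule sets.sets_Collect_countable_All)
          fix j
          show "{f \<in> space (\<Pi>\<^sub>M k\<in>?A. (borel :: real measure)). j < l \<longrightarrow> \<bar>f (\<kappa> j) - y j * real n\<bar> \<le> e * real n}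
              \<in> sets (\<Pi>\<^sub>M k\<in>?A. borel)"
          proof (cases "j < l")
            case True
            note [measurable] = ca[OF True]
            have "{f \<in> space (\<Pi>\<^sub>M k\<in>?A. (borel :: real measure)). \<bar>f (\<kappa> j) - y j * real n\<bar> \<le> e * real n}
              \<in> sets (\<Pi>\<^sub>M k\<in>?A. borel)" by measurable
            then show ?thesis using True by simp
          qed simp
        qed
        have mQ: "{f \<in> space (\<Pi>\<^sub>M k\<in>?B. (borel :: real measure)). ?Q f} \<in> sets (\<Pi>\<^sub>M k\<in>?B. borel)"
        proof (intro sets.sets_Collect_conj sets.sets_Collect_finite_All)
          show "{f \<in> space (\<Pi>\<^sub>M k\<in>?B. (borel :: real measure)). f k \<le> g * real n} \<in> sets (\<Pi>\<^sub>M k\<in>?B. borel)"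
            if "k \<in> ?B" for k
          proof -
            note [measurable] = cb[OF that]
            show ?thesis by measurable
          qed
          show "{f \<in> space (\<Pi>\<^sub>M k\<in>?B. (borel :: real measure)).
              \<bar>(\<Sum>k\<in>{..<m} - \<kappa> ` {..<l}. f k) - real m * mu\<bar> \<le> e * real n} \<in> sets (\<Pi>\<^sub>M k\<in>?B. borel)"
            if "m \<in> I n" for m
          proof -
            note [measurable] = cs[OF that]
            show ?thesis by measurable
          qed
        qed auto
        have J: "JE n \<kappa> = {\<omega>\<in>space M. ?P (\<lambda>k\<in>?A. V k \<omega>)}" by (auto simp: JE_def)
        have "(\<Sum>k\<in>{..<m} - \<kappa> ` {..<l}. (\<lambda>k\<in>?B. V k \<omega>) k) = (\<Sum>k\<in>{..<m} - \<kappa> ` {..<l}. V k \<omega>)"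
          if "m \<in> I n" for m \<omega> using sub[OF that] by (intro sum.cong) auto
        then have F: "FE n \<kappa> = {\<omega>\<in>space M. ?Q (\<lambda>k\<in>?B. V k \<omega>)}"
          unfolding FE_def T_def by (intro Collect_cong conj_cong refl ball_cong) auto
        have "JE n \<kappa> \<inter> FE n \<kappa> = {\<omega>\<in>space M. ?P (\<lambda>k\<in>?A. V k \<omega>) \<and> ?Q (\<lambda>k\<in>?B. V k \<omega>)}"
          unfolding J F by blast
        then show ?thesis
          unfolding J F by (simp only:, intro prob_V_indep_blocks mP mQ) auto
      qed
      \<comment> \<open>If \<open>\<kappa>\<close> and \<open>\<kappa>'\<close> differ at
        \<open>j\<close>, the index \<open>\<kappa> j\<close> is missed by all of
        \<open>\<kappa>'\<close>, as the windows are disjoint. The jump there would have to be near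
        \<open>y j * n\<close> and at most \<open>g * n\<close>.\<close>
      have dis: "disjoint_family_on (\<lambda>\<kappa>. JE n \<kappa> \<inter> FE n \<kappa>) (KK n)"
      proof (unfold disjoint_family_on_def, intro ballI impI)
        fix \<kappa> \<kappa>' assume k: "\<kappa> \<in> KK n" "\<kappa>' \<in> KK n" "\<kappa> \<noteq> \<kappa>'"
        then obtain j where j: "j < l" "\<kappa> j \<noteq> \<kappa>' j" unfolding KK_def by (metis PiE_ext lessThan_iff)
        have kj: "\<kappa> j \<in> Blk n j" using k(1) j(1) by (auto simp: KK_def PiE_iff)
        have "\<kappa> j \<notin> \<kappa>' ` {..<l}"
        proof
          assume "\<kappa> j \<in> \<kappa>' ` {..<l}"
          then obtain i where i: "i < l" "\<kappa> j = \<kappa>' i" by auto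
          then have "\<kappa> j \<in> Blk n i" using k(2) by (auto simp: KK_def PiE_iff)
          then have "i = j" using disj[of n i j "\<kappa> j"] elim i j kj by simp
          then show False using i j by simp
        qed
        then have kI: "\<kappa> j \<in> I n - \<kappa>' ` {..<l}" using BlkI[OF j(1)] kj by auto
        show "JE n \<kappa> \<inter> FE n \<kappa> \<inter> (JE n \<kappa>' \<inter> FE n \<kappa>') = {}"
        proof (rule ccontr)
          assume "\<not> ?thesis"
          then obtain \<omega> where w: "\<omega> \<in> JE n \<kappa>" "\<omega> \<in> FE n \<kappa>'" by auto
          have "\<bar>V (\<kappa> j) \<omega> - y j * real n\<bar> \<le> e * real n" using w(1) j(1) by (simp add: JE_def)
          moreover have "V (\<kappa> j) \<omega> \<le> g * real n" using w(2) kI unfolding FE_def by blast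
          ultimately have "(y j - e) * real n \<le> g * real n" by (simp add: abs_le_iff algebra_simps)
          then have "y j - e \<le> g" using elim by simp
          then show False using b(2)[OF j(1)] g by simp
        qed
      qed
      have card: "(e * real n) ^ l \<le> real (card (KK n))"
      proof -
        have "(\<Prod>j<l. e * real n) \<le> (\<Prod>j<l. real (card (Blk n j)))"
        proof (intro prod_mono conjI)
          fix j assume j: "j \<in> {..<l}"
          have "e * real n \<le> lam * u j * real n" using u(1)[of j] j by (intro mult_right_mono) auto
          then have "2 * (e * real n) - 1 \<le> real (card (Blk n j))"
            unfolding Blk_def using e by (intro card_nat_interval_ge) auto
          then show "e * real n \<le> real (card (Blk n j))" using elim by linarith
        qed (use e in auto)
        then show ?thesis by (simp add: KK_def card_PiE)
      qed
      have "c * (real n * tail (real n)) ^ l = (e * real n) ^ l * ((\<Prod>j<l. cj j) * tail (real n) ^ l * (1 / 2))"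
        by (simp add: c_def power_mult_distrib)
      also have "\<dots> \<le> real (card (KK n)) * ((\<Prod>j<l. cj j) * tail (real n) ^ l * (1 / 2))"
        using card cj(1) tail_nonneg by (intro mult_right_mono mult_nonneg_nonneg prod_nonneg) (auto simp: less_imp_le)
      also have "\<dots> = (\<Sum>\<kappa>\<in>KK n. (\<Prod>j<l. cj j) * tail (real n) ^ l * (1 / 2))" by simp
      also have "\<dots> \<le> (\<Sum>\<kappa>\<in>KK n. prob (JE n \<kappa> \<inter> FE n \<kappa>))"
        using PJ PF PJF by (intro sum_mono) (simp only:, intro mult_mono, auto)
      also have "\<dots> = prob (\<Omega> n)"
        unfolding \<Omega>_def using finK dis JV FV sets_V_alg_subset
        by (intro finite_measure_finite_Union[symmetric]) auto
      finally show ?case .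
    qed
  qed
qed

end

section \<open>Rescaled paths\<close>

context compound_poisson
begin

definition rescaled :: "nat \<Rightarrow> 'w \<Rightarrow> skorokhod" where
  "rescaled n \<omega> = mk_path (\<lambda>t. compensated_cp M lam N W (real n * t) \<omega> / real n)"

text \<open>Integer times give finitely many conditions, hence an event of \<open>N_alg\<close>
  amenable to a union bound; monotonicity covers the times between.\<close>

definition N_regular :: "real \<Rightarrow> nat \<Rightarrow> 'w set" where
  "N_regular d n = {\<omega>\<in>space M. \<forall>j\<le>n. \<bar>real (N (real j) \<omega>) - lam * real j\<bar> < d * real n}"

lemma N_regular_sets: "N_regular d n \<in> sets N_alg"
proof -
  have [measurable]: "N (real j) \<in> measurable N_alg (count_space UNIV)" for j by (rule N_measurable_alg) simp
  have 1: "{\<omega>\<in>space N_alg. \<bar>real (N (real j) \<omega>) - a\<bar> < b} \<in> sets N_alg" for j a b by measurable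
  have "{\<omega>\<in>space N_alg. \<forall>j\<in>{..n}. \<bar>real (N (real j) \<omega>) - lam * real j\<bar> < d * real n} \<in> sets N_alg"
    by (intro sets.sets_Collect_finite_All 1) auto
  then show ?thesis by (simp only: N_regular_def space_algs Ball_def atMost_iff)
qed

lemma prob_N_regular:
  assumes "0 < d"
  shows "eventually (\<lambda>n. prob (space M - N_regular d n) \<le> real n powr - p) sequentially"
proof -
  have "space M - N_regular d n = {\<omega>\<in>space M. \<exists>j\<le>n. d * real n \<le> \<bar>real (N (real j) \<omega>) - lam * real j\<bar>}" for n
    unfolding N_regular_def by (auto simp: not_less)
  then show ?thesis using max_poisson_deviation[OF assms, of p] by simp
qed

text \<open>Between consecutive integers the count is squeezed by its neighbours, while the
  compensator changes by at most \<open>lam\<close>.\<close>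

lemma N_regularD:
  assumes w: "\<omega> \<in> N_regular d n" and t: "t \<in> {0..real n}"
  shows "\<bar>real (N t \<omega>) - lam * t\<bar> \<le> d * real n + lam"
proof -
  have sp: "\<omega> \<in> space M" using w by (simp add: N_regular_def)
  have mono: "N s \<omega> \<le> N s' \<omega>" if "0 \<le> s" "s \<le> s'" for s s'
    using mono_onD[OF poisson_path(1)[OF N sp]] that by simp
  have grid: "\<bar>real (N (real j) \<omega>) - lam * real j\<bar> < d * real n" if "j \<le> n" for j
    using w that by (simp add: N_regular_def)
  define j where "j = nat \<lfloor>t\<rfloor>"
  have j: "real j \<le> t" "t < real j + 1" using t by (auto simp: j_def)
  have jn: "j \<le> n"
  proof -
    have "real j \<le> real n" using j t by auto
    then show ?thesis by simp
  qed
  have "lam * t \<le> lam * (real j + 1)" using j lam by (intro mult_left_mono) auto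
  then have lo: "lam * t - lam \<le> lam * real j" by (simp add: algebra_simps)
  have "real (N (real j) \<omega>) \<le> real (N t \<omega>)" using mono[of "real j" t] j by simp
  then have 1: "lam * t - lam - d * real n \<le> real (N t \<omega>)" using grid[OF jn] lo by linarith
  have jt: "lam * real j \<le> lam * t" using j lam by (intro mult_left_mono) auto
  have 2: "real (N t \<omega>) \<le> lam * t + lam + d * real n"
  \<comment> \<open>At the right end there is no next grid time, but then \<open>t\<close> is itself
    the integer \<open>n\<close>.\<close>
  proof (cases "j = n")
    case True
    then have "t = real j" using j t by auto
    then show ?thesis using grid[OF jn] lam by (simp add: abs_less_iff)
  next
    case False
    then have "Suc j \<le> n" using jn by simp
    then have "real (N (real (Suc j)) \<omega>) < lam * real (Suc j) + d * real n" using grid[of "Suc j"] by (simp add: abs_less_iff)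
    moreover have "real (N t \<omega>) \<le> real (N (real (Suc j)) \<omega>)" using mono[of t "real (Suc j)"] j t by simp
    moreover have "lam * real (Suc j) = lam * real j + lam" by (simp add: algebra_simps)
    ultimately show ?thesis using jt by linarith
  qed
  show ?thesis using 1 2 by (simp add: abs_le_iff)
qed

lemma N_regular_le:
  assumes w: "\<omega> \<in> N_regular d n" and d: "d \<le> lam" and t: "t \<in> {0..real n}"
  shows "real (N t \<omega>) \<le> 2 * lam * real n"
proof -
  have sp: "\<omega> \<in> space M" using w by (simp add: N_regular_def)
  have "N t \<omega> \<le> N (real n) \<omega>" using mono_onD[OF poisson_path(1)[OF N sp], of t "real n"] t by auto
  moreover have "\<bar>real (N (real n) \<omega>) - lam * real n\<bar> < d * real n" using w by (simp add: N_regular_def)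
  moreover have "d * real n \<le> lam * real n" using d by (intro mult_right_mono) auto
  ultimately show ?thesis by (simp add: abs_less_iff)
qed

lemma jump_times_ex:
  assumes sp: "\<omega> \<in> space M" and n: "0 < n"
  obtains T where "\<And>k. k \<in> {1..N (real n) \<omega>} \<Longrightarrow> T k \<in> {0<..real n}"
    "\<And>k t. k \<in> {1..N (real n) \<omega>} \<Longrightarrow> t \<in> {0..real n} \<Longrightarrow> k \<le> N t \<omega> \<longleftrightarrow> T k \<le> t"
    "rescaled n \<omega> = mk_path (jump_fun {1..N (real n) \<omega>} (\<lambda>k. T k / real n) (\<lambda>k. W k \<omega> / real n) (- lam * mu))"
proof -
  obtain T where T: "\<And>k. k \<in> {1..N (real n) \<omega>} \<Longrightarrow> T k \<in> {0<..real n}"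
    "\<And>k t. k \<in> {1..N (real n) \<omega>} \<Longrightarrow> t \<in> {0..real n} \<Longrightarrow> k \<le> N t \<omega> \<longleftrightarrow> T k \<le> t"
    using poisson_times[OF N sp of_nat_0_le_iff[of n]] by blast
  have "rescaled n \<omega> = mk_path (jump_fun {1..N (real n) \<omega>} (\<lambda>k. T k / real n) (\<lambda>k. W k \<omega> / real n) (- lam * mu))"
    unfolding rescaled_def expectation_W[symmetric]
    by (intro mk_path_cong compensated_cp_eq_jump_fun[OF N sp n _ T(2)])
  with T show thesis by (rule that)
qed

lemma sum_count:
  assumes sp: "\<omega> \<in> space M" and n: "0 < n" and t: "t \<in> {0..1}"
    and T: "\<And>k t. k \<in> {1..N (real n) \<omega>} \<Longrightarrow> t \<in> {0..real n} \<Longrightarrow> k \<le> N t \<omega> \<longleftrightarrow> T k \<le> t"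
  shows "(\<Sum>k=1..N (real n) \<omega>. (w k / real n) * of_bool (T k / real n \<le> t)) = (\<Sum>k=1..N (real n * t) \<omega>. w k) / real n"
proof -
  have nt: "real n * t \<in> {0..real n}" using t n by (auto intro: mult_left_le)
  have "(\<Sum>k=1..N (real n * t) \<omega>. w k) = (\<Sum>k=1..N (real n) \<omega>. w k * of_bool (T k \<le> real n * t))"
    by (rule sum_upto_count_eq[OF N sp nt T])
  also have "\<dots> / real n = (\<Sum>k=1..N (real n) \<omega>. (w k / real n) * of_bool (T k / real n \<le> t))"
    unfolding sum_divide_distrib using n by (intro sum.cong refl) (simp add: pos_divide_le_eq mult.commute)
  finally show ?thesis by (rule sym)
qed

text \<open>The almost sure event on which arrival times up to \<open>n\<close> are distinct and
  jumps are positive. Distinctness is encoded by one grid without a double cell, the form in which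
  it is proved and applied.\<close>

definition simple_at :: "nat \<Rightarrow> 'w \<Rightarrow> bool" where
  "simple_at n \<omega> \<longleftrightarrow> (\<forall>k. 0 < V k \<omega>) \<and>
    (\<exists>m>0. \<forall>j<m. N (real n * real (Suc j) / real m) \<omega> - N (real n * real j / real m) \<omega> \<le> 1)"

lemma AE_simple_at: "0 < n \<Longrightarrow> AE \<omega> in M. simple_at n \<omega>"
  unfolding simple_at_def
  using V_pos AE_no_double_jumps[OF prob_space_axioms N lam, of "real n"] by (simp add: AE_conj_iff)

lemma simple_jump_times:
  assumes sp: "\<omega> \<in> space M" and n: "0 < n" and simple: "simple_at n \<omega>"
  obtains T where
    "\<forall>k\<in>{1..N (real n) \<omega>}. \<forall>t\<in>{0..real n}. k \<le> N t \<omega> \<longleftrightarrow> T k \<le> t"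
    "rescaled n \<omega> = mk_path (jump_fun {1..N (real n) \<omega>} (\<lambda>k. T k / real n) (\<lambda>k. W k \<omega> / real n) (- lam * mu))"
    "inj_on (\<lambda>k. T k / real n) {1..N (real n) \<omega>}" "(\<lambda>k. T k / real n) ` {1..N (real n) \<omega>} \<subseteq> {0<..1}"
    "\<forall>k\<in>{1..N (real n) \<omega>}. 0 < W k \<omega>"
proof -
  obtain T where T: "\<And>k. k \<in> {1..N (real n) \<omega>} \<Longrightarrow> T k \<in> {0<..real n}"
    "\<And>k t. k \<in> {1..N (real n) \<omega>} \<Longrightarrow> t \<in> {0..real n} \<Longrightarrow> k \<le> N t \<omega> \<longleftrightarrow> T k \<le> t"
    and R: "rescaled n \<omega> = mk_path (jump_fun {1..N (real n) \<omega>} (\<lambda>k. T k / real n) (\<lambda>k. W k \<omega> / real n) (- lam * mu))"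
    using jump_times_ex[OF sp n] by blast
  obtain m where m: "0 < m" "\<And>j. j < m \<Longrightarrow> N (real n * real (Suc j) / real m) \<omega> - N (real n * real j / real m) \<omega> \<le> 1"
    using simple unfolding simple_at_def by blast
  let ?K = "{1..N (real n) \<omega>}" and ?u = "\<lambda>k. T k / real n" and ?w = "\<lambda>k. W k \<omega> / real n"
  have injT: "inj_on T ?K"
    by (rule counting_times_inj[of "\<lambda>t. N t \<omega>" "real n", OF T _ m]) (use n in simp_all)
  have inj: "inj_on ?u ?K"
  proof (rule inj_onI)
    fix a b assume ab: "a \<in> ?K" "b \<in> ?K" "?u a = ?u b"
    then have "T a = T b" using n by simp
    then show "a = b" using inj_onD[OF injT _ ab(1,2)] by simp
  qed
  have u01: "?u ` ?K \<subseteq> {0<..1}" using T(1) n by (auto simp: pos_divide_le_eq)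
  have Wpos: "0 < W k \<omega>" if "k \<in> ?K" for k
    using simple[unfolded simple_at_def, THEN conjunct1, rule_format, of "k - 1"] that by (simp add: V_def)
  show thesis
  proof (rule that[OF _ R inj u01])
    show "\<forall>k\<in>?K. \<forall>t\<in>{0..real n}. k \<le> N t \<omega> \<longleftrightarrow> T k \<le> t"
      by (intro ballI T(2))
    show "\<forall>k\<in>?K. 0 < W k \<omega>" by (intro ballI Wpos)
  qed
qed

text \<open>The drift is continuous and, arrivals being distinct, no two jumps merge; path jumps and
  summands therefore correspond one to one.\<close>

lemma card_jumps_rescaled:
  assumes sp: "\<omega> \<in> space M" and n: "0 < n" and simple: "simple_at n \<omega>" and g: "0 < g"
  shows "card {t\<in>{0<..1}. g < jump (rescaled n \<omega>) t} = card {k. k < N (real n) \<omega> \<and> g * real n < V k \<omega>}"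
proof -
  obtain T where T: "\<forall>k\<in>{1..N (real n) \<omega>}. \<forall>t\<in>{0..real n}. k \<le> N t \<omega> \<longleftrightarrow> T k \<le> t"
    and R: "rescaled n \<omega> = mk_path (jump_fun {1..N (real n) \<omega>} (\<lambda>k. T k / real n) (\<lambda>k. W k \<omega> / real n) (- lam * mu))"
    and inj: "inj_on (\<lambda>k. T k / real n) {1..N (real n) \<omega>}" and u01: "(\<lambda>k. T k / real n) ` {1..N (real n) \<omega>} \<subseteq> {0<..1}"
    and Wpos: "\<forall>k\<in>{1..N (real n) \<omega>}. 0 < W k \<omega>"
    by (rule simple_jump_times[OF sp n simple])
  let ?J = "{k\<in>{1..N (real n) \<omega>}. g < W k \<omega> / real n}"
  have "card {t\<in>{0<..1}. g < jump (rescaled n \<omega>) t} = card ?J"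
    unfolding R using g by (intro card_jumps_jump_fun inj u01) auto
  also have "?J = Suc ` {k. k < N (real n) \<omega> \<and> g * real n < V k \<omega>}"
  proof (intro set_eqI iffI)
    fix k assume "k \<in> ?J"
    then have "k = Suc (k - 1)" "k - 1 \<in> {k. k < N (real n) \<omega> \<and> g * real n < V k \<omega>}"
      using n by (auto simp: V_def pos_less_divide_eq)
    then show "k \<in> Suc ` {k. k < N (real n) \<omega> \<and> g * real n < V k \<omega>}" by blast
  qed (use n in \<open>auto simp: V_def pos_less_divide_eq\<close>)
  also have "card \<dots> = card {k. k < N (real n) \<omega> \<and> g * real n < V k \<omega>}" by (simp add: card_image)
  finally show ?thesis .
qed

text \<open>Removing the jumps above the level leaves the compensated sum of truncated jumps.\<close>

lemma rescaled_near_step: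
  assumes sp: "\<omega> \<in> space M" and n: "0 < n" and simple: "simple_at n \<omega>"
    and reg: "\<omega> \<in> N_regular d2 n" and d2: "0 \<le> d2" "d2 \<le> lam" and g: "0 < g"
    and dev: "\<And>m. real m \<le> 2 * lam * real n \<Longrightarrow> \<bar>(\<Sum>k<m. trunc (g * real n) (V k \<omega>)) - real m * mu\<bar> \<le> d1 * real n"
  shows "\<exists>\<zeta>\<in>D_eq (card {t\<in>{0<..1}. g < jump (rescaled n \<omega>) t}). dist (rescaled n \<omega>) \<zeta> \<le> d1 + mu * (d2 + lam / real n)"
proof -
  obtain T where T: "\<forall>k\<in>{1..N (real n) \<omega>}. \<forall>t\<in>{0..real n}. k \<le> N t \<omega> \<longleftrightarrow> T k \<le> t"
    and R: "rescaled n \<omega> = mk_path (jump_fun {1..N (real n) \<omega>} (\<lambda>k. T k / real n) (\<lambda>k. W k \<omega> / real n) (- lam * mu))"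
    and inj: "inj_on (\<lambda>k. T k / real n) {1..N (real n) \<omega>}" and u01: "(\<lambda>k. T k / real n) ` {1..N (real n) \<omega>} \<subseteq> {0<..1}"
    and Wpos: "\<forall>k\<in>{1..N (real n) \<omega>}. 0 < W k \<omega>"
    by (rule simple_jump_times[OF sp n simple])
  let ?K = "{1..N (real n) \<omega>}" and ?u = "\<lambda>k. T k / real n" and ?w = "\<lambda>k. W k \<omega> / real n"
  let ?J = "{k\<in>?K. g < ?w k}"
  have cJ: "card {t\<in>{0<..1}. g < jump (rescaled n \<omega>) t} = card ?J"
    unfolding R using inj u01 g by (intro card_jumps_jump_fun) auto
  have z: "mk_path (jump_fun ?J ?u ?w 0) \<in> D_eq (card ?J)"
  proof (rule jump_fun_D_eq)
    show "inj_on ?u ?J" using inj by (rule inj_on_subset) auto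
    show "?u ` ?J \<subseteq> {0<..1}" using u01 by blast
    show "0 < ?w k" if "k \<in> ?J" for k using that g by simp
  qed simp
  have d1: "0 \<le> d1"
  proof -
    have "\<bar>(\<Sum>k<0. trunc (g * real n) (V k \<omega>)) - real 0 * mu\<bar> \<le> d1 * real n" using lam by (intro dev) simp
    then show ?thesis using n by (simp add: zero_le_mult_iff)
  qed
  have "dist (mk_path (jump_fun ?K ?u ?w (- lam * mu))) (mk_path (jump_fun ?J ?u ?w 0)) \<le> d1 + mu * (d2 + lam / real n)"
  proof (rule dist_mk_path_le_sup[OF cadlag_jump_fun cadlag_jump_fun])
    show "0 \<le> d1 + mu * (d2 + lam / real n)" using d1 d2 mu_nonneg lam by simp
    fix t :: real assume t: "t \<in> {0..1}"
    have nt: "real n * t \<in> {0..real n}" using t n by (auto intro: mult_left_le)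
    let ?m = "N (real n * t) \<omega>"
    have "(\<Sum>k\<in>?K. ?w k * of_bool (?u k \<le> t)) - (\<Sum>k\<in>?J. ?w k * of_bool (?u k \<le> t)) =
        (\<Sum>k\<in>?K - ?J. ?w k * of_bool (?u k \<le> t))"
      by (subst sum_diff) auto
    also have "\<dots> = (\<Sum>k\<in>?K. (trunc (g * real n) (W k \<omega>) / real n) * of_bool (?u k \<le> t))"
      using Wpos n by (intro sum.mono_neutral_cong_left) (auto simp: trunc_def pos_divide_le_eq not_less split: if_splits)
    also have "\<dots> = (\<Sum>k=1..?m. trunc (g * real n) (W k \<omega>)) / real n"
      by (rule sum_count[OF sp n t T[rule_format]])
    also have "(\<Sum>k=1..?m. trunc (g * real n) (W k \<omega>)) = (\<Sum>k<?m. trunc (g * real n) (V k \<omega>))"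
      by (rule sum_W_eq_V)
    finally have "jump_fun ?K ?u ?w (- lam * mu) t - jump_fun ?J ?u ?w 0 t =
        (\<Sum>k<?m. trunc (g * real n) (V k \<omega>)) / real n - lam * mu * t"
      unfolding jump_fun_def by (simp del: sum_mult_of_bool_eq)
    \<comment> \<open>Centring by the actual number of jumps splits the deviation into fluctuations
      of the sizes and \<open>mu\<close> times the fluctuation of the count.\<close>
    also have "\<dots> = ((\<Sum>k<?m. trunc (g * real n) (V k \<omega>)) - real ?m * mu) / real n +
        mu * ((real ?m - lam * (real n * t)) / real n)"
      using n by (simp add: field_simps)
    also have "\<bar>\<dots>\<bar> \<le> d1 + mu * (d2 + lam / real n)"
    proof (rule order.trans[OF abs_triangle_ineq add_mono])
      have "\<bar>(\<Sum>k<?m. trunc (g * real n) (V k \<omega>)) - real ?m * mu\<bar> \<le> d1 * real n"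
        by (rule dev[OF N_regular_le[OF reg d2(2) nt]])
      then show "\<bar>((\<Sum>k<?m. trunc (g * real n) (V k \<omega>)) - real ?m * mu) / real n\<bar> \<le> d1"
        using n by (simp add: pos_divide_le_eq)
      have "\<bar>real ?m - lam * (real n * t)\<bar> \<le> d2 * real n + lam" by (rule N_regularD[OF reg nt])
      then have "\<bar>real ?m - lam * (real n * t)\<bar> / real n \<le> (d2 * real n + lam) / real n"
        by (rule divide_right_mono) simp
      also have "\<dots> = d2 + lam / real n" using n by (simp add: add_divide_distrib)
      finally have "\<bar>(real ?m - lam * (real n * t)) / real n\<bar> \<le> d2 + lam / real n" by simp
      then show "\<bar>mu * ((real ?m - lam * (real n * t)) / real n)\<bar> \<le> mu * (d2 + lam / real n)"
        unfolding abs_mult[of mu] abs_of_nonneg[OF mu_nonneg]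
          by (rule mult_left_mono[OF _ mu_nonneg])
    qed
    finally show "\<bar>jump_fun ?K ?u ?w (- lam * mu) t - jump_fun ?J ?u ?w 0 t\<bar> \<le> d1 + mu * (d2 + lam / real n)" .
  qed
  then show ?thesis
    unfolding cJ unfolding R by (rule bexI[OF _ z])
qed

text \<open>Regularity of the counts translates windows of indices into windows of times: an index
  within \<open>e * n\<close> of \<open>lam * u j * n\<close> arrives within \<open>\<rho>\<close>
  of \<open>u j\<close> after scaling. Outside these jumps the compensated sums are small by
  assumption.\<close>

lemma rescaled_near_given_step:
  fixes u y :: "nat \<Rightarrow> real"
  assumes sp: "\<omega> \<in> space M" and n: "0 < n" and u: "\<And>j. j < l \<Longrightarrow> u j < 1"
    and reg: "\<omega> \<in> N_regular e n" and e: "0 < e" "e \<le> lam" and r: "0 < \<rho>" "4 * e \<le> lam * \<rho>" "2 * (lam + 1) \<le> lam * \<rho> * real n"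
    and \<rho>: "\<And>j. j < l \<Longrightarrow> u j + \<rho> \<le> 1"
    and inj: "inj_on \<kappa> {..<l}"
    and k: "\<And>j. j < l \<Longrightarrow> \<bar>real (\<kappa> j) - lam * u j * real n\<bar> \<le> e * real n"
    and sums: "\<And>m. real m \<le> 2 * lam * real n \<Longrightarrow> \<bar>(\<Sum>k\<in>{..<m} - \<kappa> ` {..<l}. V k \<omega>) - real m * mu\<bar> \<le> e * real n"
  obtains g u' where "rescaled n \<omega> = mk_path g" "cadlag g" "\<And>j. j < l \<Longrightarrow> \<bar>u' j - u j\<bar> \<le> \<rho>"
    "\<And>t. t \<in> {0..1} \<Longrightarrow> \<bar>g t - (\<Sum>j<l. V (\<kappa> j) \<omega> / real n * of_bool (u' j \<le> t))\<bar> \<le> e + mu * (e + lam / real n)"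
proof -
  obtain T where T: "\<And>k. k \<in> {1..N (real n) \<omega>} \<Longrightarrow> T k \<in> {0<..real n}"
    "\<And>k t. k \<in> {1..N (real n) \<omega>} \<Longrightarrow> t \<in> {0..real n} \<Longrightarrow> k \<le> N t \<omega> \<longleftrightarrow> T k \<le> t"
    and R: "rescaled n \<omega> = mk_path (jump_fun {1..N (real n) \<omega>} (\<lambda>k. T k / real n) (\<lambda>k. W k \<omega> / real n) (- lam * mu))"
    using jump_times_ex[OF sp n] by blast
  let ?K = "{1..N (real n) \<omega>}" and ?u = "\<lambda>k. T k / real n" and ?w = "\<lambda>k. W k \<omega> / real n"
  \<comment> \<open>Room for the index error, the count error, its loss \<open>lam\<close> between
    integers, and 1 for the shift from \<open>\<kappa> j\<close> to
    \<open>Suc (\<kappa> j)\<close>.\<close>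
  have big: "e * real n + e * real n + lam + 1 \<le> lam * \<rho> * real n"
  proof -
    have "4 * e * real n \<le> lam * \<rho> * real n" using r(2) by (intro mult_right_mono) auto
    then show ?thesis using r(3) by simp
  qed
  have kn: "Suc (\<kappa> j) \<le> N (real n * (u j + \<rho>)) \<omega>" "real n * (u j + \<rho>) \<in> {0..real n}" if j: "j < l" "0 \<le> u j + \<rho>" for j
  proof -
    have "real n * (u j + \<rho>) \<le> real n * 1" using \<rho>[OF j(1)] by (intro mult_left_mono) auto
    then show t: "real n * (u j + \<rho>) \<in> {0..real n}" using j(2) by simp
    have "\<bar>real (N (real n * (u j + \<rho>)) \<omega>) - lam * (real n * (u j + \<rho>))\<bar> \<le> e * real n + lam" by (rule N_regularD[OF reg t])
    moreover have "lam * (real n * (u j + \<rho>)) = lam * u j * real n + lam * \<rho> * real n" by (simp add: algebra_simps)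
    ultimately have "real (Suc (\<kappa> j)) \<le> real (N (real n * (u j + \<rho>)) \<omega>)" using k[OF j(1)] big by linarith
    then show "Suc (\<kappa> j) \<le> N (real n * (u j + \<rho>)) \<omega>" by (simp only: of_nat_le_iff)
  qed
  \<comment> \<open>If \<open>u j + \<rho>\<close> were negative, the window would force the index
    \<open>\<kappa> j\<close> below zero.\<close>
  have u0: "0 \<le> u j + \<rho>" if j: "j < l" for j
  proof (rule ccontr)
    assume "\<not> 0 \<le> u j + \<rho>"
    then have "lam * (u j + \<rho>) * real n \<le> 0" using lam by (simp add: mult_le_0_iff)
    then have "lam * u j * real n + lam * \<rho> * real n \<le> 0" by (simp add: algebra_simps)
    moreover have "0 \<le> real (\<kappa> j)" "0 \<le> e * real n" using e by auto
    ultimately show False using k[OF j] big lam by linarith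
  qed
  have kK: "Suc (\<kappa> j) \<in> ?K" if j: "j < l" for j
  proof -
    have "N (real n * (u j + \<rho>)) \<omega> \<le> N (real n) \<omega>"
      using mono_onD[OF poisson_path(1)[OF N sp], of "real n * (u j + \<rho>)" "real n"] kn(2)[OF j u0[OF j]] by auto
    then show ?thesis using kn(1)[OF j u0[OF j]] by simp
  qed
  define u' where "u' j = T (Suc (\<kappa> j)) / real n" for j
  have u': "\<bar>u' j - u j\<bar> \<le> \<rho>" if j: "j < l" for j
  proof -
    have "T (Suc (\<kappa> j)) \<le> real n * (u j + \<rho>)" using T(2)[OF kK[OF j] kn(2)[OF j u0[OF j]]] kn(1)[OF j u0[OF j]] by simp
    then have 1: "u' j \<le> u j + \<rho>" unfolding u'_def using n by (simp add: pos_divide_le_eq mult.commute)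
    have 2: "u j - \<rho> \<le> u' j"
    proof (rule ccontr)
      assume "\<not> ?thesis"
      then have "T (Suc (\<kappa> j)) / real n < u j - \<rho>" unfolding u'_def by linarith
      then have lt: "T (Suc (\<kappa> j)) < real n * (u j - \<rho>)"
        using n by (simp only: pos_divide_less_eq of_nat_0_less_iff mult.commute)
      have "real n * (u j - \<rho>) \<le> real n * 1" using u[OF j] r by (intro mult_left_mono) auto
      then have t: "real n * (u j - \<rho>) \<in> {0..real n}" using lt T(1)[OF kK[OF j]] by auto
      have "Suc (\<kappa> j) \<le> N (real n * (u j - \<rho>)) \<omega>" using T(2)[OF kK[OF j] t] lt by simp
      then have "real (Suc (\<kappa> j)) \<le> real (N (real n * (u j - \<rho>)) \<omega>)" by (rule of_nat_mono)
      moreover have "\<bar>real (N (real n * (u j - \<rho>)) \<omega>) - lam * (real n * (u j - \<rho>))\<bar> \<le> e * real n + lam" by (rule N_regularD[OF reg t])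
      moreover have "lam * (real n * (u j - \<rho>)) = lam * u j * real n - lam * \<rho> * real n" by (simp add: algebra_simps)
      ultimately show False using k[OF j] big by linarith
    qed
    show ?thesis using 1 2 by (simp add: abs_le_iff)
  qed
  have rem: "\<bar>jump_fun ?K ?u ?w (- lam * mu) t - (\<Sum>j<l. V (\<kappa> j) \<omega> / real n * of_bool (u' j \<le> t))\<bar> \<le> e + mu * (e + lam / real n)"
    if t: "t \<in> {0..1}" for t
  proof -
    have nt: "real n * t \<in> {0..real n}" using t n by (auto intro: mult_left_le)
    let ?m = "N (real n * t) \<omega>"
    define I where "I = (\<lambda>j. Suc (\<kappa> j)) ` {..<l}"
    have IK: "I \<subseteq> ?K" using kK by (auto simp: I_def)
    have "inj_on (\<lambda>j. Suc (\<kappa> j)) {..<l}" using inj by (auto simp: inj_on_def)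
    then have SI: "(\<Sum>j<l. V (\<kappa> j) \<omega> / real n * of_bool (u' j \<le> t)) = (\<Sum>k\<in>I. ?w k * of_bool (?u k \<le> t))"
      unfolding I_def by (subst sum.reindex) (simp_all add: V_def u'_def del: sum_mult_of_bool_eq)
    have "(\<Sum>k\<in>?K. ?w k * of_bool (?u k \<le> t)) - (\<Sum>k\<in>I. ?w k * of_bool (?u k \<le> t)) =
        (\<Sum>k\<in>?K - I. ?w k * of_bool (?u k \<le> t))"
      using IK by (subst sum_diff) auto
    also have "\<dots> = (\<Sum>k\<in>?K. ((if k \<in> I then 0 else W k \<omega>) / real n) * of_bool (?u k \<le> t))"
      by (intro sum.mono_neutral_cong_left) (auto split: if_splits)
    also have "\<dots> = (\<Sum>k=1..?m. (if k \<in> I then 0 else W k \<omega>)) / real n"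
      by (rule sum_count[OF sp n t T(2)])
    also have "(\<Sum>k=1..?m. (if k \<in> I then 0 else W k \<omega>)) = (\<Sum>k<?m. if k \<in> \<kappa> ` {..<l} then 0 else V k \<omega>)"
      unfolding One_nat_def sum.atLeast1_atMost_eq
      by (intro sum.cong refl) (auto simp: V_def I_def)
    also have "\<dots> = (\<Sum>k\<in>{..<?m} - \<kappa> ` {..<l}. V k \<omega>)"
      by (intro sum.mono_neutral_cong_right) auto
    finally have "jump_fun ?K ?u ?w (- lam * mu) t - (\<Sum>j<l. V (\<kappa> j) \<omega> / real n * of_bool (u' j \<le> t)) =
        (\<Sum>k\<in>{..<?m} - \<kappa> ` {..<l}. V k \<omega>) / real n - lam * mu * t"
      unfolding SI jump_fun_def by (simp del: sum_mult_of_bool_eq)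
    also have "\<dots> = ((\<Sum>k\<in>{..<?m} - \<kappa> ` {..<l}. V k \<omega>) - real ?m * mu) / real n +
        mu * ((real ?m - lam * (real n * t)) / real n)"
      using n by (simp add: diff_divide_distrib add_divide_distrib algebra_simps)
    also have "\<bar>\<dots>\<bar> \<le> e + mu * (e + lam / real n)"
    proof (rule order.trans[OF abs_triangle_ineq add_mono])
      have "\<bar>(\<Sum>k\<in>{..<?m} - \<kappa> ` {..<l}. V k \<omega>) - real ?m * mu\<bar> \<le> e * real n"
        by (rule sums[OF N_regular_le[OF reg e(2) nt]])
      then show "\<bar>((\<Sum>k\<in>{..<?m} - \<kappa> ` {..<l}. V k \<omega>) - real ?m * mu) / real n\<bar> \<le> e"
        unfolding abs_divide using n by (simp only: abs_of_nat pos_divide_le_eq of_nat_0_less_iff)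
      have "\<bar>real ?m - lam * (real n * t)\<bar> \<le> e * real n + lam" by (rule N_regularD[OF reg nt])
      then have "\<bar>real ?m - lam * (real n * t)\<bar> / real n \<le> (e * real n + lam) / real n"
        by (rule divide_right_mono) simp
      also have "\<dots> = e + lam / real n" using n by (simp add: add_divide_distrib)
      finally have "\<bar>(real ?m - lam * (real n * t)) / real n\<bar> \<le> e + lam / real n" by simp
      then show "\<bar>mu * ((real ?m - lam * (real n * t)) / real n)\<bar> \<le> mu * (e + lam / real n)"
        unfolding abs_mult[of mu] abs_of_nonneg[OF mu_nonneg]
          by (rule mult_left_mono[OF _ mu_nonneg])
    qed
    finally show ?thesis .
  qed
  show thesis using R cadlag_jump_fun u' rem by (rule that)
qed

end

section \<open>Strong efficiency\<close>

text \<open>The estimator is \<open>1 / w\<close> on \<open>A - B\<close> and \<open>1 / c\<close>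
  on \<open>A \<inter> B\<close>, where \<open>c\<close> is the density of the mixture on
  \<open>B\<close>. One factor \<open>c\<close> cancels against the sampling measure, and
  \<open>1 / c\<close> is at most \<open>P(B) / (1 - w)\<close>.\<close>

lemma estimator_second_moment:
  assumes M: "prob_space M" and A: "A \<in> sets M" and B: "B \<in> sets M" and w: "0 < w" "w < 1"
  shows "0 \<le> (\<integral>\<omega>. (estimator w M A B \<omega>)\<^sup>2 \<partial>mixture w M B)"
    "(\<integral>\<omega>. (estimator w M A B \<omega>)\<^sup>2 \<partial>mixture w M B) \<le>
      measure M (A - B) / w + measure M A * measure M B / (1 - w)"
proof -
  interpret prob_space M by fact
  let ?Q = "mixture w M B"
  define c where "c = w + (1 - w) / prob B"
  have c: "w \<le> c" "0 < c" using w by (auto simp: c_def intro: add_pos_nonneg)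
  show "0 \<le> (\<integral>\<omega>. (estimator w M A B \<omega>)\<^sup>2 \<partial>?Q)" by (rule integral_nonneg_AE) simp
  have AB: "A - B \<in> sets M" "A \<inter> B \<in> sets M" using A B by auto
  have u1: "emeasure (uniform_measure M B) (A - B) = 0"
  proof -
    have "B \<inter> (A - B) = {}" by auto
    then show ?thesis using B AB by simp
  qed
  have Q1: "emeasure ?Q (A - B) = ennreal (w * prob (A - B))"
    using w by (simp add: emeasure_mixture[OF AB(1)] u1 emeasure_eq_measure ennreal_mult)
  \<comment> \<open>For a null set \<open>B\<close> division by zero makes \<open>c = w\<close> and
    conditioning yields the zero measure, so this case is separate and contributes nothing.\<close>
  have Q2: "emeasure ?Q (A \<inter> B) = ennreal (prob (A \<inter> B) * (if prob B = 0 then 0 else c))"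
  proof (cases "prob B = 0")
    case True
    then have "prob (A \<inter> B) = 0"
      using finite_measure_mono[of "A \<inter> B" B] B by (simp add: measure_le_0_iff)
    moreover have "B \<inter> (A \<inter> B) = A \<inter> B" by auto
    ultimately have "emeasure M (A \<inter> B) = 0" "emeasure (uniform_measure M B) (A \<inter> B) = 0"
      using B AB by (simp_all add: emeasure_eq_measure)
    then show ?thesis using True by (simp add: emeasure_mixture[OF AB(2)])
  next
    case False
    then have B0: "0 < prob B" by (simp add: zero_less_measure_iff)
    have e: "B \<inter> (A \<inter> B) = A \<inter> B" by auto
    have "emeasure (uniform_measure M B) (A \<inter> B) = ennreal (prob (A \<inter> B) / prob B)"
      using B AB B0 by (simp add: e emeasure_eq_measure divide_ennreal)
    then have "emeasure ?Q (A \<inter> B) = ennreal w * ennreal (prob (A \<inter> B)) + ennreal (1 - w) * ennreal (prob (A \<inter> B) / prob B)"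
      by (simp add: emeasure_mixture[OF AB(2)] emeasure_eq_measure)
    also have "\<dots> = ennreal (w * prob (A \<inter> B) + (1 - w) * (prob (A \<inter> B) / prob B))"
      using w by (simp add: ennreal_mult[symmetric] ennreal_plus[symmetric] del: ennreal_plus)
    also have "w * prob (A \<inter> B) + (1 - w) * (prob (A \<inter> B) / prob B) = prob (A \<inter> B) * c"
      by (simp add: c_def algebra_simps)
    finally show ?thesis using False by simp
  qed
  have m1: "measure ?Q (A - B) = w * prob (A - B)" using Q1 w by (simp add: measure_def)
  have m2: "measure ?Q (A \<inter> B) \<le> prob (A \<inter> B) * c"
    using Q2 c by (simp add: measure_def)
  have fin1: "emeasure ?Q (A - B) < \<infinity>" "emeasure ?Q (A \<inter> B) < \<infinity>" unfolding Q1 Q2 by simp_all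
  have "(\<integral>\<omega>. (estimator w M A B \<omega>)\<^sup>2 \<partial>?Q) =
      (\<integral>\<omega>. indicator (A - B) \<omega> * (1 / w)\<^sup>2 + indicator (A \<inter> B) \<omega> * (1 / c)\<^sup>2 \<partial>?Q)"
    by (intro Bochner_Integration.integral_cong refl) (auto simp: estimator_def c_def indicator_def)
  also have "\<dots> = measure ?Q (A - B) * (1 / w)\<^sup>2 + measure ?Q (A \<inter> B) * (1 / c)\<^sup>2"
  proof -
    have i: "integrable ?Q (indicator (A - B) :: _ \<Rightarrow> real)" "integrable ?Q (indicator (A \<inter> B) :: _ \<Rightarrow> real)"
      using fin1 AB by (auto intro!: integrable_real_indicator)
    have "space ?Q \<inter> (A - B) = A - B" "space ?Q \<inter> (A \<inter> B) = A \<inter> B"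
      using sets.sets_into_space[OF A] by auto
    then show ?thesis using i by (simp add: Int_commute)
  qed
  also have "\<dots> \<le> w * prob (A - B) * (1 / w)\<^sup>2 + prob (A \<inter> B) * c * (1 / c)\<^sup>2"
    using m1 m2 by (intro add_mono mult_right_mono) auto
  also have "\<dots> = prob (A - B) / w + prob (A \<inter> B) * (1 / c)"
    using w c by (simp add: power2_eq_square)
  also have "\<dots> \<le> prob (A - B) / w + prob A * prob B / (1 - w)"
  proof -
    have "prob (A \<inter> B) * (1 / c) \<le> prob A * (prob B / (1 - w))"
    proof (cases "prob B = 0")
      case True
      then have "prob (A \<inter> B) = 0"
        using finite_measure_mono[of "A \<inter> B" B] B by (simp add: measure_le_0_iff)
      then show ?thesis using w by simp
    next
      case False
      then have B0: "0 < prob B" by (simp add: zero_less_measure_iff)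
      have le: "(1 - w) / prob B \<le> c" using w by (simp add: c_def)
      have "0 < (1 - w) / prob B" using w B0 by simp
      then have "1 / c \<le> 1 / ((1 - w) / prob B)"
        by (intro divide_left_mono[OF le] mult_pos_pos c) auto
      then have "1 / c \<le> prob B / (1 - w)" by simp
      moreover have "prob (A \<inter> B) \<le> prob A" using A by (intro finite_measure_mono) auto
      ultimately show ?thesis using c by (intro mult_mono) auto
    qed
    then show ?thesis by simp
  qed
  finally show "(\<integral>\<omega>. (estimator w M A B \<omega>)\<^sup>2 \<partial>?Q) \<le> prob (A - B) / w + prob A * prob B / (1 - w)" .
qed

lemma eventually_const_over_n_le: "0 < b \<Longrightarrow> eventually (\<lambda>n. a / real n \<le> b) sequentially"
proof -
  assume "0 < b"
  then have "eventually (\<lambda>n. a / real n < b) sequentially"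
    by (rule order_tendstoD(2)[OF lim_const_over_n])
  then show ?thesis by eventually_elim simp
qed

section \<open>Estimates for one rescaled coordinate\<close>

context heavy_tailed
begin

text \<open>Arrival event and jump-size event are returned separately, so that joint independence
  can multiply them over all coordinates.\<close>

lemma rescaled_hits_ball:
  fixes u y :: "nat \<Rightarrow> real"
  assumes u: "inj_on u {..<l}" "u ` {..<l} \<subseteq> {0<..<1}" and y: "\<And>j. j < l \<Longrightarrow> 0 < y j" and d: "0 < d"
  obtains c E F where "0 < c" "\<And>n. E n \<in> sets N_alg" "\<And>n. F n \<in> sets V_alg"
    "eventually (\<lambda>n. c * (real n * tail (real n)) ^ l \<le> prob (E n) * prob (F n)) sequentially"
    "eventually (\<lambda>n. \<forall>\<omega>\<in>E n \<inter> F n. dist (rescaled n \<omega>) (step_path l u y) < d) sequentially"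
proof -
  obtain a where a: "0 < a" and near: "\<And>g u' y'. cadlag g \<Longrightarrow> (\<forall>j<l. \<bar>u' j - u j\<bar> \<le> a \<and> \<bar>y' j - y j\<bar> \<le> a) \<Longrightarrow>
    (\<forall>t\<in>{0..1}. \<bar>g t - (\<Sum>j<l. y' j * of_bool (u' j \<le> t))\<bar> \<le> a) \<Longrightarrow> dist (mk_path g) (step_path l u y) < d"
    using step_path_nbhd[OF u d] by blast
  have u01: "0 < u j" "u j < 1" if "j < l" for j using u(2) that by auto
  obtain r1 where r1: "0 < r1" "\<And>j. j < l \<Longrightarrow> r1 \<le> 1 - u j"
    using finite_positive_lower_bound[of "{..<l}" "\<lambda>j. 1 - u j"] u01 by auto
  define \<rho> where "\<rho> = min a r1"
  have \<rho>: "0 < \<rho>" "\<rho> \<le> a" "\<rho> \<le> r1" using a r1 by (auto simp: \<rho>_def)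
  obtain e1 where e1: "0 < e1" "\<And>j. j < l \<Longrightarrow> e1 \<le> lam * u j"
    using finite_positive_lower_bound[of "{..<l}" "\<lambda>j. lam * u j"] u01 lam by auto
  obtain e2 where e2: "0 < e2" "\<And>j. j < l \<Longrightarrow> e2 \<le> y j / 2"
    using finite_positive_lower_bound[of "{..<l}" "\<lambda>j. y j / 2"] y by auto
  have "\<exists>e>0. \<forall>p\<in>{p. fst p < l \<and> snd p < l \<and> fst p \<noteq> snd p}. e \<le> \<bar>lam * u (fst p) - lam * u (snd p)\<bar> / 3"
  proof (rule finite_positive_lower_bound)
    show "finite {p. fst p < l \<and> snd p < l \<and> fst p \<noteq> snd p}"
      by (rule finite_subset[of _ "{..<l} \<times> {..<l}"]) auto
    show "0 < \<bar>lam * u (fst p) - lam * u (snd p)\<bar> / 3" if "p \<in> {p. fst p < l \<and> snd p < l \<and> fst p \<noteq> snd p}" for p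
      using that inj_onD[OF u(1), of "fst p" "snd p"] lam by auto
  qed
  then obtain e3 where e3: "0 < e3" "\<And>i j. i < l \<Longrightarrow> j < l \<Longrightarrow> i \<noteq> j \<Longrightarrow> e3 \<le> \<bar>lam * u i - lam * u j\<bar> / 3" by force
  \<comment> \<open>The bounds serve, in turn, the counts, the conversion of indices to times,
    positions and sizes bounded away from 0, separated windows, and a path error at most
    \<open>a / 2\<close>. The other half of \<open>a\<close> absorbs the term of order
    \<open>1 / n\<close>.\<close>
  define e where "e = min (min (min lam (lam * \<rho> / 4)) (min e1 e2)) (min e3 (a / (2 * (1 + mu))))"
  have e: "0 < e" "e \<le> lam" "e \<le> lam * \<rho> / 4" "e \<le> e1" "e \<le> e2" "e \<le> e3" "e \<le> a / (2 * (1 + mu))"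
  proof -
    have "0 < lam * \<rho> / 4" "0 < a / (2 * (1 + mu))" using lam \<rho> a mu_nonneg by auto
    then show "0 < e" unfolding e_def using lam e1(1) e2(1) e3(1) by (simp only: min_less_iff_conj simp_thms)
  qed (simp_all only: e_def min_le_iff_disj order_refl simp_thms)
  have ea: "e * (1 + mu) \<le> a / 2"
    using e(7) mu_nonneg by (simp add: field_simps)
  have ea': "e \<le> a"
  proof -
    have "0 \<le> e * mu" "e * (1 + mu) = e + e * mu" using e(1) mu_nonneg by (auto simp: algebra_simps)
    then show ?thesis using ea a by linarith
  qed
  have sep: "2 * e < \<bar>lam * u i - lam * u j\<bar>" if "i < l" "j < l" "i \<noteq> j" for i j
  proof -
    have "2 * e < 3 * e" using e(1) by simp
    also have "\<dots> \<le> 3 * (\<bar>lam * u i - lam * u j\<bar> / 3)"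
      using order.trans[OF e(6) e3(2)[OF that]] by (intro mult_left_mono) auto
    finally show ?thesis by simp
  qed
  have lamu: "lam * u j < lam" if "j < l" for j using u01[OF that] lam by simp
  obtain c \<Omega> where c: "0 < c" "\<And>n. \<Omega> n \<in> sets V_alg"
    "eventually (\<lambda>n. c * (real n * tail (real n)) ^ l \<le> prob (\<Omega> n)) sequentially"
    and \<Omega>: "\<And>n \<omega>. 0 < n \<Longrightarrow> \<omega> \<in> \<Omega> n \<Longrightarrow> \<exists>\<kappa>. inj_on \<kappa> {..<l} \<and>
      (\<forall>j<l. \<bar>real (\<kappa> j) - lam * u j * real n\<bar> \<le> e * real n \<and> \<bar>V (\<kappa> j) \<omega> - y j * real n\<bar> \<le> e * real n) \<and>
      (\<forall>m. real m \<le> 2 * lam * real n \<longrightarrow> \<bar>(\<Sum>k\<in>{..<m} - \<kappa> ` {..<l}. V k \<omega>) - real m * mu\<bar> \<le> e * real n)"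
  proof (rule big_jumps_lower[of "2 * lam" e l u y])
    show "e \<le> lam * u j" if "j < l" for j using e1(2)[OF that] e(4) by linarith
    show "lam * u j + e \<le> 2 * lam" if "j < l" for j using lamu[OF that] e(2) by linarith
    show "e < y j" if "j < l" for j using e2(2)[OF that] e(5) y[OF that] by linarith
  qed (use lam e(1) sep in auto)
  show thesis
  proof
    show "0 < c / 2" using c by simp
    show "N_regular e n \<in> sets N_alg" for n by (rule N_regular_sets)
    show "\<Omega> n \<in> sets V_alg" for n by (rule c(2))
    \<comment> \<open>The halved constant reflects that the count is regular with probability at
      least 1/2 for large \<open>n\<close>.\<close>
    show "eventually (\<lambda>n. c / 2 * (real n * tail (real n)) ^ l \<le> prob (N_regular e n) * prob (\<Omega> n)) sequentially"
      using c(3) prob_N_regular[OF e(1), of 1] eventually_ge_at_top[of 2]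
    proof eventually_elim
      case (elim n)
      have "N_regular e n \<in> events" using N_regular_sets sets_N_alg_subset by blast
      then have "prob (space M - N_regular e n) = 1 - prob (N_regular e n)" by (rule prob_compl)
      moreover have "real n powr - 1 \<le> 1 / 2" using elim(3) by (simp add: powr_minus_divide)
      ultimately have "1 / 2 \<le> prob (N_regular e n)" using elim(2) by linarith
      then have "1 / 2 * (c * (real n * tail (real n)) ^ l) \<le> prob (N_regular e n) * prob (\<Omega> n)"
        using elim(1) c(1) tail_nonneg by (intro mult_mono) auto
      then show ?case by simp
    qed
    have n1: "eventually (\<lambda>n. mu * lam / real n \<le> a / 2) sequentially"
      using a by (intro eventually_const_over_n_le) simp
    have n2: "eventually (\<lambda>n. 2 * (lam + 1) / real n \<le> lam * \<rho>) sequentially"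
      using lam \<rho> by (intro eventually_const_over_n_le) simp
    show "eventually (\<lambda>n. \<forall>\<omega>\<in>N_regular e n \<inter> \<Omega> n. dist (rescaled n \<omega>) (step_path l u y) < d) sequentially"
      using n1 n2 eventually_gt_at_top[of 0]
    proof eventually_elim
      case (elim n)
      show ?case
      proof
        fix \<omega> assume w: "\<omega> \<in> N_regular e n \<inter> \<Omega> n"
        then have sp: "\<omega> \<in> space M" and reg: "\<omega> \<in> N_regular e n" by (auto simp: N_regular_def)
        obtain \<kappa> where k: "inj_on \<kappa> {..<l}"
          "\<forall>j<l. \<bar>real (\<kappa> j) - lam * u j * real n\<bar> \<le> e * real n \<and> \<bar>V (\<kappa> j) \<omega> - y j * real n\<bar> \<le> e * real n"
          "\<forall>m. real m \<le> 2 * lam * real n \<longrightarrow> \<bar>(\<Sum>k\<in>{..<m} - \<kappa> ` {..<l}. V k \<omega>) - real m * mu\<bar> \<le> e * real n"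
          using \<Omega>[of n \<omega>] elim(3) w by blast
        have nl: "2 * (lam + 1) \<le> lam * \<rho> * real n" using elim(2,3) by (simp add: pos_divide_le_eq)
        obtain g u' where g: "rescaled n \<omega> = mk_path g" "cadlag g" "\<And>j. j < l \<Longrightarrow> \<bar>u' j - u j\<bar> \<le> \<rho>"
          "\<And>t. t \<in> {0..1} \<Longrightarrow> \<bar>g t - (\<Sum>j<l. V (\<kappa> j) \<omega> / real n * of_bool (u' j \<le> t))\<bar> \<le> e + mu * (e + lam / real n)"
        proof (rule rescaled_near_given_step[OF sp elim(3) _ reg e(1,2) \<rho>(1) _ nl _ k(1)])
          show "u j < 1" if "j < l" for j using u01[OF that] by simp
          show "4 * e \<le> lam * \<rho>" using e(3) by simp
          show "u j + \<rho> \<le> 1" if "j < l" for j using r1(2)[OF that] \<rho>(3) by linarith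
        qed (use k(2,3) in auto)
        have y': "\<bar>V (\<kappa> j) \<omega> / real n - y j\<bar> \<le> a" if "j < l" for j
        proof -
          have "\<bar>V (\<kappa> j) \<omega> - y j * real n\<bar> / real n \<le> e * real n / real n"
            using k(2) that by (intro divide_right_mono) auto
          moreover have "\<bar>V (\<kappa> j) \<omega> - y j * real n\<bar> / real n = \<bar>V (\<kappa> j) \<omega> / real n - y j\<bar>"
          proof -
            have "V (\<kappa> j) \<omega> / real n - y j = (V (\<kappa> j) \<omega> - y j * real n) / real n" using elim(3) by (simp add: field_simps)
            then show ?thesis by (simp add: abs_divide)
          qed
          ultimately show ?thesis using ea' elim(3) by simp
        qed
        have "e + mu * (e + lam / real n) = e * (1 + mu) + mu * lam / real n" by (simp add: algebra_simps)
        then have le: "e + mu * (e + lam / real n) \<le> a" using ea elim(1) by linarith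
        show "dist (rescaled n \<omega>) (step_path l u y) < d"
          unfolding g(1)
        proof (rule near[OF g(2), of u' "\<lambda>j. V (\<kappa> j) \<omega> / real n"])
          show "\<forall>j<l. \<bar>u' j - u j\<bar> \<le> a \<and> \<bar>V (\<kappa> j) \<omega> / real n - y j\<bar> \<le> a"
            using g(3) \<rho>(2) y' by (meson order.trans)
          show "\<forall>t\<in>{0..1}. \<bar>g t - (\<Sum>j<l. V (\<kappa> j) \<omega> / real n * of_bool (u' j \<le> t))\<bar> \<le> a"
            using g(4) le by (meson order.trans)
        qed
      qed
    qed
  qed
qed

text \<open>The order of choice matters: distance \<open>d\<close> and power \<open>p\<close> come
  first, and the admissible truncation levels depend on them.\<close>

lemma rescaled_near_big_jumps:
  assumes d: "0 < d" and p: "0 < p"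
  obtains g0 where "0 < g0" "\<And>g. 0 < g \<Longrightarrow> g \<le> g0 \<Longrightarrow> \<exists>K>0. \<exists>Bd. (\<forall>n. Bd n \<in> events) \<and>
    eventually (\<lambda>n. prob (Bd n) \<le> K * real n powr - p) sequentially \<and>
    eventually (\<lambda>n. AE \<omega> in M. \<omega> \<notin> Bd n \<longrightarrow>
      (\<exists>\<zeta>\<in>D_eq (card {t\<in>{0<..1}. g < jump (rescaled n \<omega>) t}). dist (rescaled n \<omega>) \<zeta> < d)) sequentially"
proof -
  \<comment> \<open>Size fluctuations, count fluctuations and the term of order \<open>1 / n\<close>
    receive a quarter of \<open>d\<close> each, which leaves strict inequality.\<close>
  define d1 where "d1 = d / 4"
  define d2 where "d2 = min lam (d / (4 * (mu + 1)))"
  have d2: "0 < d2" "d2 \<le> lam" "d2 \<le> d / (4 * (mu + 1))" using d lam mu_nonneg by (auto simp: d2_def)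
  have "mu * d2 \<le> (mu + 1) * (d / (4 * (mu + 1)))" using d2 mu_nonneg by (intro mult_mono) auto
  also have "\<dots> = d / 4" using mu_nonneg by (simp add: field_simps)
  finally have mud2: "mu * d2 \<le> d / 4" .
  obtain g0 where g0: "0 < g0" and dev: "\<And>g. 0 < g \<Longrightarrow> g \<le> g0 \<Longrightarrow> \<exists>K>0. eventually (\<lambda>n.
    prob {\<omega>\<in>space M. \<exists>m. real m \<le> 2 * lam * real n \<and> d1 * real n \<le> \<bar>(\<Sum>k<m. trunc (g * real n) (V k \<omega>)) - real m * mu\<bar>}
      \<le> K * real n powr - p) sequentially"
    using max_trunc_sum_deviation[of d1 "2 * lam" p] d lam p unfolding d1_def by auto
  show thesis
  proof (rule that[OF g0])
    fix g assume g: "0 < g" "g \<le> g0"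
    define D where "D n = {\<omega>\<in>space M. \<exists>m. real m \<le> 2 * lam * real n \<and> d1 * real n \<le> \<bar>(\<Sum>k<m. trunc (g * real n) (V k \<omega>)) - real m * mu\<bar>}" for n
    obtain K where K: "0 < K" "eventually (\<lambda>n. prob (D n) \<le> K * real n powr - p) sequentially"
      using dev[OF g] unfolding D_def by blast
    have Dm: "D n \<in> events" for n unfolding D_def by measurable
    have Rm: "space M - N_regular d2 n \<in> events" for n using N_regular_sets sets_N_alg_subset by blast
    show "\<exists>K>0. \<exists>Bd. (\<forall>n. Bd n \<in> events) \<and>
      eventually (\<lambda>n. prob (Bd n) \<le> K * real n powr - p) sequentially \<and>
      eventually (\<lambda>n. AE \<omega> in M. \<omega> \<notin> Bd n \<longrightarrow>
        (\<exists>\<zeta>\<in>D_eq (card {t\<in>{0<..1}. g < jump (rescaled n \<omega>) t}). dist (rescaled n \<omega>) \<zeta> < d)) sequentially"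
    proof (intro exI[of _ "K + 1"] exI[of _ "\<lambda>n. D n \<union> (space M - N_regular d2 n)"] conjI allI)
      show "0 < K + 1" using K by simp
      show "D n \<union> (space M - N_regular d2 n) \<in> events" for n using Dm Rm by blast
      show "eventually (\<lambda>n. prob (D n \<union> (space M - N_regular d2 n)) \<le> (K + 1) * real n powr - p) sequentially"
        using K(2) prob_N_regular[OF d2(1), of p]
      proof eventually_elim
        case (elim n)
        have "prob (D n \<union> (space M - N_regular d2 n)) \<le> prob (D n) + prob (space M - N_regular d2 n)"
          by (rule measure_Un_le[OF Dm Rm])
        then show ?case using elim by (simp add: algebra_simps)
      qed
      have "eventually (\<lambda>n. mu * lam / real n \<le> d / 4) sequentially"
        using d by (intro eventually_const_over_n_le) simp
      then show "eventually (\<lambda>n. AE \<omega> in M. \<omega> \<notin> D n \<union> (space M - N_regular d2 n) \<longrightarrow>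
        (\<exists>\<zeta>\<in>D_eq (card {t\<in>{0<..1}. g < jump (rescaled n \<omega>) t}). dist (rescaled n \<omega>) \<zeta> < d)) sequentially"
        using eventually_gt_at_top[of 0]
      proof eventually_elim
        case (elim n)
        have lt: "d1 + mu * (d2 + lam / real n) < d"
        proof -
          have "mu * (d2 + lam / real n) = mu * d2 + mu * lam / real n" by (simp add: algebra_simps)
          then show ?thesis using mud2 elim(1) d unfolding d1_def by linarith
        qed
        show ?case using AE_simple_at[OF elim(2)] AE_space
        proof eventually_elim
          case w: (elim \<omega>)
          show ?case
          proof
            assume n: "\<omega> \<notin> D n \<union> (space M - N_regular d2 n)"
            then have reg: "\<omega> \<in> N_regular d2 n" using w(2) by simp
            have "\<bar>(\<Sum>k<m. trunc (g * real n) (V k \<omega>)) - real m * mu\<bar> \<le> d1 * real n" if "real m \<le> 2 * lam * real n" for m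
            proof (rule ccontr)
              assume "\<not> ?thesis"
              then have "d1 * real n \<le> \<bar>(\<Sum>k<m. trunc (g * real n) (V k \<omega>)) - real m * mu\<bar>" by linarith
              then have "\<omega> \<in> D n" using that w(2) unfolding D_def by blast
              then show False using n by simp
            qed
            from rescaled_near_step[OF w(2) elim(2) w(1) reg less_imp_le[OF d2(1)] d2(2) g(1) this]
            show "\<exists>\<zeta>\<in>D_eq (card {t\<in>{0<..1}. g < jump (rescaled n \<omega>) t}). dist (rescaled n \<omega>) \<zeta> < d"
              using lt by (meson order.strict_trans1)
          qed
        qed
      qed
    qed
  qed
qed

text \<open>On regular counts there are at most \<open>2 * lam * n\<close> jumps. Replacing the
  random count by this number gives an event of \<open>V_alg\<close>, which can be multiplied over
  coordinates; irregular counts go into \<open>Bd\<close>.\<close>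

lemma rescaled_jump_count:
  assumes g: "0 < g"
  obtains K Bd F where "0 < K" "\<And>n. Bd n \<in> events" "\<And>n. F n \<in> sets V_alg"
    "eventually (\<lambda>n. prob (Bd n) \<le> real n powr - p) sequentially"
    "eventually (\<lambda>n. prob (F n) \<le> K * (real n * tail (real n)) ^ l) sequentially"
    "eventually (\<lambda>n. AE \<omega> in M. l \<le> card {t\<in>{0<..1}. g < jump (rescaled n \<omega>) t} \<longrightarrow> \<omega> \<in> Bd n \<or> \<omega> \<in> F n) sequentially"
proof -
  define m where "m n = nat \<lfloor>2 * lam * real n\<rfloor>" for n :: nat
  define F where "F n = {\<omega>\<in>space M. l \<le> card {k. k < m n \<and> g * real n < V k \<omega>}}" for n
  define K where "K = g powr - \<beta> + 1"
  have K: "0 < K" by (simp add: K_def add_nonneg_pos)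
  have "((\<lambda>x. tail (g * x) / tail x) \<longlongrightarrow> g powr - \<beta>) at_top" by (rule tail_lim[OF g])
  then have "eventually (\<lambda>x. tail (g * x) / tail x < K) at_top"
    by (rule order_tendstoD) (simp add: K_def)
  then have "eventually (\<lambda>x. tail (g * x) \<le> K * tail x) at_top"
    using tail_pos by eventually_elim (simp add: pos_divide_less_eq less_imp_le)
  from eventually_compose_filterlim[OF this filterlim_real_sequentially]
  have tK: "eventually (\<lambda>n. tail (g * real n) \<le> K * tail (real n)) sequentially" .
  show thesis
  proof (rule that)
    show "0 < (2 * lam * K) ^ l" using lam K by simp
    show "space M - N_regular lam n \<in> events" for n using N_regular_sets sets_N_alg_subset by blast
    show "eventually (\<lambda>n. prob (space M - N_regular lam n) \<le> real n powr - p) sequentially"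
      by (rule prob_N_regular[OF lam])
    show "F n \<in> sets V_alg" for n
    proof -
      have 1: "{\<omega>\<in>space V_alg. g * real n < V k \<omega>} \<in> sets V_alg" for k by measurable
      \<comment> \<open>Having at least \<open>l\<close> large jumps means that all jumps with
        indices in some \<open>l\<close>-element set are large: a finite combination of measurable
        conditions.\<close>
      have "{\<omega>\<in>space V_alg. \<exists>J\<in>{J. J \<subseteq> {..<m n} \<and> card J = l}. \<forall>k\<in>J. g * real n < V k \<omega>} \<in> sets V_alg"
        by (intro sets.sets_Collect_finite_Ex sets.sets_Collect_finite_All 1)
           (auto intro: finite_subset finite_subset[of _ "Pow {..<m n}"])
      also have "{\<omega>\<in>space V_alg. \<exists>J\<in>{J. J \<subseteq> {..<m n} \<and> card J = l}. \<forall>k\<in>J. g * real n < V k \<omega>} = F n"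
      proof (intro set_eqI iffI)
        fix \<omega> assume w: "\<omega> \<in> F n"
        then obtain J where "J \<subseteq> {k. k < m n \<and> g * real n < V k \<omega>}" "card J = l"
          unfolding F_def using obtain_subset_with_card_n by blast
        then show "\<omega> \<in> {\<omega>\<in>space V_alg. \<exists>J\<in>{J. J \<subseteq> {..<m n} \<and> card J = l}. \<forall>k\<in>J. g * real n < V k \<omega>}"
          using w by (auto simp: F_def)
      next
        fix \<omega> assume w: "\<omega> \<in> {\<omega>\<in>space V_alg. \<exists>J\<in>{J. J \<subseteq> {..<m n} \<and> card J = l}. \<forall>k\<in>J. g * real n < V k \<omega>}"
        then obtain J where J: "J \<subseteq> {..<m n}" "card J = l" "\<forall>k\<in>J. g * real n < V k \<omega>" by blast
        then have "card J \<le> card {k. k < m n \<and> g * real n < V k \<omega>}" by (intro card_mono) auto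
        then show "\<omega> \<in> F n" using J w by (simp add: F_def)
      qed
      finally show ?thesis .
    qed
    show "eventually (\<lambda>n. prob (F n) \<le> (2 * lam * K) ^ l * (real n * tail (real n)) ^ l) sequentially"
      using tK
    proof eventually_elim
      case (elim n)
      have "prob (F n) \<le> (real (m n) * tail (g * real n)) ^ l" unfolding F_def by (rule many_big_jumps_le)
      also have "\<dots> \<le> ((2 * lam * real n) * (K * tail (real n))) ^ l"
        using elim lam tail_nonneg by (intro power_mono mult_mono) (auto simp: m_def of_nat_floor)
      also have "\<dots> = (2 * lam * K) ^ l * (real n * tail (real n)) ^ l"
        by (simp add: power_mult_distrib mult_ac)
      finally show ?case .
    qed
    show "eventually (\<lambda>n. AE \<omega> in M. l \<le> card {t\<in>{0<..1}. g < jump (rescaled n \<omega>) t} \<longrightarrow>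
        \<omega> \<in> space M - N_regular lam n \<or> \<omega> \<in> F n) sequentially"
      using eventually_gt_at_top[of 0]
    proof eventually_elim
      case (elim n)
      show ?case using AE_simple_at[OF elim] AE_space
      proof eventually_elim
        case w: (elim \<omega>)
        show ?case
        proof
          assume l: "l \<le> card {t\<in>{0<..1}. g < jump (rescaled n \<omega>) t}"
          show "\<omega> \<in> space M - N_regular lam n \<or> \<omega> \<in> F n"
          proof (cases "\<omega> \<in> N_regular lam n")
            case True
            have "real (N (real n) \<omega>) \<le> 2 * lam * real n"
              by (rule N_regular_le[OF True order_refl]) simp
            then have Nm: "N (real n) \<omega> \<le> m n" by (simp add: m_def le_nat_floor)
            have "l \<le> card {k. k < N (real n) \<omega> \<and> g * real n < V k \<omega>}"
              using l card_jumps_rescaled[OF w(2) elim w(1) g] by simp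
            also have "\<dots> \<le> card {k. k < m n \<and> g * real n < V k \<omega>}"
              using Nm by (intro card_mono) auto
            finally show ?thesis using w(2) by (simp add: F_def)
          qed (use w(2) in simp)
        qed
      qed
    qed
  qed
qed

text \<open>Together with \<open>rate_lower\<close>, brackets the expected number of jumps of size
  \<open>n\<close> between powers whose exponents differ by an arbitrarily small amount.\<close>

lemma rate_upper:
  assumes e: "0 < e" "e \<le> 1"
  obtains C where "0 < C" "eventually (\<lambda>n. real n * tail (real n) \<le> C * real n powr - (\<beta> - 1 - e)) sequentially"
proof -
  obtain C where C: "0 < C" "eventually (\<lambda>x. tail x \<le> C * x powr - (\<beta> - e)) at_top"
    using tail_poly_upper[of "\<beta> - e"] e beta by auto
  from eventually_compose_filterlim[OF C(2) filterlim_real_sequentially]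
  have "eventually (\<lambda>n. real n * tail (real n) \<le> C * real n powr - (\<beta> - 1 - e)) sequentially"
    using eventually_gt_at_top[of 0]
  proof eventually_elim
    case (elim n)
    have "real n * tail (real n) \<le> real n powr 1 * (C * real n powr - (\<beta> - e))"
      using elim by (intro mult_mono) (auto simp: tail_nonneg)
    also have "\<dots> = C * (real n powr 1 * real n powr - (\<beta> - e))" by (simp only: mult_ac)
    also have "real n powr 1 * real n powr - (\<beta> - e) = real n powr - (\<beta> - 1 - e)"
      unfolding powr_add[symmetric] by (rule arg_cong[where f="\<lambda>z. real n powr z"]) simp
    finally show ?case .
  qed
  then show thesis using C(1) that by blast
qed

lemma rate_lower:
  assumes e: "0 < e"
  obtains c where "0 < c" "eventually (\<lambda>n. c * real n powr - (\<beta> - 1 + e) \<le> real n * tail (real n)) sequentially"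
proof -
  obtain c where c: "0 < c" "eventually (\<lambda>x. c * x powr - (\<beta> + e) \<le> tail x) at_top"
    using tail_poly_lower[of "\<beta> + e"] e by auto
  from eventually_compose_filterlim[OF c(2) filterlim_real_sequentially]
  have "eventually (\<lambda>n. c * real n powr - (\<beta> - 1 + e) \<le> real n * tail (real n)) sequentially"
    using eventually_gt_at_top[of 0]
  proof eventually_elim
    case (elim n)
    have "real n powr - (\<beta> - 1 + e) = real n powr 1 * real n powr - (\<beta> + e)"
      unfolding powr_add[symmetric] by (rule arg_cong[where f="\<lambda>z. real n powr z"]) simp
    then have "c * real n powr - (\<beta> - 1 + e) = real n * (c * real n powr - (\<beta> + e))" using elim by simp
    also have "\<dots> \<le> real n * tail (real n)" using elim by (intro mult_left_mono) auto
    finally show ?case .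
  qed
  then show thesis using c(1) that by blast
qed

end

section \<open>Comparison of products of rates\<close>

lemma prod_powr_eq:
  fixes C a :: "'d::finite \<Rightarrow> real"
  assumes "0 < x"
  shows "(\<Prod>i\<in>UNIV. (C i * x powr - a i) ^ l i) = (\<Prod>i\<in>UNIV. C i ^ l i) * x powr - (\<Sum>i\<in>UNIV. a i * real (l i))"
proof -
  have "(\<Prod>i\<in>UNIV. (C i * x powr - a i) ^ l i) = (\<Prod>i\<in>UNIV. C i ^ l i * x powr (- (a i * real (l i))))"
    using assms by (intro prod.cong refl) (simp add: power_mult_distrib powr_power mult.commute)
  also have "\<dots> = (\<Prod>i\<in>UNIV. C i ^ l i) * x powr (\<Sum>i\<in>UNIV. - (a i * real (l i)))"
    using assms by (simp add: prod.distrib powr_sum)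
  finally show ?thesis by (simp add: sum_negf)
qed

lemma prod_rate_lower:
  fixes v :: "'d::finite \<Rightarrow> nat \<Rightarrow> real" and a :: "'d \<Rightarrow> real"
  assumes "\<And>i. \<exists>c>0. eventually (\<lambda>n. c * real n powr - a i \<le> v i n) sequentially"
  shows "\<exists>c>0. eventually (\<lambda>n. c * real n powr - (\<Sum>i\<in>UNIV. a i * real (l i)) \<le> (\<Prod>i\<in>UNIV. v i n ^ l i)) sequentially"
proof -
  have "\<forall>i. \<exists>c. 0 < c \<and> eventually (\<lambda>n. c * real n powr - a i \<le> v i n) sequentially" using assms by blast
  from choice[OF this] obtain c where c: "\<forall>i. 0 < c i \<and> eventually (\<lambda>n. c i * real n powr - a i \<le> v i n) sequentially" ..
  then have "\<And>i. eventually (\<lambda>n. c i * real n powr - a i \<le> v i n) sequentially" by simp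
  then have "eventually (\<lambda>n. \<forall>i. c i * real n powr - a i \<le> v i n) sequentially" by (rule eventually_all_finite)
  then have "eventually (\<lambda>n. (\<Prod>i\<in>UNIV. c i ^ l i) * real n powr - (\<Sum>i\<in>UNIV. a i * real (l i)) \<le> (\<Prod>i\<in>UNIV. v i n ^ l i)) sequentially"
    using eventually_gt_at_top[of 0]
  proof eventually_elim
    case (elim n)
    have "(\<Prod>i\<in>UNIV. (c i * real n powr - a i) ^ l i) \<le> (\<Prod>i\<in>UNIV. v i n ^ l i)"
      using elim c by (intro prod_mono conjI power_mono) (auto simp: less_imp_le)
    then show ?case using elim by (simp add: prod_powr_eq)
  qed
  moreover have "0 < (\<Prod>i\<in>UNIV. c i ^ l i)" using c by (intro prod_pos) auto
  ultimately show ?thesis by blast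
qed

lemma prod_rate_upper:
  fixes v :: "'d::finite \<Rightarrow> nat \<Rightarrow> real" and a :: "'d \<Rightarrow> real"
  assumes "\<And>i. \<exists>C>0. eventually (\<lambda>n. v i n \<le> C * real n powr - a i) sequentially" and v: "\<And>i n. 0 \<le> v i n"
  shows "\<exists>C>0. eventually (\<lambda>n. (\<Prod>i\<in>UNIV. v i n ^ l i) \<le> C * real n powr - (\<Sum>i\<in>UNIV. a i * real (l i))) sequentially"
proof -
  have "\<forall>i. \<exists>c. 0 < c \<and> eventually (\<lambda>n. v i n \<le> c * real n powr - a i) sequentially" using assms by blast
  from choice[OF this] obtain c where c: "\<forall>i. 0 < c i \<and> eventually (\<lambda>n. v i n \<le> c i * real n powr - a i) sequentially" ..
  then have "\<And>i. eventually (\<lambda>n. v i n \<le> c i * real n powr - a i) sequentially" by simp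
  then have "eventually (\<lambda>n. \<forall>i. v i n \<le> c i * real n powr - a i) sequentially" by (rule eventually_all_finite)
  then have "eventually (\<lambda>n. (\<Prod>i\<in>UNIV. v i n ^ l i) \<le> (\<Prod>i\<in>UNIV. c i ^ l i) * real n powr - (\<Sum>i\<in>UNIV. a i * real (l i))) sequentially"
    using eventually_gt_at_top[of 0]
  proof eventually_elim
    case (elim n)
    have "(\<Prod>i\<in>UNIV. v i n ^ l i) \<le> (\<Prod>i\<in>UNIV. (c i * real n powr - a i) ^ l i)"
      using elim v by (intro prod_mono conjI power_mono) auto
    then show ?case using elim by (simp add: prod_powr_eq)
  qed
  moreover have "0 < (\<Prod>i\<in>UNIV. c i ^ l i)" using c by (intro prod_pos) auto
  ultimately show ?thesis by blast
qed

text \<open>A strict gap in cost outweighs the slack \<open>e\<close> in all exponents once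
  \<open>e\<close> times the total number of jumps in both vectors is at most the gap.\<close>

lemma rate_comparison:
  fixes v :: "'d::finite \<Rightarrow> nat \<Rightarrow> real"
  assumes up: "\<And>i e. 0 < e \<Longrightarrow> e \<le> 1 \<Longrightarrow> \<exists>C>0. eventually (\<lambda>n. v i n \<le> C * real n powr - (\<beta> i - 1 - e)) sequentially"
    and lo: "\<And>i e. 0 < e \<Longrightarrow> \<exists>c>0. eventually (\<lambda>n. c * real n powr - (\<beta> i - 1 + e) \<le> v i n) sequentially"
    and v: "\<And>i n. 0 \<le> v i n" and less: "cost \<beta> l' < cost \<beta> l"
  shows "\<exists>K>0. eventually (\<lambda>n. (\<Prod>i\<in>UNIV. v i n ^ l i) \<le> K * (\<Prod>i\<in>UNIV. v i n ^ l' i)) sequentially"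
proof -
  define s where "s = (\<Sum>i\<in>UNIV. real (l i)) + (\<Sum>i\<in>UNIV. real (l' i))"
  have s: "0 \<le> s" by (auto simp: s_def intro!: add_nonneg_nonneg sum_nonneg)
  \<comment> \<open>The denominator exceeds the total \<open>s\<close> by 1 to avoid division by
    zero; the cap 1 is the range of the upper rate bound.\<close>
  define e where "e = min 1 ((cost \<beta> l - cost \<beta> l') / (s + 1))"
  have e: "0 < e" "e \<le> 1" using less s by (auto simp: e_def)
  have "e * s \<le> cost \<beta> l - cost \<beta> l'"
  proof -
    have "e * s \<le> e * (s + 1)" using e by simp
    also have "\<dots> \<le> (cost \<beta> l - cost \<beta> l') / (s + 1) * (s + 1)"
      using s by (intro mult_right_mono) (auto simp: e_def)
    finally show ?thesis using s by simp
  qed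
  then have le: "(\<Sum>i\<in>UNIV. (\<beta> i - 1 + e) * real (l' i)) \<le> (\<Sum>i\<in>UNIV. (\<beta> i - 1 - e) * real (l i))"
    by (simp add: cost_def s_def algebra_simps sum.distrib sum_subtractf sum_distrib_left)
  obtain C where C: "0 < C" "eventually (\<lambda>n. (\<Prod>i\<in>UNIV. v i n ^ l i) \<le> C * real n powr - (\<Sum>i\<in>UNIV. (\<beta> i - 1 - e) * real (l i))) sequentially"
    using prod_rate_upper[of v "\<lambda>i. \<beta> i - 1 - e" l] up[OF e] v by blast
  obtain c where c: "0 < c" "eventually (\<lambda>n. c * real n powr - (\<Sum>i\<in>UNIV. (\<beta> i - 1 + e) * real (l' i)) \<le> (\<Prod>i\<in>UNIV. v i n ^ l' i)) sequentially"
    using prod_rate_lower[of "\<lambda>i. \<beta> i - 1 + e" v l'] lo[OF e(1)] by blast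
  have "eventually (\<lambda>n. (\<Prod>i\<in>UNIV. v i n ^ l i) \<le> C / c * (\<Prod>i\<in>UNIV. v i n ^ l' i)) sequentially"
    using C(2) c(2) eventually_ge_at_top[of 1]
  proof eventually_elim
    case (elim n)
    have "C * real n powr - (\<Sum>i\<in>UNIV. (\<beta> i - 1 - e) * real (l i)) \<le> C * real n powr - (\<Sum>i\<in>UNIV. (\<beta> i - 1 + e) * real (l' i))"
      using le C elim by (intro mult_left_mono powr_mono) auto
    also have "\<dots> = C / c * (c * real n powr - (\<Sum>i\<in>UNIV. (\<beta> i - 1 + e) * real (l' i)))" using c by simp
    also have "\<dots> \<le> C / c * (\<Prod>i\<in>UNIV. v i n ^ l' i)" using elim C c by (intro mult_left_mono) auto
    finally show ?case using elim(1) by linarith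
  qed
  moreover have "0 < C / c" using C c by simp
  ultimately show ?thesis by blast
qed

section \<open>Independence across coordinates\<close>

lemma indep_families_prob:
  fixes N :: "'d::finite \<Rightarrow> real \<Rightarrow> 'w \<Rightarrow> nat"
  assumes M: "prob_space M" and ind: "indep_families M N W"
    and E: "\<And>i. E i \<in> gen_sigma M {0..} (N i) (count_space UNIV)" and F: "\<And>i. F i \<in> gen_sigma M {1..} (W i) borel"
  shows "measure M (\<Inter>i. E i \<inter> F i) = (\<Prod>i\<in>UNIV. measure M (E i) * measure M (F i))"
proof -
  interpret prob_space M by fact
  have "prob (\<Inter>j\<in>UNIV. case_sum E F j) = (\<Prod>j\<in>UNIV. prob (case_sum E F j))"
    using E F by (intro indep_setsD[OF ind[unfolded indep_families_def]]) (auto split: sum.split)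
  also have "(\<Inter>j\<in>UNIV. case_sum E F j) = (\<Inter>i. E i \<inter> F i)"
  proof (intro set_eqI iffI)
    fix x assume "x \<in> (\<Inter>j\<in>UNIV. case_sum E F j)"
    then have "x \<in> case_sum E F (Inl i)" "x \<in> case_sum E F (Inr i)" for i by blast+
    then show "x \<in> (\<Inter>i. E i \<inter> F i)" by simp
  next
    fix x assume "x \<in> (\<Inter>i. E i \<inter> F i)"
    then show "x \<in> (\<Inter>j\<in>UNIV. case_sum E F j)" by (auto split: sum.split)
  qed
  also have "(\<Prod>j\<in>UNIV. prob (case_sum E F j)) = (\<Prod>i\<in>UNIV. prob (E i)) * (\<Prod>i\<in>UNIV. prob (F i))"
    unfolding UNIV_Plus_UNIV[symmetric] by (subst prod.Plus) (auto simp: comp_def)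
  finally show ?thesis by (simp add: prod.distrib)
qed

lemma heavy_tailed_of_families:
  fixes N :: "'d::finite \<Rightarrow> real \<Rightarrow> 'w \<Rightarrow> nat"
  assumes M: "prob_space M" and ind: "indep_families M N W" and "0 < lam i" "poisson_process M (lam i) (N i)"
    "positive_iid M (W i)" "1 < \<beta> i"
    "regularly_varying (\<lambda>x. measure M {\<omega>\<in>space M. compensated_cp M (lam i) (N i) (W i) 1 \<omega> > x}) (- \<beta> i)"
  shows "heavy_tailed M (lam i) (N i) (W i) (\<beta> i)"
proof -
  interpret prob_space M by fact
  have "prob (E \<inter> F) = prob E * prob F"
    if "E \<in> gen_sigma M {0..} (N i) (count_space UNIV)" "F \<in> gen_sigma M {1..} (W i) borel" for E F
  proof -
    have "prob (\<Inter>j\<in>{Inl i, Inr i}. case_sum (\<lambda>_. E) (\<lambda>_. F) j) = (\<Prod>j\<in>{Inl i, Inr i}. prob (case_sum (\<lambda>_. E) (\<lambda>_. F) j))"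
      using that by (intro indep_setsD[OF ind[unfolded indep_families_def]]) auto
    then show ?thesis by simp
  qed
  then show ?thesis using assms
    by (intro heavy_tailed.intro compound_poisson.intro compound_poisson_axioms.intro heavy_tailed_axioms.intro)
qed

text \<open>A finite positive number lies below the infimum even if the latter is infinite, so an
  empty set causes no exception.\<close>

lemma bounded_awayD:
  assumes "bounded_away A S"
  obtains d where "0 < d" "\<And>x y. x \<in> A \<Longrightarrow> y \<in> S \<Longrightarrow> d \<le> max_dist x y"
proof -
  have "0 < (INF x\<in>A. INF y\<in>S. ereal (max_dist x y))" using assms by (simp add: bounded_away_def)
  then obtain d where d: "0 < ereal d" "ereal d < (INF x\<in>A. INF y\<in>S. ereal (max_dist x y))"
    using ereal_dense2 by blast
  show thesis
  proof
    show "0 < d" using d(1) by simp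
    fix x y assume xy: "x \<in> A" "y \<in> S"
    have "(INF x\<in>A. INF y\<in>S. ereal (max_dist x y)) \<le> ereal (max_dist x y)"
      using xy by (meson INF_lower2 INF_lower)
    then have "ereal d < ereal (max_dist x y)" using d(2) by (rule order.strict_trans2[rotated])
    then show "d \<le> max_dist x y" by simp
  qed
qed

theorem theorem3p6:
  fixes M :: "'w measure"
    and N :: "'d::finite \<Rightarrow> real \<Rightarrow> 'w \<Rightarrow> nat"
    and W :: "'d \<Rightarrow> nat \<Rightarrow> 'w \<Rightarrow> real"
    and X :: "'d \<Rightarrow> real \<Rightarrow> 'w \<Rightarrow> real"
    and lam \<beta> :: "'d \<Rightarrow> real"
    and A :: "('d \<Rightarrow> skorokhod) set"
    and l' :: "'d \<Rightarrow> nat"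
    and w :: real
  assumes "prob_space M"
    and "\<And>i. 0 < lam i"
    and "\<And>i. poisson_process M (lam i) (N i)"
    and "\<And>i. positive_iid M (W i)"
    and "indep_families M N W"
    and X_def: "\<And>i. X i = compensated_cp M (lam i) (N i) (W i)"
    and "\<And>i. - \<beta> i < -1"
    and "\<And>i. regularly_varying (\<lambda>x. measure M {\<omega>\<in>space M. X i 1 \<omega> > x}) (- \<beta> i)"
    and "A \<in> sets borel"
    and "is_arg_min (cost \<beta>) (\<lambda>l. D_prod l \<inter> A \<noteq> {}) l'"
    and "\<And>l. is_arg_min (cost \<beta>) (\<lambda>l. D_prod l \<inter> A \<noteq> {}) l \<Longrightarrow> l = l'"
    and "bounded_away A (D_lt_prod \<beta> l')"
    and "0 < emeasure (\<Pi>\<^sub>M i\<in>UNIV. C_meas (\<beta> i) (l' i)) (interior A)"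
    and "0 < w" "w < 1"
  shows "\<exists>\<gamma>. (\<forall>i. 0 < \<gamma> i) \<and>
    (let A_ev = (\<lambda>n. {\<omega>\<in>space M. scaled_path X n \<omega> \<in> A});
         B_ev = (\<lambda>n. {\<omega>\<in>space M. scaled_path X n \<omega> \<in> B_set \<beta> l' \<gamma>})
     in strongly_efficient
          (\<lambda>n. mixture w M (B_ev n))
          (\<lambda>n. estimator w M (A_ev n) (B_ev n))
          (\<lambda>n. measure M (A_ev n)))"
proof -
  interpret prob_space M by fact
  have beta: "1 < \<beta> i" for i using assms(7)[of i] by simp
  interpret H: heavy_tailed M "lam i" "N i" "W i" "\<beta> i" for i
    using assms(8)[of i] beta[of i] by (intro heavy_tailed_of_families assms(1-5)) (simp_all add: X_def)
  have sN: "sets (H.N_alg i) = gen_sigma M {0..} (N i) (count_space UNIV)"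
    and sV: "sets (H.V_alg i) = gen_sigma M {1..} (W i) borel" for i by (rule H.sets_algs)+
  have joint: "prob (\<Inter>i. E i \<inter> F i) = (\<Prod>i\<in>UNIV. prob (E i) * prob (F i))"
    if "\<And>i. E i \<in> sets (H.N_alg i)" "\<And>i. F i \<in> sets (H.V_alg i)" for E F
    using that unfolding sN sV by (rule indep_families_prob[OF assms(1,5)])
  have path: "scaled_path X n \<omega> = (\<lambda>i. H.rescaled i n \<omega>)" for n \<omega>
    by (simp add: scaled_path_def H.rescaled_def X_def)
  have meas: "scaled_path X n \<in> measurable M borel" if "0 < n" for n
    using that by (intro scaled_path_measurable[OF assms(3) _ X_def] H.W_measurable)
  define v where "v i n = real n * H.tail i (real n)" for i n
  have v0: "0 \<le> v i n" for i n by (simp add: v_def H.tail_nonneg)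
  define R where "R n = (\<Prod>i\<in>UNIV. v i n ^ l' i)" for n
  have R0: "0 \<le> R n" for n unfolding R_def by (intro prod_nonneg zero_le_power v0)
  have up: "\<exists>C>0. eventually (\<lambda>n. v i n \<le> C * real n powr - (\<beta> i - 1 - e)) sequentially" if "0 < e" "e \<le> 1" for i e
    unfolding v_def using H.rate_upper[OF that, of i] by blast
  have lo: "\<exists>c>0. eventually (\<lambda>n. c * real n powr - (\<beta> i - 1 + e) \<le> v i n) sequentially" if "0 < e" for i e
    unfolding v_def using H.rate_lower[OF that, of i] by blast
  \<comment> \<open>Exponent of a polynomial lower bound for \<open>R n\<close>, taken with slack 1
    in each rate; it need not be sharp.\<close>
  define p0 where "p0 = (\<Sum>i\<in>UNIV. (\<beta> i - 1 + 1) * real (l' i))"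
  have p0: "0 \<le> p0" unfolding p0_def using beta by (intro sum_nonneg mult_nonneg_nonneg) (auto simp: less_imp_le intro: order.trans[OF zero_le_one])
  \<comment> \<open>More than twice \<open>p0\<close>, so that \<open>n powr - p\<close> is
    dominated by the square of \<open>R n\<close> up to a constant.\<close>
  define p where "p = 2 * p0 + 1"
  have p: "0 < p" using p0 by (simp add: p_def)
  obtain cR where cR: "0 < cR" "eventually (\<lambda>n. cR * real n powr - p0 \<le> R n) sequentially"
    using prod_rate_lower[of "\<lambda>i. \<beta> i - 1 + 1" v l'] lo[OF zero_less_one] unfolding R_def p0_def by blast

  obtain d where d: "0 < d" "\<And>x y. x \<in> A \<Longrightarrow> y \<in> D_lt_prod \<beta> l' \<Longrightarrow> d \<le> max_dist x y"
    using bounded_awayD[OF assms(12)] by blast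
  \<comment> \<open>Threshold, constant and exceptional events are packed in a triple so that a
    single choice over the coordinates delivers them together.\<close>
  have "\<forall>i. \<exists>t :: real \<times> real \<times> (nat \<Rightarrow> 'w set). 0 < fst t \<and> (\<forall>n. snd (snd t) n \<in> events) \<and>
      eventually (\<lambda>n. prob (snd (snd t) n) \<le> fst (snd t) * real n powr - p) sequentially \<and>
      eventually (\<lambda>n. AE \<omega> in M. \<omega> \<notin> snd (snd t) n \<longrightarrow>
        (\<exists>\<zeta>\<in>D_eq (card {s\<in>{0<..1}. fst t < jump (H.rescaled i n \<omega>) s}). dist (H.rescaled i n \<omega>) \<zeta> < d)) sequentially"
  proof
    fix i
    obtain g0 where g0: "0 < g0" and "\<And>g. 0 < g \<Longrightarrow> g \<le> g0 \<Longrightarrow> \<exists>K>0. \<exists>Bd. (\<forall>n. Bd n \<in> events) \<and>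
      eventually (\<lambda>n. prob (Bd n) \<le> K * real n powr - p) sequentially \<and>
      eventually (\<lambda>n. AE \<omega> in M. \<omega> \<notin> Bd n \<longrightarrow>
        (\<exists>\<zeta>\<in>D_eq (card {s\<in>{0<..1}. g < jump (H.rescaled i n \<omega>) s}). dist (H.rescaled i n \<omega>) \<zeta> < d)) sequentially"
      using H.rescaled_near_big_jumps[OF d(1) p, of i] by blast
    from this(2)[OF g0 order_refl] obtain K Bd where KB: "(\<forall>n. Bd n \<in> events) \<and>
      eventually (\<lambda>n. prob (Bd n) \<le> K * real n powr - p) sequentially \<and>
      eventually (\<lambda>n. AE \<omega> in M. \<omega> \<notin> Bd n \<longrightarrow>
        (\<exists>\<zeta>\<in>D_eq (card {s\<in>{0<..1}. g0 < jump (H.rescaled i n \<omega>) s}). dist (H.rescaled i n \<omega>) \<zeta> < d)) sequentially"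
      by blast
    show "\<exists>t :: real \<times> real \<times> (nat \<Rightarrow> 'w set). 0 < fst t \<and> (\<forall>n. snd (snd t) n \<in> events) \<and>
      eventually (\<lambda>n. prob (snd (snd t) n) \<le> fst (snd t) * real n powr - p) sequentially \<and>
      eventually (\<lambda>n. AE \<omega> in M. \<omega> \<notin> snd (snd t) n \<longrightarrow>
        (\<exists>\<zeta>\<in>D_eq (card {s\<in>{0<..1}. fst t < jump (H.rescaled i n \<omega>) s}). dist (H.rescaled i n \<omega>) \<zeta> < d)) sequentially"
      unfolding fst_conv snd_conv
      by (rule exI[of _ "(g0, K, Bd)"]) (use g0 KB in \<open>simp only: fst_conv snd_conv simp_thms\<close>)
  qed
  from choice[OF this] obtain t where t: "\<forall>i. 0 < fst (t i) \<and> (\<forall>n. snd (snd (t i)) n \<in> events) \<and>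
      eventually (\<lambda>n. prob (snd (snd (t i)) n) \<le> fst (snd (t i)) * real n powr - p) sequentially \<and>
      eventually (\<lambda>n. AE \<omega> in M. \<omega> \<notin> snd (snd (t i)) n \<longrightarrow>
        (\<exists>\<zeta>\<in>D_eq (card {s\<in>{0<..1}. fst (t i) < jump (H.rescaled i n \<omega>) s}). dist (H.rescaled i n \<omega>) \<zeta> < d)) sequentially" ..
  define \<gamma> where "\<gamma> i = fst (t i)" for i
  define K1 where "K1 i = fst (snd (t i))" for i
  define Bd where "Bd i = snd (snd (t i))" for i
  have \<gamma>: "0 < \<gamma> i" and Bd: "Bd i n \<in> events" and PBd: "eventually (\<lambda>n. prob (Bd i n) \<le> K1 i * real n powr - p) sequentially"
    and near: "eventually (\<lambda>n. AE \<omega> in M. \<omega> \<notin> Bd i n \<longrightarrow>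
        (\<exists>\<zeta>\<in>D_eq (jump_counts \<gamma> (scaled_path X n \<omega>) i). dist (scaled_path X n \<omega> i) \<zeta> < d)) sequentially" for i n
    using t[rule_format, of i] unfolding \<gamma>_def[symmetric] K1_def[symmetric] Bd_def[symmetric] jump_counts_def path by blast+
  define A_ev where "A_ev n = {\<omega>\<in>space M. scaled_path X n \<omega> \<in> A}" for n
  define B_ev where "B_ev n = {\<omega>\<in>space M. scaled_path X n \<omega> \<in> B_set \<beta> l' \<gamma>}" for n
  have Aev: "A_ev n \<in> events" if "0 < n" for n
    using measurable_sets[OF meas[OF that] assms(9)] by (simp add: A_ev_def vimage_def Int_def conj_commute)
  have "B_set \<beta> l' \<gamma> \<in> sets borel"
    unfolding B_set_def using \<gamma> by (intro borel_open open_UN ballI open_B_lev)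
  then have Bev: "B_ev n \<in> events" if "0 < n" for n
    using measurable_sets[OF meas[OF that]] by (simp add: B_ev_def vimage_def Int_def conj_commute)

  have PBd_all: "eventually (\<lambda>n. \<forall>i. prob (Bd i n) \<le> K1 i * real n powr - p) sequentially"
    by (rule eventually_all_finite) (rule PBd)
  have near_all: "eventually (\<lambda>n. \<forall>i. AE \<omega> in M. \<omega> \<notin> Bd i n \<longrightarrow>
        (\<exists>\<zeta>\<in>D_eq (jump_counts \<gamma> (scaled_path X n \<omega>) i). dist (scaled_path X n \<omega> i) \<zeta> < d)) sequentially"
    by (rule eventually_all_finite) (rule near)
  have PAB: "eventually (\<lambda>n. prob (A_ev n - B_ev n) \<le> (\<Sum>i\<in>UNIV. K1 i) * real n powr - p) sequentially"
    using PBd_all near_all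
  proof eventually_elim
    case (elim n)
    have "AE \<omega> in M. \<forall>i\<in>UNIV. \<omega> \<notin> Bd i n \<longrightarrow>
        (\<exists>\<zeta>\<in>D_eq (jump_counts \<gamma> (scaled_path X n \<omega>) i). dist (scaled_path X n \<omega> i) \<zeta> < d)"
      by (rule AE_finite_allI) (use elim(2) in simp_all)
    then have "AE \<omega> in M. \<omega> \<in> A_ev n - B_ev n \<longrightarrow> \<omega> \<in> (\<Union>i. Bd i n)"
    proof eventually_elim
      case e: (elim \<omega>)
      show ?case
      proof (intro impI, rule ccontr)
        assume w: "\<omega> \<in> A_ev n - B_ev n" "\<omega> \<notin> (\<Union>i. Bd i n)"
        then have "\<forall>i. \<exists>\<zeta>. \<zeta> \<in> D_eq (jump_counts \<gamma> (scaled_path X n \<omega>) i) \<and> dist (scaled_path X n \<omega> i) \<zeta> < d"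
          using e by blast
        from choice[OF this] obtain \<zeta> where z: "\<forall>i. \<zeta> i \<in> D_eq (jump_counts \<gamma> (scaled_path X n \<omega>) i) \<and> dist (scaled_path X n \<omega> i) (\<zeta> i) < d" ..
        have "jump_counts \<gamma> (scaled_path X n \<omega>) \<in> I_lt \<beta> l'"
          using w(1) by (intro jump_counts_I_lt) (auto simp: A_ev_def B_ev_def)
        then have "\<zeta> \<in> D_lt_prod \<beta> l'" using z unfolding D_lt_prod_def D_prod_def by blast
        then have "d \<le> max_dist (scaled_path X n \<omega>) \<zeta>" using w(1) by (intro d(2)) (auto simp: A_ev_def)
        moreover have "max_dist (scaled_path X n \<omega>) \<zeta> < d" using z by (simp add: max_dist_less_iff)
        ultimately show False by simp
      qed
    qed
    then have "prob (A_ev n - B_ev n) \<le> prob (\<Union>i. Bd i n)"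
      using Bd by (intro finite_measure_mono_AE) auto
    also have "\<dots> \<le> (\<Sum>i\<in>UNIV. prob (Bd i n))"
      using Bd by (intro finite_measure_subadditive_finite) auto
    also have "\<dots> \<le> (\<Sum>i\<in>UNIV. K1 i * real n powr - p)" using elim(1) by (intro sum_mono) auto
    finally show ?case by (simp add: sum_distrib_right)
  qed

  obtain u y where uy: "\<And>i. inj_on (u i) {..<l' i}" "\<And>i. u i ` {..<l' i} \<subseteq> {0<..<1}"
    "\<And>i j. j < l' i \<Longrightarrow> 0 < y i j" "(\<lambda>i. step_path (l' i) (u i) (y i)) \<in> interior A"
    using generic_point_in_open[OF assms(13) open_interior] by blast
  obtain r where r: "0 < r" "\<And>x. max_dist (\<lambda>i. step_path (l' i) (u i) (y i)) x < r \<Longrightarrow> x \<in> interior A"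
    using uy(4) open_interior[of A] unfolding open_max_dist by blast
  \<comment> \<open>The common radius \<open>r\<close> is fixed beforehand: in the maximum metric it
    suffices to hit each coordinate's ball, which makes the problem one of independent
    coordinates.\<close>
  have "\<forall>i. \<exists>t :: real \<times> (nat \<Rightarrow> 'w set) \<times> (nat \<Rightarrow> 'w set). 0 < fst t \<and>
      (\<forall>n. fst (snd t) n \<in> sets (H.N_alg i)) \<and> (\<forall>n. snd (snd t) n \<in> sets (H.V_alg i)) \<and>
      eventually (\<lambda>n. fst t * v i n ^ l' i \<le> prob (fst (snd t) n) * prob (snd (snd t) n)) sequentially \<and>
      eventually (\<lambda>n. \<forall>\<omega>\<in>fst (snd t) n \<inter> snd (snd t) n. dist (scaled_path X n \<omega> i) (step_path (l' i) (u i) (y i)) < r) sequentially"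
  proof
    fix i
    have y_pos: "\<And>j. j < l' i \<Longrightarrow> 0 < y i j" by (rule uy(3))
    obtain c E F where "0 < c" "\<And>n. E n \<in> sets (H.N_alg i)" "\<And>n. F n \<in> sets (H.V_alg i)"
      "eventually (\<lambda>n. c * (real n * H.tail i (real n)) ^ l' i \<le> prob (E n) * prob (F n)) sequentially"
      "eventually (\<lambda>n. \<forall>\<omega>\<in>E n \<inter> F n. dist (H.rescaled i n \<omega>) (step_path (l' i) (u i) (y i)) < r) sequentially"
      by (rule H.rescaled_hits_ball[where i=i and l="l' i" and u="u i" and y="y i" and d=r, OF uy(1) uy(2) _ r(1)]) (erule y_pos, rule that)
    then show "\<exists>t :: real \<times> (nat \<Rightarrow> 'w set) \<times> (nat \<Rightarrow> 'w set). 0 < fst t \<and>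
      (\<forall>n. fst (snd t) n \<in> sets (H.N_alg i)) \<and> (\<forall>n. snd (snd t) n \<in> sets (H.V_alg i)) \<and>
      eventually (\<lambda>n. fst t * v i n ^ l' i \<le> prob (fst (snd t) n) * prob (snd (snd t) n)) sequentially \<and>
      eventually (\<lambda>n. \<forall>\<omega>\<in>fst (snd t) n \<inter> snd (snd t) n. dist (scaled_path X n \<omega> i) (step_path (l' i) (u i) (y i)) < r) sequentially"
      by (intro exI[of _ "(c, E, F)"]) (simp only: fst_conv snd_conv v_def path simp_thms)
  qed
  from choice[OF this] obtain q where q: "\<forall>i. 0 < fst (q i) \<and>
      (\<forall>n. fst (snd (q i)) n \<in> sets (H.N_alg i)) \<and> (\<forall>n. snd (snd (q i)) n \<in> sets (H.V_alg i)) \<and>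
      eventually (\<lambda>n. fst (q i) * v i n ^ l' i \<le> prob (fst (snd (q i)) n) * prob (snd (snd (q i)) n)) sequentially \<and>
      eventually (\<lambda>n. \<forall>\<omega>\<in>fst (snd (q i)) n \<inter> snd (snd (q i)) n. dist (scaled_path X n \<omega> i) (step_path (l' i) (u i) (y i)) < r) sequentially" ..
  define c where "c i = fst (q i)" for i
  define E where "E i = fst (snd (q i))" for i
  define F where "F i = snd (snd (q i))" for i
  have c: "0 < c i" and E: "E i n \<in> sets (H.N_alg i)" and F: "F i n \<in> sets (H.V_alg i)"
    and PEF: "eventually (\<lambda>n. c i * v i n ^ l' i \<le> prob (E i n) * prob (F i n)) sequentially"
    and hit: "eventually (\<lambda>n. \<forall>\<omega>\<in>E i n \<inter> F i n. dist (scaled_path X n \<omega> i) (step_path (l' i) (u i) (y i)) < r) sequentially" for i n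
    using q[rule_format, of i] unfolding c_def[symmetric] E_def[symmetric] F_def[symmetric] by blast+
  have PEF_all: "eventually (\<lambda>n. \<forall>i. c i * v i n ^ l' i \<le> prob (E i n) * prob (F i n)) sequentially"
    by (rule eventually_all_finite) (rule PEF)
  have hit_all: "eventually (\<lambda>n. \<forall>i. \<forall>\<omega>\<in>E i n \<inter> F i n.
      dist (scaled_path X n \<omega> i) (step_path (l' i) (u i) (y i)) < r) sequentially"
    by (rule eventually_all_finite) (rule hit)
  define cA where "cA = (\<Prod>i\<in>UNIV. c i)"
  have cA: "0 < cA" unfolding cA_def using c by (intro prod_pos) auto
  have PA: "eventually (\<lambda>n. cA * R n \<le> prob (A_ev n)) sequentially"
    using PEF_all hit_all eventually_gt_at_top[of 0]
  proof eventually_elim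
    case (elim n)
    have "cA * R n = (\<Prod>i\<in>UNIV. c i * v i n ^ l' i)" by (simp add: cA_def R_def prod.distrib)
    also have "\<dots> \<le> (\<Prod>i\<in>UNIV. prob (E i n) * prob (F i n))"
      using elim(1) c v0 by (intro prod_mono) (auto simp: less_imp_le)
    also have "\<dots> = prob (\<Inter>i. E i n \<inter> F i n)" by (rule joint[symmetric]) (rule E F)+
    also have "\<dots> \<le> prob (A_ev n)"
    proof (rule finite_measure_mono[OF _ Aev[OF elim(3)]])
      show "(\<Inter>i. E i n \<inter> F i n) \<subseteq> A_ev n"
      proof
        fix \<omega> assume w: "\<omega> \<in> (\<Inter>i. E i n \<inter> F i n)"
        then have "dist (scaled_path X n \<omega> i) (step_path (l' i) (u i) (y i)) < r" for i using elim(2) by blast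
        then have "max_dist (\<lambda>i. step_path (l' i) (u i) (y i)) (scaled_path X n \<omega>) < r"
          by (simp add: max_dist_less_iff dist_commute)
        then have "scaled_path X n \<omega> \<in> A" using r(2) interior_subset by blast
        \<comment> \<open>One coordinate suffices to place the point in the sample space, and the
          index type has an element.\<close>
        moreover have "\<omega> \<in> space M"
          using w E[of undefined n] sets.sets_into_space[of "E undefined n" "H.N_alg undefined"] by auto
        ultimately show "\<omega> \<in> A_ev n" by (simp add: A_ev_def)
      qed
    qed
    finally show ?case .
  qed

  obtain L where L: "finite L" "\<And>l. l \<in> L \<Longrightarrow> l = l' \<or> cost \<beta> l' < cost \<beta> l"
    "\<And>\<gamma>. B_set \<beta> l' \<gamma> \<subseteq> (\<Union>l\<in>L. B_lev \<gamma> l)" by (rule B_set_cover[OF beta, of l']) (rule that)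
  have "\<exists>K. eventually (\<lambda>n. prob {\<omega>\<in>space M. scaled_path X n \<omega> \<in> B_lev \<gamma> l} \<le> K * R n) sequentially" if l: "l \<in> L" for l
  proof -
    have "\<forall>i. \<exists>t :: real \<times> (nat \<Rightarrow> 'w set) \<times> (nat \<Rightarrow> 'w set). 0 < fst t \<and>
      (\<forall>n. fst (snd t) n \<in> events) \<and> (\<forall>n. snd (snd t) n \<in> sets (H.V_alg i)) \<and>
      eventually (\<lambda>n. prob (fst (snd t) n) \<le> real n powr - p) sequentially \<and>
      eventually (\<lambda>n. prob (snd (snd t) n) \<le> fst t * v i n ^ l i) sequentially \<and>
      eventually (\<lambda>n. AE \<omega> in M. l i \<le> jump_counts \<gamma> (scaled_path X n \<omega>) i \<longrightarrow> \<omega> \<in> fst (snd t) n \<or> \<omega> \<in> snd (snd t) n) sequentially"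
    proof
      fix i
      obtain K B F where "0 < K" "\<And>n. B n \<in> events" "\<And>n. F n \<in> sets (H.V_alg i)"
        "eventually (\<lambda>n. prob (B n) \<le> real n powr - p) sequentially"
        "eventually (\<lambda>n. prob (F n) \<le> K * (real n * H.tail i (real n)) ^ l i) sequentially"
        "eventually (\<lambda>n. AE \<omega> in M. l i \<le> card {s\<in>{0<..1}. \<gamma> i < jump (H.rescaled i n \<omega>) s} \<longrightarrow> \<omega> \<in> B n \<or> \<omega> \<in> F n) sequentially"
        by (rule H.rescaled_jump_count[where i=i and g="\<gamma> i" and l="l i" and p=p, OF \<gamma>]) (rule that)
      then show "\<exists>t :: real \<times> (nat \<Rightarrow> 'w set) \<times> (nat \<Rightarrow> 'w set). 0 < fst t \<and>
      (\<forall>n. fst (snd t) n \<in> events) \<and> (\<forall>n. snd (snd t) n \<in> sets (H.V_alg i)) \<and>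
      eventually (\<lambda>n. prob (fst (snd t) n) \<le> real n powr - p) sequentially \<and>
      eventually (\<lambda>n. prob (snd (snd t) n) \<le> fst t * v i n ^ l i) sequentially \<and>
      eventually (\<lambda>n. AE \<omega> in M. l i \<le> jump_counts \<gamma> (scaled_path X n \<omega>) i \<longrightarrow> \<omega> \<in> fst (snd t) n \<or> \<omega> \<in> snd (snd t) n) sequentially"
        by (intro exI[of _ "(K, B, F)"]) (simp only: fst_conv snd_conv v_def path jump_counts_def simp_thms)
    qed
    from choice[OF this] obtain t where t: "\<forall>i. 0 < fst (t i) \<and>
      (\<forall>n. fst (snd (t i)) n \<in> events) \<and> (\<forall>n. snd (snd (t i)) n \<in> sets (H.V_alg i)) \<and>
      eventually (\<lambda>n. prob (fst (snd (t i)) n) \<le> real n powr - p) sequentially \<and>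
      eventually (\<lambda>n. prob (snd (snd (t i)) n) \<le> fst (t i) * v i n ^ l i) sequentially \<and>
      eventually (\<lambda>n. AE \<omega> in M. l i \<le> jump_counts \<gamma> (scaled_path X n \<omega>) i \<longrightarrow> \<omega> \<in> fst (snd (t i)) n \<or> \<omega> \<in> snd (snd (t i)) n) sequentially" ..
    define K where "K i = fst (t i)" for i
    define B where "B i = fst (snd (t i))" for i
    define F where "F i = snd (snd (t i))" for i
    have K: "0 < K i" and B: "B i n \<in> events" and F: "F i n \<in> sets (H.V_alg i)"
      and PB: "eventually (\<lambda>n. prob (B i n) \<le> real n powr - p) sequentially"
      and PF: "eventually (\<lambda>n. prob (F i n) \<le> K i * v i n ^ l i) sequentially"
      and cover: "eventually (\<lambda>n. AE \<omega> in M. l i \<le> jump_counts \<gamma> (scaled_path X n \<omega>) i \<longrightarrow> \<omega> \<in> B i n \<or> \<omega> \<in> F i n) sequentially" for i n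
      using t[rule_format, of i] unfolding K_def[symmetric] B_def[symmetric] F_def[symmetric] by blast+
    have PB_all: "eventually (\<lambda>n. \<forall>i. prob (B i n) \<le> real n powr - p) sequentially"
      by (rule eventually_all_finite) (rule PB)
    have PF_all: "eventually (\<lambda>n. \<forall>i. prob (F i n) \<le> K i * v i n ^ l i) sequentially"
      by (rule eventually_all_finite) (rule PF)
    have cover_all: "eventually (\<lambda>n. \<forall>i. AE \<omega> in M. l i \<le> jump_counts \<gamma> (scaled_path X n \<omega>) i \<longrightarrow>
        \<omega> \<in> B i n \<or> \<omega> \<in> F i n) sequentially"
      by (rule eventually_all_finite) (rule cover)
    have Fe: "F i n \<in> events" for i n using F H.sets_V_alg_subset by blast
    \<comment> \<open>For \<open>l'\<close> the rate is \<open>R n\<close> itself; any other member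
      of \<open>L\<close> costs strictly more and is dominated.\<close>
    obtain K' where K': "0 < K'" "eventually (\<lambda>n. (\<Prod>i\<in>UNIV. v i n ^ l i) \<le> K' * R n) sequentially"
    proof (cases "l = l'")
      case True
      then show ?thesis using that[of 1] by (simp add: R_def)
    next
      case False
      then have less: "cost \<beta> l' < cost \<beta> l" using L(2)[OF l] by simp
      have "\<exists>K'>0. eventually (\<lambda>n. (\<Prod>i\<in>UNIV. v i n ^ l i) \<le> K' * R n) sequentially"
        unfolding R_def by (rule rate_comparison[where \<beta>=\<beta>]) (fact up lo v0 less)+
      then show ?thesis using that by blast
    qed
    \<comment> \<open>The first summand pays for irregular counts in any coordinate, as
      \<open>n powr - p\<close> is at most \<open>R n / cR\<close>; the second is the product of the
      coordinate bounds.\<close>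
    define K'' where "K'' = real CARD('d) / cR + (\<Prod>i\<in>UNIV. K i) * K'"
    have "eventually (\<lambda>n. prob {\<omega>\<in>space M. scaled_path X n \<omega> \<in> B_lev \<gamma> l} \<le> K'' * R n) sequentially"
      using PB_all PF_all cover_all K'(2) cR(2)
        eventually_ge_at_top[of 1]
    proof eventually_elim
      case (elim n)
      have "AE \<omega> in M. \<forall>i\<in>UNIV. l i \<le> jump_counts \<gamma> (scaled_path X n \<omega>) i \<longrightarrow> \<omega> \<in> B i n \<or> \<omega> \<in> F i n"
        by (rule AE_finite_allI) (use elim(3) in simp_all)
      then have "AE \<omega> in M. \<omega> \<in> {\<omega>\<in>space M. scaled_path X n \<omega> \<in> B_lev \<gamma> l} \<longrightarrow> \<omega> \<in> (\<Union>i. B i n) \<union> (\<Inter>i. F i n)"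
        by eventually_elim (auto simp: B_lev_def jump_counts_def)
      then have "prob {\<omega>\<in>space M. scaled_path X n \<omega> \<in> B_lev \<gamma> l} \<le> prob ((\<Union>i. B i n) \<union> (\<Inter>i. F i n))"
        using B Fe by (intro finite_measure_mono_AE) auto
      also have "\<dots> \<le> prob (\<Union>i. B i n) + prob (\<Inter>i. F i n)"
        using B Fe by (intro measure_Un_le) auto
      also have "\<dots> \<le> real CARD('d) / cR * R n + (\<Prod>i\<in>UNIV. K i) * K' * R n"
      proof (rule add_mono)
        have "prob (\<Union>i. B i n) \<le> (\<Sum>i\<in>UNIV. prob (B i n))"
          using B by (intro finite_measure_subadditive_finite) auto
        also have "\<dots> \<le> (\<Sum>i\<in>(UNIV :: 'd set). real n powr - p)" using elim(1) by (intro sum_mono) auto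
        also have "\<dots> = real CARD('d) * real n powr - p" by simp
        also have "\<dots> \<le> real CARD('d) * (R n / cR)"
        proof (intro mult_left_mono)
          have "real n powr - p \<le> real n powr - p0" using p0 elim(6) by (intro powr_mono) (auto simp: p_def)
          also have "\<dots> \<le> R n / cR" using elim(5) cR(1) by (simp add: pos_le_divide_eq mult.commute)
          finally show "real n powr - p \<le> R n / cR" .
        qed simp
        finally show "prob (\<Union>i. B i n) \<le> real CARD('d) / cR * R n" by simp
        \<comment> \<open>The whole space stands in as arrival event, which brings the intersection
          into the shape of the joint product formula.\<close>
        have "prob (\<Inter>i. F i n) = prob (\<Inter>i. space M \<inter> F i n)"
        proof (rule arg_cong[of _ _ prob])
          have "F i n \<subseteq> space M" for i using sets.sets_into_space[OF Fe] .
          then show "(\<Inter>i. F i n) = (\<Inter>i. space M \<inter> F i n)" by auto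
        qed
        also have "\<dots> = (\<Prod>i\<in>UNIV. prob (space M) * prob (F i n))"
          using F by (intro joint) (auto intro: sets.top[of "H.N_alg _", unfolded H.space_algs])
        also have "\<dots> \<le> (\<Prod>i\<in>UNIV. K i * v i n ^ l i)"
          using elim(2) by (intro prod_mono) (auto simp: prob_space)
        also have "\<dots> = (\<Prod>i\<in>UNIV. K i) * (\<Prod>i\<in>UNIV. v i n ^ l i)" by (simp add: prod.distrib)
        also have "\<dots> \<le> (\<Prod>i\<in>UNIV. K i) * (K' * R n)"
          using elim(4) K by (intro mult_left_mono prod_nonneg) (auto simp: less_imp_le)
        finally show "prob (\<Inter>i. F i n) \<le> (\<Prod>i\<in>UNIV. K i) * K' * R n" by (simp only: mult.assoc)
      qed
      finally show ?case by (simp add: K''_def algebra_simps)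
    qed
    then show ?thesis by blast
  qed
  then have "\<forall>l\<in>L. \<exists>K. eventually (\<lambda>n. prob {\<omega>\<in>space M. scaled_path X n \<omega> \<in> B_lev \<gamma> l} \<le> K * R n) sequentially" by blast
  from bchoice[OF this] obtain K2 where K2: "\<forall>l\<in>L. eventually (\<lambda>n. prob {\<omega>\<in>space M. scaled_path X n \<omega> \<in> B_lev \<gamma> l} \<le> K2 l * R n) sequentially" ..
  \<comment> \<open>The constants in \<open>K2\<close> carry no sign information; the absolute value
    makes the bound monotone in \<open>R n\<close>.\<close>
  define KB where "KB = \<bar>\<Sum>l\<in>L. K2 l\<bar>"
  have "eventually (\<lambda>n. \<forall>l\<in>L. prob {\<omega>\<in>space M. scaled_path X n \<omega> \<in> B_lev \<gamma> l} \<le> K2 l * R n) sequentially"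
    using K2 by (intro eventually_ball_finite[OF L(1)]) auto
  then have PB: "eventually (\<lambda>n. prob (B_ev n) \<le> KB * R n) sequentially"
    using eventually_gt_at_top[of 0]
  proof eventually_elim
    case (elim n)
    have Bl: "{\<omega>\<in>space M. scaled_path X n \<omega> \<in> B_lev \<gamma> l} \<in> events" for l
      using measurable_sets[OF meas[OF elim(2)], of "B_lev \<gamma> l"] open_B_lev[of \<gamma> l] \<gamma>
      by (simp add: vimage_def Int_def conj_commute)
    have "prob (B_ev n) \<le> prob (\<Union>l\<in>L. {\<omega>\<in>space M. scaled_path X n \<omega> \<in> B_lev \<gamma> l})"
      using Bl L(1) L(3)[of \<gamma>] by (intro finite_measure_mono sets.finite_UN) (auto simp: B_ev_def)
    also have "\<dots> \<le> (\<Sum>l\<in>L. prob {\<omega>\<in>space M. scaled_path X n \<omega> \<in> B_lev \<gamma> l})"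
      using Bl L(1) by (intro finite_measure_subadditive_finite) auto
    also have "\<dots> \<le> (\<Sum>l\<in>L. K2 l * R n)" using elim(1) by (intro sum_mono) auto
    also have "\<dots> = (\<Sum>l\<in>L. K2 l) * R n" by (simp add: sum_distrib_right)
    also have "\<dots> \<le> KB * R n" using R0 by (intro mult_right_mono) (auto simp: KB_def)
    finally show ?case .
  qed

  define KA where "KA = \<bar>\<Sum>i\<in>UNIV. K1 i\<bar>"
  \<comment> \<open>The first term collects \<open>A - B\<close> through the polynomial lower bound
    for \<open>P(A)\<close>, the second collects \<open>P(A) P(B)\<close> through the sharp bound of
    \<open>R n\<close> by \<open>P(A)\<close>.\<close>
  define C where "C = KA / (cR * cA)\<^sup>2 / w + KB / cA / (1 - w)"
  have "(\<lambda>n. \<integral>\<omega>. (estimator w M (A_ev n) (B_ev n) \<omega>)\<^sup>2 \<partial>mixture w M (B_ev n)) \<in> O(\<lambda>n. (prob (A_ev n))\<^sup>2)"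
  proof (rule bigoI[of _ C])
    show "eventually (\<lambda>n. norm (\<integral>\<omega>. (estimator w M (A_ev n) (B_ev n) \<omega>)\<^sup>2 \<partial>mixture w M (B_ev n)) \<le> C * norm ((prob (A_ev n))\<^sup>2)) sequentially"
      using PAB PA PB cR(2) eventually_ge_at_top[of 1]
    proof eventually_elim
      case (elim n)
      let ?I = "\<integral>\<omega>. (estimator w M (A_ev n) (B_ev n) \<omega>)\<^sup>2 \<partial>mixture w M (B_ev n)"
      have n: "0 < n" using elim by simp
      have Rle: "R n \<le> prob (A_ev n) / cA" using elim(2) cA by (simp add: pos_le_divide_eq mult.commute)
      have "cR * real n powr - p0 \<le> prob (A_ev n) / cA" using elim(4) Rle by linarith
      then have nle: "real n powr - p0 \<le> prob (A_ev n) / (cR * cA)" using cR(1) cA by (simp add: field_simps)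
      have "prob (A_ev n - B_ev n) \<le> KA * real n powr - p"
        using elim(1) by (rule order.trans) (auto intro!: mult_right_mono simp: KA_def)
      also have "\<dots> \<le> KA * (real n powr - p0)\<^sup>2"
      proof (intro mult_left_mono)
        have "real n powr - p \<le> real n powr (- p0 + - p0)" using elim(5) by (intro powr_mono) (auto simp: p_def)
        then show "real n powr - p \<le> (real n powr - p0)\<^sup>2" by (simp only: powr_add power2_eq_square)
      qed (simp add: KA_def)
      also have "\<dots> \<le> KA * (prob (A_ev n) / (cR * cA))\<^sup>2"
        using nle by (intro mult_left_mono power_mono) (auto simp: KA_def)
      finally have 1: "prob (A_ev n - B_ev n) \<le> KA / (cR * cA)\<^sup>2 * (prob (A_ev n))\<^sup>2" by (simp add: power_divide)
      have "KB * R n \<le> KB * (prob (A_ev n) / cA)" using Rle by (intro mult_left_mono) (auto simp: KB_def)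
      then have "prob (B_ev n) \<le> KB * (prob (A_ev n) / cA)" using elim(3) by linarith
      then have "prob (A_ev n) * prob (B_ev n) \<le> prob (A_ev n) * (KB * (prob (A_ev n) / cA))" by (intro mult_left_mono) auto
      then have 2: "prob (A_ev n) * prob (B_ev n) \<le> KB / cA * (prob (A_ev n))\<^sup>2" by (simp add: power2_eq_square mult_ac)
      have "?I \<le> prob (A_ev n - B_ev n) / w + prob (A_ev n) * prob (B_ev n) / (1 - w)"
        by (rule estimator_second_moment(2)[OF assms(1) Aev[OF n] Bev[OF n] assms(14,15)])
      also have "\<dots> \<le> KA / (cR * cA)\<^sup>2 * (prob (A_ev n))\<^sup>2 / w + KB / cA * (prob (A_ev n))\<^sup>2 / (1 - w)"
        using 1 2 assms(14,15) by (intro add_mono divide_right_mono) auto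
      also have "\<dots> = C * (prob (A_ev n))\<^sup>2" by (simp add: C_def distrib_right)
      finally have "?I \<le> C * (prob (A_ev n))\<^sup>2" .
      moreover have "0 \<le> ?I" by (rule estimator_second_moment(1)[OF assms(1) Aev[OF n] Bev[OF n] assms(14,15)])
      ultimately show ?case by simp
    qed
  qed
  then show ?thesis using \<gamma>
    unfolding strongly_efficient_def Let_def A_ev_def B_ev_def by (intro exI[of _ \<gamma>]) simp
qed

end
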